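(* Let $\mathcal{H}$ be a cocommutative Hopf $K$-algebra with a symmetric partial action on a unital $K$-algebra $A$. Consider the functors $$G_1=\operatorname{Hom}_{A^e}(A,-):(A\#\mathcal{H})^e\operatorname{-Mod}\to\mathcal{H}_{par}\operatorname{-Mod},\qquad G_2=\operatorname{Hom}_{\mathcal{H}_{par}}(\mathcal{B},-):\mathcal{H}_{par}\operatorname{-Mod}\to K\operatorname{-Mod},$$ $$G=\operatorname{Hom}_{(A\#\mathcal{H})^e}(A\#\mathcal{H},-):(A\#\mathcal{H})^e\operatorname{-Mod}\to K\operatorname{-Mod}.$$ Then the functors $G_2G_1$ and $G$ are naturally isomorphic.
   Context: $K$ is a commutative unital ring, $\otimes=\otimes_K$, all algebras are associative unital $K$-algebras. $\mathcal{H}$ has counit $\varepsilon$, antipode $S$, and Sweedler notation $\Delta(h)=h_{(1)}\otimes h_{(2)}$ is used. Symmetric partial action: a linear map $\mathcal{H}\otimes A\to A$, $h\otimes a\mapsto h\cdot a$, with $1_{\mathcal{H}}\cdot a=a$; $h\cdot(ab)=(h_{(1)}\cdot a)(h_{(2)}\cdot b)$; $h\cdot(k\cdot a)=(h_{(1)}\cdot 1_A)(h_{(2)}k\cdot a)$; and $h\cdot(k\cdot a)=(h_{(1)}k\cdot a)(h_{(2)}\cdot 1_A)$ (symmetry). Partial smash product: $A\otimes\mathcal{H}$ has the associative product $(a\otimes h)(b\otimes k)=a(h_{(1)}\cdot b)\otimes h_{(2)}k$, and $A\#\mathcal{H}:=(A\otimes\mathcal{H})(1_A\otimes 1_{\mathcal{H}})$,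 a unital algebra generated by the elements $a\#h:=a(h_{(1)}\cdot 1_A)\otimes h_{(2)}$. For an algebra $R$, $R^e=R\otimes R^{op}$; an $R$-bimodule $X$ is a left $R^e$-module by $(a\otimes b)\cdot x=a\cdot x\cdot b$. An $A\#\mathcal{H}$-bimodule is an $A$-bimodule via $a\mapsto a\#1_{\mathcal{H}}$. The algebra $\mathcal{H}_{par}$ is the quotient of the tensor algebra $T(\mathcal{H})$ by the ideal generated by the elements ($h,k\in\mathcal{H}$): $1_{\mathcal{H}}-1_{T(\mathcal{H})}$; $h\otimes k_{(1)}\otimes S(k_{(2)})-hk_{(1)}\otimes S(k_{(2)})$; $h_{(1)}\otimes S(h_{(2)})\otimes k-h_{(1)}\otimes S(h_{(2)})k$; $h\otimes S(k_{(1)})\otimes k_{(2)}-hS(k_{(1)})\otimes k_{(2)}$; $S(h_{(1)})\otimes h_{(2)}\otimes k-S(h_{(1)})\otimes h_{(2)}k$. The class of $h$ is $[h]$. $\mathcal{B}\subseteq\mathcal{H}_{par}$ is the subalgebra generated by the elements $e_h:=[h_{(1)}][S(h_{(2)})]$, $h\in\mathcal{H}$; it is a left $\mathcal{H}_{par}$-module by $[h]\triangleright b=[h_{(1)}]b[S(h_{(2)})]$. An $A\#\mathcal{H}$-bimodule $M$ is a left $\mathcal{H}_{par}$-module by $[h]\triangleright m=(1_A\#h_{(1)})\cdot m\cdot(1_A\#S(h_{(2)}))$, and $G_1(M)=\operatorname{Hom}_{A^e}(A,M)$ is a left $\mathcal{H}_{par}$-module by $([h]\triangleright f)(a)=[h_{(1)}]\triangleright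 f(S(h_{(2)})\cdot a)$. *)

theory Defs
  imports "HOL-Algebra.Module" "HOL-Algebra.QuotRing" "HOL-Algebra.Subrings" "HOL-Library.FuncSet"
begin

text \<open>
  Modules, algebras and Hopf algebras are carrier-based records in the style of HOL-Algebra; for
  records that are only used as modules the fields \<^term>\<open>mult\<close> and \<^term>\<open>one\<close> are irrelevant.
\<close>

text \<open>The library locale \<^locale>\<open>algebra\<close> is restricted to commutative algebras, and
  \<^locale>\<open>module\<close> to modules over commutative rings.\<close>

locale assoc_algebra = module K A + A?: ring A
  for K :: "'k ring" and A :: "('k, 'a, 'z) module_scheme" (structure) +
  assumes smult_mult_left:
      "\<lbrakk>c \<in> carrier K; x \<in> carrier A; y \<in> carrier A\<rbrakk> \<Longrightarrow> (c \<odot> x) \<otimes> y = c \<odot> (x \<otimes> y)"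
    and smult_mult_right:
      "\<lbrakk>c \<in> carrier K; x \<in> carrier A; y \<in> carrier A\<rbrakk> \<Longrightarrow> x \<otimes> (c \<odot> y) = c \<odot> (x \<otimes> y)"

locale left_module = R?: ring R + M?: abelian_group M
  for R :: "('r, 'y) ring_scheme" and M :: "('r, 'm) module" +
  assumes smult_closed: "\<lbrakk>a \<in> carrier R; x \<in> carrier M\<rbrakk> \<Longrightarrow> a \<odot>\<^bsub>M\<^esub> x \<in> carrier M"
    and smult_l_distr: "\<lbrakk>a \<in> carrier R; b \<in> carrier R; x \<in> carrier M\<rbrakk> \<Longrightarrow>
      (a \<oplus>\<^bsub>R\<^esub> b) \<odot>\<^bsub>M\<^esub> x = a \<odot>\<^bsub>M\<^esub> x \<oplus>\<^bsub>M\<^esub> b \<odot>\<^bsub>M\<^esub> x"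
    and smult_r_distr: "\<lbrakk>a \<in> carrier R; x \<in> carrier M; y \<in> carrier M\<rbrakk> \<Longrightarrow>
      a \<odot>\<^bsub>M\<^esub> (x \<oplus>\<^bsub>M\<^esub> y) = a \<odot>\<^bsub>M\<^esub> x \<oplus>\<^bsub>M\<^esub> a \<odot>\<^bsub>M\<^esub> y"
    and smult_assoc: "\<lbrakk>a \<in> carrier R; b \<in> carrier R; x \<in> carrier M\<rbrakk> \<Longrightarrow>
      (a \<otimes>\<^bsub>R\<^esub> b) \<odot>\<^bsub>M\<^esub> x = a \<odot>\<^bsub>M\<^esub> (b \<odot>\<^bsub>M\<^esub> x)"
    and smult_one: "x \<in> carrier M \<Longrightarrow> \<one>\<^bsub>R\<^esub> \<odot>\<^bsub>M\<^esub> x = x"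

definition restrict_scalars :: "('s \<Rightarrow> 'r) \<Rightarrow> ('r, 'm) module \<Rightarrow> ('s, 'm) module" where
  "restrict_scalars \<phi> M = \<lparr>carrier = carrier M, mult = mult M, one = one M, zero = zero M,
     add = add M, smult = (\<lambda>s x. \<phi> s \<odot>\<^bsub>M\<^esub> x)\<rparr>"

text \<open>A left module over a \<open>K\<close>-algebra \<open>R\<close> is a \<open>K\<close>-module through \<open>K \<rightarrow> R\<close>, \<open>c \<mapsto> c 1\<close>.\<close>

definition base_module :: "('k, 'r, 'z) module_scheme \<Rightarrow> ('r, 'm) module \<Rightarrow> ('k, 'm) module" where
  "base_module R M = restrict_scalars (\<lambda>c. c \<odot>\<^bsub>R\<^esub> \<one>\<^bsub>R\<^esub>) M"

text \<open>Homomorphisms are extensional, so that equal maps on the carrier are equal functions.\<close>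

definition mod_hom :: "('r, 'y) ring_scheme \<Rightarrow> ('r, 'x) module \<Rightarrow> ('r, 'm) module \<Rightarrow> ('x \<Rightarrow> 'm) set" where
  "mod_hom R X M = {f \<in> carrier X \<rightarrow>\<^sub>E carrier M.
     (\<forall>x\<in>carrier X. \<forall>y\<in>carrier X. f (x \<oplus>\<^bsub>X\<^esub> y) = f x \<oplus>\<^bsub>M\<^esub> f y) \<and>
     (\<forall>r\<in>carrier R. \<forall>x\<in>carrier X. f (r \<odot>\<^bsub>X\<^esub> x) = r \<odot>\<^bsub>M\<^esub> f x)}"

definition hom_module ::
  "('k, 'r, 'z) module_scheme \<Rightarrow> ('r, 'x) module \<Rightarrow> ('r, 'm) module \<Rightarrow> ('k, 'x \<Rightarrow> 'm) module" where
  "hom_module R X M = \<lparr>carrier = mod_hom R X M, mult = undefined, one = undefined,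
     zero = (\<lambda>x\<in>carrier X. \<zero>\<^bsub>M\<^esub>),
     add = (\<lambda>f g. \<lambda>x\<in>carrier X. f x \<oplus>\<^bsub>M\<^esub> g x),
     smult = (\<lambda>c f. \<lambda>x\<in>carrier X. c \<odot>\<^bsub>base_module R M\<^esub> f x)\<rparr>"

text \<open>
  The objects of \<open>R-Mod\<close> are the left \<open>R\<close>-modules whose carrier is a subset of a type \<open>'m\<close>, which
  plays the role of an arbitrary universe. A functor is a pair of an object map and a map
  sending a morphism \<open>f : M \<rightarrow> N\<close> (given with its source and target) to its image.
\<close>

type_synonym ('r, 'm, 's, 'n) mod_functor =
  "(('r, 'm) module \<Rightarrow> ('s, 'n) module) \<times>
   (('r, 'm) module \<Rightarrow> ('r, 'm) module \<Rightarrow> ('m \<Rightarrow> 'm) \<Rightarrow> ('n \<Rightarrow> 'n))"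

definition is_mod_functor ::
  "('r, 'y) ring_scheme \<Rightarrow> ('s, 'z) ring_scheme \<Rightarrow> ('r, 'm, 's, 'n) mod_functor \<Rightarrow> bool" where
  "is_mod_functor R S F \<longleftrightarrow>
     (\<forall>M. left_module R M \<longrightarrow> left_module S (fst F M)) \<and>
     (\<forall>M N. left_module R M \<longrightarrow> left_module R N \<longrightarrow>
       (\<forall>f\<in>mod_hom R M N. snd F M N f \<in> mod_hom S (fst F M) (fst F N))) \<and>
     (\<forall>M. left_module R M \<longrightarrow>
       snd F M M (\<lambda>x\<in>carrier M. x) = (\<lambda>x\<in>carrier (fst F M). x)) \<and>
     (\<forall>L M N. left_module R L \<longrightarrow> left_module R M \<longrightarrow> left_module R N \<longrightarrow>
       (\<forall>f\<in>mod_hom R L M. \<forall>g\<in>mod_hom R M N.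
         snd F L N (compose (carrier L) g f) =
         compose (carrier (fst F L)) (snd F M N g) (snd F L M f)))"

definition comp_mod_functor ::
  "('s, 'n, 't, 'p) mod_functor \<Rightarrow> ('r, 'm, 's, 'n) mod_functor \<Rightarrow> ('r, 'm, 't, 'p) mod_functor" where
  "comp_mod_functor G F =
     (\<lambda>M. fst G (fst F M), \<lambda>M N f. snd G (fst F M) (fst F N) (snd F M N f))"

definition naturally_isomorphic ::
  "('r, 'y) ring_scheme \<Rightarrow> ('s, 'z) ring_scheme \<Rightarrow> ('r, 'm, 's, 'n) mod_functor \<Rightarrow>
   ('r, 'm, 's, 'p) mod_functor \<Rightarrow> bool" where
  "naturally_isomorphic R S F G \<longleftrightarrow>
     (\<exists>\<eta> :: ('r, 'm) module \<Rightarrow> 'n \<Rightarrow> 'p.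
       (\<forall>M. left_module R M \<longrightarrow>
         \<eta> M \<in> mod_hom S (fst F M) (fst G M) \<and>
         bij_betw (\<eta> M) (carrier (fst F M)) (carrier (fst G M))) \<and>
       (\<forall>M N. left_module R M \<longrightarrow> left_module R N \<longrightarrow>
         (\<forall>f\<in>mod_hom R M N. \<forall>x\<in>carrier (fst F M).
           \<eta> N (snd F M N f x) = snd G M N f (\<eta> M x))))"

definition Hom_functor ::
  "('k, 'r, 'z) module_scheme \<Rightarrow> ('r, 'x) module \<Rightarrow> ('r, 'm, 'k, 'x \<Rightarrow> 'm) mod_functor" where
  "Hom_functor R X =
     (hom_module R X, \<lambda>M N f. \<lambda>g\<in>mod_hom R X M. compose (carrier X) f g)"

definition free_module :: "'k ring \<Rightarrow> 'x set \<Rightarrow> ('k, 'x \<Rightarrow> 'k) module" where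
  "free_module K X = \<lparr>carrier = {f. (\<forall>x\<in>X. f x \<in> carrier K) \<and> (\<forall>x. x \<notin> X \<longrightarrow> f x = \<zero>\<^bsub>K\<^esub>) \<and>
       finite {x. f x \<noteq> \<zero>\<^bsub>K\<^esub>}},
     mult = undefined, one = undefined, zero = (\<lambda>x. \<zero>\<^bsub>K\<^esub>),
     add = (\<lambda>f g x. f x \<oplus>\<^bsub>K\<^esub> g x), smult = (\<lambda>c f x. c \<otimes>\<^bsub>K\<^esub> f x)\<rparr>"

definition basis_elt :: "'k ring \<Rightarrow> 'x \<Rightarrow> 'x \<Rightarrow> 'k" where
  "basis_elt K x = (\<lambda>y. if y = x then \<one>\<^bsub>K\<^esub> else \<zero>\<^bsub>K\<^esub>)"

definition gen_submodule :: "'k ring \<Rightarrow> ('k, 'v) module \<Rightarrow> 'v set \<Rightarrow> 'v set" where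
  "gen_submodule K V S = \<Inter>{W. submodule W K V \<and> S \<subseteq> W}"

definition quot_module :: "('k, 'v) module \<Rightarrow> 'v set \<Rightarrow> ('k, 'v set) module" where
  "quot_module V W = \<lparr>carrier = a_rcosets\<^bsub>V\<^esub> W, mult = undefined, one = undefined, zero = W,
     add = set_add V, smult = (\<lambda>c X. \<Union>x\<in>X. W +>\<^bsub>V\<^esub> (c \<odot>\<^bsub>V\<^esub> x))\<rparr>"

text \<open>
  The linear map to the \<open>K\<close>-module \<open>P\<close> that a map \<open>g\<close> on the basis induces on a quotient of a free
  module, evaluated through a representative. It does not depend on the representative
  as soon as the linear extension of \<open>g\<close> vanishes on the submodule that is factored out.
\<close>

definition induced_map ::
  "'k ring \<Rightarrow> ('k, 'p, 'z) module_scheme \<Rightarrow> ('x \<Rightarrow> 'p) \<Rightarrow> ('x \<Rightarrow> 'k) set \<Rightarrow> 'p" where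
  "induced_map K P g t =
     (let p = (SOME p. p \<in> t) in \<Oplus>\<^bsub>P\<^esub>x\<in>{x. p x \<noteq> \<zero>\<^bsub>K\<^esub>}. p x \<odot>\<^bsub>P\<^esub> g x)"

definition tensor_relators ::
  "'k ring \<Rightarrow> ('k, 'a, 'y) module_scheme \<Rightarrow> ('k, 'b, 'z) module_scheme \<Rightarrow> ('a \<times> 'b \<Rightarrow> 'k) set" where
  "tensor_relators K M N =
     (let F = free_module K (carrier M \<times> carrier N); b = (\<lambda>x y. basis_elt K (x, y)) in
       {b (x \<oplus>\<^bsub>M\<^esub> x') y \<ominus>\<^bsub>F\<^esub> b x y \<ominus>\<^bsub>F\<^esub> b x' y |x x' y.
          x \<in> carrier M \<and> x' \<in> carrier M \<and> y \<in> carrier N} \<union>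
       {b x (y \<oplus>\<^bsub>N\<^esub> y') \<ominus>\<^bsub>F\<^esub> b x y \<ominus>\<^bsub>F\<^esub> b x y' |x y y'.
          x \<in> carrier M \<and> y \<in> carrier N \<and> y' \<in> carrier N} \<union>
       {b (c \<odot>\<^bsub>M\<^esub> x) y \<ominus>\<^bsub>F\<^esub> c \<odot>\<^bsub>F\<^esub> b x y |c x y.
          c \<in> carrier K \<and> x \<in> carrier M \<and> y \<in> carrier N} \<union>
       {b x (c \<odot>\<^bsub>N\<^esub> y) \<ominus>\<^bsub>F\<^esub> c \<odot>\<^bsub>F\<^esub> b x y |c x y.
          c \<in> carrier K \<and> x \<in> carrier M \<and> y \<in> carrier N})"

definition tensor_kernel ::
  "'k ring \<Rightarrow> ('k, 'a, 'y) module_scheme \<Rightarrow> ('k, 'b, 'z) module_scheme \<Rightarrow> ('a \<times> 'b \<Rightarrow> 'k) set" where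
  "tensor_kernel K M N =
     gen_submodule K (free_module K (carrier M \<times> carrier N)) (tensor_relators K M N)"

definition tensor ::
  "'k ring \<Rightarrow> ('k, 'a, 'y) module_scheme \<Rightarrow> ('k, 'b, 'z) module_scheme \<Rightarrow>
   ('k, ('a \<times> 'b \<Rightarrow> 'k) set) module" where
  "tensor K M N = quot_module (free_module K (carrier M \<times> carrier N)) (tensor_kernel K M N)"

definition pure_tensor ::
  "'k ring \<Rightarrow> ('k, 'a, 'y) module_scheme \<Rightarrow> ('k, 'b, 'z) module_scheme \<Rightarrow> 'a \<Rightarrow> 'b \<Rightarrow>
   ('a \<times> 'b \<Rightarrow> 'k) set" where
  "pure_tensor K M N x y =
     tensor_kernel K M N +>\<^bsub>free_module K (carrier M \<times> carrier N)\<^esub> basis_elt K (x, y)"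

text \<open>The linear map \<open>x \<otimes> y \<mapsto> f x y\<close> to \<open>P\<close> induced by a bilinear map \<open>f\<close>.\<close>

definition tensor_lift ::
  "'k ring \<Rightarrow> ('k, 'p, 'z) module_scheme \<Rightarrow> ('a \<Rightarrow> 'b \<Rightarrow> 'p) \<Rightarrow> ('a \<times> 'b \<Rightarrow> 'k) set \<Rightarrow> 'p" where
  "tensor_lift K P f = induced_map K P (\<lambda>(x, y). f x y)"

definition tensor_alg ::
  "'k ring \<Rightarrow> ('k, 'a, 'y) module_scheme \<Rightarrow> ('k, 'b, 'z) module_scheme \<Rightarrow>
   ('k, ('a \<times> 'b \<Rightarrow> 'k) set) module" where
  "tensor_alg K A B = (let T = tensor K A B in T\<lparr>
     mult := (\<lambda>s t. tensor_lift K T (\<lambda>a b.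
       tensor_lift K T (\<lambda>a' b'. pure_tensor K A B (a \<otimes>\<^bsub>A\<^esub> a') (b \<otimes>\<^bsub>B\<^esub> b')) t) s),
     one := pure_tensor K A B \<one>\<^bsub>A\<^esub> \<one>\<^bsub>B\<^esub>\<rparr>)"

definition opp_alg :: "('k, 'a) module \<Rightarrow> ('k, 'a) module" where
  "opp_alg A = A\<lparr>mult := (\<lambda>x y. y \<otimes>\<^bsub>A\<^esub> x)\<rparr>"

definition env_alg :: "'k ring \<Rightarrow> ('k, 'a) module \<Rightarrow> ('k, ('a \<times> 'a \<Rightarrow> 'k) set) module" where
  "env_alg K A = tensor_alg K A (opp_alg A)"

definition env_tensor :: "'k ring \<Rightarrow> ('k, 'a) module \<Rightarrow> 'a \<Rightarrow> 'a \<Rightarrow> ('a \<times> 'a \<Rightarrow> 'k) set" where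
  "env_tensor K A a b = pure_tensor K A (opp_alg A) a b"

text \<open>The algebra \<open>A\<close> as a left module over its enveloping algebra: \<open>(a \<otimes> b) x = a x b\<close>.\<close>

definition regular_bimodule :: "'k ring \<Rightarrow> ('k, 'a) module \<Rightarrow> (('a \<times> 'a \<Rightarrow> 'k) set, 'a) module" where
  "regular_bimodule K A = \<lparr>carrier = carrier A, mult = mult A, one = one A, zero = zero A,
     add = add A, smult = (\<lambda>t x. tensor_lift K A (\<lambda>a b. a \<otimes>\<^bsub>A\<^esub> x \<otimes>\<^bsub>A\<^esub> b) t)\<rparr>"

record ('k, 'h) hopf = "('k, 'h) module" +
  comult :: "'h \<Rightarrow> ('h \<times> 'h \<Rightarrow> 'k) set"
  counit :: "'h \<Rightarrow> 'k"
  antipode :: "'h \<Rightarrow> 'h"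

text \<open>Sweedler notation: \<open>sweedler K H P f h\<close> is \<open>f h\<^sub>(\<^sub>1\<^sub>) h\<^sub>(\<^sub>2\<^sub>)\<close>, for a bilinear \<open>f\<close> with values in
  the \<open>K\<close>-module \<open>P\<close>.\<close>

definition sweedler ::
  "'k ring \<Rightarrow> ('k, 'h) hopf \<Rightarrow> ('k, 'p, 'z) module_scheme \<Rightarrow> ('h \<Rightarrow> 'h \<Rightarrow> 'p) \<Rightarrow> 'h \<Rightarrow> 'p" where
  "sweedler K H P f h = tensor_lift K P f (comult H h)"

locale hopf_algebra = assoc_algebra K H
  for K :: "'k ring" and H :: "('k, 'h) hopf" (structure) +
  assumes comult_hom: "comult H \<in> ring_hom H (tensor_alg K H H)"
    and comult_smult: "\<lbrakk>c \<in> carrier K; h \<in> carrier H\<rbrakk> \<Longrightarrow>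
      comult H (c \<odot> h) = c \<odot>\<^bsub>tensor_alg K H H\<^esub> comult H h"
    and counit_hom: "counit H \<in> ring_hom H K"
    and counit_smult: "\<lbrakk>c \<in> carrier K; h \<in> carrier H\<rbrakk> \<Longrightarrow> counit H (c \<odot> h) = c \<otimes>\<^bsub>K\<^esub> counit H h"
    and coassoc: "h \<in> carrier H \<Longrightarrow>
      sweedler K H (tensor K H (tensor K H H)) (\<lambda>x y.
        sweedler K H (tensor K H (tensor K H H)) (\<lambda>x1 x2.
          pure_tensor K H (tensor K H H) x1 (pure_tensor K H H x2 y)) x) h =
      sweedler K H (tensor K H (tensor K H H)) (\<lambda>x y.
        pure_tensor K H (tensor K H H) x (comult H y)) h"
    and counit_left: "h \<in> carrier H \<Longrightarrow> sweedler K H H (\<lambda>x y. counit H x \<odot> y) h = h"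
    and counit_right: "h \<in> carrier H \<Longrightarrow> sweedler K H H (\<lambda>x y. counit H y \<odot> x) h = h"
    and antipode_closed: "antipode H \<in> carrier H \<rightarrow> carrier H"
    and antipode_add: "\<lbrakk>x \<in> carrier H; y \<in> carrier H\<rbrakk> \<Longrightarrow>
      antipode H (x \<oplus> y) = antipode H x \<oplus> antipode H y"
    and antipode_smult: "\<lbrakk>c \<in> carrier K; h \<in> carrier H\<rbrakk> \<Longrightarrow>
      antipode H (c \<odot> h) = c \<odot> antipode H h"
    and antipode_left: "h \<in> carrier H \<Longrightarrow>
      sweedler K H H (\<lambda>x y. antipode H x \<otimes> y) h = counit H h \<odot> \<one>"
    and antipode_right: "h \<in> carrier H \<Longrightarrow>
      sweedler K H H (\<lambda>x y. x \<otimes> antipode H y) h = counit H h \<odot> \<one>"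

locale cocommutative_hopf_algebra = hopf_algebra +
  assumes cocomm: "h \<in> carrier H \<Longrightarrow>
    sweedler K H (tensor K H H) (\<lambda>x y. pure_tensor K H H y x) h = comult H h"

text \<open>A linear map \<open>H \<otimes> A \<rightarrow> A\<close> is given by the corresponding bilinear map \<open>act\<close>.\<close>

locale symmetric_partial_action = H?: hopf_algebra K H + A?: assoc_algebra K A
  for K :: "'k ring" and H :: "('k, 'h) hopf" and A :: "('k, 'a) module"
    and act :: "'h \<Rightarrow> 'a \<Rightarrow> 'a" +
  assumes act_closed: "\<lbrakk>h \<in> carrier H; a \<in> carrier A\<rbrakk> \<Longrightarrow> act h a \<in> carrier A"
    and act_add_left: "\<lbrakk>h \<in> carrier H; k \<in> carrier H; a \<in> carrier A\<rbrakk> \<Longrightarrow>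
      act (h \<oplus>\<^bsub>H\<^esub> k) a = act h a \<oplus>\<^bsub>A\<^esub> act k a"
    and act_add_right: "\<lbrakk>h \<in> carrier H; a \<in> carrier A; b \<in> carrier A\<rbrakk> \<Longrightarrow>
      act h (a \<oplus>\<^bsub>A\<^esub> b) = act h a \<oplus>\<^bsub>A\<^esub> act h b"
    and act_smult_left: "\<lbrakk>c \<in> carrier K; h \<in> carrier H; a \<in> carrier A\<rbrakk> \<Longrightarrow>
      act (c \<odot>\<^bsub>H\<^esub> h) a = c \<odot>\<^bsub>A\<^esub> act h a"
    and act_smult_right: "\<lbrakk>c \<in> carrier K; h \<in> carrier H; a \<in> carrier A\<rbrakk> \<Longrightarrow>
      act h (c \<odot>\<^bsub>A\<^esub> a) = c \<odot>\<^bsub>A\<^esub> act h a"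
    and act_one: "a \<in> carrier A \<Longrightarrow> act \<one>\<^bsub>H\<^esub> a = a"
    and act_mult: "\<lbrakk>h \<in> carrier H; a \<in> carrier A; b \<in> carrier A\<rbrakk> \<Longrightarrow>
      act h (a \<otimes>\<^bsub>A\<^esub> b) = sweedler K H A (\<lambda>x y. act x a \<otimes>\<^bsub>A\<^esub> act y b) h"
    and act_act: "\<lbrakk>h \<in> carrier H; k \<in> carrier H; a \<in> carrier A\<rbrakk> \<Longrightarrow>
      act h (act k a) = sweedler K H A (\<lambda>x y. act x \<one>\<^bsub>A\<^esub> \<otimes>\<^bsub>A\<^esub> act (y \<otimes>\<^bsub>H\<^esub> k) a) h"
    and act_act_sym: "\<lbrakk>h \<in> carrier H; k \<in> carrier H; a \<in> carrier A\<rbrakk> \<Longrightarrow>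
      act h (act k a) = sweedler K H A (\<lambda>x y. act (x \<otimes>\<^bsub>H\<^esub> k) a \<otimes>\<^bsub>A\<^esub> act y \<one>\<^bsub>A\<^esub>) h"

definition smash_mult ::
  "'k ring \<Rightarrow> ('k, 'h) hopf \<Rightarrow> ('k, 'a) module \<Rightarrow> ('h \<Rightarrow> 'a \<Rightarrow> 'a) \<Rightarrow>
   ('a \<times> 'h \<Rightarrow> 'k) set \<Rightarrow> ('a \<times> 'h \<Rightarrow> 'k) set \<Rightarrow> ('a \<times> 'h \<Rightarrow> 'k) set" where
  "smash_mult K H A act s t = (let T = tensor K A H in
     tensor_lift K T (\<lambda>a h. tensor_lift K T (\<lambda>b k.
       sweedler K H T (\<lambda>x y. pure_tensor K A H (a \<otimes>\<^bsub>A\<^esub> act x b) (y \<otimes>\<^bsub>H\<^esub> k)) h) t) s)"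

definition smash ::
  "'k ring \<Rightarrow> ('k, 'h) hopf \<Rightarrow> ('k, 'a) module \<Rightarrow> ('h \<Rightarrow> 'a \<Rightarrow> 'a) \<Rightarrow>
   ('k, ('a \<times> 'h \<Rightarrow> 'k) set) module" where
  "smash K H A act = (let T = tensor K A H; e = pure_tensor K A H \<one>\<^bsub>A\<^esub> \<one>\<^bsub>H\<^esub> in T\<lparr>
     carrier := (\<lambda>t. smash_mult K H A act t e) ` carrier T,
     mult := smash_mult K H A act, one := e\<rparr>)"

definition smash_elt ::
  "'k ring \<Rightarrow> ('k, 'h) hopf \<Rightarrow> ('k, 'a) module \<Rightarrow> ('h \<Rightarrow> 'a \<Rightarrow> 'a) \<Rightarrow> 'a \<Rightarrow> 'h \<Rightarrow>
   ('a \<times> 'h \<Rightarrow> 'k) set" where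
  "smash_elt K H A act a h =
     sweedler K H (tensor K A H) (\<lambda>x y. pure_tensor K A H (a \<otimes>\<^bsub>A\<^esub> act x \<one>\<^bsub>A\<^esub>) y) h"

text \<open>
  The tensor algebra is the direct sum over \<open>n\<close> of the \<open>n\<close>-fold tensor powers: words of length \<open>n\<close>
  over the carrier of \<open>V\<close> modulo multilinearity span the \<open>n\<close>-th power.
\<close>

definition word_relators :: "'k ring \<Rightarrow> ('k, 'v, 'z) module_scheme \<Rightarrow> ('v list \<Rightarrow> 'k) set" where
  "word_relators K V = (let F = free_module K (lists (carrier V)); b = basis_elt K in
     {b (u @ [x \<oplus>\<^bsub>V\<^esub> y] @ v) \<ominus>\<^bsub>F\<^esub> b (u @ [x] @ v) \<ominus>\<^bsub>F\<^esub> b (u @ [y] @ v) |u v x y.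
        u \<in> lists (carrier V) \<and> v \<in> lists (carrier V) \<and> x \<in> carrier V \<and> y \<in> carrier V} \<union>
     {b (u @ [c \<odot>\<^bsub>V\<^esub> x] @ v) \<ominus>\<^bsub>F\<^esub> c \<odot>\<^bsub>F\<^esub> b (u @ [x] @ v) |u v c x.
        u \<in> lists (carrier V) \<and> v \<in> lists (carrier V) \<and> c \<in> carrier K \<and> x \<in> carrier V})"

definition word_kernel :: "'k ring \<Rightarrow> ('k, 'v, 'z) module_scheme \<Rightarrow> ('v list \<Rightarrow> 'k) set" where
  "word_kernel K V = gen_submodule K (free_module K (lists (carrier V))) (word_relators K V)"

definition word_tensor :: "'k ring \<Rightarrow> ('k, 'v, 'z) module_scheme \<Rightarrow> 'v list \<Rightarrow> ('v list \<Rightarrow> 'k) set" where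
  "word_tensor K V w = word_kernel K V +>\<^bsub>free_module K (lists (carrier V))\<^esub> basis_elt K w"

definition tensor_algebra ::
  "'k ring \<Rightarrow> ('k, 'v, 'z) module_scheme \<Rightarrow> ('k, ('v list \<Rightarrow> 'k) set) module" where
  "tensor_algebra K V =
     (let T = quot_module (free_module K (lists (carrier V))) (word_kernel K V) in T\<lparr>
       mult := (\<lambda>s t. induced_map K T (\<lambda>u. induced_map K T (\<lambda>v. word_tensor K V (u @ v)) t) s),
       one := word_tensor K V []\<rparr>)"

definition hpar_relators :: "'k ring \<Rightarrow> ('k, 'h) hopf \<Rightarrow> ('h list \<Rightarrow> 'k) set set" where
  "hpar_relators K H = (let T = tensor_algebra K H; S = antipode H; w = word_tensor K H in
     {w [\<one>\<^bsub>H\<^esub>] \<ominus>\<^bsub>T\<^esub> \<one>\<^bsub>T\<^esub>} \<union>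
     {sweedler K H T (\<lambda>x y. w [h, x, S y]) k \<ominus>\<^bsub>T\<^esub>
      sweedler K H T (\<lambda>x y. w [h \<otimes>\<^bsub>H\<^esub> x, S y]) k |h k. h \<in> carrier H \<and> k \<in> carrier H} \<union>
     {sweedler K H T (\<lambda>x y. w [x, S y, k]) h \<ominus>\<^bsub>T\<^esub>
      sweedler K H T (\<lambda>x y. w [x, S y \<otimes>\<^bsub>H\<^esub> k]) h |h k. h \<in> carrier H \<and> k \<in> carrier H} \<union>
     {sweedler K H T (\<lambda>x y. w [h, S x, y]) k \<ominus>\<^bsub>T\<^esub>
      sweedler K H T (\<lambda>x y. w [h \<otimes>\<^bsub>H\<^esub> S x, y]) k |h k. h \<in> carrier H \<and> k \<in> carrier H} \<union>
     {sweedler K H T (\<lambda>x y. w [S x, y, k]) h \<ominus>\<^bsub>T\<^esub>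
      sweedler K H T (\<lambda>x y. w [S x, y \<otimes>\<^bsub>H\<^esub> k]) h |h k. h \<in> carrier H \<and> k \<in> carrier H})"

definition hpar_ideal :: "'k ring \<Rightarrow> ('k, 'h) hopf \<Rightarrow> ('h list \<Rightarrow> 'k) set set" where
  "hpar_ideal K H = Idl\<^bsub>tensor_algebra K H\<^esub> (hpar_relators K H)"

definition hpar :: "'k ring \<Rightarrow> ('k, 'h) hopf \<Rightarrow> ('k, ('h list \<Rightarrow> 'k) set set) module" where
  "hpar K H = (let T = tensor_algebra K H; I = hpar_ideal K H; Q = T Quot I in
     \<lparr>carrier = carrier Q, mult = mult Q, one = one Q, zero = zero Q, add = add Q,
      smult = smult (quot_module T I)\<rparr>)"

definition hpar_class :: "'k ring \<Rightarrow> ('k, 'h) hopf \<Rightarrow> 'h \<Rightarrow> ('h list \<Rightarrow> 'k) set set" where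
  "hpar_class K H h = hpar_ideal K H +>\<^bsub>tensor_algebra K H\<^esub> word_tensor K H [h]"

text \<open>
  The left module structure over \<^term>\<open>hpar K H\<close> on a \<open>K\<close>-module \<open>P\<close> in which \<open>[h]\<close> acts as \<open>\<rho> h\<close>:
  the class of a word \<open>h\<^sub>1 \<otimes> \<dots> \<otimes> h\<^sub>n\<close> acts as \<open>\<rho> h\<^sub>1 \<circ> \<dots> \<circ> \<rho> h\<^sub>n\<close>. It is independent of the
  representatives when \<open>\<rho>\<close> satisfies the relations defining \<^term>\<open>hpar K H\<close>.
\<close>

definition hpar_module ::
  "'k ring \<Rightarrow> ('k, 'h) hopf \<Rightarrow> ('k, 'p) module \<Rightarrow> ('h \<Rightarrow> 'p \<Rightarrow> 'p) \<Rightarrow>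
   (('h list \<Rightarrow> 'k) set set, 'p) module" where
  "hpar_module K H P \<rho> = \<lparr>carrier = carrier P, mult = mult P, one = one P, zero = zero P,
     add = add P,
     smult = (\<lambda>z m. induced_map K P (\<lambda>w. foldr \<rho> w m) (SOME t. t \<in> z))\<rparr>"

definition hpar_idem :: "'k ring \<Rightarrow> ('k, 'h) hopf \<Rightarrow> 'h \<Rightarrow> ('h list \<Rightarrow> 'k) set set" where
  "hpar_idem K H h = sweedler K H (hpar K H)
     (\<lambda>x y. hpar_class K H x \<otimes>\<^bsub>hpar K H\<^esub> hpar_class K H (antipode H y)) h"

definition hpar_base :: "'k ring \<Rightarrow> ('k, 'h) hopf \<Rightarrow> ('h list \<Rightarrow> 'k) set set set" where
  "hpar_base K H = \<Inter>{C. subring C (hpar K H) \<and> submodule C K (hpar K H) \<and>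
     hpar_idem K H ` carrier H \<subseteq> C}"

definition hpar_base_module ::
  "'k ring \<Rightarrow> ('k, 'h) hopf \<Rightarrow> (('h list \<Rightarrow> 'k) set set, ('h list \<Rightarrow> 'k) set set) module" where
  "hpar_base_module K H = hpar_module K H ((hpar K H)\<lparr>carrier := hpar_base K H\<rparr>)
     (\<lambda>h b. sweedler K H (hpar K H) (\<lambda>x y.
        hpar_class K H x \<otimes>\<^bsub>hpar K H\<^esub> b \<otimes>\<^bsub>hpar K H\<^esub> hpar_class K H (antipode H y)) h)"

text \<open>The algebra map from the enveloping algebra of \<open>A\<close> to that of the smash product induced by
  \<open>a \<mapsto> a # 1\<close>; it makes every bimodule over the smash product an \<open>A\<close>-bimodule.\<close>

definition env_incl ::
  "'k ring \<Rightarrow> ('k, 'h) hopf \<Rightarrow> ('k, 'a) module \<Rightarrow> ('h \<Rightarrow> 'a \<Rightarrow> 'a) \<Rightarrow> ('a \<times> 'a \<Rightarrow> 'k) set \<Rightarrow>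
   (('a \<times> 'h \<Rightarrow> 'k) set \<times> ('a \<times> 'h \<Rightarrow> 'k) set \<Rightarrow> 'k) set" where
  "env_incl K H A act = (let R = smash K H A act in
     tensor_lift K (env_alg K R) (\<lambda>a b.
       env_tensor K R (smash_elt K H A act a \<one>\<^bsub>H\<^esub>) (smash_elt K H A act b \<one>\<^bsub>H\<^esub>)))"

text \<open>\<open>[h] \<rhd> m = (1 # h\<^sub>(\<^sub>1\<^sub>)) m (1 # S(h\<^sub>(\<^sub>2\<^sub>)))\<close>\<close>

definition bimodule_conj ::
  "'k ring \<Rightarrow> ('k, 'h) hopf \<Rightarrow> ('k, 'a) module \<Rightarrow> ('h \<Rightarrow> 'a \<Rightarrow> 'a) \<Rightarrow>
   ((('a \<times> 'h \<Rightarrow> 'k) set \<times> ('a \<times> 'h \<Rightarrow> 'k) set \<Rightarrow> 'k) set, 'm) module \<Rightarrow> 'h \<Rightarrow> 'm \<Rightarrow> 'm" where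
  "bimodule_conj K H A act M h m = (let R = smash K H A act in
     sweedler K H (base_module (env_alg K R) M) (\<lambda>x y.
       env_tensor K R (smash_elt K H A act \<one>\<^bsub>A\<^esub> x)
         (smash_elt K H A act \<one>\<^bsub>A\<^esub> (antipode H y)) \<odot>\<^bsub>M\<^esub> m) h)"

definition G1_hom ::
  "'k ring \<Rightarrow> ('k, 'h) hopf \<Rightarrow> ('k, 'a) module \<Rightarrow> ('h \<Rightarrow> 'a \<Rightarrow> 'a) \<Rightarrow>
   ((('a \<times> 'h \<Rightarrow> 'k) set \<times> ('a \<times> 'h \<Rightarrow> 'k) set \<Rightarrow> 'k) set, 'm) module \<Rightarrow> ('k, 'a \<Rightarrow> 'm) module" where
  "G1_hom K H A act M =
     hom_module (env_alg K A) (regular_bimodule K A) (restrict_scalars (env_incl K H A act) M)"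

text \<open>\<open>([h] \<rhd> f)(a) = [h\<^sub>(\<^sub>1\<^sub>)] \<rhd> f (S(h\<^sub>(\<^sub>2\<^sub>)) \<cdot> a)\<close>\<close>

definition G1_action ::
  "'k ring \<Rightarrow> ('k, 'h) hopf \<Rightarrow> ('k, 'a) module \<Rightarrow> ('h \<Rightarrow> 'a \<Rightarrow> 'a) \<Rightarrow>
   ((('a \<times> 'h \<Rightarrow> 'k) set \<times> ('a \<times> 'h \<Rightarrow> 'k) set \<Rightarrow> 'k) set, 'm) module \<Rightarrow>
   'h \<Rightarrow> ('a \<Rightarrow> 'm) \<Rightarrow> 'a \<Rightarrow> 'm" where
  "G1_action K H A act M h f = (\<lambda>a\<in>carrier A.
     sweedler K H (base_module (env_alg K (smash K H A act)) M) (\<lambda>x y.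
       bimodule_conj K H A act M x (f (act (antipode H y) a))) h)"

definition G1_functor ::
  "'k ring \<Rightarrow> ('k, 'h) hopf \<Rightarrow> ('k, 'a) module \<Rightarrow> ('h \<Rightarrow> 'a \<Rightarrow> 'a) \<Rightarrow>
   ((('a \<times> 'h \<Rightarrow> 'k) set \<times> ('a \<times> 'h \<Rightarrow> 'k) set \<Rightarrow> 'k) set, 'm,
    ('h list \<Rightarrow> 'k) set set, 'a \<Rightarrow> 'm) mod_functor" where
  "G1_functor K H A act =
     (\<lambda>M. hpar_module K H (G1_hom K H A act M) (G1_action K H A act M),
      \<lambda>M N f. \<lambda>g\<in>carrier (G1_hom K H A act M). compose (carrier A) f g)"

definition G2_functor ::
  "'k ring \<Rightarrow> ('k, 'h) hopf \<Rightarrow>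
   (('h list \<Rightarrow> 'k) set set, 'x, 'k, ('h list \<Rightarrow> 'k) set set \<Rightarrow> 'x) mod_functor" where
  "G2_functor K H = Hom_functor (hpar K H) (hpar_base_module K H)"

definition G_functor ::
  "'k ring \<Rightarrow> ('k, 'h) hopf \<Rightarrow> ('k, 'a) module \<Rightarrow> ('h \<Rightarrow> 'a \<Rightarrow> 'a) \<Rightarrow>
   ((('a \<times> 'h \<Rightarrow> 'k) set \<times> ('a \<times> 'h \<Rightarrow> 'k) set \<Rightarrow> 'k) set, 'm,
    'k, ('a \<times> 'h \<Rightarrow> 'k) set \<Rightarrow> 'm) mod_functor" where
  "G_functor K H A act = (let R = smash K H A act in
     Hom_functor (env_alg K R) (regular_bimodule K R))"

end

theory Submission
  imports Defs
begin

text \<open>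
  A homomorphism out of a cyclic module is determined by the image of a generator, and each of
  the three Hom functors has a cyclic first argument: \<open>A\<close> is generated by \<open>1\<close> over its
  enveloping algebra, \<open>A # H\<close> by its unit over the enveloping algebra of \<open>A # H\<close>, and \<open>B\<close> by \<open>1\<close>
  over \<open>H_par\<close>. Evaluation at the generator therefore turns the values of all three functors
  into modules of elements. It identifies \<open>G M\<close> with the centre of \<open>M\<close>, the elements with \<open>r m =
  m r\<close> for all \<open>r\<close> in \<open>A # H\<close>, and \<open>G_1 M\<close> with the \<open>A\<close>-centre \<open>C\<close> of \<open>M\<close>, on which \<open>[h]\<close> acts
  by conjugation, \<open>[h] \<rhd> m = (1 # h_1) m (1 # S h_2)\<close> (\<open>orbit_hom\<close>, \<open>hom_orbit\<close>, \<open>G1a_orbit\<close>).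
  It identifies \<open>Hom(B, N)\<close> over \<open>H_par\<close> with the elements \<open>n\<close> of \<open>N\<close> such that \<open>[h] n = e_h n\<close>
  for all \<open>h\<close> (\<open>hom_from_base\<close>, \<open>hom_from_invariant\<close>). The last identification holds because
  \<open>[h] \<rhd> 1 = e_h\<close> and because an element of \<open>B\<close> acts on \<open>B\<close> by multiplication (\<open>base_act\<close>),
  which in turn rests on the fact that the \<open>e_h\<close> commute.

  The composite \<open>G_2 (G_1 M)\<close> thus consists of the \<open>m \<in> C\<close> with \<open>[h] \<rhd> m = e_h m\<close>. On \<open>C\<close> the
  element \<open>e_h\<close> acts as multiplication by \<open>h \<cdot> 1\<close> (\<open>e_orbit\<close>). If \<open>m\<close> is central in \<open>M\<close>, then
  \<open>(1 # h_1) m (1 # S h_2) = (1 # h_1) (1 # S h_2) m = ((h \<cdot> 1) # 1) m\<close>, so \<open>m\<close> satisfies the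
  condition (\<open>center_D\<close>). Conversely, multiplying the condition by \<open>1 # h\<close> on the right gives
  \<open>(1 # h) m = m (1 # h)\<close>, and since \<open>A # 1\<close> and \<open>1 # H\<close> generate \<open>A # H\<close> the element \<open>m\<close> is
  central (\<open>invariant_center\<close>). The isomorphism sends \<open>F\<close> to \<open>r \<mapsto> r F(1)(1)\<close>, an expression that
  every homomorphism of bimodules respects.

  Cocommutativity enters through the module structures. It gives \<open>S (S h) = h\<close> and \<open>\<Delta> (S h) = S
  h_1 \<otimes> S h_2\<close> (\<open>S_S\<close>, \<open>sw_antipode\<close>) and allows the Sweedler factors of one element to be
  permuted. With these rules conjugation on any bimodule over the target of a partial
  representation satisfies the relations of \<open>H_par\<close> (\<open>D_operator_representation\<close>); this provides
  the module structures on \<open>B\<close> and on \<open>G_1 M\<close>. Tensor products, the tensor algebra and \<open>H_par\<close>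
  are presented by generators and relations, and maps out of them are evaluated through chosen
  representatives. That the choice does not matter (\<open>induced_lin_cl\<close>) is what gives their
  universal properties and the rules for Sweedler sums.
\<close>

section \<open>Linear maps\<close>

definition lin :: "'k ring \<Rightarrow> ('k, 'v, 'x) module_scheme \<Rightarrow> ('k, 'w, 'y) module_scheme \<Rightarrow> ('v \<Rightarrow> 'w) \<Rightarrow> bool" where
  "lin K V W f \<longleftrightarrow> (\<forall>x\<in>carrier V. f x \<in> carrier W) \<and>
     (\<forall>x\<in>carrier V. \<forall>y\<in>carrier V. f (x \<oplus>\<^bsub>V\<^esub> y) = f x \<oplus>\<^bsub>W\<^esub> f y) \<and>
     (\<forall>c\<in>carrier K. \<forall>x\<in>carrier V. f (c \<odot>\<^bsub>V\<^esub> x) = c \<odot>\<^bsub>W\<^esub> f x)"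

lemma linI:
  assumes "\<And>x. x \<in> carrier V \<Longrightarrow> f x \<in> carrier W"
    and "\<And>x y. x \<in> carrier V \<Longrightarrow> y \<in> carrier V \<Longrightarrow> f (x \<oplus>\<^bsub>V\<^esub> y) = f x \<oplus>\<^bsub>W\<^esub> f y"
    and "\<And>c x. c \<in> carrier K \<Longrightarrow> x \<in> carrier V \<Longrightarrow> f (c \<odot>\<^bsub>V\<^esub> x) = c \<odot>\<^bsub>W\<^esub> f x"
  shows "lin K V W f"
  using assms by (auto simp: lin_def)

lemma lin_closed: "lin K V W f \<Longrightarrow> x \<in> carrier V \<Longrightarrow> f x \<in> carrier W"
  and lin_add: "lin K V W f \<Longrightarrow> x \<in> carrier V \<Longrightarrow> y \<in> carrier V \<Longrightarrow> f (x \<oplus>\<^bsub>V\<^esub> y) = f x \<oplus>\<^bsub>W\<^esub> f y"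
  and lin_smult: "lin K V W f \<Longrightarrow> c \<in> carrier K \<Longrightarrow> x \<in> carrier V \<Longrightarrow> f (c \<odot>\<^bsub>V\<^esub> x) = c \<odot>\<^bsub>W\<^esub> f x"
  by (auto simp: lin_def)

lemma lin_zero:
  assumes "module K V" "module K W" "lin K V W f" shows "f \<zero>\<^bsub>V\<^esub> = \<zero>\<^bsub>W\<^esub>"
proof -
  interpret V: module K V by fact
  interpret W: module K W by fact
  have "f \<zero>\<^bsub>V\<^esub> = f (\<zero>\<^bsub>K\<^esub> \<odot>\<^bsub>V\<^esub> \<zero>\<^bsub>V\<^esub>)" by simp
  also have "\<dots> = \<zero>\<^bsub>W\<^esub>" using lin_smult[OF assms(3), of "\<zero>\<^bsub>K\<^esub>" "\<zero>\<^bsub>V\<^esub>"]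
      lin_closed[OF assms(3), of "\<zero>\<^bsub>V\<^esub>"] by simp
  finally show ?thesis .
qed

lemma lin_minus:
  assumes "module K V" "module K W" "lin K V W f" "x \<in> carrier V" "y \<in> carrier V"
  shows "f (x \<ominus>\<^bsub>V\<^esub> y) = f x \<ominus>\<^bsub>W\<^esub> f y"
proof -
  interpret V: module K V by fact
  interpret W: module K W by fact
  have "f (\<ominus>\<^bsub>V\<^esub> y) \<oplus>\<^bsub>W\<^esub> f y = \<zero>\<^bsub>W\<^esub>"
    using assms lin_add[OF assms(3), of "\<ominus>\<^bsub>V\<^esub> y" y] lin_zero[OF assms(1-3)] by (simp add: V.l_neg)
  then have "f (\<ominus>\<^bsub>V\<^esub> y) = \<ominus>\<^bsub>W\<^esub> f y"
    using assms lin_closed[OF assms(3)] by (simp add: W.minus_equality[symmetric])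
  then show ?thesis using assms lin_add[OF assms(3), of x "\<ominus>\<^bsub>V\<^esub> y"]
    by (simp add: V.minus_eq W.minus_eq)
qed

lemma lin_finsum:
  assumes "module K V" "module K W" "lin K V W f" "g \<in> S \<rightarrow> carrier V"
  shows "f (\<Oplus>\<^bsub>V\<^esub>x\<in>S. g x) = (\<Oplus>\<^bsub>W\<^esub>x\<in>S. f (g x))"
proof -
  interpret V: module K V by fact
  interpret W: module K W by fact
  note z = lin_zero[OF assms(1-3)]
  show ?thesis
  proof (cases "finite S")
    case True
    then show ?thesis using assms(4)
    proof (induction S)
      case empty then show ?case by (simp add: z)
    next
      case (insert x S)
      then show ?case using lin_closed[OF assms(3)] lin_add[OF assms(3)]
        by (simp add: Pi_def)
    qed
  qed (simp add: z V.finsum_infinite W.finsum_infinite)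
qed

lemma (in module) submoduleI_smult:
  assumes "W \<subseteq> carrier M" "\<zero>\<^bsub>M\<^esub> \<in> W" "\<And>a b. a \<in> W \<Longrightarrow> b \<in> W \<Longrightarrow> a \<oplus>\<^bsub>M\<^esub> b \<in> W"
    and sm: "\<And>c a. c \<in> carrier R \<Longrightarrow> a \<in> W \<Longrightarrow> c \<odot>\<^bsub>M\<^esub> a \<in> W"
  shows "submodule W R M"
proof (rule submoduleI)
  fix a assume a: "a \<in> W"
  then have "\<ominus>\<^bsub>M\<^esub> a = (\<ominus> \<one>) \<odot>\<^bsub>M\<^esub> a" using assms(1) by (auto simp: smult_l_minus)
  then show "\<ominus>\<^bsub>M\<^esub> a \<in> W" using sm[OF _ a, of "\<ominus> \<one>"] by simp
qed (use assms in auto)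

lemma lin_kernel_submodule:
  assumes "module K V" "module K W" "lin K V W f"
  shows "submodule {x \<in> carrier V. f x = \<zero>\<^bsub>W\<^esub>} K V"
proof -
  interpret V: module K V by fact
  interpret W: module K W by fact
  show ?thesis
    by (rule V.submoduleI_smult) (use lin_add[OF assms(3)] lin_smult[OF assms(3)] lin_zero[OF assms] in auto)
qed

lemma lin_id: "lin K V V (\<lambda>x. x)"
  by (auto simp: lin_def)

lemma lin_compose: "lin K W P g \<Longrightarrow> lin K V W f \<Longrightarrow> lin K V P (\<lambda>x. g (f x))"
  by (auto simp: lin_def)

lemma lin_body_finsum:
  assumes "module K V" "module K P" "\<And>x. x \<in> S \<Longrightarrow> lin K V P (\<lambda>v. f v x)"
  shows "lin K V P (\<lambda>v. \<Oplus>\<^bsub>P\<^esub>x\<in>S. f v x)"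
proof -
  interpret V: module K V by fact
  interpret P: module K P by fact
  have cl: "f v x \<in> carrier P" if "x \<in> S" "v \<in> carrier V" for x v
    using lin_closed[OF assms(3)] that by auto
  have ad: "f (v \<oplus>\<^bsub>V\<^esub> w) x = f v x \<oplus>\<^bsub>P\<^esub> f w x" if "x \<in> S" "v \<in> carrier V" "w \<in> carrier V" for x v w
    using lin_add[OF assms(3)] that by auto
  have sm: "f (c \<odot>\<^bsub>V\<^esub> v) x = c \<odot>\<^bsub>P\<^esub> f v x" if "x \<in> S" "v \<in> carrier V" "c \<in> carrier K" for x v c
    using lin_smult[OF assms(3)] that by auto
  show ?thesis
  proof (cases "finite S")
    case True
    show ?thesis
    proof (rule linI)
      fix c x assume c: "c \<in> carrier K" "x \<in> carrier V"
      have "(\<Oplus>\<^bsub>P\<^esub>y\<in>S. f (c \<odot>\<^bsub>V\<^esub> x) y) = (\<Oplus>\<^bsub>P\<^esub>y\<in>S. c \<odot>\<^bsub>P\<^esub> f x y)"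
        by (rule P.finsum_cong') (use c cl sm in auto)
      also have "\<dots> = c \<odot>\<^bsub>P\<^esub> (\<Oplus>\<^bsub>P\<^esub>y\<in>S. f x y)"
        by (rule P.finsum_smult_ldistr[symmetric]) (use c cl True in auto)
      finally show "(\<Oplus>\<^bsub>P\<^esub>y\<in>S. f (c \<odot>\<^bsub>V\<^esub> x) y) = c \<odot>\<^bsub>P\<^esub> (\<Oplus>\<^bsub>P\<^esub>y\<in>S. f x y)" .
    next
      fix x y assume c: "x \<in> carrier V" "y \<in> carrier V"
      have "(\<Oplus>\<^bsub>P\<^esub>z\<in>S. f (x \<oplus>\<^bsub>V\<^esub> y) z) = (\<Oplus>\<^bsub>P\<^esub>z\<in>S. f x z \<oplus>\<^bsub>P\<^esub> f y z)"
        by (rule P.finsum_cong') (use c cl ad in auto)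
      also have "\<dots> = (\<Oplus>\<^bsub>P\<^esub>z\<in>S. f x z) \<oplus>\<^bsub>P\<^esub> (\<Oplus>\<^bsub>P\<^esub>z\<in>S. f y z)"
        by (rule P.finsum_addf) (use c cl in auto)
      finally show "(\<Oplus>\<^bsub>P\<^esub>z\<in>S. f (x \<oplus>\<^bsub>V\<^esub> y) z) = (\<Oplus>\<^bsub>P\<^esub>z\<in>S. f x z) \<oplus>\<^bsub>P\<^esub> (\<Oplus>\<^bsub>P\<^esub>z\<in>S. f y z)" .
    qed (use cl in \<open>auto intro!: P.finsum_closed\<close>)
  qed (auto simp: lin_def P.finsum_infinite)
qed

lemma lin_smult_left:
  assumes "module K W" "lin K V W f" "c \<in> carrier K" "module K V"
  shows "lin K V W (\<lambda>v. c \<odot>\<^bsub>W\<^esub> f v)"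
proof -
  interpret W: module K W by fact
  show ?thesis using assms(2,3)
    by (auto simp: lin_def W.smult_r_distr W.smult_assoc1[symmetric] W.R.m_comm)
qed

lemma (in abelian_monoid) finsum_swap:
  assumes "\<And>x y. x \<in> S \<Longrightarrow> y \<in> T \<Longrightarrow> f x y \<in> carrier G" "finite S" "finite T"
  shows "(\<Oplus>x\<in>S. \<Oplus>y\<in>T. f x y) = (\<Oplus>y\<in>T. \<Oplus>x\<in>S. f x y)"
  using assms(2,1)
proof (induction S)
  case empty then show ?case by simp
next
  case (insert a S)
  have "(\<Oplus>y\<in>T. \<Oplus>x\<in>insert a S. f x y) = (\<Oplus>y\<in>T. f a y \<oplus> (\<Oplus>x\<in>S. f x y))"
    using insert by (intro finsum_cong') (auto intro!: finsum_closed)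
  also have "\<dots> = (\<Oplus>y\<in>T. f a y) \<oplus> (\<Oplus>y\<in>T. \<Oplus>x\<in>S. f x y)"
    using insert by (intro finsum_addf) (auto intro!: finsum_closed)
  also have "\<dots> = (\<Oplus>x\<in>insert a S. \<Oplus>y\<in>T. f x y)"
    using insert by (subst finsum_insert) (auto intro!: finsum_closed)
  finally show ?case by simp
qed

lemma submodule_zero: "module K V \<Longrightarrow> submodule W K V \<Longrightarrow> \<zero>\<^bsub>V\<^esub> \<in> W"
  using subgroup.one_closed[of W "add_monoid V"] by (simp add: submodule_def)

section \<open>Free modules\<close>

lemma free_module_is_module:
  assumes "cring K" shows "module K (free_module K X)"
proof -
  interpret K: cring K by fact
  have fin: "finite {x. f x \<oplus>\<^bsub>K\<^esub> g x \<noteq> \<zero>\<^bsub>K\<^esub>}"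
    if "finite {x. f x \<noteq> \<zero>\<^bsub>K\<^esub>}" "finite {x. g x \<noteq> \<zero>\<^bsub>K\<^esub>}" for f g :: "'b \<Rightarrow> 'a"
    by (rule finite_subset[OF _ finite_UnI[OF that]]) auto
  have memI: "f \<in> carrier (free_module K X)" if "\<And>x. x \<in> X \<Longrightarrow> f x \<in> carrier K"
    "\<And>x. x \<notin> X \<Longrightarrow> f x = \<zero>\<^bsub>K\<^esub>" "finite {x. f x \<noteq> \<zero>\<^bsub>K\<^esub>}" for f
    using that by (simp add: free_module_def)
  have D: "f x \<in> carrier K" "x \<notin> X \<longrightarrow> f x = \<zero>\<^bsub>K\<^esub>" "finite {x. f x \<noteq> \<zero>\<^bsub>K\<^esub>}"
    if "f \<in> carrier (free_module K X)" for f x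
    using that by (cases "x \<in> X"; simp add: free_module_def)+
  have add: "f \<oplus>\<^bsub>free_module K X\<^esub> g = (\<lambda>x. f x \<oplus>\<^bsub>K\<^esub> g x)"
    and sm: "c \<odot>\<^bsub>free_module K X\<^esub> f = (\<lambda>x. c \<otimes>\<^bsub>K\<^esub> f x)"
    and z: "\<zero>\<^bsub>free_module K X\<^esub> = (\<lambda>x. \<zero>\<^bsub>K\<^esub>)" for f g c
    by (simp_all add: free_module_def)
  have sub: "finite {x. h (f x) \<noteq> \<zero>\<^bsub>K\<^esub>}"
    if "f \<in> carrier (free_module K X)" "h \<zero>\<^bsub>K\<^esub> = \<zero>\<^bsub>K\<^esub>" for f h
    by (rule finite_subset[OF _ D(3)[OF that(1)]]) (use that(2) in auto)
  show ?thesis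
  proof (rule moduleI)
    show "abelian_group (free_module K X)"
    proof (rule abelian_groupI)
      fix x assume x: "x \<in> carrier (free_module K X)"
      have "(\<lambda>i. \<ominus>\<^bsub>K\<^esub> x i) \<in> carrier (free_module K X)"
        by (rule memI) (use D[OF x] sub[OF x, of "a_inv K"] in auto)
      then show "\<exists>y\<in>carrier (free_module K X). y \<oplus>\<^bsub>free_module K X\<^esub> x = \<zero>\<^bsub>free_module K X\<^esub>"
        by (rule bexI[rotated]) (simp add: add z D[OF x] K.l_neg)
    next
      fix x y assume x: "x \<in> carrier (free_module K X)" and y: "y \<in> carrier (free_module K X)"
      show "x \<oplus>\<^bsub>free_module K X\<^esub> y \<in> carrier (free_module K X)"
        unfolding add by (rule memI) (use D[OF x] D[OF y] fin in auto)
      show "x \<oplus>\<^bsub>free_module K X\<^esub> y = y \<oplus>\<^bsub>free_module K X\<^esub> x"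
        by (simp add: add D[OF x] D[OF y] K.a_comm)
    next
      fix x y w assume x: "x \<in> carrier (free_module K X)" and y: "y \<in> carrier (free_module K X)"
        and w: "w \<in> carrier (free_module K X)"
      show "x \<oplus>\<^bsub>free_module K X\<^esub> y \<oplus>\<^bsub>free_module K X\<^esub> w = x \<oplus>\<^bsub>free_module K X\<^esub> (y \<oplus>\<^bsub>free_module K X\<^esub> w)"
        by (simp add: add D[OF x] D[OF y] D[OF w] K.a_assoc)
    next
      show "\<zero>\<^bsub>free_module K X\<^esub> \<in> carrier (free_module K X)" unfolding z by (rule memI) auto
    next
      fix x assume x: "x \<in> carrier (free_module K X)"
      show "\<zero>\<^bsub>free_module K X\<^esub> \<oplus>\<^bsub>free_module K X\<^esub> x = x" by (simp add: z add D[OF x])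
    qed
  next
    fix a x assume a: "a \<in> carrier K" and x: "x \<in> carrier (free_module K X)"
    show "a \<odot>\<^bsub>free_module K X\<^esub> x \<in> carrier (free_module K X)"
      unfolding sm by (rule memI) (use a D[OF x] sub[OF x, of "\<lambda>y. a \<otimes>\<^bsub>K\<^esub> y"] in auto)
    fix y assume y: "y \<in> carrier (free_module K X)"
    show "a \<odot>\<^bsub>free_module K X\<^esub> (x \<oplus>\<^bsub>free_module K X\<^esub> y) =
        a \<odot>\<^bsub>free_module K X\<^esub> x \<oplus>\<^bsub>free_module K X\<^esub> a \<odot>\<^bsub>free_module K X\<^esub> y"
      by (simp add: sm add a D[OF x] D[OF y] K.r_distr)
  next
    fix a b x assume a: "a \<in> carrier K" "b \<in> carrier K" and x: "x \<in> carrier (free_module K X)"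
    show "(a \<oplus>\<^bsub>K\<^esub> b) \<odot>\<^bsub>free_module K X\<^esub> x =
        a \<odot>\<^bsub>free_module K X\<^esub> x \<oplus>\<^bsub>free_module K X\<^esub> b \<odot>\<^bsub>free_module K X\<^esub> x"
      by (simp add: sm add a D[OF x] K.l_distr)
    show "(a \<otimes>\<^bsub>K\<^esub> b) \<odot>\<^bsub>free_module K X\<^esub> x =
        a \<odot>\<^bsub>free_module K X\<^esub> (b \<odot>\<^bsub>free_module K X\<^esub> x)"
      by (simp add: sm a D[OF x] K.m_assoc)
  next
    fix x assume x: "x \<in> carrier (free_module K X)"
    show "\<one>\<^bsub>K\<^esub> \<odot>\<^bsub>free_module K X\<^esub> x = x" by (simp add: sm D[OF x])
  qed fact
qed

lemma basis_elt_closed: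
  assumes "cring K" "x \<in> X" shows "basis_elt K x \<in> carrier (free_module K X)"
proof -
  interpret K: cring K by fact
  show ?thesis using assms(2)
    by (auto simp: free_module_def basis_elt_def intro: finite_subset[of _ "{x}"])
qed

text \<open>
  The linear extension of \<open>g\<close> to the free module, written as the sum that also defines
  \<open>induced_map\<close>.
\<close>

definition free_lift :: "'k ring \<Rightarrow> ('k, 'p, 'z) module_scheme \<Rightarrow> ('x \<Rightarrow> 'p) \<Rightarrow> ('x \<Rightarrow> 'k) \<Rightarrow> 'p" where
  "free_lift K P g p = (\<Oplus>\<^bsub>P\<^esub>x\<in>{x. p x \<noteq> \<zero>\<^bsub>K\<^esub>}. p x \<odot>\<^bsub>P\<^esub> g x)"

lemma induced_map_eq: "induced_map K P g t = free_lift K P g (SOME p. p \<in> t)"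
  by (simp add: induced_map_def free_lift_def Let_def)

lemma free_carrierD:
  assumes "p \<in> carrier (free_module K X)"
  shows "finite {x. p x \<noteq> \<zero>\<^bsub>K\<^esub>}" "{x. p x \<noteq> \<zero>\<^bsub>K\<^esub>} \<subseteq> X" "x \<in> X \<Longrightarrow> p x \<in> carrier K"
  using assms by (auto simp: free_module_def)

text \<open>
  Summands outside the support vanish, so elements with different supports can be summed over a
  common index set.
\<close>

lemma free_lift_superset:
  assumes "module K P" "\<And>x. x \<in> X \<Longrightarrow> g x \<in> carrier P" "p \<in> carrier (free_module K X)"
    and "finite S" "{x. p x \<noteq> \<zero>\<^bsub>K\<^esub>} \<subseteq> S" "S \<subseteq> X"
  shows "free_lift K P g p = (\<Oplus>\<^bsub>P\<^esub>x\<in>S. p x \<odot>\<^bsub>P\<^esub> g x)"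
proof -
  interpret P: module K P by fact
  show ?thesis unfolding free_lift_def
    by (rule P.add.finprod_mono_neutral_cong_left)
      (use assms in \<open>auto simp: free_carrierD(3)[OF assms(3)] subset_iff\<close>)
qed

lemma free_lift_lin:
  assumes "module K P" "\<And>x. x \<in> X \<Longrightarrow> g x \<in> carrier P"
  shows "lin K (free_module K X) P (free_lift K P g)"
proof -
  interpret P: module K P by fact
  let ?F = "free_module K X"
  interpret F: module K ?F by (rule free_module_is_module) (rule P.R.is_cring)
  note cd = free_carrierD
  show ?thesis
  proof (rule linI)
    fix p assume p: "p \<in> carrier ?F"
    show "free_lift K P g p \<in> carrier P" unfolding free_lift_def
      by (rule P.finsum_closed) (use assms cd[OF p] in auto)
  next
    fix p q assume p: "p \<in> carrier ?F" and q: "q \<in> carrier ?F"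
    let ?S = "{x. p x \<noteq> \<zero>\<^bsub>K\<^esub>} \<union> {x. q x \<noteq> \<zero>\<^bsub>K\<^esub>}"
    have S: "finite ?S" "?S \<subseteq> X" using cd[OF p] cd[OF q] by auto
    have pq: "p \<oplus>\<^bsub>?F\<^esub> q \<in> carrier ?F" using p q by simp
    have sub: "{x. (p \<oplus>\<^bsub>?F\<^esub> q) x \<noteq> \<zero>\<^bsub>K\<^esub>} \<subseteq> ?S" by (auto simp: free_module_def)
    have "free_lift K P g (p \<oplus>\<^bsub>?F\<^esub> q) = (\<Oplus>\<^bsub>P\<^esub>x\<in>?S. (p \<oplus>\<^bsub>?F\<^esub> q) x \<odot>\<^bsub>P\<^esub> g x)"
      by (rule free_lift_superset[OF assms pq S(1) sub S(2)])
    also have "\<dots> = (\<Oplus>\<^bsub>P\<^esub>x\<in>?S. p x \<odot>\<^bsub>P\<^esub> g x \<oplus>\<^bsub>P\<^esub> q x \<odot>\<^bsub>P\<^esub> g x)"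
      by (rule P.finsum_cong')
        (use S(2) assms(2) cd(3)[OF p] cd(3)[OF q] in
          \<open>auto simp: free_module_def P.smult_l_distr subset_iff\<close>)
    also have "\<dots> = (\<Oplus>\<^bsub>P\<^esub>x\<in>?S. p x \<odot>\<^bsub>P\<^esub> g x) \<oplus>\<^bsub>P\<^esub> (\<Oplus>\<^bsub>P\<^esub>x\<in>?S. q x \<odot>\<^bsub>P\<^esub> g x)"
      by (rule P.finsum_addf) (use S(2) assms(2) cd(3)[OF p] cd(3)[OF q] in \<open>auto simp: subset_iff\<close>)
    also have "\<dots> = free_lift K P g p \<oplus>\<^bsub>P\<^esub> free_lift K P g q"
      by (subst (1 2) free_lift_superset[OF assms _ S(1) _ S(2)]) (use p q in auto)
    finally show "free_lift K P g (p \<oplus>\<^bsub>?F\<^esub> q) = free_lift K P g p \<oplus>\<^bsub>P\<^esub> free_lift K P g q" .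
  next
    fix c p assume c: "c \<in> carrier K" and p: "p \<in> carrier ?F"
    let ?S = "{x. p x \<noteq> \<zero>\<^bsub>K\<^esub>}"
    have S: "finite ?S" "?S \<subseteq> X" using cd[OF p] by auto
    have cp: "c \<odot>\<^bsub>?F\<^esub> p \<in> carrier ?F" using c p by simp
    have sub: "{x. (c \<odot>\<^bsub>?F\<^esub> p) x \<noteq> \<zero>\<^bsub>K\<^esub>} \<subseteq> ?S" using c by (auto simp: free_module_def)
    have "free_lift K P g (c \<odot>\<^bsub>?F\<^esub> p) = (\<Oplus>\<^bsub>P\<^esub>x\<in>?S. (c \<odot>\<^bsub>?F\<^esub> p) x \<odot>\<^bsub>P\<^esub> g x)"
      by (rule free_lift_superset[OF assms cp S(1) sub S(2)])
    also have "\<dots> = (\<Oplus>\<^bsub>P\<^esub>x\<in>?S. c \<odot>\<^bsub>P\<^esub> (p x \<odot>\<^bsub>P\<^esub> g x))"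
      by (rule P.finsum_cong')
        (use c S(2) assms(2) cd(3)[OF p] in \<open>auto simp: free_module_def P.smult_assoc1 subset_iff\<close>)
    also have "\<dots> = c \<odot>\<^bsub>P\<^esub> free_lift K P g p" unfolding free_lift_def
      by (rule P.finsum_smult_ldistr[symmetric]) (use c S assms(2) cd(3)[OF p] in \<open>auto simp: subset_iff\<close>)
    finally show "free_lift K P g (c \<odot>\<^bsub>?F\<^esub> p) = c \<odot>\<^bsub>P\<^esub> free_lift K P g p" .
  qed
qed

lemma free_lift_basis:
  assumes "module K P" "g x \<in> carrier P"
  shows "free_lift K P g (basis_elt K x) = g x"
proof -
  interpret P: module K P by fact
  have b: "basis_elt K x \<in> carrier (free_module K {x})"
    by (rule basis_elt_closed) (auto intro: P.R.is_cring)
  have "free_lift K P g (basis_elt K x) = (\<Oplus>\<^bsub>P\<^esub>y\<in>{x}. basis_elt K x y \<odot>\<^bsub>P\<^esub> g y)"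
    by (rule free_lift_superset[OF assms(1) _ b]) (use assms(2) in \<open>auto simp: basis_elt_def\<close>)
  also have "\<dots> = g x" using assms(2)
    by (subst P.finsum_insert) (auto simp: basis_elt_def)
  finally show ?thesis .
qed

lemma free_module_expand:
  assumes "cring K" "p \<in> carrier (free_module K X)"
  shows "free_lift K (free_module K X) (basis_elt K) p = p"
proof -
  let ?F = "free_module K X"
  interpret F: module K ?F by (rule free_module_is_module) fact
  \<comment> \<open>The free module on one point plays the role of \<open>K\<close> as a module, which makes evaluation at
    \<open>x\<close> a linear map between modules.\<close>
  have ev: "lin K ?F (free_module K {()}) (\<lambda>p u. p x)" if "x \<in> X" for x
    by (rule linI) (use that in \<open>auto simp: free_module_def\<close>)
  have "free_lift K ?F (basis_elt K) p x = p x" for x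
  proof (cases "x \<in> X")
    case False
    have "free_lift K ?F (basis_elt K) p \<in> carrier ?F"
      by (rule lin_closed[OF free_lift_lin assms(2)]) (use F.module_axioms basis_elt_closed[OF assms(1)] in auto)
    then show ?thesis using False assms(2) by (auto simp: free_module_def)
  next
    case True
    let ?S = "{x. p x \<noteq> \<zero>\<^bsub>K\<^esub>} \<union> {x}" and ?Q = "free_module K {()}"
    have S: "finite ?S" "?S \<subseteq> X" using free_carrierD[OF assms(2)] True by auto
    interpret Q: module K ?Q by (rule free_module_is_module) fact
    have mem: "p y \<odot>\<^bsub>?F\<^esub> basis_elt K y \<in> carrier ?F" if "y \<in> ?S" for y
    proof -
      have "y \<in> X" using S(2) that by auto
      then show ?thesis
        by (intro F.smult_closed free_carrierD(3)[OF assms(2)] basis_elt_closed[OF assms(1)])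
    qed
    have "free_lift K ?F (basis_elt K) p = (\<Oplus>\<^bsub>?F\<^esub>y\<in>?S. p y \<odot>\<^bsub>?F\<^esub> basis_elt K y)"
      by (rule free_lift_superset[OF F.module_axioms _ assms(2)])
        (use S assms basis_elt_closed in auto)
    then have "(\<lambda>u::unit. free_lift K ?F (basis_elt K) p x) =
        (\<lambda>u::unit. (\<Oplus>\<^bsub>?F\<^esub>y\<in>?S. p y \<odot>\<^bsub>?F\<^esub> basis_elt K y) x)" by simp
    also have "\<dots> = (\<Oplus>\<^bsub>?Q\<^esub>y\<in>?S. (\<lambda>u::unit. (p y \<odot>\<^bsub>?F\<^esub> basis_elt K y) x))"
      by (rule lin_finsum[OF F.module_axioms Q.module_axioms ev[OF True]]) (use mem in auto)
    also have "\<dots> = (\<Oplus>\<^bsub>?Q\<^esub>y\<in>{x}. (\<lambda>u::unit. p x))"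
      by (rule Q.add.finprod_mono_neutral_cong_right)
        (use S free_carrierD(3)[OF assms(2)] True F.R.cring_axioms in
          \<open>auto simp: free_module_def basis_elt_def subset_iff fun_eq_iff\<close>)
    also have "\<dots> = (\<lambda>u. p x)"
    proof -
      have "(\<lambda>u::unit. p x) \<in> carrier ?Q"
        using free_carrierD(3)[OF assms(2) True] by (simp add: free_module_def)
      then show ?thesis by (subst Q.finsum_insert) auto
    qed
    finally show ?thesis by (simp add: fun_eq_iff)
  qed
  then show ?thesis by blast
qed

lemma free_module_induct:
  assumes "cring K" "submodule Z K (free_module K X)" "\<And>x. x \<in> X \<Longrightarrow> basis_elt K x \<in> Z"
    and p: "p \<in> carrier (free_module K X)"
  shows "p \<in> Z"
proof -
  let ?F = "free_module K X"
  interpret F: module K ?F by (rule free_module_is_module) fact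
  note Z = F.submoduleE[OF assms(2)]
  have "(\<Oplus>\<^bsub>?F\<^esub>x\<in>S. p x \<odot>\<^bsub>?F\<^esub> basis_elt K x) \<in> Z" if "finite S" "S \<subseteq> X" for S
    using that
  proof (induction S)
    case empty
    then show ?case by (simp add: submodule_zero[OF F.module_axioms assms(2)])
  next
    case (insert x S)
    then have "p x \<odot>\<^bsub>?F\<^esub> basis_elt K x \<in> Z" using Z(4) assms(3) free_carrierD(3)[OF p] by auto
    moreover have "p y \<odot>\<^bsub>?F\<^esub> basis_elt K y \<in> carrier ?F" if "y \<in> insert x S" for y
      using that insert.prems
      by (intro F.smult_closed free_carrierD(3)[OF p] basis_elt_closed[OF assms(1)]) auto
    ultimately show ?case using insert
      by (subst F.finsum_insert) (auto intro!: Z(5))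
  qed
  from this[of "{x. p x \<noteq> \<zero>\<^bsub>K\<^esub>}"] show ?thesis
    using free_module_expand[OF assms(1) p] free_carrierD[OF p] by (simp add: free_lift_def)
qed

section \<open>Quotient modules\<close>

lemma submodule_abelian_subgroup:
  assumes "module K V" "submodule W K V" shows "abelian_subgroup W V"
proof -
  interpret V: module K V by fact
  show ?thesis
    using assms(2) by (intro abelian_subgroupI3 additive_subgroupI) (auto simp: submodule_def V.abelian_group_axioms)
qed

lemma quot_module_carrier: "carrier (quot_module V W) = (\<lambda>x. W +>\<^bsub>V\<^esub> x) ` carrier V"
  by (auto simp: quot_module_def A_RCOSETS_def' a_r_coset_def')

text \<open>
  The scalar multiple of a coset is a union over its elements; all members of that union are the
  same coset, because \<open>W\<close> is closed under scalars.
\<close>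

lemma quot_proj_lin:
  assumes "module K V" "submodule W K V"
  shows "lin K V (quot_module V W) (\<lambda>x. W +>\<^bsub>V\<^esub> x)"
proof -
  interpret V: module K V by fact
  interpret abelian_subgroup W V by (rule submodule_abelian_subgroup) fact+
  note sm = V.submoduleE[OF assms(2)]
  show ?thesis
  proof (rule linI)
    fix c x assume c: "c \<in> carrier K" and x: "x \<in> carrier V"
    have eq: "W +>\<^bsub>V\<^esub> (c \<odot>\<^bsub>V\<^esub> y) = W +>\<^bsub>V\<^esub> (c \<odot>\<^bsub>V\<^esub> x)" if y: "y \<in> W +>\<^bsub>V\<^esub> x" for y
    proof -
      obtain w where w: "w \<in> W" "y = w \<oplus>\<^bsub>V\<^esub> x" using y by (auto simp: a_r_coset_def')
      then have "c \<odot>\<^bsub>V\<^esub> y = c \<odot>\<^bsub>V\<^esub> w \<oplus>\<^bsub>V\<^esub> c \<odot>\<^bsub>V\<^esub> x" using c x sm(1) by (auto simp: V.smult_r_distr)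
      moreover have "c \<odot>\<^bsub>V\<^esub> w \<in> W" using sm(4) c w by auto
      ultimately have "c \<odot>\<^bsub>V\<^esub> y \<in> W +>\<^bsub>V\<^esub> (c \<odot>\<^bsub>V\<^esub> x)" by (auto simp: a_r_coset_def')
      then show ?thesis using c x by (intro V.a_repr_independence[symmetric])
          (auto simp: a_subgroup)
    qed
    have "x \<in> W +>\<^bsub>V\<^esub> x" using x by (simp add: a_rcos_self)
    with eq have "(\<Union>y\<in>W +>\<^bsub>V\<^esub> x. W +>\<^bsub>V\<^esub> (c \<odot>\<^bsub>V\<^esub> y)) = W +>\<^bsub>V\<^esub> (c \<odot>\<^bsub>V\<^esub> x)" by blast
    then show "W +>\<^bsub>V\<^esub> (c \<odot>\<^bsub>V\<^esub> x) = c \<odot>\<^bsub>quot_module V W\<^esub> (W +>\<^bsub>V\<^esub> x)"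
      by (simp add: quot_module_def)
  qed (simp_all add: quot_module_carrier, simp_all add: quot_module_def a_rcos_sum)
qed

lemma quot_module_is_module:
  fixes K :: "'k ring"
  assumes "module K V" "submodule W K V"
  shows "module K (quot_module V W)"
proof -
  interpret V: module K V by fact
  interpret abelian_subgroup W V by (rule submodule_abelian_subgroup) fact+
  let ?Q = "quot_module V W" and ?p = "\<lambda>x. W +>\<^bsub>V\<^esub> x"
  note l = quot_proj_lin[OF assms]
  note la = lin_add[OF l, symmetric] and ls = lin_smult[OF l, symmetric]
  have z: "\<zero>\<^bsub>?Q\<^esub> = ?p \<zero>\<^bsub>V\<^esub>" using a_subset by (simp add: quot_module_def)
  show ?thesis
  proof (rule moduleI)
    show "abelian_group ?Q"
    proof (rule abelian_groupI)
      fix x assume "x \<in> carrier ?Q"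
      then obtain v where v: "v \<in> carrier V" "x = ?p v" by (auto simp: quot_module_carrier)
      then show "\<exists>y\<in>carrier ?Q. y \<oplus>\<^bsub>?Q\<^esub> x = \<zero>\<^bsub>?Q\<^esub>"
        by (intro bexI[of _ "?p (\<ominus>\<^bsub>V\<^esub> v)"]) (auto simp: z la V.l_neg quot_module_carrier)
    qed (auto simp: quot_module_carrier z la V.a_ac)
  qed (auto simp: quot_module_carrier V.R.is_cring la ls V.smult_l_distr V.smult_r_distr V.smult_assoc1)
qed

lemma quot_eq_iff:
  fixes K :: "'k ring"
  assumes "module K V" "submodule W K V" "x \<in> carrier V" "y \<in> carrier V"
  shows "W +>\<^bsub>V\<^esub> x = W +>\<^bsub>V\<^esub> y \<longleftrightarrow> x \<ominus>\<^bsub>V\<^esub> y \<in> W"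
proof -
  interpret V: module K V by fact
  interpret abelian_subgroup W V by (rule submodule_abelian_subgroup) fact+
  have "W +>\<^bsub>V\<^esub> x = W +>\<^bsub>V\<^esub> y \<longleftrightarrow> x \<in> W +>\<^bsub>V\<^esub> y"
    using V.a_repr_independence[of x W y] a_rcos_self[of x] assms(3,4) a_subgroup by blast
  then show ?thesis using a_rcos_module[of y x] assms(3,4) by (simp add: V.minus_eq)
qed

lemma quot_rep:
  fixes K :: "'k ring"
  assumes "module K V" "submodule W K V" "t \<in> carrier (quot_module V W)"
  shows "(SOME p. p \<in> t) \<in> carrier V" "W +>\<^bsub>V\<^esub> (SOME p. p \<in> t) = t"
proof -
  interpret V: module K V by fact
  interpret abelian_subgroup W V by (rule submodule_abelian_subgroup) fact+
  obtain x where x: "x \<in> carrier V" "t = W +>\<^bsub>V\<^esub> x" using assms(3) by (auto simp: quot_module_carrier)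
  then have "x \<in> t" by (simp add: a_rcos_self)
  then have s: "(SOME p. p \<in> t) \<in> t" by (rule someI)
  then show "(SOME p. p \<in> t) \<in> carrier V" using x a_elemrcos_carrier by blast
  show "W +>\<^bsub>V\<^esub> (SOME p. p \<in> t) = t"
    using V.a_repr_independence[OF s[unfolded x(2)] x(1) a_subgroup] x(2) by simp
qed

text \<open>
  An intersection of submodules is a submodule; the family is not empty, since it contains the
  whole carrier.
\<close>

lemma gen_submodule_is_submodule:
  fixes K :: "'k ring"
  assumes "module K V" "S \<subseteq> carrier V"
  shows "submodule (gen_submodule K V S) K V" "S \<subseteq> gen_submodule K V S"
proof -
  interpret V: module K V by fact
  have c: "carrier V \<in> {W. submodule W K V \<and> S \<subseteq> W}" using assms V.carrier_is_submodule by auto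
  show "submodule (gen_submodule K V S) K V" unfolding gen_submodule_def
  proof (rule V.submoduleI)
    show "\<Inter> {W. submodule W K V \<and> S \<subseteq> W} \<subseteq> carrier V" using c by blast
    have "\<zero>\<^bsub>V\<^esub> \<in> W" if "submodule W K V" for W
      by (rule submodule_zero[OF assms(1) that])
    then show "\<zero>\<^bsub>V\<^esub> \<in> \<Inter> {W. submodule W K V \<and> S \<subseteq> W}" by blast
  qed (use V.submoduleE in \<open>auto 0 4\<close>)
qed (auto simp: gen_submodule_def)

lemma gen_submodule_least: "submodule W K V \<Longrightarrow> S \<subseteq> W \<Longrightarrow> gen_submodule K V S \<subseteq> W"
  by (auto simp: gen_submodule_def)

lemma (in abelian_group) minus_eq_zero_iff:
  assumes "x \<in> carrier G" "y \<in> carrier G" shows "x \<ominus> y = \<zero> \<longleftrightarrow> x = y"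
proof
  assume "x \<ominus> y = \<zero>"
  then have "x \<ominus> y \<oplus> y = y" using assms by simp
  then show "x = y" using assms by (simp add: minus_eq a_assoc l_neg)
qed (use assms in \<open>simp add: minus_eq r_neg\<close>)

lemma (in abelian_group) minus_zero_right: "x \<in> carrier G \<Longrightarrow> x \<ominus> \<zero> = x"
  using r_neg[of \<zero>] by (simp add: minus_eq)

lemma (in abelian_group) minus_minus_eq_zero_iff:
  assumes "x \<in> carrier G" "y \<in> carrier G" "z \<in> carrier G"
  shows "x \<ominus> y \<ominus> z = \<zero> \<longleftrightarrow> x = y \<oplus> z"
proof -
  have "x \<ominus> y \<ominus> z = x \<ominus> (y \<oplus> z)" using assms by (simp add: minus_eq a_assoc minus_add)
  then show ?thesis using assms minus_eq_zero_iff by simp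
qed

section \<open>Modules given by generators and relations\<close>

text \<open>
  Tensor products and tensor algebras are both free modules modulo the submodule generated by a
  set of relators. Maps out of such a quotient are treated here once for arbitrary generators
  and relators.
\<close>

locale presented =
  fixes K :: "'k ring" and X :: "'x set" and Rel :: "('x \<Rightarrow> 'k) set"
  assumes K_cring: "cring K" and Rel_sub: "Rel \<subseteq> carrier (free_module K X)"
begin

abbreviation "FM \<equiv> free_module K X"
abbreviation "Ker \<equiv> gen_submodule K FM Rel"
abbreviation "Quo \<equiv> quot_module FM Ker"
abbreviation "cl x \<equiv> Ker +>\<^bsub>FM\<^esub> basis_elt K x"

lemma FM: "module K FM" by (rule free_module_is_module[OF K_cring])
lemma Ker: "submodule Ker K FM" by (rule gen_submodule_is_submodule[OF FM Rel_sub])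
lemma Quo: "module K Quo" by (rule quot_module_is_module[OF FM Ker])
lemma proj: "lin K FM Quo (\<lambda>p. Ker +>\<^bsub>FM\<^esub> p)" by (rule quot_proj_lin[OF FM Ker])

lemma relator_zero:
  assumes "r \<in> Rel" shows "Ker +>\<^bsub>FM\<^esub> r = \<zero>\<^bsub>Quo\<^esub>"
proof -
  interpret FM: module K FM by (rule FM)
  have r: "r \<in> Ker" "r \<in> carrier FM"
    using gen_submodule_is_submodule(2)[OF FM Rel_sub] Rel_sub assms by auto
  have "Ker +>\<^bsub>FM\<^esub> r = Ker +>\<^bsub>FM\<^esub> \<zero>\<^bsub>FM\<^esub>"
    using r by (subst quot_eq_iff[OF FM Ker]) (auto simp: FM.minus_zero_right)
  then show ?thesis using lin_zero[OF FM Quo proj] by simp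
qed

lemma cl_closed: "x \<in> X \<Longrightarrow> cl x \<in> carrier Quo"
  by (rule lin_closed[OF proj basis_elt_closed[OF K_cring]])

text \<open>
  The elements of the free module whose class satisfies the predicate form a submodule that
  contains the basis.
\<close>

lemma induct [consumes 1, case_names cl zero add smult]:
  assumes t: "t \<in> carrier Quo" and "\<And>x. x \<in> X \<Longrightarrow> Pr (cl x)" and "Pr \<zero>\<^bsub>Quo\<^esub>"
    and "\<And>s t. s \<in> carrier Quo \<Longrightarrow> t \<in> carrier Quo \<Longrightarrow> Pr s \<Longrightarrow> Pr t \<Longrightarrow> Pr (s \<oplus>\<^bsub>Quo\<^esub> t)"
    and sm: "\<And>c s. c \<in> carrier K \<Longrightarrow> s \<in> carrier Quo \<Longrightarrow> Pr s \<Longrightarrow> Pr (c \<odot>\<^bsub>Quo\<^esub> s)"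
  shows "Pr t"
proof -
  interpret FM: module K FM by (rule FM)
  let ?Z = "{p \<in> carrier FM. Pr (Ker +>\<^bsub>FM\<^esub> p)}"
  have "submodule ?Z K FM"
  proof (rule FM.submoduleI_smult)
    show "\<zero>\<^bsub>FM\<^esub> \<in> ?Z" using assms(3) lin_zero[OF FM Quo proj] by simp
  next
    fix p q assume "p \<in> ?Z" "q \<in> ?Z"
    then show "p \<oplus>\<^bsub>FM\<^esub> q \<in> ?Z"
      using assms(4)[of "Ker +>\<^bsub>FM\<^esub> p" "Ker +>\<^bsub>FM\<^esub> q"] lin_add[OF proj] lin_closed[OF proj] by simp
  next
    fix c p assume "c \<in> carrier K" "p \<in> ?Z"
    then show "c \<odot>\<^bsub>FM\<^esub> p \<in> ?Z"
      using sm[of c "Ker +>\<^bsub>FM\<^esub> p"] lin_smult[OF proj] lin_closed[OF proj] by simp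
  qed auto
  moreover have "basis_elt K x \<in> ?Z" if "x \<in> X" for x
    using that assms(2) basis_elt_closed[OF K_cring] by simp
  ultimately have "(SOME p. p \<in> t) \<in> ?Z"
    using quot_rep(1)[OF FM Ker t] by (rule free_module_induct[OF K_cring])
  then show ?thesis using quot_rep(2)[OF FM Ker t] by simp
qed

lemma ext:
  assumes "lin K Quo P f" "lin K Quo P g" "module K P" "\<And>x. x \<in> X \<Longrightarrow> f (cl x) = g (cl x)"
    and t: "t \<in> carrier Quo"
  shows "f t = g t"
  using t by (induction rule: induct)
    (use assms(4) in \<open>simp_all add: lin_zero[OF Quo assms(3,1)] lin_zero[OF Quo assms(3,2)]
      lin_add[OF assms(1)] lin_add[OF assms(2)] lin_smult[OF assms(1)] lin_smult[OF assms(2)]\<close>)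

lemma repr: "t \<in> carrier Quo \<Longrightarrow> (SOME p. p \<in> t) \<in> carrier FM"
  by (rule quot_rep(1)[OF FM Ker])

lemma induced_closed:
  assumes "module K P" "\<And>x. x \<in> X \<Longrightarrow> g x \<in> carrier P" "t \<in> carrier Quo"
  shows "induced_map K P g t \<in> carrier P"
  unfolding induced_map_eq by (rule lin_closed[OF free_lift_lin[OF assms(1,2)] repr[OF assms(3)]])

text \<open>
  An induced map is evaluated through one chosen representative and is therefore a finite sum.
  Congruence, compatibility with a linear map and linear dependence on a parameter are
  statements about this sum, and hold for every \<open>g\<close>, whether or not its linear extension kills
  the relators.
\<close>

lemma induced_cong:
  assumes "module K P" "\<And>x. x \<in> X \<Longrightarrow> g x \<in> carrier P" "\<And>x. x \<in> X \<Longrightarrow> g x = g' x" "t \<in> carrier Quo"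
  shows "induced_map K P g t = induced_map K P g' t"
proof -
  interpret P: module K P by fact
  let ?p = "SOME p. p \<in> t"
  note p = repr[OF assms(4)]
  have "?p x \<odot>\<^bsub>P\<^esub> g x = ?p x \<odot>\<^bsub>P\<^esub> g' x" "?p x \<odot>\<^bsub>P\<^esub> g' x \<in> carrier P" if "?p x \<noteq> \<zero>\<^bsub>K\<^esub>" for x
  proof -
    have "x \<in> X" using free_carrierD(2)[OF p] that by auto
    then show "?p x \<odot>\<^bsub>P\<^esub> g x = ?p x \<odot>\<^bsub>P\<^esub> g' x" "?p x \<odot>\<^bsub>P\<^esub> g' x \<in> carrier P"
      using assms(2)[of x] assms(3)[of x] free_carrierD(3)[OF p] by auto
  qed
  then show ?thesis unfolding induced_map_eq free_lift_def
    by (intro P.finsum_cong') auto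
qed

lemma induced_push:
  assumes "module K P" "module K P'" "lin K P P' h" "\<And>x. x \<in> X \<Longrightarrow> g x \<in> carrier P" "t \<in> carrier Quo"
  shows "h (induced_map K P g t) = induced_map K P' (\<lambda>x. h (g x)) t"
proof -
  interpret P: module K P by fact
  interpret P': module K P' by fact
  let ?p = "SOME p. p \<in> t"
  note p = repr[OF assms(5)]
  have m: "g x \<in> carrier P" "?p x \<in> carrier K" if "?p x \<noteq> \<zero>\<^bsub>K\<^esub>" for x
  proof -
    have "x \<in> X" using free_carrierD(2)[OF p] that by auto
    then show "g x \<in> carrier P" "?p x \<in> carrier K" using assms(4)[of x] free_carrierD(3)[OF p] by auto
  qed
  have "h (induced_map K P g t) = (\<Oplus>\<^bsub>P'\<^esub>x\<in>{x. ?p x \<noteq> \<zero>\<^bsub>K\<^esub>}. h (?p x \<odot>\<^bsub>P\<^esub> g x))"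
    unfolding induced_map_eq free_lift_def
    by (rule lin_finsum[OF assms(1-3)]) (use m in auto)
  also have "\<dots> = induced_map K P' (\<lambda>x. h (g x)) t"
    unfolding induced_map_eq free_lift_def
    by (rule P'.finsum_cong') (use m lin_smult[OF assms(3)] lin_closed[OF assms(3)] in auto)
  finally show ?thesis .
qed

lemma induced_body_lin:
  assumes "module K V" "module K P" "\<And>x. x \<in> X \<Longrightarrow> lin K V P (\<lambda>v. f v x)" "t \<in> carrier Quo"
  shows "lin K V P (\<lambda>v. induced_map K P (f v) t)"
proof -
  note p = repr[OF assms(4)]
  show ?thesis unfolding induced_map_eq free_lift_def
    by (rule lin_body_finsum[OF assms(1,2)], rule lin_smult_left)
      (use assms(1-3) free_carrierD(2,3)[OF p] in auto)
qed

text \<open>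
  The linear extension of \<open>g\<close> vanishes on the relators, hence on the submodule that they
  generate, so that any representative gives the same value.
\<close>

lemma induced_lin_cl:
  assumes P: "module K P" and g: "\<And>x. x \<in> X \<Longrightarrow> g x \<in> carrier P"
    and r: "\<And>r. r \<in> Rel \<Longrightarrow> free_lift K P g r = \<zero>\<^bsub>P\<^esub>"
  shows "lin K Quo P (induced_map K P g)" and "x \<in> X \<Longrightarrow> induced_map K P g (cl x) = g x"
proof -
  interpret P: module K P by fact
  interpret FM: module K FM by (rule FM)
  let ?l = "free_lift K P g"
  note l = free_lift_lin[OF P g]
  let ?N = "{p \<in> carrier FM. ?l p = \<zero>\<^bsub>P\<^esub>}"
  have kn: "Ker \<subseteq> ?N"
    by (rule gen_submodule_least[OF lin_kernel_submodule[OF FM P l]]) (use Rel_sub r in auto)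
  have ev: "induced_map K P g (Ker +>\<^bsub>FM\<^esub> p) = ?l p" if p: "p \<in> carrier FM" for p
  proof -
    let ?t = "Ker +>\<^bsub>FM\<^esub> p"
    have t: "?t \<in> carrier Quo" using lin_closed[OF proj p] .
    let ?q = "SOME p. p \<in> ?t"
    have q: "?q \<in> carrier FM" "Ker +>\<^bsub>FM\<^esub> ?q = ?t" using quot_rep[OF FM Ker t] by auto
    have "?q \<ominus>\<^bsub>FM\<^esub> p \<in> Ker" using quot_eq_iff[OF FM Ker q(1) p] q(2) by simp
    with kn have "?l (?q \<ominus>\<^bsub>FM\<^esub> p) = \<zero>\<^bsub>P\<^esub>" by blast
    then show ?thesis unfolding induced_map_eq
      using lin_minus[OF FM P l q(1) p] P.minus_eq_zero_iff[OF lin_closed[OF l q(1)] lin_closed[OF l p]]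
      by simp
  qed
  show "lin K Quo P (induced_map K P g)"
  proof (rule linI)
    fix s assume s: "s \<in> carrier Quo"
    show "induced_map K P g s \<in> carrier P" by (rule induced_closed[OF P _ s]) (rule g)
  next
    fix s t assume "s \<in> carrier Quo" "t \<in> carrier Quo"
    then obtain p q where p: "p \<in> carrier FM" "s = Ker +>\<^bsub>FM\<^esub> p" and q: "q \<in> carrier FM" "t = Ker +>\<^bsub>FM\<^esub> q"
      by (auto simp: quot_module_carrier)
    then show "induced_map K P g (s \<oplus>\<^bsub>Quo\<^esub> t) = induced_map K P g s \<oplus>\<^bsub>P\<^esub> induced_map K P g t"
      by (simp add: lin_add[OF proj, symmetric] ev lin_add[OF l])
  next
    fix c s assume c: "c \<in> carrier K" and "s \<in> carrier Quo"
    then obtain p where p: "p \<in> carrier FM" "s = Ker +>\<^bsub>FM\<^esub> p" by (auto simp: quot_module_carrier)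
    then show "induced_map K P g (c \<odot>\<^bsub>Quo\<^esub> s) = c \<odot>\<^bsub>P\<^esub> induced_map K P g s"
      using c by (simp add: lin_smult[OF proj, symmetric] ev lin_smult[OF l])
  qed
  show "induced_map K P g (cl x) = g x" if "x \<in> X"
    using that by (simp add: ev basis_elt_closed[OF K_cring] free_lift_basis[OF P] g)
qed

end

section \<open>Tensor products of modules and of algebras\<close>

definition bil :: "'k ring \<Rightarrow> ('k, 'a, 'x) module_scheme \<Rightarrow> ('k, 'b, 'y) module_scheme \<Rightarrow>
    ('k, 'p, 'z) module_scheme \<Rightarrow> ('a \<Rightarrow> 'b \<Rightarrow> 'p) \<Rightarrow> bool" where
  "bil K M N P f \<longleftrightarrow> (\<forall>y\<in>carrier N. lin K M P (\<lambda>x. f x y)) \<and> (\<forall>x\<in>carrier M. lin K N P (\<lambda>y. f x y))"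

lemma bilI:
  "(\<And>y. y \<in> carrier N \<Longrightarrow> lin K M P (\<lambda>x. f x y)) \<Longrightarrow> (\<And>x. x \<in> carrier M \<Longrightarrow> lin K N P (\<lambda>y. f x y)) \<Longrightarrow>
    bil K M N P f"
  by (simp add: bil_def)

lemma bilD: "bil K M N P f \<Longrightarrow> y \<in> carrier N \<Longrightarrow> lin K M P (\<lambda>x. f x y)"
  "bil K M N P f \<Longrightarrow> x \<in> carrier M \<Longrightarrow> lin K N P (\<lambda>y. f x y)"
  by (simp_all add: bil_def)

lemma bil_closed: "bil K M N P f \<Longrightarrow> x \<in> carrier M \<Longrightarrow> y \<in> carrier N \<Longrightarrow> f x y \<in> carrier P"
  using lin_closed[OF bilD(1)] .

text \<open>
  The universal property of the tensor product: bilinear maps correspond to linear maps on it.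
\<close>

locale two_modules = M: module K M + N: module K N
  for K :: "'k ring" and M :: "('k, 'a, 'x) module_scheme" and N :: "('k, 'b, 'y) module_scheme"
begin

abbreviation "T \<equiv> tensor K M N"
abbreviation "tns x y \<equiv> pure_tensor K M N x y"

sublocale pr: presented K "carrier M \<times> carrier N" "tensor_relators K M N"
proof (rule presented.intro)
  show "cring K" by (rule M.R.is_cring)
  interpret F: module K "free_module K (carrier M \<times> carrier N)"
    by (rule free_module_is_module[OF M.R.is_cring])
  have b: "basis_elt K (x, y) \<in> carrier (free_module K (carrier M \<times> carrier N))"
    if "x \<in> carrier M" "y \<in> carrier N" for x y
    by (rule basis_elt_closed[OF M.R.is_cring]) (use that in auto)
  show "tensor_relators K M N \<subseteq> carrier (free_module K (carrier M \<times> carrier N))"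
    unfolding tensor_relators_def Let_def by (auto intro!: F.minus_closed b)
qed

lemma T_eq: "T = pr.Quo" by (simp add: tensor_def tensor_kernel_def)
lemma tns_eq: "tns x y = pr.cl (x, y)" by (simp add: pure_tensor_def tensor_kernel_def)

lemma T_module: "module K T" unfolding T_eq by (rule pr.Quo)

lemma tns_closed: "x \<in> carrier M \<Longrightarrow> y \<in> carrier N \<Longrightarrow> tns x y \<in> carrier T"
  unfolding T_eq tns_eq by (rule pr.cl_closed) simp

lemma T_induct [consumes 1, case_names tns zero add smult]:
  assumes "t \<in> carrier T" and "\<And>x y. x \<in> carrier M \<Longrightarrow> y \<in> carrier N \<Longrightarrow> Pr (tns x y)" and "Pr \<zero>\<^bsub>T\<^esub>"
    and "\<And>s t. s \<in> carrier T \<Longrightarrow> t \<in> carrier T \<Longrightarrow> Pr s \<Longrightarrow> Pr t \<Longrightarrow> Pr (s \<oplus>\<^bsub>T\<^esub> t)"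
    and "\<And>c s. c \<in> carrier K \<Longrightarrow> s \<in> carrier T \<Longrightarrow> Pr s \<Longrightarrow> Pr (c \<odot>\<^bsub>T\<^esub> s)"
  shows "Pr t"
proof -
  have "t \<in> carrier pr.Quo" using assms(1) T_eq by simp
  then show ?thesis
  proof (induction rule: pr.induct)
    case (cl x)
    then show ?case using assms(2)[of "fst x" "snd x"] by (auto simp: tns_eq)
  qed (use assms(3-5)[unfolded T_eq] in blast)+
qed

lemma T_ext:
  assumes "lin K T P f" "lin K T P g" "module K P"
    "\<And>x y. x \<in> carrier M \<Longrightarrow> y \<in> carrier N \<Longrightarrow> f (tns x y) = g (tns x y)" "t \<in> carrier T"
  shows "f t = g t"
  using pr.ext[of P f g t] assms unfolding T_eq tns_eq by auto

lemma lift_closed: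
  assumes "module K P" "\<And>x y. x \<in> carrier M \<Longrightarrow> y \<in> carrier N \<Longrightarrow> f x y \<in> carrier P" "t \<in> carrier T"
  shows "tensor_lift K P f t \<in> carrier P"
  unfolding tensor_lift_def by (rule pr.induced_closed) (use assms T_eq in auto)

lemma lift_cong:
  assumes "module K P" "\<And>x y. x \<in> carrier M \<Longrightarrow> y \<in> carrier N \<Longrightarrow> f x y \<in> carrier P"
    "\<And>x y. x \<in> carrier M \<Longrightarrow> y \<in> carrier N \<Longrightarrow> f x y = g x y" "t \<in> carrier T"
  shows "tensor_lift K P f t = tensor_lift K P g t"
  unfolding tensor_lift_def by (rule pr.induced_cong) (use assms T_eq in auto)

lemma lift_push:
  assumes "module K P" "module K P'" "lin K P P' h"
    "\<And>x y. x \<in> carrier M \<Longrightarrow> y \<in> carrier N \<Longrightarrow> f x y \<in> carrier P" "t \<in> carrier T"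
  shows "h (tensor_lift K P f t) = tensor_lift K P' (\<lambda>x y. h (f x y)) t"
  unfolding tensor_lift_def
  by (subst pr.induced_push[OF assms(1-3)]) (use assms T_eq in \<open>auto simp: case_prod_beta'\<close>)

lemma lift_body_lin:
  assumes "module K V" "module K P"
    "\<And>x y. x \<in> carrier M \<Longrightarrow> y \<in> carrier N \<Longrightarrow> lin K V P (\<lambda>v. f v x y)" "t \<in> carrier T"
  shows "lin K V P (\<lambda>v. tensor_lift K P (f v) t)"
  unfolding tensor_lift_def by (rule pr.induced_body_lin) (use assms T_eq in auto)

lemma lift_relators:
  assumes P: "module K P" and f: "bil K M N P f" and r: "r \<in> tensor_relators K M N"
  shows "free_lift K P (\<lambda>(x, y). f x y) r = \<zero>\<^bsub>P\<^esub>"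
proof -
  interpret P: module K P by fact
  let ?F = "free_module K (carrier M \<times> carrier N)"
  interpret F: module K ?F by (rule pr.FM)
  have l: "lin K ?F P (free_lift K P (\<lambda>(x, y). f x y))"
    by (rule free_lift_lin[OF P]) (use bil_closed[OF f] in auto)
  have b: "basis_elt K (x, y) \<in> carrier ?F" if "x \<in> carrier M" "y \<in> carrier N" for x y
    by (rule basis_elt_closed[OF M.R.is_cring]) (use that in auto)
  have lb: "free_lift K P (\<lambda>(x, y). f x y) (basis_elt K (x, y)) = f x y"
    if "x \<in> carrier M" "y \<in> carrier N" for x y
    using free_lift_basis[OF P, of "\<lambda>(x, y). f x y" "(x,y)"] bil_closed[OF f that] by simp
  note lm = lin_minus[OF pr.FM P l]
  note c = bil_closed[OF f]
  have sub: "a \<oplus>\<^bsub>P\<^esub> b \<ominus>\<^bsub>P\<^esub> a \<ominus>\<^bsub>P\<^esub> b = \<zero>\<^bsub>P\<^esub>" if "a \<in> carrier P" "b \<in> carrier P" for a b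
    using that by (simp add: P.minus_minus_eq_zero_iff)
  from r show ?thesis unfolding tensor_relators_def Let_def
    by (elim UnE CollectE exE conjE; simp)
      (simp_all add: lm b lb c lin_add[OF bilD(1)[OF f]] lin_add[OF bilD(2)[OF f]]
        lin_smult[OF bilD(1)[OF f]] lin_smult[OF bilD(2)[OF f]] lin_smult[OF l] sub P.minus_eq_zero_iff)
qed

lemma lift_lin: "module K P \<Longrightarrow> bil K M N P f \<Longrightarrow> lin K T P (tensor_lift K P f)"
  unfolding T_eq tensor_lift_def
  by (rule pr.induced_lin_cl(1)) (auto simp: lift_relators bil_closed)

lemma lift_tns:
  "module K P \<Longrightarrow> bil K M N P f \<Longrightarrow> x \<in> carrier M \<Longrightarrow> y \<in> carrier N \<Longrightarrow> tensor_lift K P f (tns x y) = f x y"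
  unfolding tns_eq tensor_lift_def
  by (subst pr.induced_lin_cl(2)) (auto simp: lift_relators bil_closed)

text \<open>
  Each instance of bilinearity is one of the relators of the tensor product, read modulo the
  submodule that they generate.
\<close>

lemma tns_bil: "bil K M N T (pure_tensor K M N)"
proof -
  let ?F = "free_module K (carrier M \<times> carrier N)"
  interpret F: module K ?F by (rule pr.FM)
  interpret T: module K T by (rule T_module)
  have b: "basis_elt K (x, y) \<in> carrier ?F" if "x \<in> carrier M" "y \<in> carrier N" for x y
    by (rule basis_elt_closed[OF M.R.is_cring]) (use that in auto)
  note zero = pr.relator_zero[folded T_eq]
  note lm = lin_minus[OF pr.FM pr.Quo pr.proj]
  have sub: "a = b \<oplus>\<^bsub>T\<^esub> c" if "a \<ominus>\<^bsub>T\<^esub> b \<ominus>\<^bsub>T\<^esub> c = \<zero>\<^bsub>T\<^esub>" "a \<in> carrier T" "b \<in> carrier T" "c \<in> carrier T" for a b c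
    using that by (simp add: T.minus_minus_eq_zero_iff)
  show ?thesis
  proof (rule bilI)
    fix y assume y: "y \<in> carrier N"
    show "lin K M T (\<lambda>x. tns x y)"
    proof (rule linI)
      fix x x' assume x: "x \<in> carrier M" "x' \<in> carrier M"
      have "basis_elt K (x \<oplus>\<^bsub>M\<^esub> x', y) \<ominus>\<^bsub>?F\<^esub> basis_elt K (x, y) \<ominus>\<^bsub>?F\<^esub> basis_elt K (x', y) \<in> tensor_relators K M N"
        unfolding tensor_relators_def Let_def using x y by blast
      from zero[OF this] show "tns (x \<oplus>\<^bsub>M\<^esub> x') y = tns x y \<oplus>\<^bsub>T\<^esub> tns x' y"
        using x y by (intro sub tns_closed) (auto simp: lm b tns_eq T_eq)
    next
      fix c x assume x: "c \<in> carrier K" "x \<in> carrier M"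
      have "basis_elt K (c \<odot>\<^bsub>M\<^esub> x, y) \<ominus>\<^bsub>?F\<^esub> c \<odot>\<^bsub>?F\<^esub> basis_elt K (x, y) \<in> tensor_relators K M N"
        unfolding tensor_relators_def Let_def using x y by blast
      from zero[OF this] have "tns (c \<odot>\<^bsub>M\<^esub> x) y \<ominus>\<^bsub>T\<^esub> c \<odot>\<^bsub>T\<^esub> tns x y = \<zero>\<^bsub>T\<^esub>"
        using x y by (simp add: lm b tns_eq T_eq lin_smult[OF pr.proj])
      then show "tns (c \<odot>\<^bsub>M\<^esub> x) y = c \<odot>\<^bsub>T\<^esub> tns x y"
        using x y by (subst (asm) T.minus_eq_zero_iff) (auto intro: tns_closed)
    qed (use y tns_closed in auto)
  next
    fix x assume x: "x \<in> carrier M"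
    show "lin K N T (\<lambda>y. tns x y)"
    proof (rule linI)
      fix y y' assume y: "y \<in> carrier N" "y' \<in> carrier N"
      have "basis_elt K (x, y \<oplus>\<^bsub>N\<^esub> y') \<ominus>\<^bsub>?F\<^esub> basis_elt K (x, y) \<ominus>\<^bsub>?F\<^esub> basis_elt K (x, y') \<in> tensor_relators K M N"
        unfolding tensor_relators_def Let_def using x y by blast
      from zero[OF this] show "tns x (y \<oplus>\<^bsub>N\<^esub> y') = tns x y \<oplus>\<^bsub>T\<^esub> tns x y'"
        using x y by (intro sub tns_closed) (auto simp: lm b tns_eq T_eq)
    next
      fix c y assume y: "c \<in> carrier K" "y \<in> carrier N"
      have "basis_elt K (x, c \<odot>\<^bsub>N\<^esub> y) \<ominus>\<^bsub>?F\<^esub> c \<odot>\<^bsub>?F\<^esub> basis_elt K (x, y) \<in> tensor_relators K M N"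
        unfolding tensor_relators_def Let_def using x y by blast
      from zero[OF this] have "tns x (c \<odot>\<^bsub>N\<^esub> y) \<ominus>\<^bsub>T\<^esub> c \<odot>\<^bsub>T\<^esub> tns x y = \<zero>\<^bsub>T\<^esub>"
        using x y by (simp add: lm b tns_eq T_eq lin_smult[OF pr.proj])
      then show "tns x (c \<odot>\<^bsub>N\<^esub> y) = c \<odot>\<^bsub>T\<^esub> tns x y"
        using x y by (subst (asm) T.minus_eq_zero_iff) (auto intro: tns_closed)
    qed (use x tns_closed in auto)
  qed
qed

end

text \<open>
  Linearity of a term in one variable is proved by descending through its operations; the rules
  for the single operations are collected here as they become available.
\<close>

named_theorems lin_intros

lemmas [lin_intros] = bilI lin_id

lemma (in two_modules) tns_lin1 [lin_intros]:
    "lin K V M f \<Longrightarrow> y \<in> carrier N \<Longrightarrow> lin K V T (\<lambda>v. tns (f v) y)"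
  and tns_lin2 [lin_intros]: "lin K V N g \<Longrightarrow> x \<in> carrier M \<Longrightarrow> lin K V T (\<lambda>v. tns x (g v))"
  using lin_compose[OF bilD(1)[OF tns_bil]] lin_compose[OF bilD(2)[OF tns_bil]] by auto

lemma assoc_algebra_module: "assoc_algebra K A \<Longrightarrow> module K A"
  by (simp add: assoc_algebra_def)

lemma assoc_algebra_mult_bil:
  assumes "assoc_algebra K A" shows "bil K A A A (mult A)"
proof -
  interpret A: assoc_algebra K A by fact
  show ?thesis by (intro bilI linI) (auto simp: A.A.l_distr A.A.r_distr A.smult_mult_left A.smult_mult_right)
qed

lemma alg_lin1 [lin_intros]: "assoc_algebra K A \<Longrightarrow> lin K V A f \<Longrightarrow> y \<in> carrier A \<Longrightarrow> lin K V A (\<lambda>v. f v \<otimes>\<^bsub>A\<^esub> y)"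
  by (rule lin_compose[OF bilD(1)[OF assoc_algebra_mult_bil]])

lemma alg_lin2 [lin_intros]: "assoc_algebra K A \<Longrightarrow> lin K V A g \<Longrightarrow> x \<in> carrier A \<Longrightarrow> lin K V A (\<lambda>v. x \<otimes>\<^bsub>A\<^esub> g v)"
  by (rule lin_compose[OF bilD(2)[OF assoc_algebra_mult_bil]])

lemma assoc_algebraI:
  assumes M: "module K A" and b: "bil K A A A (mult A)" and one: "\<one>\<^bsub>A\<^esub> \<in> carrier A"
    and l: "\<And>x. x \<in> carrier A \<Longrightarrow> \<one>\<^bsub>A\<^esub> \<otimes>\<^bsub>A\<^esub> x = x" and r: "\<And>x. x \<in> carrier A \<Longrightarrow> x \<otimes>\<^bsub>A\<^esub> \<one>\<^bsub>A\<^esub> = x"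
    and a: "\<And>x y z. x \<in> carrier A \<Longrightarrow> y \<in> carrier A \<Longrightarrow> z \<in> carrier A \<Longrightarrow>
      x \<otimes>\<^bsub>A\<^esub> y \<otimes>\<^bsub>A\<^esub> z = x \<otimes>\<^bsub>A\<^esub> (y \<otimes>\<^bsub>A\<^esub> z)"
  shows "assoc_algebra K A"
proof -
  interpret A: module K A by fact
  have "ring A"
    by (rule ringI) (auto intro!: A.M.abelian_group_axioms monoidI one l r a bil_closed[OF b]
      simp: lin_add[OF bilD(1)[OF b]] lin_add[OF bilD(2)[OF b]])
  then show ?thesis unfolding assoc_algebra_def assoc_algebra_axioms_def
    using M lin_smult[OF bilD(1)[OF b]] lin_smult[OF bilD(2)[OF b]] by auto
qed

lemma opp_alg_simps [simp]:
  "carrier (opp_alg A) = carrier A" "\<zero>\<^bsub>opp_alg A\<^esub> = \<zero>\<^bsub>A\<^esub>" "\<one>\<^bsub>opp_alg A\<^esub> = \<one>\<^bsub>A\<^esub>"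
  "x \<oplus>\<^bsub>opp_alg A\<^esub> y = x \<oplus>\<^bsub>A\<^esub> y" "c \<odot>\<^bsub>opp_alg A\<^esub> x = c \<odot>\<^bsub>A\<^esub> x" "x \<otimes>\<^bsub>opp_alg A\<^esub> y = y \<otimes>\<^bsub>A\<^esub> x"
  by (simp_all add: opp_alg_def)

lemma lin_opp [simp]: "lin K (opp_alg A) P = lin K A P" "lin K V (opp_alg A) = lin K V A"
  by (simp_all add: lin_def fun_eq_iff)

text \<open>
  The module axioms mention only the carrier and the additive and scalar operations, so they
  pass to a record with a different multiplication.
\<close>

lemma module_cong:
  assumes "module K A" and "carrier A' = carrier A" "add A' = add A" "zero A' = zero A" "smult A' = smult A"
  shows "module K A'"
proof -
  interpret A: module K A by fact
  show ?thesis
  proof (rule moduleI)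
    show "abelian_group A'"
    proof (rule abelian_groupI)
      fix x assume "x \<in> carrier A'"
      then show "\<exists>y\<in>carrier A'. y \<oplus>\<^bsub>A'\<^esub> x = \<zero>\<^bsub>A'\<^esub>"
        unfolding assms by (intro bexI[of _ "\<ominus>\<^bsub>A\<^esub> x"]) (auto simp: A.M.l_neg)
    qed (auto simp: assms A.M.a_ac)
  qed (auto simp: assms A.R.is_cring A.smult_l_distr A.smult_r_distr A.smult_assoc1)
qed

lemma opp_alg_algebra: "assoc_algebra K A \<Longrightarrow> assoc_algebra K (opp_alg A)"
proof (rule assoc_algebraI)
  assume a: "assoc_algebra K A"
  then interpret A: assoc_algebra K A .
  show "module K (opp_alg A)" by (rule module_cong[OF assoc_algebra_module[OF a]]) (auto simp: fun_eq_iff opp_alg_def)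
  show "bil K (opp_alg A) (opp_alg A) (opp_alg A) (mult (opp_alg A))"
    using assoc_algebra_mult_bil[OF a] by (auto simp: bil_def)
qed (auto simp: assoc_algebra_def ring.ring_simprules monoid.m_assoc ring.is_monoid)

lemma tensor_alg_simps [simp]:
  "carrier (tensor_alg K A B) = carrier (tensor K A B)" "\<zero>\<^bsub>tensor_alg K A B\<^esub> = \<zero>\<^bsub>tensor K A B\<^esub>"
  "\<one>\<^bsub>tensor_alg K A B\<^esub> = pure_tensor K A B \<one>\<^bsub>A\<^esub> \<one>\<^bsub>B\<^esub>"
  "x \<oplus>\<^bsub>tensor_alg K A B\<^esub> y = x \<oplus>\<^bsub>tensor K A B\<^esub> y" "c \<odot>\<^bsub>tensor_alg K A B\<^esub> x = c \<odot>\<^bsub>tensor K A B\<^esub> x"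
  by (simp_all add: tensor_alg_def Let_def)

lemma lin_tensor_alg [simp]: "lin K (tensor_alg K A B) P = lin K (tensor K A B) P"
  "lin K V (tensor_alg K A B) = lin K V (tensor K A B)"
  by (simp_all add: lin_def fun_eq_iff)

locale two_algebras = A: assoc_algebra K A + B: assoc_algebra K B
  for K :: "'k ring" and A :: "('k, 'a, 'x) module_scheme" and B :: "('k, 'b, 'y) module_scheme"
begin

sublocale two_modules K A B
  by (simp add: two_modules_def A.module_axioms B.module_axioms)

abbreviation "mul \<equiv> mult (tensor_alg K A B)"

lemma mul_eq: "mul s t = tensor_lift K T (\<lambda>a b.
       tensor_lift K T (\<lambda>a' b'. tns (a \<otimes>\<^bsub>A\<^esub> a') (b \<otimes>\<^bsub>B\<^esub> b')) t) s"
  by (simp add: tensor_alg_def Let_def)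

lemma bil_inner:
  "a \<in> carrier A \<Longrightarrow> b \<in> carrier B \<Longrightarrow> bil K A B T (\<lambda>a' b'. tns (a \<otimes>\<^bsub>A\<^esub> a') (b \<otimes>\<^bsub>B\<^esub> b'))"
  "a' \<in> carrier A \<Longrightarrow> b' \<in> carrier B \<Longrightarrow> bil K A B T (\<lambda>a b. tns (a \<otimes>\<^bsub>A\<^esub> a') (b \<otimes>\<^bsub>B\<^esub> b'))"
  by (intro lin_intros A.assoc_algebra_axioms B.assoc_algebra_axioms A.A.m_closed B.A.m_closed; assumption)+

lemma bil_outer: "t \<in> carrier T \<Longrightarrow>
   bil K A B T (\<lambda>a b. tensor_lift K T (\<lambda>a' b'. tns (a \<otimes>\<^bsub>A\<^esub> a') (b \<otimes>\<^bsub>B\<^esub> b')) t)"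
  by (intro bilI lift_body_lin T_module bilD(1)[OF bil_inner(2)] bilD(2)[OF bil_inner(2)]
      A.module_axioms B.module_axioms)

lemma mul_bil: "bil K T T T mul"
proof (rule bilI)
  fix t assume t: "t \<in> carrier T"
  show "lin K T T (\<lambda>s. mul s t)" unfolding mul_eq by (rule lift_lin[OF T_module bil_outer[OF t]])
next
  fix s assume s: "s \<in> carrier T"
  show "lin K T T (mul s)" unfolding mul_eq
    by (intro lift_body_lin T_module s lift_lin bil_inner)
qed

lemma mul_tns: "\<lbrakk>a \<in> carrier A; a' \<in> carrier A; b \<in> carrier B; b' \<in> carrier B\<rbrakk> \<Longrightarrow>
    mul (tns a b) (tns a' b') = tns (a \<otimes>\<^bsub>A\<^esub> a') (b \<otimes>\<^bsub>B\<^esub> b')"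
  by (simp add: mul_eq lift_tns[OF T_module bil_outer] lift_tns[OF T_module bil_inner(1)] tns_closed)

text \<open>
  Both sides of each law are linear in every variable, so the variables can be replaced by pure
  tensors one after the other.
\<close>

lemma T_algebra: "assoc_algebra K (tensor_alg K A B)"
proof (rule assoc_algebraI)
  let ?R = "tensor_alg K A B"
  note mc = bil_closed[OF mul_bil]
  note ml = lin_compose[OF bilD(1)[OF mul_bil]] lin_compose[OF bilD(2)[OF mul_bil]] lin_id
  show "module K ?R" by (rule module_cong[OF T_module]) (auto simp: tensor_alg_def Let_def)
  show "bil K ?R ?R ?R mul" using mul_bil by (simp add: bil_def)
  show "\<one>\<^bsub>?R\<^esub> \<in> carrier ?R" by (simp add: tns_closed)
  have one: "tns \<one>\<^bsub>A\<^esub> \<one>\<^bsub>B\<^esub> \<in> carrier T" by (simp add: tns_closed)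
  show "\<one>\<^bsub>?R\<^esub> \<otimes>\<^bsub>?R\<^esub> x = x" if "x \<in> carrier ?R" for x
    using T_ext[OF bilD(2)[OF mul_bil one] lin_id T_module, of x] that by (simp add: mul_tns)
  show "x \<otimes>\<^bsub>?R\<^esub> \<one>\<^bsub>?R\<^esub> = x" if "x \<in> carrier ?R" for x
    using T_ext[OF bilD(1)[OF mul_bil one] lin_id T_module, of x] that by (simp add: mul_tns)
  fix x y z assume x: "x \<in> carrier ?R" and y: "y \<in> carrier ?R" and z: "z \<in> carrier ?R"
  have 1: "mul (mul (tns a b) (tns a' b')) (tns a'' b'') = mul (tns a b) (mul (tns a' b') (tns a'' b''))"
    if "a \<in> carrier A" "b \<in> carrier B" "a' \<in> carrier A" "b' \<in> carrier B" "a'' \<in> carrier A" "b'' \<in> carrier B"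
    for a b a' b' a'' b''
    using that by (simp add: mul_tns A.A.m_assoc B.A.m_assoc)
  have 2: "mul (mul (tns a b) (tns a' b')) z = mul (tns a b) (mul (tns a' b') z)"
    if "a \<in> carrier A" "b \<in> carrier B" "a' \<in> carrier A" "b' \<in> carrier B" for a b a' b'
    by (rule T_ext[of T "\<lambda>z. mul (mul (tns a b) (tns a' b')) z" "\<lambda>z. mul (tns a b) (mul (tns a' b') z)"])
      (use that 1 z in \<open>auto intro!: ml T_module mc tns_closed\<close>)
  have 3: "mul (mul (tns a b) y) z = mul (tns a b) (mul y z)"
    if "a \<in> carrier A" "b \<in> carrier B" for a b
    by (rule T_ext[of T "\<lambda>y. mul (mul (tns a b) y) z" "\<lambda>y. mul (tns a b) (mul y z)"])
      (use that 2 y z in \<open>auto intro!: ml T_module mc tns_closed\<close>)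
  show "mul (mul x y) z = mul x (mul y z)"
    by (rule T_ext[of T "\<lambda>x. mul (mul x y) z" "\<lambda>x. mul x (mul y z)"])
      (use 3 x y z in \<open>auto intro!: ml T_module mc tns_closed\<close>)
qed

end

text \<open>
  Both sides are iterated finite sums over the supports of \<open>p\<close> and \<open>q\<close>.
\<close>

lemma free_lift_swap:
  assumes P: "module K P" and f: "\<And>x y. x \<in> X \<Longrightarrow> y \<in> Y \<Longrightarrow> f x y \<in> carrier P"
    and p: "p \<in> carrier (free_module K X)" and q: "q \<in> carrier (free_module K Y)"
  shows "free_lift K P (\<lambda>x. free_lift K P (\<lambda>y. f x y) q) p = free_lift K P (\<lambda>y. free_lift K P (\<lambda>x. f x y) p) q"
proof -
  interpret P: module K P by fact
  let ?S = "{x. p x \<noteq> \<zero>\<^bsub>K\<^esub>}" and ?T = "{x. q x \<noteq> \<zero>\<^bsub>K\<^esub>}"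
  have pS: "p x \<in> carrier K" "x \<in> X" if "x \<in> ?S" for x
    using free_carrierD(2,3)[OF p] that by auto
  have qT: "q x \<in> carrier K" "x \<in> Y" if "x \<in> ?T" for x
    using free_carrierD(2,3)[OF q] that by auto
  have "free_lift K P (\<lambda>x. free_lift K P (\<lambda>y. f x y) q) p = (\<Oplus>\<^bsub>P\<^esub>x\<in>?S. \<Oplus>\<^bsub>P\<^esub>y\<in>?T. p x \<odot>\<^bsub>P\<^esub> (q y \<odot>\<^bsub>P\<^esub> f x y))"
    unfolding free_lift_def
    by (intro P.finsum_cong' P.finsum_smult_ldistr Pi_I free_carrierD(1)[OF q] P.finsum_closed P.smult_closed f pS qT) auto
  also have "\<dots> = (\<Oplus>\<^bsub>P\<^esub>y\<in>?T. \<Oplus>\<^bsub>P\<^esub>x\<in>?S. p x \<odot>\<^bsub>P\<^esub> (q y \<odot>\<^bsub>P\<^esub> f x y))"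
    by (intro P.finsum_swap P.smult_closed f pS qT free_carrierD(1)[OF q] free_carrierD(1)[OF p])
  also have "\<dots> = (\<Oplus>\<^bsub>P\<^esub>y\<in>?T. \<Oplus>\<^bsub>P\<^esub>x\<in>?S. q y \<odot>\<^bsub>P\<^esub> (p x \<odot>\<^bsub>P\<^esub> f x y))"
    by (intro P.finsum_cong' Pi_I P.finsum_closed P.smult_closed f pS qT)
      (auto simp: P.smult_assoc1[symmetric] P.R.m_comm pS qT f)
  also have "\<dots> = free_lift K P (\<lambda>y. free_lift K P (\<lambda>x. f x y) p) q"
    unfolding free_lift_def
    by (intro P.finsum_cong' P.finsum_smult_ldistr[symmetric] Pi_I free_carrierD(1)[OF p] P.finsum_closed P.smult_closed f pS qT) auto
  finally show ?thesis .
qed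

lemma lift_swap:
  assumes "two_modules K M N" "two_modules K M' N'" "module K P"
    "\<And>x y u v. x \<in> carrier M \<Longrightarrow> y \<in> carrier N \<Longrightarrow> u \<in> carrier M' \<Longrightarrow> v \<in> carrier N' \<Longrightarrow> f x y u v \<in> carrier P"
    "s \<in> carrier (tensor K M N)" "t \<in> carrier (tensor K M' N')"
  shows "tensor_lift K P (\<lambda>x y. tensor_lift K P (\<lambda>u v. f x y u v) t) s =
    tensor_lift K P (\<lambda>u v. tensor_lift K P (\<lambda>x y. f x y u v) s) t"
proof -
  interpret A: two_modules K M N by fact
  interpret B: two_modules K M' N' by fact
  show ?thesis unfolding tensor_lift_def induced_map_eq
    using free_lift_swap[OF assms(3) _ A.pr.repr B.pr.repr, of "\<lambda>z w. f (fst z) (snd z) (fst w) (snd w)" s t]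
      assms(4-6) A.T_eq B.T_eq
    by (auto simp: case_prod_beta')
qed

section \<open>Sweedler calculus\<close>

lemma foldSetD_eqI:
  "(A, y) \<in> foldSetD D f e \<Longrightarrow> (\<And>x. x \<in> A \<Longrightarrow> f x = g x) \<Longrightarrow> (A, y) \<in> foldSetD D g e"
  by (induction rule: foldSetD.induct) (auto intro: foldSetD.intros simp: foldSetD.insertI)

text \<open>
  The graph by which finite sums are defined inspects only the values of the summand on the
  index set, so summands that agree there give the same sum even when they leave the carrier.
  The congruence rule for Sweedler sums below rests on this; its premises carry no condition on
  the values of the summand, which the simplifier could not establish while rewriting.
\<close>

lemma finsum_eqI:
  assumes "\<And>x. x \<in> A \<Longrightarrow> f x = g x" shows "finsum P f A = finsum P g A"
proof -
  let ?F = "\<lambda>f. foldSetD (carrier P) (\<lambda>x. (\<oplus>\<^bsub>P\<^esub>) (f x)) \<zero>\<^bsub>P\<^esub>"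
  have "(A, y) \<in> ?F f \<longleftrightarrow> (A, y) \<in> ?F g" for y
    using assms by (auto elim!: foldSetD_eqI)
  then have "foldD (carrier P) (\<lambda>x. (\<oplus>\<^bsub>P\<^esub>) (f x)) \<zero>\<^bsub>P\<^esub> A = foldD (carrier P) (\<lambda>x. (\<oplus>\<^bsub>P\<^esub>) (g x)) \<zero>\<^bsub>P\<^esub> A"
    by (simp add: foldD_def)
  then show ?thesis by (simp add: finsum_def finprod_def comp_def)
qed

context hopf_algebra
begin

sublocale HH: two_algebras K H H
  by (simp add: two_algebras_def assoc_algebra_axioms)

abbreviation "sw P f h \<equiv> sweedler K H P f h"
abbreviation "S \<equiv> antipode H"
abbreviation "\<epsilon> \<equiv> counit H"

lemma H_module: "module K H" by (rule module_axioms)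

lemma counit_closed [simp]: "h \<in> carrier H \<Longrightarrow> \<epsilon> h \<in> carrier K"
  using counit_hom by (auto simp: ring_hom_def)

lemma S_closed [simp]: "h \<in> carrier H \<Longrightarrow> S h \<in> carrier H"
  using antipode_closed by auto

lemma S_lin [lin_intros]: "lin K V H f \<Longrightarrow> lin K V H (\<lambda>v. S (f v))"
  by (rule lin_compose[of K H]) (auto intro!: linI simp: antipode_add antipode_smult)

lemma eps_lin [lin_intros]:
  assumes "module K P" "c \<in> carrier P" "lin K V H f" shows "lin K V P (\<lambda>v. \<epsilon> (f v) \<odot>\<^bsub>P\<^esub> c)"
proof -
  interpret P: module K P by fact
  have "\<epsilon> (x \<oplus> y) = \<epsilon> x \<oplus>\<^bsub>K\<^esub> \<epsilon> y" if "x \<in> carrier H" "y \<in> carrier H" for x y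
    using counit_hom that by (auto simp: ring_hom_def)
  then have "lin K H P (\<lambda>x. \<epsilon> x \<odot>\<^bsub>P\<^esub> c)" using assms(2)
    by (intro linI) (auto simp: P.smult_l_distr counit_smult P.smult_assoc1)
  from lin_compose[OF this assms(3)] show ?thesis .
qed

lemma comult_closed [simp]: "h \<in> carrier H \<Longrightarrow> comult H h \<in> carrier (tensor K H H)"
  using comult_hom by (auto simp: ring_hom_def)

lemma comult_lin: "lin K H (tensor K H H) (comult H)"
  using comult_hom comult_smult by (intro linI) (auto simp: ring_hom_def)

lemma sw_closed [simp, intro]:
  assumes "module K P" "\<And>x y. x \<in> carrier H \<Longrightarrow> y \<in> carrier H \<Longrightarrow> f x y \<in> carrier P" "h \<in> carrier H"
  shows "sw P f h \<in> carrier P"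
  unfolding sweedler_def by (rule HH.lift_closed) (use assms in auto)

lemma sw_cong:
  assumes "module K P" "\<And>x y. x \<in> carrier H \<Longrightarrow> y \<in> carrier H \<Longrightarrow> f x y \<in> carrier P"
    "\<And>x y. x \<in> carrier H \<Longrightarrow> y \<in> carrier H \<Longrightarrow> f x y = g x y" "h \<in> carrier H"
  shows "sw P f h = sw P g h"
  unfolding sweedler_def by (rule HH.lift_cong) (use assms in auto)

text \<open>
  Rewriting below a Sweedler sum may use that the two Sweedler factors lie in \<open>H\<close>.
\<close>

lemma sw_congruence [cong]:
  assumes "h = h'" "h' \<in> carrier H"
    "\<And>x y. x \<in> carrier H \<Longrightarrow> y \<in> carrier H \<Longrightarrow> f x y = g x y"
  shows "sw P f h = sw P g h'"
proof -
  let ?p = "SOME p. p \<in> comult H h'"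
  have "comult H h' \<in> carrier HH.pr.Quo" using comult_closed[OF assms(2)] HH.T_eq by simp
  then have p: "?p \<in> carrier (free_module K (carrier H \<times> carrier H))" by (rule HH.pr.repr)
  show ?thesis
    unfolding assms(1) sweedler_def tensor_lift_def induced_map_eq free_lift_def
    by (rule finsum_eqI) (use free_carrierD(2)[OF p] assms(3) in auto)
qed

lemma sw_push:
  assumes "lin K P Q g" "module K P" "module K Q" "\<And>x y. x \<in> carrier H \<Longrightarrow> y \<in> carrier H \<Longrightarrow> f x y \<in> carrier P"
    "h \<in> carrier H"
  shows "g (sw P f h) = sw Q (\<lambda>x y. g (f x y)) h"
  unfolding sweedler_def by (rule HH.lift_push) (use assms in auto)

lemma sw_alg_left:
  "\<lbrakk>assoc_algebra K R; a \<in> carrier R; \<And>x y. x \<in> carrier H \<Longrightarrow> y \<in> carrier H \<Longrightarrow> f x y \<in> carrier R; h \<in> carrier H\<rbrakk> \<Longrightarrow>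
    a \<otimes>\<^bsub>R\<^esub> sw R f h = sw R (\<lambda>x y. a \<otimes>\<^bsub>R\<^esub> f x y) h"
  by (rule sw_push[where g = "\<lambda>t. a \<otimes>\<^bsub>R\<^esub> t"]) (auto intro!: lin_intros assoc_algebra_module)

lemma sw_alg_right:
  "\<lbrakk>assoc_algebra K R; a \<in> carrier R; \<And>x y. x \<in> carrier H \<Longrightarrow> y \<in> carrier H \<Longrightarrow> f x y \<in> carrier R; h \<in> carrier H\<rbrakk> \<Longrightarrow>
    sw R f h \<otimes>\<^bsub>R\<^esub> a = sw R (\<lambda>x y. f x y \<otimes>\<^bsub>R\<^esub> a) h"
  by (rule sw_push[where g = "\<lambda>t. t \<otimes>\<^bsub>R\<^esub> a"]) (auto intro!: lin_intros assoc_algebra_module)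

lemma sw_submodule:
  assumes P: "module K P" and C: "submodule C K P"
    and f: "\<And>x y. x \<in> carrier H \<Longrightarrow> y \<in> carrier H \<Longrightarrow> f x y \<in> C" and h: "h \<in> carrier H"
  shows "sw (P\<lparr>carrier := C\<rparr>) f h = sw P f h" and "sw P f h \<in> C"
proof -
  let ?C = "P\<lparr>carrier := C\<rparr>"
  interpret P: module K P by (rule P)
  have CM: "module K ?C" by (rule submodule.submodule_is_module[OF C P])
  have il: "lin K ?C P (\<lambda>x. x)" by (rule linI) (use P.submoduleE(1)[OF C] in auto)
  show eq: "sw ?C f h = sw P f h" by (rule sw_push[OF il CM P]) (use f h in auto)
  have "sw ?C f h \<in> carrier ?C" by (rule sw_closed[OF CM _ h]) (use f in auto)
  then show "sw P f h \<in> C" by (simp add: eq)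
qed

lemma sw_body_lin [lin_intros]:
  assumes "module K V" "module K P" "h \<in> carrier H"
    "\<And>x y. x \<in> carrier H \<Longrightarrow> y \<in> carrier H \<Longrightarrow> lin K V P (\<lambda>v. f v x y)"
  shows "lin K V P (\<lambda>v. sw P (\<lambda>x y. f v x y) h)"
  unfolding sweedler_def by (rule HH.lift_body_lin) (use assms in auto)

lemma sw_arg_lin [lin_intros]:
  assumes "module K P" "lin K V H g" "bil K H H P f"
  shows "lin K V P (\<lambda>v. sw P f (g v))"
  unfolding sweedler_def
  by (rule lin_compose[OF HH.lift_lin[OF assms(1,3)] lin_compose[OF comult_lin assms(2)]])

lemma sw_swap:
  assumes "module K P"
    "\<And>x y u v. x \<in> carrier H \<Longrightarrow> y \<in> carrier H \<Longrightarrow> u \<in> carrier H \<Longrightarrow> v \<in> carrier H \<Longrightarrow> f x y u v \<in> carrier P"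
    "h \<in> carrier H" "k \<in> carrier H"
  shows "sw P (\<lambda>x y. sw P (\<lambda>u v. f x y u v) k) h = sw P (\<lambda>u v. sw P (\<lambda>x y. f x y u v) h) k"
  unfolding sweedler_def
  by (rule lift_swap[OF HH.two_modules_axioms HH.two_modules_axioms]) (use assms in auto)

lemma sw_tns: assumes "h \<in> carrier H" shows "sw (tensor K H H) (pure_tensor K H H) h = comult H h"
  unfolding sweedler_def
  by (rule HH.T_ext[OF HH.lift_lin[OF HH.T_module HH.tns_bil] lin_id HH.T_module])
    (use assms in \<open>auto simp: HH.lift_tns[OF HH.T_module HH.tns_bil]\<close>)

text \<open>
  A trilinear \<open>f\<close> induces a linear map on \<open>H \<otimes> (H \<otimes> H)\<close>; applied to the coassociativity law of
  \<open>H\<close> it yields the corresponding law for iterated Sweedler sums in any module.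
\<close>

lemma sw_assoc:
  assumes P: "module K P" and h: "h \<in> carrier H"
    and f1: "\<And>y z. y \<in> carrier H \<Longrightarrow> z \<in> carrier H \<Longrightarrow> lin K H P (\<lambda>x. f x y z)"
    and f2: "\<And>x z. x \<in> carrier H \<Longrightarrow> z \<in> carrier H \<Longrightarrow> lin K H P (\<lambda>y. f x y z)"
    and f3: "\<And>x y. x \<in> carrier H \<Longrightarrow> y \<in> carrier H \<Longrightarrow> lin K H P (\<lambda>z. f x y z)"
  shows "sw P (\<lambda>x y. sw P (\<lambda>u v. f u v y) x) h = sw P (\<lambda>x y. sw P (\<lambda>u v. f x u v) y) h"
proof -
  let ?T = "tensor K H H"
  interpret T3: two_modules K H ?T by (simp add: two_modules_def H_module HH.T_module)
  define L where "L x = tensor_lift K P (f x)" for x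
  have Lb: "bil K H H P (f x)" if "x \<in> carrier H" for x using that f2 f3 by (auto intro: bilI)
  have L2: "bil K H ?T P L" unfolding L_def
    by (intro bilI HH.lift_body_lin HH.lift_lin P H_module Lb f1)
  let ?L = "tensor_lift K P L"
  note Ll = T3.lift_lin[OF P L2]
  have Lt: "?L (T3.tns x t) = L x t" if "x \<in> carrier H" "t \<in> carrier ?T" for x t
    by (rule T3.lift_tns[OF P L2 that])
  have Ltt: "L x (HH.tns y z) = f x y z" if "x \<in> carrier H" "y \<in> carrier H" "z \<in> carrier H" for x y z
    unfolding L_def by (rule HH.lift_tns[OF P Lb[OF that(1)] that(2,3)])
  note c = T3.tns_closed HH.tns_closed T3.T_module lin_closed[OF f1]
  have "?L (sw T3.T (\<lambda>x y. sw T3.T (\<lambda>u v. T3.tns u (HH.tns v y)) x) h) =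
      sw P (\<lambda>x y. ?L (sw T3.T (\<lambda>u v. T3.tns u (HH.tns v y)) x)) h"
    by (rule sw_push[OF Ll T3.T_module P _ h]) (auto intro!: c)
  also have "\<dots> = sw P (\<lambda>x y. sw P (\<lambda>u v. f u v y) x) h"
  proof (rule sw_cong[OF P _ _ h])
    fix x y assume x: "x \<in> carrier H" "y \<in> carrier H"
    show "?L (sw T3.T (\<lambda>u v. T3.tns u (HH.tns v y)) x) \<in> carrier P"
      using x by (auto intro!: lin_closed[OF Ll] c)
    have "?L (sw T3.T (\<lambda>u v. T3.tns u (HH.tns v y)) x) = sw P (\<lambda>u v. ?L (T3.tns u (HH.tns v y))) x"
      by (rule sw_push[OF Ll T3.T_module P _ x(1)]) (use x in \<open>auto intro!: c\<close>)
    also have "\<dots> = sw P (\<lambda>u v. f u v y) x"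
      by (rule sw_cong[OF P _ _ x(1)]) (use x in \<open>auto intro!: lin_closed[OF Ll] c simp: Lt Ltt HH.tns_closed\<close>)
    finally show "?L (sw T3.T (\<lambda>u v. T3.tns u (HH.tns v y)) x) = sw P (\<lambda>u v. f u v y) x" .
  qed
  finally have 1: "?L (sw T3.T (\<lambda>x y. sw T3.T (\<lambda>u v. T3.tns u (HH.tns v y)) x) h) =
    sw P (\<lambda>x y. sw P (\<lambda>u v. f u v y) x) h" .
  have "?L (sw T3.T (\<lambda>x y. T3.tns x (comult H y)) h) = sw P (\<lambda>x y. ?L (T3.tns x (comult H y))) h"
    by (rule sw_push[OF Ll T3.T_module P _ h]) (auto intro!: c)
  also have "\<dots> = sw P (\<lambda>x y. sw P (\<lambda>u v. f x u v) y) h"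
    by (rule sw_cong[OF P _ _ h]) (auto intro!: c lin_closed[OF Ll] HH.lift_closed P simp: Lt L_def sweedler_def)
  finally have 2: "?L (sw T3.T (\<lambda>x y. T3.tns x (comult H y)) h) = sw P (\<lambda>x y. sw P (\<lambda>u v. f x u v) y) h" .
  show ?thesis using 1 2 coassoc[OF h] by simp
qed

lemma sw_counit_left:
  assumes P: "module K P" and f: "lin K H P f" and h: "h \<in> carrier H"
  shows "sw P (\<lambda>x y. \<epsilon> x \<odot>\<^bsub>P\<^esub> f y) h = f h"
proof -
  interpret P: module K P by fact
  have "f h = f (sw H (\<lambda>x y. \<epsilon> x \<odot> y) h)" using counit_left[OF h] by simp
  also have "\<dots> = sw P (\<lambda>x y. f (\<epsilon> x \<odot> y)) h"
    by (rule sw_push[OF f H_module P _ h]) auto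
  also have "\<dots> = sw P (\<lambda>x y. \<epsilon> x \<odot>\<^bsub>P\<^esub> f y) h"
    by (rule sw_cong[OF P _ _ h]) (auto simp: lin_smult[OF f] lin_closed[OF f])
  finally show ?thesis by simp
qed

lemma sw_counit_right:
  assumes P: "module K P" and f: "lin K H P f" and h: "h \<in> carrier H"
  shows "sw P (\<lambda>x y. \<epsilon> y \<odot>\<^bsub>P\<^esub> f x) h = f h"
proof -
  interpret P: module K P by fact
  have "f h = f (sw H (\<lambda>x y. \<epsilon> y \<odot> x) h)" using counit_right[OF h] by simp
  also have "\<dots> = sw P (\<lambda>x y. f (\<epsilon> y \<odot> x)) h"
    by (rule sw_push[OF f H_module P _ h]) auto
  also have "\<dots> = sw P (\<lambda>x y. \<epsilon> y \<odot>\<^bsub>P\<^esub> f x) h"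
    by (rule sw_cong[OF P _ _ h]) (auto simp: lin_smult[OF f] lin_closed[OF f])
  finally show ?thesis by simp
qed

lemma sw_antipode_left:
  assumes P: "module K P" and f: "lin K H P f" and h: "h \<in> carrier H"
  shows "sw P (\<lambda>x y. f (S x \<otimes> y)) h = \<epsilon> h \<odot>\<^bsub>P\<^esub> f \<one>"
  using sw_push[OF f H_module P, of "\<lambda>x y. S x \<otimes> y" h] antipode_left[OF h] h
  by (simp add: lin_smult[OF f])

lemma sw_antipode_right:
  assumes P: "module K P" and f: "lin K H P f" and h: "h \<in> carrier H"
  shows "sw P (\<lambda>x y. f (x \<otimes> S y)) h = \<epsilon> h \<odot>\<^bsub>P\<^esub> f \<one>"
  using sw_push[OF f H_module P, of "\<lambda>x y. x \<otimes> S y" h] antipode_right[OF h] h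
  by (simp add: lin_smult[OF f])

lemma sw_one:
  assumes P: "module K P" and f: "bil K H H P f"
  shows "sw P f \<one> = f \<one> \<one>"
proof -
  have "comult H \<one> = HH.tns \<one> \<one>" using comult_hom by (simp add: ring_hom_def)
  then show ?thesis by (simp add: sweedler_def HH.lift_tns[OF P f])
qed

lemma counit_one [simp]: "\<epsilon> \<one> = \<one>\<^bsub>K\<^esub>"
  using counit_hom by (simp add: ring_hom_def)

lemma counit_mult: "h \<in> carrier H \<Longrightarrow> k \<in> carrier H \<Longrightarrow> \<epsilon> (h \<otimes> k) = \<epsilon> h \<otimes>\<^bsub>K\<^esub> \<epsilon> k"
  using counit_hom by (simp add: ring_hom_def)

text \<open>
  The linear map induced by \<open>f\<close> is applied to \<open>\<Delta>(hk) = \<Delta>(h) \<Delta>(k)\<close>.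
\<close>

lemma sw_mult:
  assumes P: "module K P" and f: "bil K H H P f" and h: "h \<in> carrier H" and k: "k \<in> carrier H"
  shows "sw P f (h \<otimes> k) = sw P (\<lambda>x y. sw P (\<lambda>u v. f (x \<otimes> u) (y \<otimes> v)) k) h"
proof -
  let ?l = "tensor_lift K P f"
  note l = HH.lift_lin[OF P f]
  have "comult H (h \<otimes> k) = HH.mul (comult H h) (comult H k)"
    using comult_hom h k by (simp add: ring_hom_def)
  also have "\<dots> = sw HH.T (\<lambda>x y. sw HH.T (\<lambda>u v. HH.tns (x \<otimes> u) (y \<otimes> v)) k) h"
    by (simp add: HH.mul_eq sweedler_def)
  finally have "sw P f (h \<otimes> k) = ?l (sw HH.T (\<lambda>x y. sw HH.T (\<lambda>u v. HH.tns (x \<otimes> u) (y \<otimes> v)) k) h)"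
    by (simp add: sweedler_def[of K H P f "h \<otimes> k"])
  also have "\<dots> = sw P (\<lambda>x y. ?l (sw HH.T (\<lambda>u v. HH.tns (x \<otimes> u) (y \<otimes> v)) k)) h"
    by (rule sw_push[OF l HH.T_module P _ h]) (use k in \<open>auto intro!: HH.T_module HH.tns_closed\<close>)
  also have "\<dots> = sw P (\<lambda>x y. sw P (\<lambda>u v. f (x \<otimes> u) (y \<otimes> v)) k) h"
  proof (rule sw_cong[OF P _ _ h])
    fix x y assume x: "x \<in> carrier H" "y \<in> carrier H"
    show "?l (sw HH.T (\<lambda>u v. HH.tns (x \<otimes> u) (y \<otimes> v)) k) \<in> carrier P"
      using x k by (auto intro!: lin_closed[OF l] HH.T_module HH.tns_closed)
    have "?l (sw HH.T (\<lambda>u v. HH.tns (x \<otimes> u) (y \<otimes> v)) k) = sw P (\<lambda>u v. ?l (HH.tns (x \<otimes> u) (y \<otimes> v))) k"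
      by (rule sw_push[OF l HH.T_module P _ k]) (use x in \<open>auto intro!: HH.tns_closed\<close>)
    also have "\<dots> = sw P (\<lambda>u v. f (x \<otimes> u) (y \<otimes> v)) k"
      by (rule sw_cong[OF P _ _ k])
        (use x in \<open>auto intro!: lin_closed[OF l] HH.tns_closed simp: HH.lift_tns[OF P f] bil_closed[OF f]\<close>)
    finally show "?l (sw HH.T (\<lambda>u v. HH.tns (x \<otimes> u) (y \<otimes> v)) k) = sw P (\<lambda>u v. f (x \<otimes> u) (y \<otimes> v)) k" .
  qed
  finally show ?thesis .
qed

end

declare (in hopf_algebra) H_module [simp, intro!] assoc_algebra_axioms [intro!] HH.T_module [intro!]

lemma (in two_algebras) T_alg_module: "module K (tensor_alg K A B)"
  by (rule assoc_algebra_module[OF T_algebra])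

text \<open>
  The record of the target enters a Sweedler sum only through its additive and scalar structure.
  In particular the tensor product module and the tensor product algebra give the same sums.
\<close>

lemma sweedler_target_cong:
  fixes P Q :: "('k, 'p, 'z) module_scheme" and H :: "('k, 'h) hopf"
  assumes "carrier P = carrier Q" "add P = add Q" "zero P = zero Q" "smult P = smult Q"
  shows "sweedler K H P = sweedler K H Q"
proof -
  have "add_monoid P = add_monoid Q" by (simp add: assms)
  then have "finsum P = (finsum Q :: ('h \<times> 'h \<Rightarrow> 'p) \<Rightarrow> _)" unfolding finsum_def by (simp only:)
  then show ?thesis
    by (intro ext) (simp only: sweedler_def tensor_lift_def induced_map_def assms)
qed

text \<open>
  In the convolution algebra of linear maps \<open>H \<rightarrow> R\<close> a left inverse \<open>F\<close> and a right inverse \<open>L\<close>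
  of \<open>G\<close> agree: \<open>F = F (G L) = (F G) L = L\<close>.
\<close>

lemma (in hopf_algebra) convolution_inverse_unique:
  assumes R: "assoc_algebra K R" and F: "lin K H R F" and G: "lin K H R G" and L: "lin K H R L"
    and FG: "\<And>h. h \<in> carrier H \<Longrightarrow> sw R (\<lambda>x y. F x \<otimes>\<^bsub>R\<^esub> G y) h = \<epsilon> h \<odot>\<^bsub>R\<^esub> \<one>\<^bsub>R\<^esub>"
    and GL: "\<And>h. h \<in> carrier H \<Longrightarrow> sw R (\<lambda>x y. G x \<otimes>\<^bsub>R\<^esub> L y) h = \<epsilon> h \<odot>\<^bsub>R\<^esub> \<one>\<^bsub>R\<^esub>"
    and h: "h \<in> carrier H"
  shows "F h = L h"
proof -
  interpret R: assoc_algebra K R by fact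
  note [simp] = lin_closed[OF F] lin_closed[OF G] lin_closed[OF L]
  note M = R.module_axioms
  note li = lin_compose[OF F] lin_compose[OF G] lin_compose[OF L] F G L
  have "F h = sw R (\<lambda>x y. \<epsilon> y \<odot>\<^bsub>R\<^esub> F x) h" by (rule sw_counit_right[OF M F h, symmetric])
  also have "\<dots> = sw R (\<lambda>x y. F x \<otimes>\<^bsub>R\<^esub> sw R (\<lambda>u v. G u \<otimes>\<^bsub>R\<^esub> L v) y) h"
    by (rule sw_cong) (auto simp: GL R.smult_mult_right M h)
  also have "\<dots> = sw R (\<lambda>x y. sw R (\<lambda>u v. F x \<otimes>\<^bsub>R\<^esub> (G u \<otimes>\<^bsub>R\<^esub> L v)) y) h"
  proof (rule sw_cong)
    fix x y assume "x \<in> carrier H" "y \<in> carrier H"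
    then show "F x \<otimes>\<^bsub>R\<^esub> sw R (\<lambda>u v. G u \<otimes>\<^bsub>R\<^esub> L v) y = sw R (\<lambda>u v. F x \<otimes>\<^bsub>R\<^esub> (G u \<otimes>\<^bsub>R\<^esub> L v)) y"
      by (intro sw_push[of R R]) (auto intro!: lin_intros R M)
  qed (auto simp: M h)
  also have "\<dots> = sw R (\<lambda>x y. sw R (\<lambda>u v. F u \<otimes>\<^bsub>R\<^esub> (G v \<otimes>\<^bsub>R\<^esub> L y)) x) h"
    by (rule sw_assoc[symmetric]) (auto intro!: lin_intros li R M h)
  also have "\<dots> = sw R (\<lambda>x y. sw R (\<lambda>u v. F u \<otimes>\<^bsub>R\<^esub> G v) x \<otimes>\<^bsub>R\<^esub> L y) h"
  proof (rule sw_cong)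
    fix x y assume "x \<in> carrier H" "y \<in> carrier H"
    then show "sw R (\<lambda>u v. F u \<otimes>\<^bsub>R\<^esub> (G v \<otimes>\<^bsub>R\<^esub> L y)) x = sw R (\<lambda>u v. F u \<otimes>\<^bsub>R\<^esub> G v) x \<otimes>\<^bsub>R\<^esub> L y"
      by (subst sw_push[of R R "\<lambda>t. t \<otimes>\<^bsub>R\<^esub> L y"])
        (auto intro!: lin_intros R M sw_cong simp: R.A.m_assoc)
  qed (auto simp: M h)
  also have "\<dots> = sw R (\<lambda>x y. \<epsilon> x \<odot>\<^bsub>R\<^esub> L y) h"
    by (rule sw_cong) (auto simp: FG R.smult_mult_left M h)
  also have "\<dots> = L h" by (rule sw_counit_left[OF M L h])
  finally show ?thesis .
qed

section \<open>The antipode of a cocommutative Hopf algebra\<close>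

context cocommutative_hopf_algebra
begin

lemma sw_comm:
  assumes P: "module K P" and f: "bil K H H P f" and h: "h \<in> carrier H"
  shows "sw P (\<lambda>x y. f x y) h = sw P (\<lambda>x y. f y x) h"
proof -
  let ?l = "tensor_lift K P f"
  note l = HH.lift_lin[OF P f]
  have "sw P f h = ?l (sw HH.T (\<lambda>x y. HH.tns y x) h)"
    using cocomm[OF h] by (simp add: sweedler_def[of K H P f])
  also have "\<dots> = sw P (\<lambda>x y. ?l (HH.tns y x)) h"
    by (rule sw_push[OF l HH.T_module P _ h]) (auto intro!: HH.tns_closed)
  also have "\<dots> = sw P (\<lambda>x y. f y x) h"
    by (rule sw_cong[OF P _ _ h]) (auto simp: HH.lift_tns[OF P f] bil_closed[OF f])
  finally show ?thesis .
qed

lemma sw_lcomm: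
  assumes P: "module K P" and h: "h \<in> carrier H"
    and f1: "\<And>y z. y \<in> carrier H \<Longrightarrow> z \<in> carrier H \<Longrightarrow> lin K H P (\<lambda>x. f x y z)"
    and f2: "\<And>x z. x \<in> carrier H \<Longrightarrow> z \<in> carrier H \<Longrightarrow> lin K H P (\<lambda>y. f x y z)"
    and f3: "\<And>x y. x \<in> carrier H \<Longrightarrow> y \<in> carrier H \<Longrightarrow> lin K H P (\<lambda>z. f x y z)"
  shows "sw P (\<lambda>x y. sw P (\<lambda>u v. f x u v) y) h = sw P (\<lambda>x y. sw P (\<lambda>u v. f u x v) y) h"
proof -
  have "sw P (\<lambda>x y. sw P (\<lambda>u v. f x u v) y) h = sw P (\<lambda>x y. sw P (\<lambda>u v. f u v y) x) h"
    by (rule sw_assoc[symmetric, OF P h f1 f2 f3])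
  also have "\<dots> = sw P (\<lambda>x y. sw P (\<lambda>u v. f v u y) x) h"
    by (rule sw_cong[OF P _ _ h]) (auto intro!: sw_closed P sw_comm bilI f1 f2 lin_closed[OF f1])
  also have "\<dots> = sw P (\<lambda>x y. sw P (\<lambda>u v. f u x v) y) h"
    by (rule sw_assoc[OF P h f2 f1 f3])
  finally show ?thesis .
qed

text \<open>
  Products of two Sweedler sums over the same element lead to the four factors \<open>h_1\<close>, \<open>h_2\<close>,
  \<open>h_3\<close>, \<open>h_4\<close> bracketed as \<open>(\<Delta> \<otimes> \<Delta>) \<circ> \<Delta>\<close>. Regrouped as \<open>h_1 \<otimes> (h_2 \<otimes> (h_3 \<otimes> h_4))\<close> by
  coassociativity, they allow \<open>h_2\<close> and \<open>h_3\<close> to be exchanged by cocommutativity.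
\<close>

lemma sw_mid:
  assumes P: "module K P" and h: "h \<in> carrier H"
    and f1: "\<And>x y z. x \<in> carrier H \<Longrightarrow> y \<in> carrier H \<Longrightarrow> z \<in> carrier H \<Longrightarrow> lin K H P (\<lambda>w. f w x y z)"
    and f2: "\<And>x y z. x \<in> carrier H \<Longrightarrow> y \<in> carrier H \<Longrightarrow> z \<in> carrier H \<Longrightarrow> lin K H P (\<lambda>w. f x w y z)"
    and f3: "\<And>x y z. x \<in> carrier H \<Longrightarrow> y \<in> carrier H \<Longrightarrow> z \<in> carrier H \<Longrightarrow> lin K H P (\<lambda>w. f x y w z)"
    and f4: "\<And>x y z. x \<in> carrier H \<Longrightarrow> y \<in> carrier H \<Longrightarrow> z \<in> carrier H \<Longrightarrow> lin K H P (\<lambda>w. f x y z w)"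
  shows "sw P (\<lambda>x y. sw P (\<lambda>a b. sw P (\<lambda>c d. f a b c d) y) x) h =
    sw P (\<lambda>x y. sw P (\<lambda>a b. sw P (\<lambda>c d. f a c b d) y) x) h"
proof -
  \<comment> \<open>Rebracketing from \<open>\<Delta> \<otimes> \<Delta>\<close> to nested right factors.\<close>
  have lr: "sw P (\<lambda>x y. sw P (\<lambda>a b. sw P (\<lambda>c d. g a b c d) y) x) h =
      sw P (\<lambda>x y. sw P (\<lambda>b y. sw P (\<lambda>c d. g x b c d) y) y) h"
    if g1: "\<And>x y z. x \<in> carrier H \<Longrightarrow> y \<in> carrier H \<Longrightarrow> z \<in> carrier H \<Longrightarrow> lin K H P (\<lambda>w. g w x y z)"
    and g2: "\<And>x y z. x \<in> carrier H \<Longrightarrow> y \<in> carrier H \<Longrightarrow> z \<in> carrier H \<Longrightarrow> lin K H P (\<lambda>w. g x w y z)"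
    and g3: "\<And>x y z. x \<in> carrier H \<Longrightarrow> y \<in> carrier H \<Longrightarrow> z \<in> carrier H \<Longrightarrow> lin K H P (\<lambda>w. g x y w z)"
    and g4: "\<And>x y z. x \<in> carrier H \<Longrightarrow> y \<in> carrier H \<Longrightarrow> z \<in> carrier H \<Longrightarrow> lin K H P (\<lambda>w. g x y z w)" for g
    by (rule sw_assoc[OF P h]) (intro lin_intros sw_body_lin sw_arg_lin P H_module g1 g2 g3 g4; assumption)+
  have "sw P (\<lambda>x y. sw P (\<lambda>b y. sw P (\<lambda>c d. f x b c d) y) y) h =
      sw P (\<lambda>x y. sw P (\<lambda>b y. sw P (\<lambda>c d. f x c b d) y) y) h"
    by (rule sw_cong[OF P _ _ h]; (rule sw_lcomm[OF P])?)
      (auto intro!: P f1 f2 f3 f4 lin_closed[OF f1])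
  then show ?thesis using lr[OF f1 f2 f3 f4] lr[of "\<lambda>a b c d. f a c b d", OF f1 f3 f2 f4] by simp
qed

text \<open>
  The contraction \<open>h_1 \<otimes> h_2 S(h_3) = h \<otimes> 1\<close>, below an arbitrary bilinear map.
\<close>

lemma sw_cancel_right:
  assumes P: "module K P" and f: "bil K H H P f" and h: "h \<in> carrier H"
  shows "sw P (\<lambda>x y. sw P (\<lambda>u v. f x (u \<otimes> S v)) y) h = f h \<one>"
proof -
  interpret P: module K P by fact
  note [simp] = bil_closed[OF f] P
  have "sw P (\<lambda>x y. sw P (\<lambda>u v. f x (u \<otimes> S v)) y) h = sw P (\<lambda>x y. \<epsilon> y \<odot>\<^bsub>P\<^esub> f x \<one>) h"
    by (rule sw_cong[OF P _ _ h]) (auto simp: sw_antipode_right[OF P bilD(2)[OF f]])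
  also have "\<dots> = f h \<one>" by (rule sw_counit_right[OF P _ h]) (rule bilD(1)[OF f], simp)
  finally show ?thesis .
qed

lemma sw_cancel_left:
  assumes P: "module K P" and f: "bil K H H P f" and h: "h \<in> carrier H"
  shows "sw P (\<lambda>x y. sw P (\<lambda>u v. f x (S u \<otimes> v)) y) h = f h \<one>"
proof -
  interpret P: module K P by fact
  note [simp] = bil_closed[OF f] P
  have "sw P (\<lambda>x y. sw P (\<lambda>u v. f x (S u \<otimes> v)) y) h = sw P (\<lambda>x y. \<epsilon> y \<odot>\<^bsub>P\<^esub> f x \<one>) h"
    by (rule sw_cong[OF P _ _ h]) (auto simp: sw_antipode_left[OF P bilD(2)[OF f]])
  also have "\<dots> = f h \<one>" by (rule sw_counit_right[OF P _ h]) (rule bilD(1)[OF f], simp)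
  finally show ?thesis .
qed

lemma S_one [simp]: "S \<one> = \<one>"
proof -
  have "sw H (\<lambda>x y. S x \<otimes> y) \<one> = S \<one> \<otimes> \<one>"
    by (rule sw_one) (auto intro!: lin_intros)
  then show ?thesis using antipode_left[of \<one>] by simp
qed

text \<open>
  Writing \<open>k = k_1 k_2 S(k_3)\<close> turns the left-hand side into \<open>S(h_1 k_1) h_2 k_2 S(k_3)\<close>, where
  everything before \<open>S(k_3)\<close> contracts.
\<close>

lemma S_mult_aux:
  assumes h: "h \<in> carrier H" and k: "k \<in> carrier H"
  shows "sw H (\<lambda>x y. S (x \<otimes> k) \<otimes> y) h = \<epsilon> h \<odot> S k"
proof -
  note [simp] = h k
  define B where "B a b = sw H (\<lambda>x y. S (x \<otimes> a) \<otimes> (y \<otimes> b)) h" for a b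
  have Bb: "bil K H H H B" unfolding B_def by (auto intro!: lin_intros)
  have "sw H (\<lambda>x y. S (x \<otimes> k) \<otimes> y) h = B k \<one>"
    unfolding B_def by (auto intro!: sw_cong)
  also have "\<dots> = sw H (\<lambda>x y. sw H (\<lambda>u v. B x (u \<otimes> S v)) y) k"
    by (rule sw_cancel_right[symmetric]) (auto intro!: Bb)
  also have "\<dots> = sw H (\<lambda>x y. sw H (\<lambda>u v. B u (v \<otimes> S y)) x) k"
    by (rule sw_assoc[symmetric]) (auto intro!: lin_intros simp: B_def)
  also have "\<dots> = sw H (\<lambda>x y. (\<epsilon> h \<odot> (\<epsilon> x \<odot> \<one>)) \<otimes> S y) k"
  proof (rule sw_cong)
    fix x y assume [simp]: "x \<in> carrier H" "y \<in> carrier H"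
    have "sw H (\<lambda>u v. B u (v \<otimes> S y)) x = sw H (\<lambda>a b. sw H (\<lambda>u v. S (a \<otimes> u) \<otimes> (b \<otimes> (v \<otimes> S y))) x) h"
      unfolding B_def by (rule sw_swap) auto
    also have "\<dots> = sw H (\<lambda>p q. S p \<otimes> (q \<otimes> S y)) (h \<otimes> x)"
      by (subst sw_mult) (auto intro!: lin_intros sw_cong simp: A.m_assoc)
    also have "\<dots> = sw H (\<lambda>p q. S p \<otimes> q) (h \<otimes> x) \<otimes> S y"
      by (subst sw_push[of H H "\<lambda>t. t \<otimes> S y"]) (auto intro!: lin_intros sw_cong simp: A.m_assoc)
    also have "\<dots> = (\<epsilon> h \<odot> (\<epsilon> x \<odot> \<one>)) \<otimes> S y"
      by (simp add: antipode_left counit_mult smult_assoc1)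
    finally show "sw H (\<lambda>u v. B u (v \<otimes> S y)) x = (\<epsilon> h \<odot> (\<epsilon> x \<odot> \<one>)) \<otimes> S y" .
  qed (auto simp: B_def)
  also have "\<dots> = sw H (\<lambda>x y. \<epsilon> x \<odot> (\<epsilon> h \<odot> S y)) k"
    by (rule sw_cong) (auto simp: smult_mult_left smult_assoc1[symmetric] R.m_comm)
  also have "\<dots> = \<epsilon> h \<odot> S k"
    by (rule sw_counit_left) (auto intro!: lin_intros lin_smult_left)
  finally show ?thesis .
qed

text \<open>
  Since \<open>h_1 \<otimes> h_2 S(h_3) = h \<otimes> 1\<close>, the left-hand side is \<open>S(h_1 k) h_2 S(h_3)\<close>, and the first
  two factors contract to \<open>\<epsilon>(h_1) S(k)\<close>.
\<close>

lemma S_mult: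
  assumes h: "h \<in> carrier H" and k: "k \<in> carrier H"
  shows "S (h \<otimes> k) = S k \<otimes> S h"
proof -
  note [simp] = h k
  have "S (h \<otimes> k) = S (h \<otimes> k) \<otimes> \<one>" by simp
  also have "\<dots> = sw H (\<lambda>x y. sw H (\<lambda>u v. S (x \<otimes> k) \<otimes> (u \<otimes> S v)) y) h"
    by (rule sw_cancel_right[symmetric]) (auto intro!: lin_intros)
  also have "\<dots> = sw H (\<lambda>x y. sw H (\<lambda>u v. S (u \<otimes> k) \<otimes> (v \<otimes> S y)) x) h"
    by (rule sw_assoc[symmetric]) (auto intro!: lin_intros)
  also have "\<dots> = sw H (\<lambda>x y. \<epsilon> x \<odot> (S k \<otimes> S y)) h"
  proof (rule sw_cong)
    fix x y assume [simp]: "x \<in> carrier H" "y \<in> carrier H"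
    have "sw H (\<lambda>u v. S (u \<otimes> k) \<otimes> (v \<otimes> S y)) x = sw H (\<lambda>u v. S (u \<otimes> k) \<otimes> v) x \<otimes> S y"
      by (subst sw_push[of H H "\<lambda>t. t \<otimes> S y"]) (auto intro!: lin_intros sw_cong simp: A.m_assoc)
    then show "sw H (\<lambda>u v. S (u \<otimes> k) \<otimes> (v \<otimes> S y)) x = \<epsilon> x \<odot> (S k \<otimes> S y)"
      by (simp add: S_mult_aux smult_mult_left)
  qed auto
  also have "\<dots> = S k \<otimes> S h"
    by (rule sw_counit_left) (auto intro!: lin_intros)
  finally show ?thesis .
qed

text \<open>
  Both \<open>S \<circ> S\<close> and the identity are convolution inverse to \<open>S\<close>. For \<open>S \<circ> S\<close>, cocommutativity and
  antimultiplicativity give \<open>S(S(h_1)) S(h_2) = S(S(h_2)) S(h_1) = S(h_1 S(h_2)) = \<epsilon>(h)\<close>.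
\<close>

lemma S_S [simp]:
  assumes h: "h \<in> carrier H" shows "S (S h) = h"
proof (rule convolution_inverse_unique[of H "\<lambda>h. S (S h)" S "\<lambda>h. h"])
  fix h assume [simp]: "h \<in> carrier H"
  have "sw H (\<lambda>x y. S (S x) \<otimes> S y) h = sw H (\<lambda>x y. S (S y) \<otimes> S x) h"
    by (rule sw_comm) (auto intro!: lin_intros)
  also have "\<dots> = sw H (\<lambda>x y. S (x \<otimes> S y)) h" by (rule sw_cong) (auto simp: S_mult)
  also have "\<dots> = \<epsilon> h \<odot> \<one>"
    by (subst sw_antipode_right) (auto intro!: lin_intros)
  finally show "sw H (\<lambda>x y. S (S x) \<otimes> S y) h = \<epsilon> h \<odot> \<one>" .
qed (auto intro!: lin_intros h antipode_left)

text \<open>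
  Both \<open>\<Delta> \<circ> S\<close> and \<open>h \<mapsto> S(h_1) \<otimes> S(h_2)\<close> are inverse to \<open>\<Delta>\<close> in the convolution algebra of linear
  maps \<open>H \<rightarrow> H \<otimes> H\<close>.
\<close>

lemma sw_antipode:
  assumes P: "module K P" and f: "bil K H H P f" and h: "h \<in> carrier H"
  shows "sw P (\<lambda>x y. f x y) (S h) = sw P (\<lambda>x y. f (S x) (S y)) h"
proof -
  let ?R = "tensor_alg K H H"
  note R = HH.T_algebra and RM = HH.T_alg_module
  interpret R: assoc_algebra K ?R by (rule R)
  have tl: "lin K H ?R (comult H)" using comult_lin by simp
  note tcl = lin_closed[OF tl]
  have tm: "HH.tns a b \<otimes>\<^bsub>?R\<^esub> HH.tns c d = HH.tns (a \<otimes> c) (b \<otimes> d)"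
    if "a \<in> carrier H" "b \<in> carrier H" "c \<in> carrier H" "d \<in> carrier H" for a b c d
    using that by (simp add: HH.mul_tns)
  have swR: "sweedler K H ?R = sweedler K H HH.T"
    by (rule sweedler_target_cong) (simp_all add: fun_eq_iff)
  have cm: "comult H (x \<otimes> y) = comult H x \<otimes>\<^bsub>?R\<^esub> comult H y" if "x \<in> carrier H" "y \<in> carrier H" for x y
    using comult_hom that by (simp add: ring_hom_def)
  have c1: "comult H \<one> = \<one>\<^bsub>?R\<^esub>" using comult_hom by (simp add: ring_hom_def)
  let ?L = "\<lambda>h. sw ?R (\<lambda>x y. HH.tns (S x) (S y)) h"
  have tb: "bil K H H ?R (\<lambda>x y. HH.tns (S x) (S y))"
    by (simp add: bil_def) (auto intro!: lin_intros)
  have tc: "HH.tns a b \<in> carrier ?R" if "a \<in> carrier H" "b \<in> carrier H" for a b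
    using that HH.tns_closed by simp
  have tl1: "lin K V ?R (\<lambda>v. HH.tns (g v) y)" if "lin K V H g" "y \<in> carrier H" for g y V
    using that by (simp add: HH.tns_lin1)
  have tl2: "lin K V ?R (\<lambda>v. HH.tns y (g v))" if "lin K V H g" "y \<in> carrier H" for g y V
    using that by (simp add: HH.tns_lin2)
  have Lc: "?L y \<in> carrier ?R" if "y \<in> carrier H" for y
    by (intro sw_closed RM tc that S_closed)
  have "comult H (S h) = ?L h"
  proof (rule convolution_inverse_unique[OF R _ tl _ _ _ h])
    show "lin K H ?R (\<lambda>h. comult H (S h))" by (rule lin_compose[OF tl]) (auto intro!: lin_intros)
    show "lin K H ?R ?L" by (rule sw_arg_lin[OF RM lin_id tb])
  next
    fix h assume h: "h \<in> carrier H"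
    have "sw ?R (\<lambda>x y. comult H (S x) \<otimes>\<^bsub>?R\<^esub> comult H y) h = sw ?R (\<lambda>x y. comult H (S x \<otimes> y)) h"
      by (rule sw_cong[OF RM _ _ h]) (simp_all add: cm tcl R.A.m_closed del: tensor_alg_simps)
    also have "\<dots> = \<epsilon> h \<odot>\<^bsub>?R\<^esub> \<one>\<^bsub>?R\<^esub>" using sw_antipode_left[OF RM tl h] c1 by simp
    finally show "sw ?R (\<lambda>x y. comult H (S x) \<otimes>\<^bsub>?R\<^esub> comult H y) h = \<epsilon> h \<odot>\<^bsub>?R\<^esub> \<one>\<^bsub>?R\<^esub>" .
  next
    fix h assume h [simp]: "h \<in> carrier H"
    have "sw ?R (\<lambda>x y. comult H x \<otimes>\<^bsub>?R\<^esub> ?L y) h =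
        sw ?R (\<lambda>x y. sw ?R (\<lambda>a b. sw ?R (\<lambda>c d. HH.tns (a \<otimes> S c) (b \<otimes> S d)) y) x) h"
    proof (rule sw_cong[OF RM _ _ h])
      fix x y assume [simp]: "x \<in> carrier H" "y \<in> carrier H"
      show "comult H x \<otimes>\<^bsub>?R\<^esub> ?L y \<in> carrier ?R"
        by (intro R.A.m_closed tcl sw_closed RM tc) auto
      have "comult H x \<otimes>\<^bsub>?R\<^esub> ?L y = sw ?R (\<lambda>a b. HH.tns a b) x \<otimes>\<^bsub>?R\<^esub> ?L y"
        by (simp add: swR sw_tns)
      also have "\<dots> = sw ?R (\<lambda>a b. HH.tns a b \<otimes>\<^bsub>?R\<^esub> ?L y) x"
        by (rule sw_push[OF alg_lin1[OF R lin_id Lc] RM RM tc]) simp_all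
      also have "\<dots> = sw ?R (\<lambda>a b. sw ?R (\<lambda>c d. HH.tns (a \<otimes> S c) (b \<otimes> S d)) y) x"
      proof (rule sw_cong[OF RM])
        fix a b assume ab [simp]: "a \<in> carrier H" "b \<in> carrier H"
        show "HH.tns a b \<otimes>\<^bsub>?R\<^esub> ?L y \<in> carrier ?R"
          by (intro R.A.m_closed tcl sw_closed RM tc) auto
        have "HH.tns a b \<otimes>\<^bsub>?R\<^esub> ?L y = sw ?R (\<lambda>c d. HH.tns a b \<otimes>\<^bsub>?R\<^esub> HH.tns (S c) (S d)) y"
          by (rule sw_push[OF alg_lin2[OF R lin_id tc[OF ab]] RM RM tc]) simp_all
        also have "\<dots> = sw ?R (\<lambda>c d. HH.tns (a \<otimes> S c) (b \<otimes> S d)) y"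
          by (rule sw_cong[OF RM]) (simp_all add: tm HH.tns_closed)
        finally show "HH.tns a b \<otimes>\<^bsub>?R\<^esub> ?L y = sw ?R (\<lambda>c d. HH.tns (a \<otimes> S c) (b \<otimes> S d)) y" .
      qed simp
      finally show "comult H x \<otimes>\<^bsub>?R\<^esub> ?L y = sw ?R (\<lambda>a b. sw ?R (\<lambda>c d. HH.tns (a \<otimes> S c) (b \<otimes> S d)) y) x" .
    qed
    \<comment> \<open>In \<open>h_1 S(h_3) \<otimes> h_2 S(h_4)\<close> the two inner factors are exchanged, so that both tensor
      factors contract.\<close>
    also have "\<dots> = sw ?R (\<lambda>x y. sw ?R (\<lambda>a b. sw ?R (\<lambda>c d. HH.tns (a \<otimes> S b) (c \<otimes> S d)) y) x) h"
      by (rule sw_mid[OF RM h]) (intro tl1 tl2 lin_intros assoc_algebra_axioms A.m_closed S_closed; assumption)+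
    also have "\<dots> = sw ?R (\<lambda>x y. \<epsilon> x \<odot>\<^bsub>?R\<^esub> (\<epsilon> y \<odot>\<^bsub>?R\<^esub> \<one>\<^bsub>?R\<^esub>)) h"
    proof (rule sw_cong[OF RM _ _ h])
      fix x y assume xy [simp]: "x \<in> carrier H" "y \<in> carrier H"
      have "sw ?R (\<lambda>a b. sw ?R (\<lambda>c d. HH.tns (a \<otimes> S b) (c \<otimes> S d)) y) x =
          sw ?R (\<lambda>a b. \<epsilon> y \<odot>\<^bsub>?R\<^esub> HH.tns (a \<otimes> S b) \<one>) x"
        by (rule sw_cong[OF RM])
          (simp_all add: sw_antipode_right[OF RM, of "\<lambda>t. HH.tns _ t"] HH.tns_lin2 lin_id HH.tns_closed RM sw_closed
            module.smult_closed[OF HH.T_module])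
      also have "\<dots> = \<epsilon> x \<odot>\<^bsub>?R\<^esub> (\<epsilon> y \<odot>\<^bsub>?R\<^esub> HH.tns \<one> \<one>)"
        by (rule sw_antipode_right[OF RM, of "\<lambda>t. \<epsilon> y \<odot>\<^bsub>?R\<^esub> HH.tns t \<one>"])
          (auto intro!: lin_smult_left[of K "HH.T"] lin_intros)
      finally show "sw ?R (\<lambda>a b. sw ?R (\<lambda>c d. HH.tns (a \<otimes> S b) (c \<otimes> S d)) y) x =
        \<epsilon> x \<odot>\<^bsub>?R\<^esub> (\<epsilon> y \<odot>\<^bsub>?R\<^esub> \<one>\<^bsub>?R\<^esub>)" by simp
    qed (intro sw_closed RM tc A.m_closed S_closed; assumption)
    also have "\<dots> = \<epsilon> h \<odot>\<^bsub>?R\<^esub> \<one>\<^bsub>?R\<^esub>"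
      by (rule sw_counit_left[OF RM _ h]) (rule eps_lin[OF RM R.A.one_closed lin_id])
    finally show "sw ?R (\<lambda>x y. comult H x \<otimes>\<^bsub>?R\<^esub> ?L y) h = \<epsilon> h \<odot>\<^bsub>?R\<^esub> \<one>\<^bsub>?R\<^esub>" .
  qed
  then have "sw P f (S h) = tensor_lift K P f (sw HH.T (\<lambda>x y. HH.tns (S x) (S y)) h)"
    by (simp add: sweedler_def[of K H P f] swR)
  also have "\<dots> = sw P (\<lambda>x y. tensor_lift K P f (HH.tns (S x) (S y))) h"
    by (rule sw_push[OF HH.lift_lin[OF P f] HH.T_module P _ h]) (auto intro!: HH.tns_closed)
  also have "\<dots> = sw P (\<lambda>x y. f (S x) (S y)) h"
    by (rule sw_cong[OF P _ _ h]) (auto simp: HH.lift_tns[OF P f] bil_closed[OF f])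
  finally show ?thesis .
qed

end

section \<open>Partial representations of a cocommutative Hopf algebra\<close>

text \<open>
  The assumptions are the first three groups of defining relations of \<open>H_par\<close>. The other two
  groups are these relations for \<open>S(k)\<close> in place of \<open>k\<close>, because \<open>S\<close> is an involution compatible
  with \<open>\<Delta>\<close>.
\<close>

locale partial_representation = cocommutative_hopf_algebra K H + R: assoc_algebra K R
  for K :: "'k ring" and H :: "('k, 'h) hopf" (structure) and R :: "('k, 'r, 'z) module_scheme"
    and \<sigma> :: "'h \<Rightarrow> 'r" +
  assumes \<sigma>_linear: "lin K H R \<sigma>" and \<sigma>_one: "\<sigma> \<one> = \<one>\<^bsub>R\<^esub>"
    and rel1: "\<lbrakk>h \<in> carrier H; k \<in> carrier H\<rbrakk> \<Longrightarrow>
      sw R (\<lambda>x y. \<sigma> h \<otimes>\<^bsub>R\<^esub> (\<sigma> x \<otimes>\<^bsub>R\<^esub> \<sigma> (S y))) k = sw R (\<lambda>x y. \<sigma> (h \<otimes> x) \<otimes>\<^bsub>R\<^esub> \<sigma> (S y)) k"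
    and rel2: "\<lbrakk>h \<in> carrier H; k \<in> carrier H\<rbrakk> \<Longrightarrow>
      sw R (\<lambda>x y. \<sigma> x \<otimes>\<^bsub>R\<^esub> (\<sigma> (S y) \<otimes>\<^bsub>R\<^esub> \<sigma> k)) h = sw R (\<lambda>x y. \<sigma> x \<otimes>\<^bsub>R\<^esub> \<sigma> (S y \<otimes> k)) h"
begin

abbreviation rmul (infixl "\<star>" 70) where "a \<star> b \<equiv> a \<otimes>\<^bsub>R\<^esub> b"

lemma R_alg [simp, intro!]: "assoc_algebra K R" by (rule R.assoc_algebra_axioms)
lemma R_mod [simp, intro!]: "module K R" by (rule R.module_axioms)

lemma \<sigma>_closed [simp]: "h \<in> carrier H \<Longrightarrow> \<sigma> h \<in> carrier R"
  by (rule lin_closed[OF \<sigma>_linear])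

lemma \<sigma>_lin [lin_intros]: "lin K V H f \<Longrightarrow> lin K V R (\<lambda>v. \<sigma> (f v))"
  by (rule lin_compose[OF \<sigma>_linear])

lemmas mult_sw_left = sw_alg_left[OF R_alg] and mult_sw_right = sw_alg_right[OF R_alg]
lemmas mult_sw = mult_sw_left mult_sw_right

text \<open>
  The image of the element \<open>e_h\<close>.
\<close>

definition e :: "'h \<Rightarrow> 'r" where "e h = sw R (\<lambda>x y. \<sigma> x \<star> \<sigma> (S y)) h"

lemma e_closed [simp]: "h \<in> carrier H \<Longrightarrow> e h \<in> carrier R"
  by (simp add: e_def sw_closed)

lemma e_lin [lin_intros]: "lin K V H f \<Longrightarrow> lin K V R (\<lambda>v. e (f v))"
  unfolding e_def by (auto intro!: lin_intros)

lemma e_antipode: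
  assumes h: "h \<in> carrier H" shows "sw R (\<lambda>x y. \<sigma> (S x) \<star> \<sigma> y) h = e (S h)"
proof -
  have "e (S h) = sw R (\<lambda>x y. \<sigma> (S x) \<star> \<sigma> (S (S y))) h"
    unfolding e_def by (rule sw_antipode) (auto intro!: lin_intros h)
  then show ?thesis using h by simp
qed

lemma \<sigma>_e: "\<lbrakk>h \<in> carrier H; k \<in> carrier H\<rbrakk> \<Longrightarrow> \<sigma> h \<star> e k = sw R (\<lambda>x y. \<sigma> (h \<otimes> x) \<star> \<sigma> (S y)) k"
  by (simp add: e_def mult_sw rel1)

lemma e_\<sigma>: "\<lbrakk>h \<in> carrier H; k \<in> carrier H\<rbrakk> \<Longrightarrow> e h \<star> \<sigma> k = sw R (\<lambda>x y. \<sigma> x \<star> \<sigma> (S y \<otimes> k)) h"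
  by (simp add: e_def mult_sw R.A.m_assoc rel2)

text \<open>
  Expanding the left-hand side by the second relation gives \<open>\<sigma>(h_1 k_1) \<sigma>(S(k_2) S(h_2) h_3)\<close>,
  in which \<open>S(h_2) h_3\<close> contracts; the result \<open>\<sigma>(h k_1) \<sigma>(S k_2)\<close> is \<open>\<sigma>(h) e(k)\<close> by the first
  relation. Read from right to left, the lemma moves \<open>e\<close> to the left of \<open>\<sigma>\<close>.
\<close>

lemma \<sigma>_e_commute:
  assumes h [simp]: "h \<in> carrier H" and k [simp]: "k \<in> carrier H"
  shows "sw R (\<lambda>x y. e (x \<otimes> k) \<star> \<sigma> y) h = \<sigma> h \<star> e k"
proof -
  have "sw R (\<lambda>x y. e (x \<otimes> k) \<star> \<sigma> y) h =
      sw R (\<lambda>x y. sw R (\<lambda>a b. sw R (\<lambda>u v. \<sigma> (a \<otimes> u) \<star> \<sigma> (S v \<otimes> (S b \<otimes> y))) k) x) h"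
  proof (rule sw_congruence)
    fix x y assume [simp]: "x \<in> carrier H" "y \<in> carrier H"
    have "e (x \<otimes> k) \<star> \<sigma> y = sw R (\<lambda>p q. \<sigma> p \<star> \<sigma> (S q \<otimes> y)) (x \<otimes> k)" by (simp add: e_\<sigma>)
    also have "\<dots> = sw R (\<lambda>a b. sw R (\<lambda>u v. \<sigma> (a \<otimes> u) \<star> \<sigma> (S (b \<otimes> v) \<otimes> y)) k) x"
      by (rule sw_mult) (auto intro!: lin_intros)
    finally show "e (x \<otimes> k) \<star> \<sigma> y = sw R (\<lambda>a b. sw R (\<lambda>u v. \<sigma> (a \<otimes> u) \<star> \<sigma> (S v \<otimes> (S b \<otimes> y))) k) x"
      by (simp add: S_mult A.m_assoc)
  qed auto
  also have "\<dots> = sw R (\<lambda>x y. sw R (\<lambda>u v. sw R (\<lambda>a b. \<sigma> (a \<otimes> u) \<star> \<sigma> (S v \<otimes> (S b \<otimes> y))) x) k) h"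
    by (intro sw_congruence sw_swap) auto
  also have "\<dots> = sw R (\<lambda>u v. sw R (\<lambda>x y. sw R (\<lambda>a b. \<sigma> (a \<otimes> u) \<star> \<sigma> (S v \<otimes> (S b \<otimes> y))) x) h) k"
    by (intro sw_swap) auto
  also have "\<dots> = sw R (\<lambda>u v. \<sigma> (h \<otimes> u) \<star> \<sigma> (S v)) k"
  proof (rule sw_congruence)
    fix u v assume [simp]: "u \<in> carrier H" "v \<in> carrier H"
    have "sw R (\<lambda>x y. sw R (\<lambda>a b. \<sigma> (a \<otimes> u) \<star> \<sigma> (S v \<otimes> (S b \<otimes> y))) x) h =
      sw R (\<lambda>x y. sw R (\<lambda>a b. \<sigma> (x \<otimes> u) \<star> \<sigma> (S v \<otimes> (S a \<otimes> b))) y) h"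
      by (rule sw_assoc) (auto intro!: lin_intros)
    also have "\<dots> = \<sigma> (h \<otimes> u) \<star> \<sigma> (S v \<otimes> \<one>)"
      by (rule sw_cancel_left) (auto intro!: lin_intros)
    finally show "sw R (\<lambda>x y. sw R (\<lambda>a b. \<sigma> (a \<otimes> u) \<star> \<sigma> (S v \<otimes> (S b \<otimes> y))) x) h = \<sigma> (h \<otimes> u) \<star> \<sigma> (S v)"
      by simp
  qed auto
  also have "\<dots> = \<sigma> h \<star> e k" by (simp add: \<sigma>_e)
  finally show ?thesis .
qed

text \<open>
  Moving \<open>e(k)\<close> to the left through both factors of \<open>e(h) = \<sigma>(h_1) \<sigma>(S h_2)\<close> replaces its
  argument by \<open>h_1 S(h_3) k\<close>. By cocommutativity this can be read as \<open>h_1 S(h_2) k\<close>, which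
  contracts to \<open>k\<close>, and the remaining factors form \<open>e(h)\<close> again.
\<close>

lemma e_commute:
  assumes h [simp]: "h \<in> carrier H" and k [simp]: "k \<in> carrier H"
  shows "e h \<star> e k = e k \<star> e h"
proof -
  have "e h \<star> e k = sw R (\<lambda>x y. \<sigma> x \<star> (\<sigma> (S y) \<star> e k)) h"
    by (simp add: e_def[of h] mult_sw R.A.m_assoc)
  also have "\<dots> = sw R (\<lambda>x y. sw R (\<lambda>a b. sw R (\<lambda>u v. e (a \<otimes> (S u \<otimes> k)) \<star> (\<sigma> b \<star> \<sigma> (S v))) y) x) h"
  proof (rule sw_congruence)
    fix x y assume [simp]: "x \<in> carrier H" "y \<in> carrier H"
    have "\<sigma> (S y) \<star> e k = sw R (\<lambda>u v. e (u \<otimes> k) \<star> \<sigma> v) (S y)" by (simp add: \<sigma>_e_commute)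
    also have "\<dots> = sw R (\<lambda>u v. e (S u \<otimes> k) \<star> \<sigma> (S v)) y"
      by (rule sw_antipode) (auto intro!: lin_intros)
    finally have "\<sigma> x \<star> (\<sigma> (S y) \<star> e k) = sw R (\<lambda>u v. \<sigma> x \<star> e (S u \<otimes> k) \<star> \<sigma> (S v)) y"
      by (simp add: mult_sw R.A.m_assoc)
    also have "\<dots> = sw R (\<lambda>u v. sw R (\<lambda>a b. e (a \<otimes> (S u \<otimes> k)) \<star> (\<sigma> b \<star> \<sigma> (S v))) x) y"
      by (simp add: \<sigma>_e_commute[symmetric] mult_sw R.A.m_assoc)
    also have "\<dots> = sw R (\<lambda>a b. sw R (\<lambda>u v. e (a \<otimes> (S u \<otimes> k)) \<star> (\<sigma> b \<star> \<sigma> (S v))) y) x"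
      by (rule sw_swap) auto
    finally show "\<sigma> x \<star> (\<sigma> (S y) \<star> e k) = sw R (\<lambda>a b. sw R (\<lambda>u v. e (a \<otimes> (S u \<otimes> k)) \<star> (\<sigma> b \<star> \<sigma> (S v))) y) x" .
  qed auto
  also have "\<dots> = sw R (\<lambda>x y. sw R (\<lambda>a b. sw R (\<lambda>u v. e (a \<otimes> (S b \<otimes> k)) \<star> (\<sigma> u \<star> \<sigma> (S v))) y) x) h"
    by (rule sw_mid) (auto intro!: lin_intros)
  also have "\<dots> = sw R (\<lambda>x y. sw R (\<lambda>a b. e (a \<otimes> S b \<otimes> k) \<star> e y) x) h"
    by (simp add: e_def[of "y" for y] mult_sw A.m_assoc)
  also have "\<dots> = sw R (\<lambda>x y. \<epsilon> x \<odot>\<^bsub>R\<^esub> (e (\<one> \<otimes> k) \<star> e y)) h"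
    by (intro sw_congruence sw_antipode_right[where f = "\<lambda>t. e (t \<otimes> k) \<star> e _"]) (auto intro!: lin_intros)
  also have "\<dots> = e (\<one> \<otimes> k) \<star> e h"
    by (rule sw_counit_left) (auto intro!: lin_intros)
  finally show ?thesis by simp
qed

lemma e_one: "e \<one> = \<one>\<^bsub>R\<^esub>"
proof -
  have "e \<one> = \<sigma> \<one> \<star> \<sigma> (S \<one>)"
    unfolding e_def by (rule sw_one) (auto intro!: lin_intros)
  then show ?thesis by (simp add: \<sigma>_one)
qed

lemma e_\<sigma>_sum:
  assumes h [simp]: "h \<in> carrier H" shows "sw R (\<lambda>x y. e x \<star> \<sigma> y) h = \<sigma> h"
  using \<sigma>_e_commute[of h \<one>] by (simp add: e_one)

text \<open>
  Because \<open>e(S h) = \<sigma>(S h_1) \<sigma>(h_2)\<close>, the left-hand side is \<open>\<sigma>(h_1) \<sigma>(S h_2) \<sigma>(h_3)\<close>, which is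
  also \<open>e(h_1) \<sigma>(h_2)\<close>.
\<close>

lemma \<sigma>_e_antipode_sum:
  assumes h [simp]: "h \<in> carrier H" shows "sw R (\<lambda>x y. \<sigma> x \<star> e (S y)) h = \<sigma> h"
proof -
  have "sw R (\<lambda>x y. \<sigma> x \<star> e (S y)) h = sw R (\<lambda>x y. sw R (\<lambda>u v. \<sigma> x \<star> (\<sigma> (S u) \<star> \<sigma> v)) y) h"
    by (simp add: e_antipode[symmetric] mult_sw)
  also have "\<dots> = sw R (\<lambda>x y. sw R (\<lambda>u v. \<sigma> u \<star> (\<sigma> (S v) \<star> \<sigma> y)) x) h"
    by (rule sw_assoc[symmetric]) (auto intro!: lin_intros)
  also have "\<dots> = sw R (\<lambda>x y. e x \<star> \<sigma> y) h"
    by (simp add: e_def mult_sw R.A.m_assoc)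
  finally show ?thesis by (simp add: e_\<sigma>_sum)
qed

lemma e_e_sum:
  assumes h [simp]: "h \<in> carrier H" shows "sw R (\<lambda>x y. e x \<star> e y) h = e h"
proof -
  have "sw R (\<lambda>x y. e x \<star> e y) h = sw R (\<lambda>x y. sw R (\<lambda>u v. e x \<star> (\<sigma> u \<star> \<sigma> (S v))) y) h"
    by (simp add: e_def[of y for y] mult_sw)
  also have "\<dots> = sw R (\<lambda>x y. sw R (\<lambda>u v. e u \<star> (\<sigma> v \<star> \<sigma> (S y))) x) h"
    by (rule sw_assoc[symmetric]) (auto intro!: lin_intros)
  also have "\<dots> = sw R (\<lambda>x y. sw R (\<lambda>u v. e u \<star> \<sigma> v) x \<star> \<sigma> (S y)) h"
    by (simp add: mult_sw_right R.A.m_assoc)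
  also have "\<dots> = e h" by (simp add: e_\<sigma>_sum) (simp add: e_def)
  finally show ?thesis .
qed

end

section \<open>Operators satisfying the relations of the algebra of partial representations\<close>

text \<open>
  Operators \<open>\<rho> h\<close> on a module that satisfy the relations of \<open>H_par\<close> elementwise. The relations
  with the antipode in the other positions are derived below by substituting \<open>S k\<close> for \<open>k\<close>.
\<close>

locale operator_representation = cocommutative_hopf_algebra K H + P: module K P
  for K :: "'k ring" and H :: "('k, 'h) hopf" (structure) and P :: "('k, 'p, 'z) module_scheme"
    and \<rho> :: "'h \<Rightarrow> 'p \<Rightarrow> 'p" +
  assumes \<rho>_bilinear: "bil K H P P \<rho>" and \<rho>_one: "m \<in> carrier P \<Longrightarrow> \<rho> \<one> m = m"
    and \<rho>_rel1: "\<lbrakk>h \<in> carrier H; k \<in> carrier H; m \<in> carrier P\<rbrakk> \<Longrightarrow>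
      sw P (\<lambda>x y. \<rho> h (\<rho> x (\<rho> (S y) m))) k = sw P (\<lambda>x y. \<rho> (h \<otimes> x) (\<rho> (S y) m)) k"
    and \<rho>_rel2: "\<lbrakk>h \<in> carrier H; k \<in> carrier H; m \<in> carrier P\<rbrakk> \<Longrightarrow>
      sw P (\<lambda>x y. \<rho> x (\<rho> (S y) (\<rho> k m))) h = sw P (\<lambda>x y. \<rho> x (\<rho> (S y \<otimes> k) m)) h"
begin

lemma P_mod [simp, intro!]: "module K P" by (rule P.module_axioms)

lemma \<rho>_closed [simp]: "h \<in> carrier H \<Longrightarrow> m \<in> carrier P \<Longrightarrow> \<rho> h m \<in> carrier P"
  by (rule bil_closed[OF \<rho>_bilinear])

lemma \<rho>_lin1 [lin_intros]: "lin K V H f \<Longrightarrow> m \<in> carrier P \<Longrightarrow> lin K V P (\<lambda>v. \<rho> (f v) m)"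
  and \<rho>_lin2 [lin_intros]: "lin K V P g \<Longrightarrow> h \<in> carrier H \<Longrightarrow> lin K V P (\<lambda>v. \<rho> h (g v))"
  by (erule lin_compose[OF bilD(1)[OF \<rho>_bilinear], rotated], assumption)
    (erule lin_compose[OF bilD(2)[OF \<rho>_bilinear], rotated], assumption)

lemma \<rho>_rel3:
  assumes h [simp]: "h \<in> carrier H" and k [simp]: "k \<in> carrier H" and m [simp]: "m \<in> carrier P"
  shows "sw P (\<lambda>x y. \<rho> h (\<rho> (S x) (\<rho> y m))) k = sw P (\<lambda>x y. \<rho> (h \<otimes> S x) (\<rho> y m)) k"
proof -
  have "sw P (\<lambda>x y. \<rho> h (\<rho> x (\<rho> (S y) m))) (S k) = sw P (\<lambda>x y. \<rho> h (\<rho> (S x) (\<rho> (S (S y)) m))) k"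
    by (rule sw_antipode) (auto intro!: lin_intros)
  moreover have "sw P (\<lambda>x y. \<rho> (h \<otimes> x) (\<rho> (S y) m)) (S k) = sw P (\<lambda>x y. \<rho> (h \<otimes> S x) (\<rho> (S (S y)) m)) k"
    by (rule sw_antipode) (auto intro!: lin_intros)
  ultimately show ?thesis using \<rho>_rel1[of h "S k" m] by simp
qed

lemma \<rho>_rel4:
  assumes h [simp]: "h \<in> carrier H" and k [simp]: "k \<in> carrier H" and m [simp]: "m \<in> carrier P"
  shows "sw P (\<lambda>x y. \<rho> (S x) (\<rho> y (\<rho> k m))) h = sw P (\<lambda>x y. \<rho> (S x) (\<rho> (y \<otimes> k) m)) h"
proof -
  have "sw P (\<lambda>x y. \<rho> x (\<rho> (S y) (\<rho> k m))) (S h) = sw P (\<lambda>x y. \<rho> (S x) (\<rho> (S (S y)) (\<rho> k m))) h"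
    by (rule sw_antipode) (auto intro!: lin_intros)
  moreover have "sw P (\<lambda>x y. \<rho> x (\<rho> (S y \<otimes> k) m)) (S h) = sw P (\<lambda>x y. \<rho> (S x) (\<rho> (S (S y) \<otimes> k) m)) h"
    by (rule sw_antipode) (auto intro!: lin_intros)
  ultimately show ?thesis using \<rho>_rel2[of "S h" k m] by simp
qed

end

section \<open>Conjugation on bimodules\<close>

text \<open>
  A bimodule over the target of a partial representation, with left and right multiplication
  given as operators \<open>lm\<close> and \<open>rm\<close>. The operator \<open>D h\<close> is the conjugation \<open>m \<mapsto> \<sigma>(h_1) m \<sigma>(S
  h_2)\<close>.
\<close>

locale bimodule_representation = partial_representation K H R \<sigma> + P: module K P
  for K :: "'k ring" and H :: "('k, 'h) hopf" (structure) and R :: "('k, 'r, 'z) module_scheme"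
    and \<sigma> :: "'h \<Rightarrow> 'r" and P :: "('k, 'p, 'y) module_scheme"
    and lm :: "'r \<Rightarrow> 'p \<Rightarrow> 'p" and rm :: "'r \<Rightarrow> 'p \<Rightarrow> 'p" +
  assumes lm_bilinear: "bil K R P P lm" and rm_bilinear: "bil K R P P rm"
    and lm_mult: "\<lbrakk>a \<in> carrier R; b \<in> carrier R; m \<in> carrier P\<rbrakk> \<Longrightarrow> lm (a \<otimes>\<^bsub>R\<^esub> b) m = lm a (lm b m)"
    and rm_mult: "\<lbrakk>a \<in> carrier R; b \<in> carrier R; m \<in> carrier P\<rbrakk> \<Longrightarrow> rm (a \<otimes>\<^bsub>R\<^esub> b) m = rm b (rm a m)"
    and lm_one: "m \<in> carrier P \<Longrightarrow> lm \<one>\<^bsub>R\<^esub> m = m" and rm_one: "m \<in> carrier P \<Longrightarrow> rm \<one>\<^bsub>R\<^esub> m = m"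
    and rm_lm: "\<lbrakk>a \<in> carrier R; b \<in> carrier R; m \<in> carrier P\<rbrakk> \<Longrightarrow> rm b (lm a m) = lm a (rm b m)"
begin

lemma P_mod [simp, intro!]: "module K P" by (rule P.module_axioms)

lemma lm_closed [simp]: "a \<in> carrier R \<Longrightarrow> m \<in> carrier P \<Longrightarrow> lm a m \<in> carrier P"
  by (rule bil_closed[OF lm_bilinear])
lemma rm_closed [simp]: "a \<in> carrier R \<Longrightarrow> m \<in> carrier P \<Longrightarrow> rm a m \<in> carrier P"
  by (rule bil_closed[OF rm_bilinear])

lemma lm_lin1 [lin_intros]: "lin K V R f \<Longrightarrow> m \<in> carrier P \<Longrightarrow> lin K V P (\<lambda>v. lm (f v) m)"
  by (erule lin_compose[OF bilD(1)[OF lm_bilinear], rotated])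
lemma lm_lin2 [lin_intros]: "lin K V P g \<Longrightarrow> a \<in> carrier R \<Longrightarrow> lin K V P (\<lambda>v. lm a (g v))"
  by (erule lin_compose[OF bilD(2)[OF lm_bilinear], rotated])
lemma rm_lin1 [lin_intros]: "lin K V R f \<Longrightarrow> m \<in> carrier P \<Longrightarrow> lin K V P (\<lambda>v. rm (f v) m)"
  by (erule lin_compose[OF bilD(1)[OF rm_bilinear], rotated])
lemma rm_lin2 [lin_intros]: "lin K V P g \<Longrightarrow> a \<in> carrier R \<Longrightarrow> lin K V P (\<lambda>v. rm a (g v))"
  by (erule lin_compose[OF bilD(2)[OF rm_bilinear], rotated])

lemma lm_sw:
  "\<lbrakk>m \<in> carrier P; \<And>x y. x \<in> carrier H \<Longrightarrow> y \<in> carrier H \<Longrightarrow> f x y \<in> carrier R; h \<in> carrier H\<rbrakk> \<Longrightarrow>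
    lm (sw R f h) m = sw P (\<lambda>x y. lm (f x y) m) h"
  "\<lbrakk>a \<in> carrier R; \<And>x y. x \<in> carrier H \<Longrightarrow> y \<in> carrier H \<Longrightarrow> g x y \<in> carrier P; h \<in> carrier H\<rbrakk> \<Longrightarrow>
    lm a (sw P g h) = sw P (\<lambda>x y. lm a (g x y)) h"
  by (rule sw_push[where g = "\<lambda>t. lm t m"]; auto intro!: lin_intros)
    (rule sw_push[where g = "\<lambda>t. lm a t"]; auto intro!: lin_intros)

lemma rm_sw:
  "\<lbrakk>m \<in> carrier P; \<And>x y. x \<in> carrier H \<Longrightarrow> y \<in> carrier H \<Longrightarrow> f x y \<in> carrier R; h \<in> carrier H\<rbrakk> \<Longrightarrow>
    rm (sw R f h) m = sw P (\<lambda>x y. rm (f x y) m) h"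
  "\<lbrakk>a \<in> carrier R; \<And>x y. x \<in> carrier H \<Longrightarrow> y \<in> carrier H \<Longrightarrow> g x y \<in> carrier P; h \<in> carrier H\<rbrakk> \<Longrightarrow>
    rm a (sw P g h) = sw P (\<lambda>x y. rm a (g x y)) h"
  by (rule sw_push[where g = "\<lambda>t. rm t m"]; auto intro!: lin_intros)
    (rule sw_push[where g = "\<lambda>t. rm a t"]; auto intro!: lin_intros)

lemmas lrm_sw = lm_sw rm_sw

definition D :: "'h \<Rightarrow> 'p \<Rightarrow> 'p" where "D h m = sw P (\<lambda>x y. lm (\<sigma> x) (rm (\<sigma> (S y)) m)) h"

lemma D_closed [simp]: "h \<in> carrier H \<Longrightarrow> m \<in> carrier P \<Longrightarrow> D h m \<in> carrier P"
  by (simp add: D_def)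

lemma D_bil: "bil K H P P D"
  unfolding D_def by (auto intro!: lin_intros)

text \<open>
  In a product of two conjugations the Sweedler factors of \<open>k\<close> alternate between the two sides
  of \<open>m\<close>: the first and third stand on the left, the second and fourth on the right.
  Cocommutativity collects them into a sum over \<open>k_1\<close> on the left and a sum over \<open>k_2\<close> on the
  right.
\<close>

lemma split_sides:
  assumes F: "bil K H H R F" and G: "bil K H H R G" and k [simp]: "k \<in> carrier H" and m [simp]: "m \<in> carrier P"
  shows "sw P (\<lambda>x y. sw P (\<lambda>a b. sw P (\<lambda>u v. lm (F a u) (rm (G v b) m)) y) x) k =
    sw P (\<lambda>x y. lm (sw R (\<lambda>a b. F a b) x) (rm (sw R (\<lambda>a b. G a b) y) m)) k"
proof -
  note [simp] = bil_closed[OF F] bil_closed[OF G]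
  note fl = lin_compose[OF bilD(1)[OF F]] lin_compose[OF bilD(2)[OF F]]
    lin_compose[OF bilD(1)[OF G]] lin_compose[OF bilD(2)[OF G]]
  have "sw P (\<lambda>x y. sw P (\<lambda>a b. sw P (\<lambda>u v. lm (F a u) (rm (G v b) m)) y) x) k =
    sw P (\<lambda>x y. sw P (\<lambda>a b. sw P (\<lambda>u v. lm (F a b) (rm (G v u) m)) y) x) k"
    by (rule sw_mid) (auto intro!: lin_intros fl)
  also have "\<dots> = sw P (\<lambda>x y. sw P (\<lambda>a b. sw P (\<lambda>u v. lm (F a b) (rm (G u v) m)) y) x) k"
    by (intro sw_congruence sw_comm) (auto intro!: lin_intros fl)
  also have "\<dots> = sw P (\<lambda>x y. lm (sw R (\<lambda>a b. F a b) x) (rm (sw R (\<lambda>a b. G a b) y) m)) k"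
    by (simp add: lm_sw(1)) (simp add: rm_sw(1) lm_sw(2))
  finally show ?thesis .
qed

text \<open>
  The sum that governs all relations: with \<open>S(k_2) q\<close> in the inner conjugation, each side of \<open>m\<close>
  carries a product of the form \<open>\<sigma>(a c) \<sigma>(S(d) u)\<close> with \<open>c \<otimes> d\<close> the coproduct of one factor of
  \<open>k\<close>. For \<open>u = 1\<close> this is \<open>\<sigma>(a) e(k_1)\<close> and for \<open>a = 1\<close> it is \<open>e(k_1) \<sigma>(u)\<close>.
\<close>

lemma D_D:
  assumes [simp]: "h \<in> carrier H" "p \<in> carrier H" "q \<in> carrier H" "m \<in> carrier P" "k \<in> carrier H"
  shows "sw P (\<lambda>x y. D (p \<otimes> x) (D (S y \<otimes> q) m)) k =
    sw P (\<lambda>a b. sw P (\<lambda>u v. sw P (\<lambda>x y. lm (sw R (\<lambda>c d. \<sigma> (a \<otimes> c) \<star> \<sigma> (S d \<otimes> u)) x)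
      (rm (sw R (\<lambda>c d. \<sigma> (S v \<otimes> c) \<star> \<sigma> (S d \<otimes> S b)) y) m)) k) q) p"
proof -
  have 1: "D (p \<otimes> x) (D (S y \<otimes> q) m) =
      sw P (\<lambda>a b. sw P (\<lambda>u v. sw P (\<lambda>c d. sw P (\<lambda>r s.
        lm (\<sigma> (a \<otimes> c) \<star> \<sigma> (S r \<otimes> u)) (rm (\<sigma> (S v \<otimes> s) \<star> \<sigma> (S d \<otimes> S b)) m)) y) x) q) p"
    if [simp]: "x \<in> carrier H" "y \<in> carrier H" for x y
  proof -
    have 2: "D (S y \<otimes> q) m = sw P (\<lambda>r s. sw P (\<lambda>u v. lm (\<sigma> (S r \<otimes> u)) (rm (\<sigma> (S v \<otimes> s)) m)) q) y"
    proof -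
      have "D (S y \<otimes> q) m = sw P (\<lambda>r s. sw P (\<lambda>u v. lm (\<sigma> (r \<otimes> u)) (rm (\<sigma> (S (s \<otimes> v))) m)) q) (S y)"
        unfolding D_def by (rule sw_mult) (auto intro!: lin_intros)
      also have "\<dots> = sw P (\<lambda>r s. sw P (\<lambda>u v. lm (\<sigma> (S r \<otimes> u)) (rm (\<sigma> (S (S s \<otimes> v))) m)) q) y"
        by (rule sw_antipode) (auto intro!: lin_intros)
      finally show ?thesis by (simp add: S_mult)
    qed
    have 3: "D (p \<otimes> x) n = sw P (\<lambda>a b. sw P (\<lambda>c d. lm (\<sigma> (a \<otimes> c)) (rm (\<sigma> (S d \<otimes> S b)) n)) x) p"
      if [simp]: "n \<in> carrier P" for n
    proof -
      have "D (p \<otimes> x) n = sw P (\<lambda>a b. sw P (\<lambda>c d. lm (\<sigma> (a \<otimes> c)) (rm (\<sigma> (S (b \<otimes> d))) n)) x) p"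
        unfolding D_def by (rule sw_mult) (auto intro!: lin_intros)
      then show ?thesis by (simp add: S_mult)
    qed
    have "D (p \<otimes> x) (D (S y \<otimes> q) m) = sw P (\<lambda>a b. sw P (\<lambda>c d. sw P (\<lambda>r s. sw P (\<lambda>u v.
        lm (\<sigma> (a \<otimes> c) \<star> \<sigma> (S r \<otimes> u)) (rm (\<sigma> (S v \<otimes> s) \<star> \<sigma> (S d \<otimes> S b)) m)) q) y) x) p"
      by (simp add: 3) (simp add: 2 lrm_sw lm_mult rm_mult rm_lm)
    also have "\<dots> = sw P (\<lambda>a b. sw P (\<lambda>c d. sw P (\<lambda>u v. sw P (\<lambda>r s.
        lm (\<sigma> (a \<otimes> c) \<star> \<sigma> (S r \<otimes> u)) (rm (\<sigma> (S v \<otimes> s) \<star> \<sigma> (S d \<otimes> S b)) m)) y) q) x) p"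
      by (intro sw_congruence sw_swap) auto
    also have "\<dots> = sw P (\<lambda>a b. sw P (\<lambda>u v. sw P (\<lambda>c d. sw P (\<lambda>r s.
        lm (\<sigma> (a \<otimes> c) \<star> \<sigma> (S r \<otimes> u)) (rm (\<sigma> (S v \<otimes> s) \<star> \<sigma> (S d \<otimes> S b)) m)) y) x) q) p"
      by (rule sw_congruence[OF refl], simp, rule sw_swap) auto
    finally show ?thesis .
  qed
  \<comment> \<open>The sums over \<open>p\<close> and \<open>q\<close> do not interact with the one over \<open>k\<close> and are moved outside.\<close>
  have "sw P (\<lambda>x y. D (p \<otimes> x) (D (S y \<otimes> q) m)) k =
      sw P (\<lambda>x y. sw P (\<lambda>a b. sw P (\<lambda>u v. sw P (\<lambda>c d. sw P (\<lambda>r s.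
        lm (\<sigma> (a \<otimes> c) \<star> \<sigma> (S r \<otimes> u)) (rm (\<sigma> (S v \<otimes> s) \<star> \<sigma> (S d \<otimes> S b)) m)) y) x) q) p) k"
    by (simp add: 1)
  also have "\<dots> = sw P (\<lambda>a b. sw P (\<lambda>x y. sw P (\<lambda>u v. sw P (\<lambda>c d. sw P (\<lambda>r s.
        lm (\<sigma> (a \<otimes> c) \<star> \<sigma> (S r \<otimes> u)) (rm (\<sigma> (S v \<otimes> s) \<star> \<sigma> (S d \<otimes> S b)) m)) y) x) q) k) p"
    by (rule sw_swap) auto
  also have "\<dots> = sw P (\<lambda>a b. sw P (\<lambda>u v. sw P (\<lambda>x y. sw P (\<lambda>c d. sw P (\<lambda>r s.
        lm (\<sigma> (a \<otimes> c) \<star> \<sigma> (S r \<otimes> u)) (rm (\<sigma> (S v \<otimes> s) \<star> \<sigma> (S d \<otimes> S b)) m)) y) x) k) q) p"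
    by (rule sw_congruence[OF refl], simp, rule sw_swap) auto
  also have "\<dots> = sw P (\<lambda>a b. sw P (\<lambda>u v. sw P (\<lambda>x y. lm (sw R (\<lambda>c d. \<sigma> (a \<otimes> c) \<star> \<sigma> (S d \<otimes> u)) x)
      (rm (sw R (\<lambda>c d. \<sigma> (S v \<otimes> c) \<star> \<sigma> (S d \<otimes> S b)) y) m)) k) q) p"
    by (intro sw_congruence[OF refl] split_sides) (auto intro!: lin_intros)
  finally show ?thesis .
qed

lemma D_one: "m \<in> carrier P \<Longrightarrow> D \<one> m = m"
proof -
  assume [simp]: "m \<in> carrier P"
  have "D \<one> m = lm (\<sigma> \<one>) (rm (\<sigma> (S \<one>)) m)"
    unfolding D_def by (rule sw_one) (auto intro!: lin_intros)
  then show ?thesis by (simp add: \<sigma>_one lm_one rm_one)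
qed

lemma D_D_left:
  assumes [simp]: "m \<in> carrier P" "k \<in> carrier H" "p \<in> carrier H"
  shows "sw P (\<lambda>x y. D (p \<otimes> x) (D (S y) m)) k =
    sw P (\<lambda>a b. sw P (\<lambda>x y. lm (\<sigma> a \<star> e x) (rm (e y \<star> \<sigma> (S b)) m)) k) p"
proof -
  have "sw P (\<lambda>x y. D (p \<otimes> x) (D (S y) m)) k = sw P (\<lambda>x y. D (p \<otimes> x) (D (S y \<otimes> \<one>) m)) k" by simp
  also have "\<dots> = sw P (\<lambda>a b. sw P (\<lambda>u v. sw P (\<lambda>x y. lm (sw R (\<lambda>c d. \<sigma> (a \<otimes> c) \<star> \<sigma> (S d \<otimes> u)) x)
      (rm (sw R (\<lambda>c d. \<sigma> (S v \<otimes> c) \<star> \<sigma> (S d \<otimes> S b)) y) m)) k) \<one>) p"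
    by (rule D_D) auto
  also have "\<dots> = sw P (\<lambda>a b. sw P (\<lambda>x y. lm (sw R (\<lambda>c d. \<sigma> (a \<otimes> c) \<star> \<sigma> (S d \<otimes> \<one>)) x)
      (rm (sw R (\<lambda>c d. \<sigma> (S \<one> \<otimes> c) \<star> \<sigma> (S d \<otimes> S b)) y) m)) k) p"
    by (intro sw_congruence[OF refl] sw_one) (auto intro!: lin_intros)
  also have "\<dots> = sw P (\<lambda>a b. sw P (\<lambda>x y. lm (\<sigma> a \<star> e x) (rm (e y \<star> \<sigma> (S b)) m)) k) p"
    by (simp add: \<sigma>_e e_\<sigma>)
  finally show ?thesis .
qed

lemma D_D_right:
  assumes [simp]: "m \<in> carrier P" "k \<in> carrier H" "q \<in> carrier H"
  shows "sw P (\<lambda>x y. D x (D (S y \<otimes> q) m)) k =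
    sw P (\<lambda>u v. sw P (\<lambda>x y. lm (e x \<star> \<sigma> u) (rm (\<sigma> (S v) \<star> e y) m)) k) q"
proof -
  have "sw P (\<lambda>x y. D x (D (S y \<otimes> q) m)) k = sw P (\<lambda>x y. D (\<one> \<otimes> x) (D (S y \<otimes> q) m)) k" by simp
  also have "\<dots> = sw P (\<lambda>a b. sw P (\<lambda>u v. sw P (\<lambda>x y. lm (sw R (\<lambda>c d. \<sigma> (a \<otimes> c) \<star> \<sigma> (S d \<otimes> u)) x)
      (rm (sw R (\<lambda>c d. \<sigma> (S v \<otimes> c) \<star> \<sigma> (S d \<otimes> S b)) y) m)) k) q) \<one>"
    by (rule D_D) auto
  also have "\<dots> = sw P (\<lambda>u v. sw P (\<lambda>x y. lm (sw R (\<lambda>c d. \<sigma> (\<one> \<otimes> c) \<star> \<sigma> (S d \<otimes> u)) x)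
      (rm (sw R (\<lambda>c d. \<sigma> (S v \<otimes> c) \<star> \<sigma> (S d \<otimes> S \<one>)) y) m)) k) q"
    by (rule sw_one) (auto intro!: lin_intros)
  also have "\<dots> = sw P (\<lambda>u v. sw P (\<lambda>x y. lm (e x \<star> \<sigma> u) (rm (\<sigma> (S v) \<star> e y) m)) k) q"
    by (simp add: \<sigma>_e e_\<sigma>)
  finally show ?thesis .
qed

lemma D_D_antipode:
  assumes [simp]: "m \<in> carrier P" "k \<in> carrier H"
  shows "sw P (\<lambda>x y. D x (D (S y) m)) k = sw P (\<lambda>x y. lm (e x) (rm (e y) m)) k"
proof -
  have "sw P (\<lambda>x y. D x (D (S y) m)) k = sw P (\<lambda>x y. D (\<one> \<otimes> x) (D (S y) m)) k" by simp
  also have "\<dots> = sw P (\<lambda>a b. sw P (\<lambda>x y. lm (\<sigma> a \<star> e x) (rm (e y \<star> \<sigma> (S b)) m)) k) \<one>"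
    by (rule D_D_left) auto
  also have "\<dots> = sw P (\<lambda>x y. lm (\<sigma> \<one> \<star> e x) (rm (e y \<star> \<sigma> (S \<one>)) m)) k"
    by (rule sw_one) (auto intro!: lin_intros)
  finally show ?thesis by (simp add: \<sigma>_one)
qed

text \<open>
  By the two specialisations of the previous sum, both sides of each relation become the same
  product of \<open>\<sigma>\<close> and \<open>e\<close> on either side of \<open>m\<close>.
\<close>

lemma D_operator_representation: "operator_representation K H P D"
proof (unfold_locales)
  show "bil K H P P D" by (rule D_bil)
  show "D \<one> m = m" if "m \<in> carrier P" for m using that by (rule D_one)
next
  fix h k m assume [simp]: "h \<in> carrier H" "k \<in> carrier H" "m \<in> carrier P"
  have dl: "lin K P P (D h)" if "h \<in> carrier H" for h using bilD(2)[OF D_bil that] .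
  have "sw P (\<lambda>x y. D h (D x (D (S y) m))) k = D h (sw P (\<lambda>x y. D x (D (S y) m)) k)"
    by (rule sw_push[symmetric, OF dl]) auto
  also have "\<dots> = sw P (\<lambda>a b. lm (\<sigma> a) (rm (\<sigma> (S b)) (sw P (\<lambda>x y. lm (e x) (rm (e y) m)) k))) h"
    by (simp add: D_D_antipode) (simp add: D_def)
  also have "\<dots> = sw P (\<lambda>x y. D (h \<otimes> x) (D (S y) m)) k"
    by (simp add: D_D_left lrm_sw lm_mult rm_mult rm_lm)
  finally show "sw P (\<lambda>x y. D h (D x (D (S y) m))) k = sw P (\<lambda>x y. D (h \<otimes> x) (D (S y) m)) k" .
  have "sw P (\<lambda>x y. D x (D (S y) (D k m))) h = sw P (\<lambda>x y. lm (e x) (rm (e y) (D k m))) h"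
    by (rule D_D_antipode) auto
  also have "\<dots> = sw P (\<lambda>x y. sw P (\<lambda>u v. lm (e x \<star> \<sigma> u) (rm (\<sigma> (S v) \<star> e y) m)) k) h"
    by (simp add: D_def lrm_sw lm_mult rm_mult rm_lm)
  also have "\<dots> = sw P (\<lambda>u v. sw P (\<lambda>x y. lm (e x \<star> \<sigma> u) (rm (\<sigma> (S v) \<star> e y) m)) h) k"
    by (rule sw_swap) auto
  also have "\<dots> = sw P (\<lambda>x y. D x (D (S y \<otimes> k) m)) h" by (simp add: D_D_right)
  finally show "sw P (\<lambda>x y. D x (D (S y) (D k m))) h = sw P (\<lambda>x y. D x (D (S y \<otimes> k) m)) h" .
qed

end

section \<open>The tensor algebra\<close>

locale word_algebra = V: module K V
  for K :: "'k ring" and V :: "('k, 'v, 'z) module_scheme"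
begin

abbreviation "W \<equiv> lists (carrier V)"
abbreviation "TA \<equiv> tensor_algebra K V"
abbreviation "wd \<equiv> word_tensor K V"

sublocale pr: presented K W "word_relators K V"
proof (rule presented.intro)
  show "cring K" by (rule V.R.is_cring)
  interpret F: module K "free_module K W" by (rule free_module_is_module[OF V.R.is_cring])
  have b: "basis_elt K u \<in> carrier (free_module K W)" if "u \<in> W" for u
    by (rule basis_elt_closed[OF V.R.is_cring that])
  show "word_relators K V \<subseteq> carrier (free_module K W)"
    unfolding word_relators_def Let_def by (auto intro!: F.minus_closed F.smult_closed b)
qed

lemma TA_simps [simp]: "carrier TA = carrier pr.Quo" "add TA = add pr.Quo" "zero TA = zero pr.Quo"
   "smult TA = smult pr.Quo"
  by (simp_all add: tensor_algebra_def Let_def word_kernel_def)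

lemma TA_one: "\<one>\<^bsub>TA\<^esub> = wd []"
  by (simp add: tensor_algebra_def Let_def)

lemma lin_TA: "lin K TA P = lin K pr.Quo P" "lin K U TA = lin K U pr.Quo"
  by (simp_all add: lin_def fun_eq_iff)

lemma TA_module: "module K TA"
  by (rule module_cong[OF pr.Quo]) simp_all

lemma wd_eq: "wd u = pr.cl u" by (simp add: word_tensor_def word_kernel_def)

lemma wd_closed: "u \<in> W \<Longrightarrow> wd u \<in> carrier TA"
  unfolding wd_eq by (simp add: pr.cl_closed del: in_lists_conv_set)

text \<open>
  Functions on words of all lengths that are linear in each letter; they correspond to linear
  maps on the tensor algebra.
\<close>

definition multilinear :: "('k, 'p, 'y) module_scheme \<Rightarrow> ('v list \<Rightarrow> 'p) \<Rightarrow> bool" where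
  "multilinear P g \<longleftrightarrow> (\<forall>u\<in>W. g u \<in> carrier P) \<and>
     (\<forall>u\<in>W. \<forall>v\<in>W. lin K V P (\<lambda>x. g (u @ [x] @ v)))"

lemma multilinear_relators:
  assumes P: "module K P" and g: "multilinear P g" and r: "r \<in> word_relators K V"
  shows "free_lift K P g r = \<zero>\<^bsub>P\<^esub>"
proof -
  interpret P: module K P by fact
  interpret F: module K pr.FM by (rule pr.FM)
  have gc: "g u \<in> carrier P" if "u \<in> W" for u using g that by (simp add: multilinear_def)
  have gl: "lin K V P (\<lambda>x. g (u @ [x] @ v))" if "u \<in> W" "v \<in> W" for u v
    using g that by (simp add: multilinear_def)
  have l: "lin K pr.FM P (free_lift K P g)" by (rule free_lift_lin[OF P gc])
  have b: "basis_elt K u \<in> carrier pr.FM" if "u \<in> W" for u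
    by (rule basis_elt_closed[OF V.R.is_cring that])
  have lb: "free_lift K P g (basis_elt K u) = g u" if "u \<in> W" for u
    by (rule free_lift_basis[where g = g, OF P gc[OF that]])
  note lm = lin_minus[OF pr.FM P l]
  have app: "u @ [x] @ v \<in> W" if "u \<in> W" "v \<in> W" "x \<in> carrier V" for u v x using that by auto
  consider (a) u v x y where "r = basis_elt K (u @ [x \<oplus>\<^bsub>V\<^esub> y] @ v) \<ominus>\<^bsub>pr.FM\<^esub> basis_elt K (u @ [x] @ v)
        \<ominus>\<^bsub>pr.FM\<^esub> basis_elt K (u @ [y] @ v)" "u \<in> W" "v \<in> W" "x \<in> carrier V" "y \<in> carrier V"
    | (s) u v c x where "r = basis_elt K (u @ [c \<odot>\<^bsub>V\<^esub> x] @ v) \<ominus>\<^bsub>pr.FM\<^esub> c \<odot>\<^bsub>pr.FM\<^esub> basis_elt K (u @ [x] @ v)"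
       "u \<in> W" "v \<in> W" "c \<in> carrier K" "x \<in> carrier V"
    using r unfolding word_relators_def Let_def by blast
  then show ?thesis
  proof cases
    case a
    note m = app[OF a(2,3)]
    have "free_lift K P g r = g (u @ [x \<oplus>\<^bsub>V\<^esub> y] @ v) \<ominus>\<^bsub>P\<^esub> g (u @ [x] @ v) \<ominus>\<^bsub>P\<^esub> g (u @ [y] @ v)"
      unfolding a(1)
      by (simp only: lm b lb m a V.M.a_closed F.minus_closed)
    then show ?thesis
      using lin_add[OF gl[OF a(2,3)] a(4,5)] gc[OF m] a(4,5) by (simp add: P.minus_minus_eq_zero_iff)
  next
    case s
    note m = app[OF s(2,3)]
    have "free_lift K P g r = g (u @ [c \<odot>\<^bsub>V\<^esub> x] @ v) \<ominus>\<^bsub>P\<^esub> c \<odot>\<^bsub>P\<^esub> g (u @ [x] @ v)"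
      unfolding s(1)
      by (simp only: lm b lb m s V.smult_closed F.smult_closed lin_smult[OF l])
    then show ?thesis
      using lin_smult[OF gl[OF s(2,3)] s(4,5)] gc[OF m] s(4,5) by (simp add: P.minus_eq_zero_iff)
  qed
qed

lemma TA_lift:
  assumes P: "module K P" and g: "multilinear P g"
  shows "lin K TA P (induced_map K P g)" and "u \<in> W \<Longrightarrow> induced_map K P g (wd u) = g u"
proof -
  have gc: "g u \<in> carrier P" if "u \<in> W" for u using g that by (simp add: multilinear_def)
  note r = multilinear_relators[OF P g]
  show "lin K TA P (induced_map K P g)"
    unfolding lin_TA by (rule pr.induced_lin_cl(1)[OF P gc r])
  show "u \<in> W \<Longrightarrow> induced_map K P g (wd u) = g u"
    unfolding wd_eq by (rule pr.induced_lin_cl(2)[OF P gc r])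
qed

text \<open>
  Each instance of linearity in one letter is one of the relators, read modulo the submodule
  that they generate.
\<close>

lemma wd_multilinear: "multilinear TA wd"
proof -
  interpret F: module K pr.FM by (rule pr.FM)
  interpret Q: module K pr.Quo by (rule pr.Quo)
  have b: "basis_elt K u \<in> carrier pr.FM" if "u \<in> W" for u
    by (rule basis_elt_closed[OF V.R.is_cring that])
  note zero = pr.relator_zero
  note lm = lin_minus[OF pr.FM pr.Quo pr.proj]
  have app: "u @ [x] @ v \<in> W" if "u \<in> W" "v \<in> W" "x \<in> carrier V" for u v x using that by auto
  have "lin K V pr.Quo (\<lambda>x. wd (u @ [x] @ v))" if u: "u \<in> W" and v: "v \<in> W" for u v
  proof (rule linI)
    fix x assume x: "x \<in> carrier V"
    show "wd (u @ [x] @ v) \<in> carrier pr.Quo" using wd_closed[OF app[OF u v x]] by simp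
    fix y assume y: "y \<in> carrier V"
    have "basis_elt K (u @ [x \<oplus>\<^bsub>V\<^esub> y] @ v) \<ominus>\<^bsub>pr.FM\<^esub> basis_elt K (u @ [x] @ v)
        \<ominus>\<^bsub>pr.FM\<^esub> basis_elt K (u @ [y] @ v) \<in> word_relators K V"
      unfolding word_relators_def Let_def using u v x y by blast
    from zero[OF this] have "wd (u @ [x \<oplus>\<^bsub>V\<^esub> y] @ v) \<ominus>\<^bsub>pr.Quo\<^esub> wd (u @ [x] @ v) \<ominus>\<^bsub>pr.Quo\<^esub> wd (u @ [y] @ v) = \<zero>\<^bsub>pr.Quo\<^esub>"
      unfolding wd_eq by (simp only: lm b app[OF u v] x y V.M.a_closed F.minus_closed)
    then show "wd (u @ [x \<oplus>\<^bsub>V\<^esub> y] @ v) = wd (u @ [x] @ v) \<oplus>\<^bsub>pr.Quo\<^esub> wd (u @ [y] @ v)"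
      using wd_closed app[OF u v] x y by (simp add: Q.minus_minus_eq_zero_iff)
  next
    fix c x assume c: "c \<in> carrier K" and x: "x \<in> carrier V"
    have "basis_elt K (u @ [c \<odot>\<^bsub>V\<^esub> x] @ v) \<ominus>\<^bsub>pr.FM\<^esub> c \<odot>\<^bsub>pr.FM\<^esub> basis_elt K (u @ [x] @ v) \<in> word_relators K V"
      unfolding word_relators_def Let_def using u v x c by blast
    from zero[OF this] have "wd (u @ [c \<odot>\<^bsub>V\<^esub> x] @ v) \<ominus>\<^bsub>pr.Quo\<^esub> c \<odot>\<^bsub>pr.Quo\<^esub> wd (u @ [x] @ v) = \<zero>\<^bsub>pr.Quo\<^esub>"
      unfolding wd_eq by (simp only: lm b app[OF u v] x c V.smult_closed F.smult_closed lin_smult[OF pr.proj])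
    then show "wd (u @ [c \<odot>\<^bsub>V\<^esub> x] @ v) = c \<odot>\<^bsub>pr.Quo\<^esub> wd (u @ [x] @ v)"
      using wd_closed app[OF u v] x c by (simp add: Q.minus_eq_zero_iff)
  qed
  then show ?thesis unfolding multilinear_def using wd_closed by (simp add: lin_TA)
qed

lemma wd_lin: "u \<in> W \<Longrightarrow> v \<in> W \<Longrightarrow> lin K V TA (\<lambda>x. wd (u @ [x] @ v))"
  using wd_multilinear by (simp add: multilinear_def)

lemma TA_ext:
  assumes "lin K TA P f" "lin K TA P g" "module K P" "\<And>u. u \<in> W \<Longrightarrow> f (wd u) = g (wd u)" "t \<in> carrier TA"
  shows "f t = g t"
  using pr.ext[of P f g t] assms unfolding lin_TA wd_eq by simp

abbreviation "tmul \<equiv> mult TA"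

lemma tmul_eq: "tmul s t = induced_map K TA (\<lambda>u. induced_map K TA (\<lambda>v. wd (u @ v)) t) s"
proof -
  let ?Q = "quot_module (free_module K W) (word_kernel K V)"
  \<comment> \<open>The product of the tensor algebra is defined by sums in the underlying quotient module,
    whose additive and scalar structure is that of the tensor algebra.\<close>
  have "add_monoid TA = add_monoid ?Q" by (simp add: word_kernel_def)
  then have "finsum TA = (finsum ?Q :: ('v list \<Rightarrow> _) \<Rightarrow> _)" unfolding finsum_def by (simp only:)
  moreover have "smult TA = smult ?Q" by (simp add: word_kernel_def)
  ultimately have "induced_map K TA = (induced_map K ?Q :: ('v list \<Rightarrow> _) \<Rightarrow> _)"
    by (intro ext) (simp only: induced_map_def)
  then show ?thesis by (simp add: tensor_algebra_def Let_def)
qed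

lemma W_app: "u \<in> W \<Longrightarrow> v \<in> W \<Longrightarrow> u @ v \<in> W"
  by simp

lemma wd_append_multilinear:
  "u \<in> W \<Longrightarrow> multilinear TA (\<lambda>v. wd (u @ v))" "v \<in> W \<Longrightarrow> multilinear TA (\<lambda>u. wd (u @ v))"
proof -
  assume u: "u \<in> W"
  show "multilinear TA (\<lambda>v. wd (u @ v))" unfolding multilinear_def
  proof (intro conjI ballI)
    fix a b assume a: "a \<in> W" and b: "b \<in> W"
    show "wd (u @ a) \<in> carrier TA" by (rule wd_closed[OF W_app[OF u a]])
    show "lin K V TA (\<lambda>x. wd (u @ (a @ [x] @ b)))"
      using wd_lin[OF W_app[OF u a] b] by (simp only: append_assoc)
  qed
next
  assume v: "v \<in> W"
  show "multilinear TA (\<lambda>u. wd (u @ v))" unfolding multilinear_def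
  proof (intro conjI ballI)
    fix a b assume a: "a \<in> W" and b: "b \<in> W"
    show "wd (a @ v) \<in> carrier TA" by (rule wd_closed[OF W_app[OF a v]])
    show "lin K V TA (\<lambda>x. wd ((a @ [x] @ b) @ v))"
      using wd_lin[OF a W_app[OF b v]] by (simp only: append_assoc)
  qed
qed

lemma tmul_inner: "t \<in> carrier TA \<Longrightarrow> multilinear TA (\<lambda>u. induced_map K TA (\<lambda>v. wd (u @ v)) t)"
  unfolding multilinear_def
proof (intro conjI ballI)
  assume t: "t \<in> carrier TA"
  show "induced_map K TA (\<lambda>v. wd (u @ v)) t \<in> carrier TA" if "u \<in> W" for u
    by (rule lin_closed[OF TA_lift(1)[OF TA_module wd_append_multilinear(1)[OF that]] t])
  show "lin K V TA (\<lambda>x. induced_map K TA (\<lambda>w. wd ((u @ [x] @ v) @ w)) t)" if "u \<in> W" "v \<in> W" for u v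
  proof (rule pr.induced_body_lin[OF V.module_axioms TA_module])
    show "lin K V TA (\<lambda>x. wd ((u @ [x] @ v) @ w))" if "w \<in> W" for w
      using wd_append_multilinear(2)[OF that] \<open>u \<in> W\<close> \<open>v \<in> W\<close> by (simp add: multilinear_def)
    show "t \<in> carrier pr.Quo" using t by simp
  qed
qed

lemma tmul_bil: "bil K TA TA TA tmul"
proof (rule bilI)
  fix t assume t: "t \<in> carrier TA"
  show "lin K TA TA (\<lambda>s. tmul s t)" unfolding tmul_eq
    by (rule TA_lift(1)[OF TA_module tmul_inner[OF t]])
next
  fix s assume s: "s \<in> carrier TA"
  show "lin K TA TA (tmul s)" unfolding tmul_eq
    by (rule pr.induced_body_lin[OF TA_module TA_module])
      (rule TA_lift(1)[OF TA_module wd_append_multilinear(1)], assumption, use s in simp)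
qed

lemma tmul_wd: "u \<in> W \<Longrightarrow> v \<in> W \<Longrightarrow> tmul (wd u) (wd v) = wd (u @ v)"
  by (simp only: tmul_eq TA_lift(2)[OF TA_module tmul_inner] wd_closed
      TA_lift(2)[OF TA_module wd_append_multilinear(1)])

lemma TA_algebra: "assoc_algebra K TA"
proof (rule assoc_algebraI)
  note mc = bil_closed[OF tmul_bil]
  note ml = lin_compose[OF bilD(1)[OF tmul_bil]] lin_compose[OF bilD(2)[OF tmul_bil]] lin_id
  show "module K TA" by (rule TA_module)
  show "bil K TA TA TA tmul" by (rule tmul_bil)
  have nil: "[] \<in> W" by simp
  show one: "\<one>\<^bsub>TA\<^esub> \<in> carrier TA" unfolding TA_one by (rule wd_closed[OF nil])
  show "tmul \<one>\<^bsub>TA\<^esub> x = x" if "x \<in> carrier TA" for x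
    by (rule TA_ext[OF bilD(2)[OF tmul_bil one] lin_id TA_module _ that])
      (simp only: TA_one tmul_wd nil append_Nil)
  show "tmul x \<one>\<^bsub>TA\<^esub> = x" if "x \<in> carrier TA" for x
    by (rule TA_ext[OF bilD(1)[OF tmul_bil one] lin_id TA_module _ that])
      (simp only: TA_one tmul_wd nil append_Nil2)
  fix x y z assume x: "x \<in> carrier TA" and y: "y \<in> carrier TA" and z: "z \<in> carrier TA"
  have 2: "tmul (tmul (wd u) (wd v)) z = tmul (wd u) (tmul (wd v) z)" if "u \<in> W" "v \<in> W" for u v
    by (rule TA_ext[of TA "\<lambda>z. tmul (tmul (wd u) (wd v)) z" "\<lambda>z. tmul (wd u) (tmul (wd v) z)", OF _ _ TA_module _ z])
      (intro ml mc wd_closed that, intro ml mc wd_closed that, simp only: tmul_wd W_app that append_assoc)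
  have 3: "tmul (tmul (wd u) y) z = tmul (wd u) (tmul y z)" if "u \<in> W" for u
    by (rule TA_ext[of TA "\<lambda>y. tmul (tmul (wd u) y) z" "\<lambda>y. tmul (wd u) (tmul y z)", OF _ _ TA_module _ y])
      (intro ml mc wd_closed that z, intro ml mc wd_closed that z, rule 2[OF that])
  show "tmul (tmul x y) z = tmul x (tmul y z)"
    by (rule TA_ext[of TA "\<lambda>x. tmul (tmul x y) z" "\<lambda>x. tmul x (tmul y z)", OF _ _ TA_module _ x])
      (intro ml mc wd_closed y z, intro ml mc wd_closed y z, rule 3)
qed

end

section \<open>Quotient algebras\<close>

locale quotient_algebra = T: assoc_algebra K T + ideal I T
  for K :: "'k ring" and T :: "('k, 't) module" and I :: "'t set"
begin

definition Qalg :: "('k, 't set) module" where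
  "Qalg = (let Q = T Quot I in
     \<lparr>carrier = carrier Q, mult = mult Q, one = one Q, zero = zero Q, add = add Q,
      smult = smult (quot_module T I)\<rparr>)"

text \<open>
  Scalars act as multiplication by multiples of \<open>1\<close>, so an ideal is closed under them.
\<close>

lemma I_submodule: "submodule I K T"
proof (rule T.submoduleI)
  fix c x assume c: "c \<in> carrier K" and x: "x \<in> I"
  have "c \<odot>\<^bsub>T\<^esub> x = (c \<odot>\<^bsub>T\<^esub> \<one>\<^bsub>T\<^esub>) \<otimes>\<^bsub>T\<^esub> x"
    using c x a_subset by (auto simp: T.smult_mult_left)
  then show "c \<odot>\<^bsub>T\<^esub> x \<in> I" using I_l_closed[OF x, of "c \<odot>\<^bsub>T\<^esub> \<one>\<^bsub>T\<^esub>"] c by simp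
qed (use a_subset in auto)

abbreviation "pj x \<equiv> I +>\<^bsub>T\<^esub> x"

lemma Q_eqs: "carrier Qalg = carrier (quot_module T I)" "add Qalg = add (quot_module T I)"
  "zero Qalg = zero (quot_module T I)" "smult Qalg = smult (quot_module T I)"
  by (simp_all add: Qalg_def Let_def quot_module_def FactRing_def)

lemma Q_module: "module K Qalg"
  by (rule module_cong[OF quot_module_is_module[OF T.module_axioms I_submodule]]) (simp_all add: Q_eqs)

lemma Q_carrier: "carrier Qalg = pj ` carrier T"
  by (simp add: Q_eqs quot_module_carrier)

lemma pj_lin: "lin K T Qalg pj"
  using quot_proj_lin[OF T.module_axioms I_submodule] by (simp add: lin_def Q_eqs)

lemma pj_mult: "x \<in> carrier T \<Longrightarrow> y \<in> carrier T \<Longrightarrow> pj x \<otimes>\<^bsub>Qalg\<^esub> pj y = pj (x \<otimes>\<^bsub>T\<^esub> y)"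
  by (simp add: Qalg_def Let_def FactRing_def rcoset_mult_add)

lemma pj_one: "\<one>\<^bsub>Qalg\<^esub> = pj \<one>\<^bsub>T\<^esub>"
  by (simp add: Qalg_def Let_def FactRing_def)

lemma pj_eq: "x \<in> carrier T \<Longrightarrow> y \<in> carrier T \<Longrightarrow> x \<ominus>\<^bsub>T\<^esub> y \<in> I \<Longrightarrow> pj x = pj y"
  using quot_eq_iff[OF T.module_axioms I_submodule] by blast

lemma Q_algebra: "assoc_algebra K Qalg"
proof (rule assoc_algebraI)
  note c = lin_closed[OF pj_lin]
  show "module K Qalg" by (rule Q_module)
  show "bil K Qalg Qalg Qalg (mult Qalg)"
    by (intro bilI linI) (auto simp: Q_carrier pj_mult T.A.l_distr T.A.r_distr
        T.smult_mult_left T.smult_mult_right lin_add[OF pj_lin, symmetric] lin_smult[OF pj_lin, symmetric])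
  show "\<one>\<^bsub>Qalg\<^esub> \<in> carrier Qalg" by (simp add: pj_one c)
qed (auto simp: Q_carrier pj_mult pj_one T.A.m_assoc)

end

section \<open>The algebra of partial representations\<close>

lemma assoc_algebra_ring: "assoc_algebra K A \<Longrightarrow> ring A"
  by (simp add: assoc_algebra_def)

lemma base_module_simps [simp]:
  "carrier (base_module R M) = carrier M" "x \<oplus>\<^bsub>base_module R M\<^esub> y = x \<oplus>\<^bsub>M\<^esub> y"
  "\<zero>\<^bsub>base_module R M\<^esub> = \<zero>\<^bsub>M\<^esub>" "c \<odot>\<^bsub>base_module R M\<^esub> x = (c \<odot>\<^bsub>R\<^esub> \<one>\<^bsub>R\<^esub>) \<odot>\<^bsub>M\<^esub> x"
  by (simp_all add: base_module_def restrict_scalars_def)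

text \<open>
  Multiples of \<open>1\<close> multiply like the scalars themselves.
\<close>

lemma base_module_is_module:
  assumes R: "assoc_algebra K R" and M: "left_module R M"
  shows "module K (base_module R M)"
proof -
  interpret R: assoc_algebra K R by fact
  interpret M: left_module R M by fact
  show ?thesis
  proof (rule moduleI)
    show "cring K" by (rule R.R.is_cring)
    show "abelian_group (base_module R M)"
    proof (rule abelian_groupI)
      fix x assume "x \<in> carrier (base_module R M)"
      then show "\<exists>y\<in>carrier (base_module R M). y \<oplus>\<^bsub>base_module R M\<^esub> x = \<zero>\<^bsub>base_module R M\<^esub>"
        by (intro bexI[of _ "\<ominus>\<^bsub>M\<^esub> x"]) (auto simp: M.M.l_neg)
    qed (auto simp: M.M.a_ac)
    fix a b x assume "a \<in> carrier K" "b \<in> carrier K" "x \<in> carrier (base_module R M)"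
    moreover from this have "(a \<odot>\<^bsub>R\<^esub> \<one>\<^bsub>R\<^esub>) \<otimes>\<^bsub>R\<^esub> (b \<odot>\<^bsub>R\<^esub> \<one>\<^bsub>R\<^esub>) = (a \<otimes>\<^bsub>K\<^esub> b) \<odot>\<^bsub>R\<^esub> \<one>\<^bsub>R\<^esub>"
      by (simp add: R.smult_mult_left R.smult_assoc1)
    ultimately show "(a \<otimes>\<^bsub>K\<^esub> b) \<odot>\<^bsub>base_module R M\<^esub> x = a \<odot>\<^bsub>base_module R M\<^esub> (b \<odot>\<^bsub>base_module R M\<^esub> x)"
      by (simp add: M.smult_assoc[symmetric])
  qed (auto simp: M.smult_closed M.smult_l_distr M.smult_r_distr M.smult_one R.smult_l_distr)
qed

lemma base_module_bilinear:
  assumes R: "assoc_algebra K R" and M: "left_module R M"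
  shows "bil K R (base_module R M) (base_module R M) (smult M)"
proof -
  interpret R: assoc_algebra K R by fact
  interpret M: left_module R M by fact
  have 1: "(c \<odot>\<^bsub>R\<^esub> \<one>\<^bsub>R\<^esub>) \<otimes>\<^bsub>R\<^esub> r = c \<odot>\<^bsub>R\<^esub> r" "r \<otimes>\<^bsub>R\<^esub> (c \<odot>\<^bsub>R\<^esub> \<one>\<^bsub>R\<^esub>) = c \<odot>\<^bsub>R\<^esub> r"
    if "c \<in> carrier K" "r \<in> carrier R" for c r
    using that by (simp_all add: R.smult_mult_left R.smult_mult_right)
  show ?thesis
    by (intro bilI linI)
      (auto simp: M.smult_closed M.smult_l_distr M.smult_r_distr M.smult_assoc[symmetric] 1)
qed

context cocommutative_hopf_algebra
begin

sublocale TW: word_algebra K H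
  by (simp add: word_algebra_def)

abbreviation "TH \<equiv> tensor_algebra K H"
abbreviation "HP \<equiv> hpar K H"
abbreviation "wd \<equiv> word_tensor K H"

declare TW.TA_simps [simp del]

lemma wd_closed [simp]: "set u \<subseteq> carrier H \<Longrightarrow> wd u \<in> carrier TH"
  by (rule TW.wd_closed) auto

lemma TH_alg [simp, intro!]: "assoc_algebra K TH" by (rule TW.TA_algebra)
lemma TH_mod [simp, intro!]: "module K TH" by (rule TW.TA_module)

lemma wd_lins [lin_intros]:
  "lin K V H f \<Longrightarrow> lin K V TH (\<lambda>v. wd [f v])"
  "lin K V H f \<Longrightarrow> a \<in> carrier H \<Longrightarrow> lin K V TH (\<lambda>v. wd [f v, a])"
  "lin K V H f \<Longrightarrow> a \<in> carrier H \<Longrightarrow> lin K V TH (\<lambda>v. wd [a, f v])"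
  "lin K V H f \<Longrightarrow> a \<in> carrier H \<Longrightarrow> b \<in> carrier H \<Longrightarrow> lin K V TH (\<lambda>v. wd [f v, a, b])"
  "lin K V H f \<Longrightarrow> a \<in> carrier H \<Longrightarrow> b \<in> carrier H \<Longrightarrow> lin K V TH (\<lambda>v. wd [a, f v, b])"
  "lin K V H f \<Longrightarrow> a \<in> carrier H \<Longrightarrow> b \<in> carrier H \<Longrightarrow> lin K V TH (\<lambda>v. wd [a, b, f v])"
  using lin_compose[OF TW.wd_lin[of "[]" "[]"], of V f] lin_compose[OF TW.wd_lin[of "[]" "[a]"], of V f]
    lin_compose[OF TW.wd_lin[of "[a]" "[]"], of V f] lin_compose[OF TW.wd_lin[of "[]" "[a, b]"], of V f]
    lin_compose[OF TW.wd_lin[of "[a]" "[b]"], of V f] lin_compose[OF TW.wd_lin[of "[a, b]" "[]"], of V f]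
  by simp_all

lemma relators_closed: "hpar_relators K H \<subseteq> carrier TH"
proof -
  interpret TH: assoc_algebra K TH by (rule TH_alg)
  show ?thesis unfolding hpar_relators_def Let_def by (auto intro!: TH.M.minus_closed sw_closed)
qed

lemma ideal_hpar: "ideal (hpar_ideal K H) TH"
proof -
  interpret TH: assoc_algebra K TH by (rule TH_alg)
  show ?thesis unfolding hpar_ideal_def by (rule ring.genideal_ideal[OF assoc_algebra_ring[OF TH_alg] relators_closed])
qed

lemma relators_in_ideal: "r \<in> hpar_relators K H \<Longrightarrow> r \<in> hpar_ideal K H"
  unfolding hpar_ideal_def genideal_def by auto

sublocale HQ: quotient_algebra K TH "hpar_ideal K H"
  by (intro quotient_algebra.intro TH_alg ideal_hpar)

lemma hpar_eq: "HP = HQ.Qalg"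
  by (simp add: hpar_def HQ.Qalg_def Let_def)

lemma HP_alg [simp, intro!]: "assoc_algebra K HP"
  unfolding hpar_eq by (rule HQ.Q_algebra)

lemma HP_mod [simp, intro!]: "module K HP"
  unfolding hpar_eq by (rule HQ.Q_module)

lemma pj_lin: "lin K TH HP HQ.pj" unfolding hpar_eq by (rule HQ.pj_lin)
lemma HP_carrier: "carrier HP = HQ.pj ` carrier TH" unfolding hpar_eq by (rule HQ.Q_carrier)
lemma pj_closed [simp]: "t \<in> carrier TH \<Longrightarrow> HQ.pj t \<in> carrier HP" by (rule lin_closed[OF pj_lin])
lemma pj_mult: "x \<in> carrier TH \<Longrightarrow> y \<in> carrier TH \<Longrightarrow> HQ.pj x \<otimes>\<^bsub>HP\<^esub> HQ.pj y = HQ.pj (x \<otimes>\<^bsub>TH\<^esub> y)"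
  unfolding hpar_eq by (rule HQ.pj_mult)
lemma pj_one: "\<one>\<^bsub>HP\<^esub> = HQ.pj (wd [])" unfolding hpar_eq HQ.pj_one TW.TA_one ..

abbreviation "cls \<equiv> hpar_class K H"

lemma cls_eq: "cls h = HQ.pj (wd [h])" by (simp add: hpar_class_def)

lemma cls_closed [simp]: "h \<in> carrier H \<Longrightarrow> cls h \<in> carrier HP" by (simp add: cls_eq)

lemma wd_mult: "set u \<subseteq> carrier H \<Longrightarrow> set v \<subseteq> carrier H \<Longrightarrow> wd u \<otimes>\<^bsub>TH\<^esub> wd v = wd (u @ v)"
  by (rule TW.tmul_wd) auto

lemma pj_wd_Cons: "h \<in> carrier H \<Longrightarrow> set u \<subseteq> carrier H \<Longrightarrow> HQ.pj (wd (h # u)) = cls h \<otimes>\<^bsub>HP\<^esub> HQ.pj (wd u)"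
  using wd_mult[of "[h]" u] by (simp add: cls_eq pj_mult)

text \<open>
  Words in the classes \<open>[h]\<close> span \<open>H_par\<close>, and a word is built from \<open>1\<close> by multiplication with
  one class at a time on the left. An action on a module is therefore controlled by the
  operators of the single classes.
\<close>

lemma hpar_induct [consumes 1, case_names one cls zero add smult]:
  assumes z: "z \<in> carrier HP" and one: "Pr \<one>\<^bsub>HP\<^esub>"
    and cls: "\<And>h z. h \<in> carrier H \<Longrightarrow> z \<in> carrier HP \<Longrightarrow> Pr z \<Longrightarrow> Pr (cls h \<otimes>\<^bsub>HP\<^esub> z)"
    and zero: "Pr \<zero>\<^bsub>HP\<^esub>"
    and add: "\<And>y z. y \<in> carrier HP \<Longrightarrow> z \<in> carrier HP \<Longrightarrow> Pr y \<Longrightarrow> Pr z \<Longrightarrow> Pr (y \<oplus>\<^bsub>HP\<^esub> z)"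
    and smult: "\<And>c z. c \<in> carrier K \<Longrightarrow> z \<in> carrier HP \<Longrightarrow> Pr z \<Longrightarrow> Pr (c \<odot>\<^bsub>HP\<^esub> z)"
  shows "Pr z"
proof -
  obtain t where t: "t \<in> carrier TH" "z = HQ.pj t" using z HP_carrier by auto
  from t(1) have "t \<in> carrier TW.pr.Quo" by (simp add: TW.TA_simps)
  then have "Pr (HQ.pj t)"
  proof (induction rule: TW.pr.induct)
    case (cl u)
    then have "set u \<subseteq> carrier H" by auto
    then have "Pr (HQ.pj (wd u))"
    proof (induction u)
      case Nil then show ?case using one by (simp add: pj_one)
    next
      case (Cons h u) then show ?case using cls[of h "HQ.pj (wd u)"] by (simp add: pj_wd_Cons)
    qed
    then show ?case by (simp add: TW.wd_eq)
  next
    case zero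
    show ?case using assms(4) lin_zero[OF TH_mod HP_mod pj_lin] by (simp add: TW.TA_simps)
  next
    case (add s t)
    then show ?case using assms(5)[of "HQ.pj s" "HQ.pj t"] lin_add[OF pj_lin, of s t] by (simp add: TW.TA_simps)
  next
    case (smult c s)
    then show ?case using assms(6)[of c "HQ.pj s"] lin_smult[OF pj_lin, of c s] by (simp add: TW.TA_simps)
  qed
  then show ?thesis by (simp add: t(2))
qed

lemma relator_eq:
  assumes "s \<ominus>\<^bsub>TH\<^esub> t \<in> hpar_relators K H" "s \<in> carrier TH" "t \<in> carrier TH"
  shows "HQ.pj s = HQ.pj t"
  by (rule HQ.pj_eq[OF assms(2,3) relators_in_ideal[OF assms(1)]])

text \<open>
  The projection from the tensor algebra is linear and so maps the Sweedler sums in the relators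
  to Sweedler sums of products of classes.
\<close>

lemma cls_partial_representation: "partial_representation K H HP cls"
proof (intro partial_representation.intro partial_representation_axioms.intro)
  show "cocommutative_hopf_algebra K H" by (rule cocommutative_hopf_algebra_axioms)
  show "assoc_algebra K HP" by (rule HP_alg)
  show "lin K H HP cls" unfolding cls_eq by (rule lin_compose[OF pj_lin]) (auto intro!: lin_intros)
  interpret TH: assoc_algebra K TH by (rule TH_alg)
  interpret HPa: assoc_algebra K HP by (rule HP_alg)
  have "wd [\<one>] \<ominus>\<^bsub>TH\<^esub> wd [] \<in> hpar_relators K H"
    unfolding hpar_relators_def Let_def TW.TA_one[symmetric] by blast
  from relator_eq[OF this] show "cls \<one> = \<one>\<^bsub>HP\<^esub>" by (simp add: cls_eq pj_one)
  fix h k assume h [simp]: "h \<in> carrier H" and k [simp]: "k \<in> carrier H"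
  have p3: "HQ.pj (wd [a, b, c]) = cls a \<otimes>\<^bsub>HP\<^esub> (cls b \<otimes>\<^bsub>HP\<^esub> cls c)"
    and p2: "HQ.pj (wd [a, b]) = cls a \<otimes>\<^bsub>HP\<^esub> cls b"
    if "a \<in> carrier H" "b \<in> carrier H" "c \<in> carrier H" for a b c
    using that by (simp_all add: pj_wd_Cons pj_one[symmetric])
  have push: "HQ.pj (sw TH f k) = sw HP (\<lambda>x y. HQ.pj (f x y)) k"
    if "\<And>x y. x \<in> carrier H \<Longrightarrow> y \<in> carrier H \<Longrightarrow> f x y \<in> carrier TH" "k \<in> carrier H" for f k
    by (rule sw_push[OF pj_lin]) (use that in auto)
  have "sw TH (\<lambda>x y. wd [h, x, S y]) k \<ominus>\<^bsub>TH\<^esub> sw TH (\<lambda>x y. wd [h \<otimes> x, S y]) k \<in> hpar_relators K H"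
    unfolding hpar_relators_def Let_def using h k by blast
  from relator_eq[OF this] show "sw HP (\<lambda>x y. cls h \<otimes>\<^bsub>HP\<^esub> (cls x \<otimes>\<^bsub>HP\<^esub> cls (S y))) k =
      sw HP (\<lambda>x y. cls (h \<otimes> x) \<otimes>\<^bsub>HP\<^esub> cls (S y)) k"
    by (simp add: push p3 p2[OF _ _ \<open>h \<in> carrier H\<close>])
  have "sw TH (\<lambda>x y. wd [x, S y, k]) h \<ominus>\<^bsub>TH\<^esub> sw TH (\<lambda>x y. wd [x, S y \<otimes> k]) h \<in> hpar_relators K H"
    unfolding hpar_relators_def Let_def using h k by blast
  from relator_eq[OF this] show "sw HP (\<lambda>x y. cls x \<otimes>\<^bsub>HP\<^esub> (cls (S y) \<otimes>\<^bsub>HP\<^esub> cls k)) h =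
      sw HP (\<lambda>x y. cls x \<otimes>\<^bsub>HP\<^esub> cls (S y \<otimes> k)) h"
    by (simp add: push p3 p2[OF _ _ \<open>h \<in> carrier H\<close>])
qed

sublocale HR: partial_representation K H HP cls
  by (rule cls_partial_representation)

end

section \<open>Modules over the algebra of partial representations\<close>

context operator_representation
begin

abbreviation "act_word m u \<equiv> foldr \<rho> u m"

lemma foldr_closed [simp]: "set u \<subseteq> carrier H \<Longrightarrow> m \<in> carrier P \<Longrightarrow> foldr \<rho> u m \<in> carrier P"
  by (induction u) auto

lemma foldr_lin: "set u \<subseteq> carrier H \<Longrightarrow> lin K V P g \<Longrightarrow> lin K V P (\<lambda>v. foldr \<rho> u (g v))"
  by (induction u) (auto intro!: lin_intros)

lemma act_word_multilinear: "m \<in> carrier P \<Longrightarrow> TW.multilinear P (act_word m)"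
  unfolding TW.multilinear_def
  by (auto intro!: foldr_lin lin_intros foldr_closed)

text \<open>
  The action of the tensor algebra in which a word acts as the composite of the operators of its
  letters.
\<close>

definition \<theta> :: "('h list \<Rightarrow> 'k) set \<Rightarrow> 'p \<Rightarrow> 'p" where
  "\<theta> t m = induced_map K P (act_word m) t"

lemma \<theta>_lin1: "m \<in> carrier P \<Longrightarrow> lin K TH P (\<lambda>t. \<theta> t m)"
  unfolding \<theta>_def by (rule TW.TA_lift(1)[OF P_mod act_word_multilinear])

lemma \<theta>_wd: "set u \<subseteq> carrier H \<Longrightarrow> m \<in> carrier P \<Longrightarrow> \<theta> (wd u) m = foldr \<rho> u m"
  unfolding \<theta>_def by (rule TW.TA_lift(2)[OF P_mod act_word_multilinear]) auto

lemma \<theta>_lin2: "t \<in> carrier TH \<Longrightarrow> lin K P P (\<theta> t)"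
  unfolding \<theta>_def
  by (rule TW.pr.induced_body_lin[OF P_mod P_mod]) (auto intro!: foldr_lin lin_intros simp: TW.TA_simps)

lemma \<theta>_closed [simp]: "t \<in> carrier TH \<Longrightarrow> m \<in> carrier P \<Longrightarrow> \<theta> t m \<in> carrier P"
  by (rule lin_closed[OF \<theta>_lin1])

lemma \<theta>_mult:
  assumes s: "s \<in> carrier TH" and t: "t \<in> carrier TH" and m: "m \<in> carrier P"
  shows "\<theta> (s \<otimes>\<^bsub>TH\<^esub> t) m = \<theta> s (\<theta> t m)"
proof -
  have 1: "\<theta> (wd u \<otimes>\<^bsub>TH\<^esub> t) m = \<theta> (wd u) (\<theta> t m)" if u: "u \<in> TW.W" for u
  proof (rule TW.TA_ext[where f = "\<lambda>t. \<theta> (wd u \<otimes>\<^bsub>TH\<^esub> t) m" and g = "\<lambda>t. \<theta> (wd u) (\<theta> t m)", OF _ _ P_mod _ t])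
    have u': "wd u \<in> carrier TH" "set u \<subseteq> carrier H" using u by (auto intro!: wd_closed)
    show "lin K TH P (\<lambda>t. \<theta> (wd u \<otimes>\<^bsub>TH\<^esub> t) m)"
      by (rule lin_compose[OF \<theta>_lin1[OF m] bilD(2)[OF TW.tmul_bil u'(1)]])
    show "lin K TH P (\<lambda>t. \<theta> (wd u) (\<theta> t m))" by (rule lin_compose[OF \<theta>_lin2[OF u'(1)] \<theta>_lin1[OF m]])
    show "\<theta> (wd u \<otimes>\<^bsub>TH\<^esub> wd v) m = \<theta> (wd u) (\<theta> (wd v) m)" if "v \<in> TW.W" for v
    proof -
      have "set v \<subseteq> carrier H" using that by auto
      then show ?thesis using u'(2) m by (simp add: wd_mult \<theta>_wd)
    qed
  qed
  show ?thesis
    by (rule TW.TA_ext[where f = "\<lambda>s. \<theta> (s \<otimes>\<^bsub>TH\<^esub> t) m" and g = "\<lambda>s. \<theta> s (\<theta> t m)", OF _ _ P_mod _ s])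
      (use lin_compose[OF \<theta>_lin1[OF m] bilD(1)[OF TW.tmul_bil t]] \<theta>_lin1[OF \<theta>_closed[OF t m]] 1 in auto)
qed

lemma \<theta>_relator:
  assumes "r \<in> hpar_relators K H" and m [simp]: "m \<in> carrier P"
  shows "\<theta> r m = \<zero>\<^bsub>P\<^esub>"
proof -
  interpret TH: assoc_algebra K TH by (rule TH_alg)
  note lm = lin_minus[OF TH_mod P_mod \<theta>_lin1[OF m]]
  have push: "\<theta> (sw TH f k) m = sw P (\<lambda>x y. \<theta> (f x y) m) k"
    if "\<And>x y. x \<in> carrier H \<Longrightarrow> y \<in> carrier H \<Longrightarrow> f x y \<in> carrier TH" "k \<in> carrier H" for f k
    by (rule sw_push[OF \<theta>_lin1[OF m]]) (use that in auto)
  from assms(1) show ?thesis unfolding hpar_relators_def Let_def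
    by (elim UnE CollectE exE conjE singletonE; simp only:)
      (simp_all add: TW.TA_one lm push \<theta>_wd \<rho>_rel1 \<rho>_rel2 \<rho>_rel3 \<rho>_rel4 P.minus_eq_zero_iff \<rho>_one)
qed

text \<open>
  The tensors that act as zero form a two-sided ideal, since the action is multiplicative, and
  this ideal contains the relators.
\<close>

lemma \<theta>_ideal:
  assumes "t \<in> hpar_ideal K H" "m \<in> carrier P" shows "\<theta> t m = \<zero>\<^bsub>P\<^esub>"
proof -
  interpret TH: assoc_algebra K TH by (rule TH_alg)
  let ?J = "{t \<in> carrier TH. \<forall>m\<in>carrier P. \<theta> t m = \<zero>\<^bsub>P\<^esub>}"
  have "ideal ?J TH"
  proof (rule idealI[OF assoc_algebra_ring[OF TH_alg]])
    have "submodule ?J K TH"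
      by (rule module.submoduleI_smult[OF TH_mod])
        (auto simp: lin_zero[OF TH_mod P_mod \<theta>_lin1] lin_add[OF \<theta>_lin1] lin_smult[OF \<theta>_lin1])
    then show "subgroup ?J (add_monoid TH)" by (simp add: submodule_def)
  qed (auto simp: \<theta>_mult lin_zero[OF P_mod P_mod \<theta>_lin2])
  moreover have "hpar_relators K H \<subseteq> ?J" using relators_closed \<theta>_relator by auto
  ultimately have "hpar_ideal K H \<subseteq> ?J" unfolding hpar_ideal_def genideal_def by blast
  then show ?thesis using assms by blast
qed

end

locale hpar_operator_module = operator_representation K H P \<rho>
  for K :: "'k ring" and H :: "('k, 'h) hopf" (structure) and P :: "('k, 'p) module"
    and \<rho> :: "'h \<Rightarrow> 'p \<Rightarrow> 'p"
begin

abbreviation "N \<equiv> hpar_module K H P \<rho>"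

lemma N_simps [simp]: "carrier N = carrier P" "x \<oplus>\<^bsub>N\<^esub> y = x \<oplus>\<^bsub>P\<^esub> y" "\<zero>\<^bsub>N\<^esub> = \<zero>\<^bsub>P\<^esub>"
  by (simp_all add: hpar_module_def)

text \<open>
  The action is evaluated through a chosen representative, which differs from \<open>t\<close> by an element
  of the ideal, and such an element acts as zero.
\<close>

lemma N_smult_pj:
  assumes t: "t \<in> carrier TH" and m: "m \<in> carrier P" shows "HQ.pj t \<odot>\<^bsub>N\<^esub> m = \<theta> t m"
proof -
  interpret TH: assoc_algebra K TH by (rule TH_alg)
  have z: "HQ.pj t \<in> carrier (quot_module TH (hpar_ideal K H))" using t by (simp add: quot_module_carrier)
  let ?s = "SOME s. s \<in> HQ.pj t"
  have s: "?s \<in> carrier TH" "HQ.pj ?s = HQ.pj t" using quot_rep[OF TH_mod HQ.I_submodule z] by auto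
  have "?s \<ominus>\<^bsub>TH\<^esub> t \<in> hpar_ideal K H" using quot_eq_iff[OF TH_mod HQ.I_submodule s(1) t] s(2) by simp
  then have "\<theta> (?s \<ominus>\<^bsub>TH\<^esub> t) m = \<zero>\<^bsub>P\<^esub>" using \<theta>_ideal m by blast
  then have "\<theta> ?s m = \<theta> t m"
    using lin_minus[OF TH_mod P_mod \<theta>_lin1[OF m] s(1) t] s(1) t m by (simp add: P.minus_eq_zero_iff)
  then show ?thesis by (simp add: hpar_module_def \<theta>_def)
qed

lemma N_smult_bil: "bil K HP P P (smult N)"
proof (intro bilI linI)
  interpret TH: assoc_algebra K TH by (rule TH_alg)
  show "z \<odot>\<^bsub>N\<^esub> m \<in> carrier P" if "z \<in> carrier HP" "m \<in> carrier P" for z m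
    using that by (auto simp: HP_carrier N_smult_pj)
  then show "z \<odot>\<^bsub>N\<^esub> m \<in> carrier P" if "z \<in> carrier HP" "m \<in> carrier P" for z m using that .
  show "(z \<oplus>\<^bsub>HP\<^esub> z') \<odot>\<^bsub>N\<^esub> m = z \<odot>\<^bsub>N\<^esub> m \<oplus>\<^bsub>P\<^esub> z' \<odot>\<^bsub>N\<^esub> m"
    if "z \<in> carrier HP" "z' \<in> carrier HP" "m \<in> carrier P" for z z' m
    using that by (auto simp: HP_carrier N_smult_pj lin_add[OF \<theta>_lin1] lin_add[OF pj_lin, symmetric])
  show "(c \<odot>\<^bsub>HP\<^esub> z) \<odot>\<^bsub>N\<^esub> m = c \<odot>\<^bsub>P\<^esub> (z \<odot>\<^bsub>N\<^esub> m)"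
    if "z \<in> carrier HP" "c \<in> carrier K" "m \<in> carrier P" for z c m
    using that by (auto simp: HP_carrier N_smult_pj lin_smult[OF \<theta>_lin1] lin_smult[OF pj_lin, symmetric])
  show "z \<odot>\<^bsub>N\<^esub> (m \<oplus>\<^bsub>P\<^esub> m') = z \<odot>\<^bsub>N\<^esub> m \<oplus>\<^bsub>P\<^esub> z \<odot>\<^bsub>N\<^esub> m'"
    if "z \<in> carrier HP" "m \<in> carrier P" "m' \<in> carrier P" for z m m'
    using that by (auto simp: HP_carrier N_smult_pj lin_add[OF \<theta>_lin2])
  show "z \<odot>\<^bsub>N\<^esub> (c \<odot>\<^bsub>P\<^esub> m) = c \<odot>\<^bsub>P\<^esub> (z \<odot>\<^bsub>N\<^esub> m)"
    if "z \<in> carrier HP" "c \<in> carrier K" "m \<in> carrier P" for z c m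
    using that by (auto simp: HP_carrier N_smult_pj lin_smult[OF \<theta>_lin2])
qed

lemma N_smult_cls: "h \<in> carrier H \<Longrightarrow> m \<in> carrier P \<Longrightarrow> cls h \<odot>\<^bsub>N\<^esub> m = \<rho> h m"
  by (simp add: cls_eq N_smult_pj \<theta>_wd)

lemma N_left_module: "left_module HP N"
proof -
  interpret HPa: assoc_algebra K HP by (rule HP_alg)
  note c = bil_closed[OF N_smult_bil]
  show ?thesis
  proof (intro left_module.intro left_module_axioms.intro)
    show "ring HP" by (rule assoc_algebra_ring[OF HP_alg])
    show "abelian_group N"
    proof (rule abelian_groupI)
      fix x assume "x \<in> carrier N"
      then show "\<exists>y\<in>carrier N. y \<oplus>\<^bsub>N\<^esub> x = \<zero>\<^bsub>N\<^esub>"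
        by (intro bexI[of _ "\<ominus>\<^bsub>P\<^esub> x"]) (auto simp: P.l_neg)
    qed (auto simp: P.a_ac)
    show "\<one>\<^bsub>HP\<^esub> \<odot>\<^bsub>N\<^esub> x = x" if "x \<in> carrier N" for x
      using that by (simp add: pj_one N_smult_pj \<theta>_wd)
    show "(a \<otimes>\<^bsub>HP\<^esub> b) \<odot>\<^bsub>N\<^esub> x = a \<odot>\<^bsub>N\<^esub> (b \<odot>\<^bsub>N\<^esub> x)"
      if "a \<in> carrier HP" "b \<in> carrier HP" "x \<in> carrier N" for a b x
    proof -
      interpret TH: assoc_algebra K TH by (rule TH_alg)
      show ?thesis using that by (auto simp: HP_carrier pj_mult N_smult_pj \<theta>_mult)
    qed
  qed (auto simp: c lin_add[OF bilD(1)[OF N_smult_bil]] lin_add[OF bilD(2)[OF N_smult_bil]])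
qed

lemma N_scalar: "c \<in> carrier K \<Longrightarrow> m \<in> carrier P \<Longrightarrow> (c \<odot>\<^bsub>HP\<^esub> \<one>\<^bsub>HP\<^esub>) \<odot>\<^bsub>N\<^esub> m = c \<odot>\<^bsub>P\<^esub> m"
proof -
  interpret HPa: assoc_algebra K HP by (rule HP_alg)
  interpret N: left_module HP N by (rule N_left_module)
  assume "c \<in> carrier K" "m \<in> carrier P"
  then show ?thesis using lin_smult[OF bilD(1)[OF N_smult_bil]] N.smult_one[of m] by simp
qed

end

section \<open>The base subalgebra\<close>

lemma (in monoid) commute_mult:
  assumes "a \<in> carrier G" "b \<in> carrier G" "x \<in> carrier G" and a: "a \<otimes> x = x \<otimes> a" and b: "b \<otimes> x = x \<otimes> b"
  shows "a \<otimes> b \<otimes> x = x \<otimes> (a \<otimes> b)"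
proof -
  have "a \<otimes> b \<otimes> x = a \<otimes> x \<otimes> b" using assms(1-3) by (simp add: m_assoc b)
  then show ?thesis using assms(1-3) by (simp add: a m_assoc)
qed

text \<open>
  The relations are inherited by stable submodules. This applies to \<open>B\<close>, which is stable under
  conjugation inside \<open>H_par\<close>, and to the \<open>A\<close>-centre of a bimodule over \<open>A # H\<close>.
\<close>

lemma operator_representation_restrict:
  fixes H (structure)
  assumes "operator_representation K H P \<rho>" and C: "submodule C K P"
    and cl: "\<And>h m. h \<in> carrier H \<Longrightarrow> m \<in> C \<Longrightarrow> \<rho>' h m \<in> C"
    and eq: "\<And>h m. h \<in> carrier H \<Longrightarrow> m \<in> C \<Longrightarrow> \<rho>' h m = \<rho> h m"
  shows "operator_representation K H (P\<lparr>carrier := C\<rparr>) \<rho>'"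
proof -
  interpret operator_representation K H P \<rho> by fact
  let ?C = "P\<lparr>carrier := C\<rparr>"
  have CM [simp]: "module K ?C" by (rule submodule.submodule_is_module[OF C P_mod])
  have sub: "m \<in> carrier P" if "m \<in> C" for m using P.submoduleE(1)[OF C] that by blast
  note swC = sw_submodule(1)[OF P_mod C]
  have clr: "\<rho> h m \<in> C" if "h \<in> carrier H" "m \<in> C" for h m using cl[OF that] eq[OF that] by simp
  show ?thesis
  proof (intro operator_representation.intro operator_representation_axioms.intro CM)
    show "cocommutative_hopf_algebra K H" by (rule cocommutative_hopf_algebra_axioms)
    show "bil K H ?C ?C \<rho>'"
      by (intro bilI linI) (auto simp: cl eq sub clr lin_add[OF bilD(1)[OF \<rho>_bilinear]]
          lin_smult[OF bilD(1)[OF \<rho>_bilinear]] lin_add[OF bilD(2)[OF \<rho>_bilinear]] lin_smult[OF bilD(2)[OF \<rho>_bilinear]]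
          P.submoduleE(4,5)[OF C])
  next
    fix m assume "m \<in> carrier ?C" then show "\<rho>' \<one> m = m" by (simp add: eq \<rho>_one sub)
  next
    fix h k m assume [simp]: "h \<in> carrier H" "k \<in> carrier H" and "m \<in> carrier ?C"
    then have [simp]: "m \<in> C" by simp
    show "sw ?C (\<lambda>x y. \<rho>' h (\<rho>' x (\<rho>' (S y) m))) k = sw ?C (\<lambda>x y. \<rho>' (h \<otimes> x) (\<rho>' (S y) m)) k"
      using \<rho>_rel1[of h k m] by (simp add: swC eq clr sub)
    show "sw ?C (\<lambda>x y. \<rho>' x (\<rho>' (S y) (\<rho>' k m))) h = sw ?C (\<lambda>x y. \<rho>' x (\<rho>' (S y \<otimes> k) m)) h"
      using \<rho>_rel2[of h k m] by (simp add: swC eq clr sub)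
  qed
qed

context cocommutative_hopf_algebra
begin

abbreviation "B \<equiv> hpar_base K H"
abbreviation hmul (infixl "\<diamondop>" 70) where "a \<diamondop> b \<equiv> a \<otimes>\<^bsub>HP\<^esub> b"

lemma HP_ring: "ring HP" by (rule assoc_algebra_ring[OF HP_alg])

lemma idem_eq: "hpar_idem K H h = HR.e h"
  by (simp add: hpar_idem_def HR.e_def)

lemma base_family: "C \<in> {C. subring C HP \<and> submodule C K HP \<and> hpar_idem K H ` carrier H \<subseteq> C} \<longleftrightarrow>
    subring C HP \<and> submodule C K HP \<and> (\<forall>h\<in>carrier H. HR.e h \<in> C)"
  by (auto simp: idem_eq)

lemma B_sub: "B \<subseteq> carrier HP"
proof -
  have "subring (carrier HP) HP \<and> submodule (carrier HP) K HP \<and> (\<forall>h\<in>carrier H. HR.e h \<in> carrier HP)"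
    using ring.carrier_is_subring[OF HP_ring] module.carrier_is_submodule[OF HP_mod] by auto
  then show ?thesis unfolding hpar_base_def using base_family by blast
qed

lemma B_in [simp]: "b \<in> B \<Longrightarrow> b \<in> carrier HP" using B_sub by blast

lemma B_memI: "(\<And>C. subring C HP \<Longrightarrow> submodule C K HP \<Longrightarrow> (\<And>h. h \<in> carrier H \<Longrightarrow> HR.e h \<in> C) \<Longrightarrow> b \<in> C) \<Longrightarrow> b \<in> B"
  unfolding hpar_base_def using base_family by auto

lemma B_memD: "b \<in> B \<Longrightarrow> subring C HP \<Longrightarrow> submodule C K HP \<Longrightarrow> (\<And>h. h \<in> carrier H \<Longrightarrow> HR.e h \<in> C) \<Longrightarrow> b \<in> C"
  unfolding hpar_base_def using base_family by auto

lemma B_one [simp]: "\<one>\<^bsub>HP\<^esub> \<in> B" by (rule B_memI) (rule subringE(3))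
lemma B_e [simp]: "h \<in> carrier H \<Longrightarrow> HR.e h \<in> B" by (rule B_memI)
lemma B_mult [simp]: "a \<in> B \<Longrightarrow> b \<in> B \<Longrightarrow> a \<diamondop> b \<in> B"
  by (rule B_memI) (blast intro: subringE(6) B_memD)
lemma B_add [simp]: "a \<in> B \<Longrightarrow> b \<in> B \<Longrightarrow> a \<oplus>\<^bsub>HP\<^esub> b \<in> B"
  by (rule B_memI) (blast intro: subringE(7) B_memD)
lemma B_neg [simp]: "a \<in> B \<Longrightarrow> \<ominus>\<^bsub>HP\<^esub> a \<in> B"
  by (rule B_memI) (blast intro: subringE(5) B_memD)
lemma B_smult [simp]: "c \<in> carrier K \<Longrightarrow> a \<in> B \<Longrightarrow> c \<odot>\<^bsub>HP\<^esub> a \<in> B"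
  by (rule B_memI) (blast intro: submodule.smult_closed B_memD)

lemma B_submodule: "submodule B K HP"
proof (rule module.submoduleI[OF HP_mod B_sub])
  interpret HPm: module K HP by (rule HP_mod)
  show "\<zero>\<^bsub>HP\<^esub> \<in> B" using B_smult[OF _ B_one, of "\<zero>\<^bsub>K\<^esub>"] module.smult_l_null[OF HP_mod, of "\<one>\<^bsub>HP\<^esub>"] by simp
qed auto

text \<open>
  The elements of \<open>B\<close> with the property form a subalgebra that contains every \<open>e_h\<close>.
\<close>

lemma B_induct [consumes 1, case_names one e mult add smult]:
  assumes b: "b \<in> B" and one: "Pr \<one>\<^bsub>HP\<^esub>" and e: "\<And>h. h \<in> carrier H \<Longrightarrow> Pr (HR.e h)"
    and mult: "\<And>a b. a \<in> B \<Longrightarrow> b \<in> B \<Longrightarrow> Pr a \<Longrightarrow> Pr b \<Longrightarrow> Pr (a \<diamondop> b)"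
    and add: "\<And>a b. a \<in> B \<Longrightarrow> b \<in> B \<Longrightarrow> Pr a \<Longrightarrow> Pr b \<Longrightarrow> Pr (a \<oplus>\<^bsub>HP\<^esub> b)"
    and smult: "\<And>c a. c \<in> carrier K \<Longrightarrow> a \<in> B \<Longrightarrow> Pr a \<Longrightarrow> Pr (c \<odot>\<^bsub>HP\<^esub> a)"
  shows "Pr b"
proof -
  interpret HPr: ring HP by (rule HP_ring)
  let ?C = "{b \<in> B. Pr b}"
  have neg: "\<ominus>\<^bsub>HP\<^esub> a \<in> ?C" if "a \<in> ?C" for a
  proof -
    have "\<ominus>\<^bsub>HP\<^esub> a = (\<ominus>\<^bsub>K\<^esub> \<one>\<^bsub>K\<^esub>) \<odot>\<^bsub>HP\<^esub> a"
      using that module.smult_l_minus[OF HP_mod, of "\<one>\<^bsub>K\<^esub>" a] module.smult_one[OF HP_mod, of a] by simp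
    then show ?thesis using that smult[of "\<ominus>\<^bsub>K\<^esub> \<one>\<^bsub>K\<^esub>" a] B_neg[of a] by auto
  qed
  have "subring ?C HP"
    by (rule ring.subringI[OF HP_ring]) (use neg one mult add in auto)
  moreover have "submodule ?C K HP"
  proof (rule module.submoduleI[OF HP_mod])
    show "\<zero>\<^bsub>HP\<^esub> \<in> ?C"
      using smult[of "\<zero>\<^bsub>K\<^esub>" "\<one>\<^bsub>HP\<^esub>"] B_smult[of "\<zero>\<^bsub>K\<^esub>" "\<one>\<^bsub>HP\<^esub>"] one
        module.smult_l_null[OF HP_mod, of "\<one>\<^bsub>HP\<^esub>"] by simp
  qed (use neg add smult in auto)
  ultimately have "b \<in> ?C" by (rule B_memD[OF b]) (use e in auto)
  then show ?thesis by blast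
qed

lemma B_commute_e:
  assumes "b \<in> B" and h: "h \<in> carrier H" shows "b \<diamondop> HR.e h = HR.e h \<diamondop> b"
proof -
  from assms(1) show ?thesis
  proof (induction rule: B_induct)
    case (mult a b)
    then show ?case using h by (intro HR.R.A.commute_mult) auto
  qed (use h in \<open>auto simp: HR.e_commute HR.R.A.l_distr HR.R.A.r_distr HR.R.smult_mult_left HR.R.smult_mult_right\<close>)
qed

text \<open>
  \<open>H_par\<close> is a bimodule over itself, and its conjugation operators restrict to the action \<open>\<rhd>\<close> on
  \<open>B\<close>.
\<close>

sublocale HB: bimodule_representation K H HP cls HP "\<lambda>a m. a \<diamondop> m" "\<lambda>a m. m \<diamondop> a"
proof (unfold_locales)
  show "bil K HP HP HP (\<lambda>a m. a \<diamondop> m)" by (rule assoc_algebra_mult_bil[OF HP_alg])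
  show "bil K HP HP HP (\<lambda>a m. m \<diamondop> a)"
    using assoc_algebra_mult_bil[OF HP_alg] by (simp add: bil_def)
qed (auto simp: HR.R.A.m_assoc)

lemmas B_sw = sw_submodule(2)[OF HP_mod B_submodule]

lemma D_one_e: "h \<in> carrier H \<Longrightarrow> HB.D h \<one>\<^bsub>HP\<^esub> = HR.e h"
  by (simp add: HB.D_def HR.e_def)

text \<open>
  The product \<open>(h_1 \<rhd> a) (h_2 \<rhd> b)\<close> is \<open>[h_1] a [S h_2] [h_3] b [S h_4]\<close>. The two inner classes
  form \<open>e\<close> at the antipode of \<open>h_2\<close>, which commutes with \<open>a\<close> and is then absorbed by \<open>[h_1]\<close>.
\<close>

lemma D_mult:
  assumes [simp]: "h \<in> carrier H" "a \<in> B" "b \<in> B"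
  shows "HB.D h (a \<diamondop> b) = sw HP (\<lambda>x y. HB.D x a \<diamondop> HB.D y b) h"
proof -
  have "sw HP (\<lambda>x y. HB.D x a \<diamondop> HB.D y b) h =
     sw HP (\<lambda>x y. sw HP (\<lambda>p q. cls p \<diamondop> a \<diamondop> cls (S q) \<diamondop> HB.D y b) x) h"
  proof (intro sw_congruence[OF refl])
    fix x y assume [simp]: "x \<in> carrier H" "y \<in> carrier H"
    show "HB.D x a \<diamondop> HB.D y b = sw HP (\<lambda>p q. cls p \<diamondop> a \<diamondop> cls (S q) \<diamondop> HB.D y b) x"
      unfolding HB.D_def[of x a] by (simp add: HR.mult_sw_right HR.R.A.m_assoc)
  qed auto
  also have "\<dots> = sw HP (\<lambda>p y. sw HP (\<lambda>q x. cls p \<diamondop> a \<diamondop> cls (S q) \<diamondop> HB.D x b) y) h"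
    by (rule sw_assoc) (auto intro!: lin_intros lin_compose[OF bilD(1)[OF HB.D_bil]])
  also have "\<dots> = sw HP (\<lambda>p y. sw HP (\<lambda>q x. sw HP (\<lambda>u v. cls p \<diamondop> a \<diamondop> cls (S q) \<diamondop> (cls u \<diamondop> (b \<diamondop> cls (S v)))) x) y) h"
    by (simp add: HB.D_def HR.mult_sw_left)
  also have "\<dots> = sw HP (\<lambda>p y. sw HP (\<lambda>x v. sw HP (\<lambda>q u. cls p \<diamondop> a \<diamondop> cls (S q) \<diamondop> (cls u \<diamondop> (b \<diamondop> cls (S v)))) x) y) h"
    by (intro sw_congruence[OF refl] sw_assoc[symmetric]) (auto intro!: lin_intros)
  also have "\<dots> = sw HP (\<lambda>p y. sw HP (\<lambda>x v. cls p \<diamondop> a \<diamondop> HR.e (S x) \<diamondop> (b \<diamondop> cls (S v))) y) h"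
    by (simp add: HR.e_antipode[symmetric] HR.mult_sw HR.R.A.m_assoc)
  also have "\<dots> = sw HP (\<lambda>p y. sw HP (\<lambda>x v. cls p \<diamondop> HR.e (S x) \<diamondop> (a \<diamondop> b \<diamondop> cls (S v))) y) h"
  proof -
    have "cls p \<diamondop> a \<diamondop> HR.e (S x) \<diamondop> (b \<diamondop> cls (S v)) = cls p \<diamondop> HR.e (S x) \<diamondop> (a \<diamondop> b \<diamondop> cls (S v))"
      if "p \<in> carrier H" "x \<in> carrier H" "v \<in> carrier H" for p x v
    proof -
      have "a \<diamondop> (HR.e (S x) \<diamondop> (b \<diamondop> cls (S v))) = HR.e (S x) \<diamondop> (a \<diamondop> (b \<diamondop> cls (S v)))"
        using B_commute_e[of a "S x"] that by (simp add: HR.R.A.m_assoc[symmetric])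
      then show ?thesis using that by (simp add: HR.R.A.m_assoc)
    qed
    then show ?thesis by simp
  qed
  also have "\<dots> = sw HP (\<lambda>x v. sw HP (\<lambda>p y. cls p \<diamondop> HR.e (S y) \<diamondop> (a \<diamondop> b \<diamondop> cls (S v))) x) h"
    by (rule sw_assoc[symmetric]) (auto intro!: lin_intros)
  also have "\<dots> = sw HP (\<lambda>x v. sw HP (\<lambda>p y. cls p \<diamondop> HR.e (S y)) x \<diamondop> (a \<diamondop> b \<diamondop> cls (S v))) h"
    by (simp add: HR.mult_sw_right)
  also have "\<dots> = HB.D h (a \<diamondop> b)" by (simp add: HR.\<sigma>_e_antipode_sum) (simp add: HB.D_def)
  finally show ?thesis by (rule sym)
qed

text \<open>
  Moving \<open>e_k\<close> to the left of \<open>[h_1]\<close> leaves \<open>e\<close> at \<open>h_1 k\<close> and the factors \<open>[h_2] [S h_3]\<close>,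
  that is, \<open>e\<close> at \<open>h_2\<close>.
\<close>

lemma D_e:
  assumes [simp]: "h \<in> carrier H" "k \<in> carrier H"
  shows "HB.D h (HR.e k) = sw HP (\<lambda>x y. HR.e (x \<otimes> k) \<diamondop> HR.e y) h"
proof -
  have pull: "sw HP (\<lambda>u v. r \<diamondop> (cls u \<diamondop> cls (S v))) y = r \<diamondop> HR.e y"
    if "r \<in> carrier HP" "y \<in> carrier H" for r y
    using that by (simp add: HR.e_def HR.mult_sw_left)
  have "HB.D h (HR.e k) = sw HP (\<lambda>x y. sw HP (\<lambda>u v. HR.e (u \<otimes> k) \<diamondop> (cls v \<diamondop> cls (S y))) x) h"
    by (simp add: HB.D_def HR.R.A.m_assoc[symmetric] HR.\<sigma>_e_commute[symmetric]) (simp add: HR.mult_sw HR.R.A.m_assoc)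
  also have "\<dots> = sw HP (\<lambda>x y. sw HP (\<lambda>u v. HR.e (x \<otimes> k) \<diamondop> (cls u \<diamondop> cls (S v))) y) h"
    by (rule sw_assoc) (auto intro!: lin_intros)
  also have "\<dots> = sw HP (\<lambda>x y. HR.e (x \<otimes> k) \<diamondop> HR.e y) h"
    by (simp add: pull)
  finally show ?thesis .
qed

lemma D_B [simp]: "b \<in> B \<Longrightarrow> h \<in> carrier H \<Longrightarrow> HB.D h b \<in> B"
proof (induction arbitrary: h rule: B_induct)
  case (mult a b)
  then show ?case by (simp add: D_mult B_sw)
qed (simp_all add: D_one_e D_e B_sw lin_add[OF bilD(2)[OF HB.D_bil]] lin_smult[OF bilD(2)[OF HB.D_bil]])

abbreviation "BM \<equiv> hpar_base_module K H"

text \<open>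
  The action \<open>\<rhd>\<close> with the product bracketed to the left; \<open>D\<close> is bracketed to the right.
\<close>

definition base_conj where
  "base_conj h b = sw HP (\<lambda>x y. cls x \<diamondop> b \<diamondop> cls (S y)) h"

lemma base_conj_eq: "h \<in> carrier H \<Longrightarrow> b \<in> B \<Longrightarrow> base_conj h b = HB.D h b"
  by (simp add: base_conj_def HB.D_def HR.R.A.m_assoc)

lemma BM_eq: "BM = hpar_module K H (HP\<lparr>carrier := B\<rparr>) base_conj"
  by (simp add: hpar_base_module_def base_conj_def[abs_def])

sublocale BMod: hpar_operator_module K H "HP\<lparr>carrier := B\<rparr>" base_conj
  by (intro hpar_operator_module.intro operator_representation_restrict[OF HB.D_operator_representation B_submodule])
    (simp_all add: base_conj_eq)

lemma BM_left_module: "left_module HP BM"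
  unfolding BM_eq by (rule BMod.N_left_module)

lemma BM_simps [simp]: "carrier BM = B" "x \<oplus>\<^bsub>BM\<^esub> y = x \<oplus>\<^bsub>HP\<^esub> y" "\<zero>\<^bsub>BM\<^esub> = \<zero>\<^bsub>HP\<^esub>"
  by (simp_all add: BM_eq)

lemma BM_cls: "h \<in> carrier H \<Longrightarrow> b \<in> B \<Longrightarrow> cls h \<odot>\<^bsub>BM\<^esub> b = HB.D h b"
  using BMod.N_smult_cls[of h b] by (simp add: BM_eq base_conj_eq)

text \<open>
  As a product of two classes \<open>e_h\<close> acts by two conjugations, which together map \<open>b\<close> to \<open>e b e'\<close>
  with \<open>e\<close>, \<open>e'\<close> taken at \<open>h_1\<close>, \<open>h_2\<close>. Since \<open>b\<close> commutes with \<open>e'\<close> and \<open>e e'\<close> sums to \<open>e_h\<close>,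
  this is \<open>e_h b\<close>.
\<close>

lemma e_act:
  assumes [simp]: "h \<in> carrier H" "b \<in> B" shows "HR.e h \<odot>\<^bsub>BM\<^esub> b = HR.e h \<diamondop> b"
proof -
  let ?C = "HP\<lparr>carrier := B\<rparr>"
  interpret BM: left_module HP BM by (rule BM_left_module)
  have CM [simp]: "module K ?C" by (rule submodule.submodule_is_module[OF B_submodule HP_mod])
  have bl: "lin K HP ?C (\<lambda>z. z \<odot>\<^bsub>BM\<^esub> b)" using bilD(1)[OF BMod.N_smult_bil, of b] by (simp add: BM_eq)
  have "HR.e h \<odot>\<^bsub>BM\<^esub> b = sw ?C (\<lambda>x y. (cls x \<diamondop> cls (S y)) \<odot>\<^bsub>BM\<^esub> b) h"
    unfolding HR.e_def by (rule sw_push[OF bl HP_mod CM]) auto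
  also have "\<dots> = sw ?C (\<lambda>x y. HB.D x (HB.D (S y) b)) h"
    by (simp add: BM.smult_assoc BM_cls)
  also have "\<dots> = sw HP (\<lambda>x y. HB.D x (HB.D (S y) b)) h"
    by (rule sw_submodule(1)[OF HP_mod B_submodule]) auto
  also have "\<dots> = sw HP (\<lambda>x y. HR.e x \<diamondop> (b \<diamondop> HR.e y)) h"
    by (simp add: HB.D_D_antipode)
  also have "\<dots> = sw HP (\<lambda>x y. HR.e x \<diamondop> HR.e y) h \<diamondop> b"
    by (simp add: B_commute_e[OF assms(2)] HR.mult_sw_right HR.R.A.m_assoc)
  finally show ?thesis by (simp add: HR.e_e_sum)
qed

text \<open>
  The generators \<open>e_h\<close> of \<open>B\<close> act by multiplication, and hence all of \<open>B\<close> does.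
\<close>

lemma base_act:
  assumes "b \<in> B" "x \<in> B" shows "b \<odot>\<^bsub>BM\<^esub> x = b \<diamondop> x"
  using assms
proof (induction arbitrary: x rule: B_induct)
  interpret BM: left_module HP BM by (rule BM_left_module)
  note bl = bilD(1)[OF BMod.N_smult_bil, folded BM_eq]
  {
    case one then show ?case using BM.smult_one[of x] by simp
  next
    case (e h) then show ?case by (simp add: e_act)
  next
    case (mult a b) then show ?case using BM.smult_assoc[of a b x] by (simp add: HR.R.A.m_assoc)
  next
    case (add a b) then show ?case using lin_add[OF bl, of x a b] by (simp add: HR.R.A.l_distr)
  next
    case (smult c a) then show ?case using lin_smult[OF bl, of x c a] by (simp add: HR.R.smult_mult_left)
  }
qed

text \<open>
  The unit generates: \<open>b = b \<rhd> 1\<close> for \<open>b \<in> B\<close>. The elements \<open>[h]\<close> and \<open>e_h\<close> have the same effect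
  on it, because \<open>[h] \<rhd> 1 = e_h = e_h \<rhd> 1\<close>.
\<close>

lemma hom_from_base:
  assumes N: "left_module HP N" and f: "f \<in> mod_hom HP BM N"
  shows "f \<one>\<^bsub>HP\<^esub> \<in> carrier N"
    and "b \<in> B \<Longrightarrow> f b = b \<odot>\<^bsub>N\<^esub> f \<one>\<^bsub>HP\<^esub>"
    and "h \<in> carrier H \<Longrightarrow> cls h \<odot>\<^bsub>N\<^esub> f \<one>\<^bsub>HP\<^esub> = HR.e h \<odot>\<^bsub>N\<^esub> f \<one>\<^bsub>HP\<^esub>"
proof -
  have fh: "f (z \<odot>\<^bsub>BM\<^esub> x) = z \<odot>\<^bsub>N\<^esub> f x" if "z \<in> carrier HP" "x \<in> B" for z x
    using f that by (simp add: mod_hom_def)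
  show "f \<one>\<^bsub>HP\<^esub> \<in> carrier N" using f by (auto simp: mod_hom_def)
  show fb: "f b = b \<odot>\<^bsub>N\<^esub> f \<one>\<^bsub>HP\<^esub>" if "b \<in> B" for b
    using fh[of b "\<one>\<^bsub>HP\<^esub>"] base_act[OF that B_one] that by simp
  show "cls h \<odot>\<^bsub>N\<^esub> f \<one>\<^bsub>HP\<^esub> = HR.e h \<odot>\<^bsub>N\<^esub> f \<one>\<^bsub>HP\<^esub>" if "h \<in> carrier H" for h
    using fh[of "cls h" "\<one>\<^bsub>HP\<^esub>"] fb[of "HR.e h"] that by (simp add: BM_cls D_one_e)
qed

text \<open>
  Compatibility with \<open>[h]\<close> is the computation \<open>([h] \<rhd> b) n = [h_1] b [S h_2] n = [h_1] b e n =
  [h_1] e b n = [h] b n\<close>, where \<open>e\<close> is taken at \<open>S h_2\<close>; it uses the invariance of \<open>n\<close>, the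
  commutation of \<open>b\<close> with \<open>e\<close>, and the absorption of \<open>e\<close> by \<open>[h_1]\<close>.
\<close>

lemma hom_from_invariant:
  assumes N: "left_module HP N" and n: "n \<in> carrier N"
    and inv: "\<And>h. h \<in> carrier H \<Longrightarrow> cls h \<odot>\<^bsub>N\<^esub> n = HR.e h \<odot>\<^bsub>N\<^esub> n"
  shows "(\<lambda>b\<in>B. b \<odot>\<^bsub>N\<^esub> n) \<in> mod_hom HP BM N"
proof -
  interpret N: left_module HP N by fact
  interpret BM: left_module HP BM by (rule BM_left_module)
  let ?P = "base_module HP N"
  have PM [simp]: "module K ?P" by (rule base_module_is_module[OF HP_alg N])
  note bl = base_module_bilinear[OF HP_alg N]
  note [simp] = N.smult_closed n
  have al: "lin K HP ?P (\<lambda>z. z \<odot>\<^bsub>N\<^esub> n)" using bilD(1)[OF bl] by simp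
  have step: "HB.D h b \<odot>\<^bsub>N\<^esub> n = cls h \<odot>\<^bsub>N\<^esub> (b \<odot>\<^bsub>N\<^esub> n)" if [simp]: "h \<in> carrier H" "b \<in> B" for h b
  proof -
    have "HB.D h b \<odot>\<^bsub>N\<^esub> n = sw ?P (\<lambda>x y. (cls x \<diamondop> (b \<diamondop> cls (S y))) \<odot>\<^bsub>N\<^esub> n) h"
      unfolding HB.D_def by (rule sw_push[OF al HP_mod PM]) auto
    also have "\<dots> = sw ?P (\<lambda>x y. (cls x \<diamondop> (b \<diamondop> HR.e (S y))) \<odot>\<^bsub>N\<^esub> n) h"
      by (simp add: N.smult_assoc inv)
    also have "\<dots> = sw ?P (\<lambda>x y. (cls x \<diamondop> HR.e (S y) \<diamondop> b) \<odot>\<^bsub>N\<^esub> n) h"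
      by (simp add: B_commute_e[of b] HR.R.A.m_assoc)
    also have "\<dots> = sw HP (\<lambda>x y. cls x \<diamondop> HR.e (S y) \<diamondop> b) h \<odot>\<^bsub>N\<^esub> n"
      by (rule sw_push[symmetric, OF al HP_mod PM]) auto
    also have "\<dots> = (cls h \<diamondop> b) \<odot>\<^bsub>N\<^esub> n"
      by (simp add: HR.mult_sw_right[symmetric] HR.\<sigma>_e_antipode_sum)
    finally show ?thesis by (simp add: N.smult_assoc)
  qed
  have BMc: "z \<odot>\<^bsub>BM\<^esub> b \<in> B" if "z \<in> carrier HP" "b \<in> B" for z b using BM.smult_closed[of z b] that by simp
  have lin: "(z \<odot>\<^bsub>BM\<^esub> b) \<odot>\<^bsub>N\<^esub> n = z \<odot>\<^bsub>N\<^esub> (b \<odot>\<^bsub>N\<^esub> n)" if z: "z \<in> carrier HP" and b [simp]: "b \<in> B" for z b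
    using z
  proof (induction rule: hpar_induct)
    case one
    then show ?case using BM.smult_one[of b] by (simp add: N.smult_one)
  next
    case (cls h z)
    then show ?case using step[of h "z \<odot>\<^bsub>BM\<^esub> b"] BMc by (simp add: BM.smult_assoc N.smult_assoc BM_cls)
  next
    case zero
    have "\<zero>\<^bsub>HP\<^esub> \<odot>\<^bsub>BM\<^esub> b = \<zero>\<^bsub>HP\<^esub>"
      using lin_zero[OF HP_mod BMod.P_mod bilD(1)[OF BMod.N_smult_bil]] by (simp add: BM_eq)
    moreover have "\<zero>\<^bsub>HP\<^esub> \<odot>\<^bsub>N\<^esub> m = \<zero>\<^bsub>N\<^esub>" if "m \<in> carrier N" for m
      using lin_zero[OF HP_mod PM bilD(1)[OF bl]] that by simp
    ultimately show ?case by simp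
  next
    case (add y z)
    then show ?case using BMc by (simp add: BM.smult_l_distr N.smult_l_distr)
  next
    case (smult c z)
    have "(c \<odot>\<^bsub>HP\<^esub> z) \<odot>\<^bsub>BM\<^esub> b = c \<odot>\<^bsub>HP\<^esub> (z \<odot>\<^bsub>BM\<^esub> b)"
      using lin_smult[OF bilD(1)[OF BMod.N_smult_bil]] smult by (simp add: BM_eq)
    moreover have "(c \<odot>\<^bsub>HP\<^esub> y) \<odot>\<^bsub>N\<^esub> m = (c \<odot>\<^bsub>HP\<^esub> \<one>\<^bsub>HP\<^esub>) \<odot>\<^bsub>N\<^esub> (y \<odot>\<^bsub>N\<^esub> m)"
      if "m \<in> carrier N" "y \<in> carrier HP" for m y
      using lin_smult[OF bilD(1)[OF bl], of m c y] that smult(1) by simp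
    ultimately show ?case using smult BMc by simp
  qed
  show ?thesis unfolding mod_hom_def
    using BMc lin by (auto simp: N.smult_l_distr BM_simps)
qed

end

section \<open>The partial smash product\<close>

locale cocommutative_partial_action =
  cocommutative_hopf_algebra K H + Aa: assoc_algebra K A + PA: symmetric_partial_action K H A act
  for K :: "'k ring" and H :: "('k, 'h) hopf" (structure) and A :: "('k, 'a) module"
    and act :: "'h \<Rightarrow> 'a \<Rightarrow> 'a"
begin

abbreviation amul (infixl "\<bullet>" 70) where "a \<bullet> b \<equiv> a \<otimes>\<^bsub>A\<^esub> b"

lemma A_alg [simp, intro!]: "assoc_algebra K A" by (rule Aa.assoc_algebra_axioms)
lemma A_mod [simp, intro!]: "module K A" by (rule Aa.module_axioms)

declare PA.act_closed [simp] PA.act_one [simp]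

lemma act_lin1 [lin_intros]: "lin K V H f \<Longrightarrow> a \<in> carrier A \<Longrightarrow> lin K V A (\<lambda>v. act (f v) a)"
  by (rule lin_compose[where g = "\<lambda>h. act h a"]) (auto intro!: linI simp: PA.act_add_left PA.act_smult_left)

lemma act_lin2 [lin_intros]: "lin K V A f \<Longrightarrow> h \<in> carrier H \<Longrightarrow> lin K V A (\<lambda>v. act h (f v))"
  by (rule lin_compose[where g = "\<lambda>a. act h a"]) (auto intro!: linI simp: PA.act_add_right PA.act_smult_right)

lemmas amul_sw_left = sw_alg_left[OF A_alg] and amul_sw_right = sw_alg_right[OF A_alg]

lemma act_one_right:
  assumes [simp]: "h \<in> carrier H" "a \<in> carrier A"
  shows "sw A (\<lambda>x y. act x a \<bullet> act y \<one>\<^bsub>A\<^esub>) h = act h a"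
  using PA.act_mult[of h a "\<one>\<^bsub>A\<^esub>"] by simp

sublocale AH: two_modules K A H
  by (simp add: two_modules_def)

abbreviation "TT \<equiv> tensor K A H"
abbreviation "tn \<equiv> pure_tensor K A H"

lemma TT_mod [simp, intro!]: "module K TT" by (rule AH.T_module)
lemma tn_closed [simp]: "a \<in> carrier A \<Longrightarrow> h \<in> carrier H \<Longrightarrow> tn a h \<in> carrier TT" by (rule AH.tns_closed)

lemma tn_lin1 [lin_intros]: "lin K V A f \<Longrightarrow> h \<in> carrier H \<Longrightarrow> lin K V TT (\<lambda>v. tn (f v) h)"
  and tn_lin2 [lin_intros]: "lin K V H g \<Longrightarrow> a \<in> carrier A \<Longrightarrow> lin K V TT (\<lambda>v. tn a (g v))"
  by (rule AH.tns_lin1, assumption+) (rule AH.tns_lin2, assumption+)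

lemma tn_sw: "\<lbrakk>h \<in> carrier H; \<And>x y. x \<in> carrier H \<Longrightarrow> y \<in> carrier H \<Longrightarrow> f x y \<in> carrier A; k \<in> carrier H\<rbrakk> \<Longrightarrow>
    tn (sw A f k) h = sw TT (\<lambda>x y. tn (f x y) h) k"
  by (rule sw_push[where g = "\<lambda>t. tn t h"]) (auto intro!: lin_intros)

abbreviation sm (infixl "\<odot>\<odot>" 70) where "s \<odot>\<odot> t \<equiv> smash_mult K H A act s t"

lemma sm_eq: "s \<odot>\<odot> t = tensor_lift K TT (\<lambda>a h. tensor_lift K TT (\<lambda>b k.
       sw TT (\<lambda>x y. tn (a \<bullet> act x b) (y \<otimes> k)) h) t) s"
  by (simp add: smash_mult_def Let_def)

lemma sm_inner:
  "a \<in> carrier A \<Longrightarrow> h \<in> carrier H \<Longrightarrow> bil K A H TT (\<lambda>b k. sw TT (\<lambda>x y. tn (a \<bullet> act x b) (y \<otimes> k)) h)"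
  "b \<in> carrier A \<Longrightarrow> k \<in> carrier H \<Longrightarrow> bil K A H TT (\<lambda>a h. sw TT (\<lambda>x y. tn (a \<bullet> act x b) (y \<otimes> k)) h)"
  by (auto intro!: lin_intros)

lemma sm_outer: "t \<in> carrier TT \<Longrightarrow>
   bil K A H TT (\<lambda>a h. tensor_lift K TT (\<lambda>b k. sw TT (\<lambda>x y. tn (a \<bullet> act x b) (y \<otimes> k)) h) t)"
  by (intro bilI AH.lift_body_lin TT_mod A_mod H_module bilD(1)[OF sm_inner(2)] bilD(2)[OF sm_inner(2)])

lemma sm_bil: "bil K TT TT TT (smash_mult K H A act)"
proof (rule bilI)
  fix t assume t: "t \<in> carrier TT"
  show "lin K TT TT (\<lambda>s. s \<odot>\<odot> t)" unfolding sm_eq by (rule AH.lift_lin[OF TT_mod sm_outer[OF t]])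
next
  fix s assume s: "s \<in> carrier TT"
  show "lin K TT TT (smash_mult K H A act s)" unfolding sm_eq
    by (intro AH.lift_body_lin TT_mod s AH.lift_lin sm_inner)
qed

lemma sm_closed [simp]: "s \<in> carrier TT \<Longrightarrow> t \<in> carrier TT \<Longrightarrow> s \<odot>\<odot> t \<in> carrier TT"
  by (rule bil_closed[OF sm_bil])

lemma sm_lin1 [lin_intros]: "lin K V TT f \<Longrightarrow> t \<in> carrier TT \<Longrightarrow> lin K V TT (\<lambda>v. f v \<odot>\<odot> t)"
  by (erule lin_compose[OF bilD(1)[OF sm_bil], rotated])
lemma sm_lin2 [lin_intros]: "lin K V TT f \<Longrightarrow> t \<in> carrier TT \<Longrightarrow> lin K V TT (\<lambda>v. t \<odot>\<odot> f v)"
  by (erule lin_compose[OF bilD(2)[OF sm_bil], rotated])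

lemma sm_sw_left: "\<lbrakk>t \<in> carrier TT; \<And>x y. x \<in> carrier H \<Longrightarrow> y \<in> carrier H \<Longrightarrow> f x y \<in> carrier TT; k \<in> carrier H\<rbrakk> \<Longrightarrow>
    t \<odot>\<odot> sw TT f k = sw TT (\<lambda>x y. t \<odot>\<odot> f x y) k"
  by (rule sw_push[where g = "\<lambda>s. t \<odot>\<odot> s"]) (auto intro!: lin_intros)
lemma sm_sw_right: "\<lbrakk>t \<in> carrier TT; \<And>x y. x \<in> carrier H \<Longrightarrow> y \<in> carrier H \<Longrightarrow> f x y \<in> carrier TT; k \<in> carrier H\<rbrakk> \<Longrightarrow>
    sw TT f k \<odot>\<odot> t = sw TT (\<lambda>x y. f x y \<odot>\<odot> t) k"
  by (rule sw_push[where g = "\<lambda>s. s \<odot>\<odot> t"]) (auto intro!: lin_intros)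

lemma sm_tn: "\<lbrakk>a \<in> carrier A; h \<in> carrier H; b \<in> carrier A; k \<in> carrier H\<rbrakk> \<Longrightarrow>
    tn a h \<odot>\<odot> tn b k = sw TT (\<lambda>x y. tn (a \<bullet> act x b) (y \<otimes> k)) h"
  by (simp add: sm_eq AH.lift_tns[OF TT_mod sm_outer] AH.lift_tns[OF TT_mod sm_inner(1)])

lemma sm_tn_one: "\<lbrakk>a \<in> carrier A; b \<in> carrier A; k \<in> carrier H\<rbrakk> \<Longrightarrow> tn a \<one> \<odot>\<odot> tn b k = tn (a \<bullet> b) k"
proof -
  assume [simp]: "a \<in> carrier A" "b \<in> carrier A" "k \<in> carrier H"
  have "sw TT (\<lambda>x y. tn (a \<bullet> act x b) (y \<otimes> k)) \<one> = tn (a \<bullet> act \<one> b) (\<one> \<otimes> k)"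
    by (rule sw_one) (auto intro!: lin_intros)
  then show ?thesis by (simp add: sm_tn)
qed

text \<open>
  Both products equal \<open>a (h_1 \<cdot> b) (h_2 k_1 \<cdot> c) \<otimes> h_3 k_2 l\<close>. On the right-hand side \<open>h_1 \<cdot> (b
  (k_1 \<cdot> c))\<close> is expanded by multiplicativity and by the law of partial actions, and \<open>h_1 \<cdot> b\<close>
  absorbs the additional factor \<open>h_2 \<cdot> 1\<close>.
\<close>

lemma sm_assoc_tn:
  assumes [simp]: "a \<in> carrier A" "h \<in> carrier H" "b \<in> carrier A" "k \<in> carrier H" "c \<in> carrier A" "l \<in> carrier H"
  shows "tn a h \<odot>\<odot> tn b k \<odot>\<odot> tn c l = tn a h \<odot>\<odot> (tn b k \<odot>\<odot> tn c l)"
proof -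
  \<comment> \<open>The summand common to both sides; \<open>u\<close>, \<open>v\<close> stand for the factors of \<open>k\<close> and \<open>x\<close>, \<open>p\<close>, \<open>q\<close>
    for those of \<open>h\<close>.\<close>
  define F where "F u v x = (\<lambda>p q. tn (a \<bullet> (act x b \<bullet> act (p \<otimes> u) c)) (q \<otimes> (v \<otimes> l)))" for u v x
  have "tn a h \<odot>\<odot> tn b k \<odot>\<odot> tn c l = sw TT (\<lambda>x y. sw TT (\<lambda>p q. tn (a \<bullet> act x b \<bullet> act p c) (q \<otimes> l)) (y \<otimes> k)) h"
    by (simp add: sm_tn sm_sw_right)
  also have "\<dots> = sw TT (\<lambda>x y. sw TT (\<lambda>p q. sw TT (\<lambda>u v. tn (a \<bullet> act x b \<bullet> act (p \<otimes> u) c) (q \<otimes> v \<otimes> l)) k) y) h"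
    by (intro sw_congruence[OF refl] sw_mult) (auto intro!: lin_intros)
  also have "\<dots> = sw TT (\<lambda>x y. sw TT (\<lambda>u v. sw TT (F u v x) y) k) h"
    unfolding F_def by (simp add: A.m_assoc Aa.A.m_assoc) (intro sw_congruence[OF refl] sw_swap; simp)
  also have "\<dots> = sw TT (\<lambda>u v. sw TT (\<lambda>x y. sw TT (F u v x) y) h) k"
    by (rule sw_swap) (auto simp: F_def)
  finally have L: "tn a h \<odot>\<odot> tn b k \<odot>\<odot> tn c l = sw TT (\<lambda>u v. sw TT (\<lambda>x y. sw TT (F u v x) y) h) k" .
  have "tn a h \<odot>\<odot> (tn b k \<odot>\<odot> tn c l) = sw TT (\<lambda>u v. sw TT (\<lambda>x y. tn (a \<bullet> act x (b \<bullet> act u c)) (y \<otimes> (v \<otimes> l))) h) k"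
    by (simp add: sm_tn sm_sw_left)
  also have "\<dots> = sw TT (\<lambda>u v. sw TT (\<lambda>x y. sw TT (F u v x) y) h) k"
  proof (rule sw_congruence[OF refl])
    fix u v assume [simp]: "u \<in> carrier H" "v \<in> carrier H"
    have 1: "act x (b \<bullet> act u c) = sw A (\<lambda>x p. act x b \<bullet> act (p \<otimes> u) c) x" if [simp]: "x \<in> carrier H" for x
    proof -
      have "act x (b \<bullet> act u c) = sw A (\<lambda>x y. act x b \<bullet> act y (act u c)) x"
        by (rule PA.act_mult) auto
      also have "\<dots> = sw A (\<lambda>x y. sw A (\<lambda>r s. act x b \<bullet> (act r \<one>\<^bsub>A\<^esub> \<bullet> act (s \<otimes> u) c)) y) x"
        by (simp add: PA.act_act amul_sw_left)
      also have "\<dots> = sw A (\<lambda>x y. sw A (\<lambda>r s. act r b \<bullet> (act s \<one>\<^bsub>A\<^esub> \<bullet> act (y \<otimes> u) c)) x) x"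
        by (rule sw_assoc[symmetric]) (auto intro!: lin_intros)
      also have "\<dots> = sw A (\<lambda>x y. sw A (\<lambda>r s. act r b \<bullet> act s \<one>\<^bsub>A\<^esub>) x \<bullet> act (y \<otimes> u) c) x"
        by (simp add: amul_sw_right Aa.A.m_assoc)
      finally show ?thesis by (simp add: act_one_right)
    qed
    have "sw TT (\<lambda>x y. tn (a \<bullet> act x (b \<bullet> act u c)) (y \<otimes> (v \<otimes> l))) h =
      sw TT (\<lambda>x y. sw TT (\<lambda>x p. F u v x p y) x) h"
      by (simp add: F_def 1 amul_sw_left tn_sw)
    also have "\<dots> = sw TT (\<lambda>x y. sw TT (F u v x) y) h"
      unfolding F_def by (rule sw_assoc) (auto intro!: lin_intros)
    finally show "sw TT (\<lambda>x y. tn (a \<bullet> act x (b \<bullet> act u c)) (y \<otimes> (v \<otimes> l))) h = sw TT (\<lambda>x y. sw TT (F u v x) y) h" .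
  qed auto
  finally show ?thesis using L by simp
qed

lemma sm_assoc:
  assumes s: "s \<in> carrier TT" and t: "t \<in> carrier TT" and u: "u \<in> carrier TT"
  shows "s \<odot>\<odot> t \<odot>\<odot> u = s \<odot>\<odot> (t \<odot>\<odot> u)"
proof -
  have 1: "tn a h \<odot>\<odot> tn b k \<odot>\<odot> u = tn a h \<odot>\<odot> (tn b k \<odot>\<odot> u)"
    if "a \<in> carrier A" "h \<in> carrier H" "b \<in> carrier A" "k \<in> carrier H" for a h b k
    by (rule AH.T_ext[where f = "\<lambda>u. tn a h \<odot>\<odot> tn b k \<odot>\<odot> u" and g = "\<lambda>u. tn a h \<odot>\<odot> (tn b k \<odot>\<odot> u)", OF _ _ TT_mod _ u])
      (use that sm_assoc_tn in \<open>auto intro!: lin_intros\<close>)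
  have 2: "tn a h \<odot>\<odot> t \<odot>\<odot> u = tn a h \<odot>\<odot> (t \<odot>\<odot> u)" if "a \<in> carrier A" "h \<in> carrier H" for a h
    by (rule AH.T_ext[where f = "\<lambda>t. tn a h \<odot>\<odot> t \<odot>\<odot> u" and g = "\<lambda>t. tn a h \<odot>\<odot> (t \<odot>\<odot> u)", OF _ _ TT_mod _ t])
      (use that 1 u in \<open>auto intro!: lin_intros\<close>)
  show ?thesis
    by (rule AH.T_ext[where f = "\<lambda>s. s \<odot>\<odot> t \<odot>\<odot> u" and g = "\<lambda>s. s \<odot>\<odot> (t \<odot>\<odot> u)", OF _ _ TT_mod _ s])
      (use 2 t u in \<open>auto intro!: lin_intros\<close>)
qed

abbreviation "R \<equiv> smash K H A act"
abbreviation "ee \<equiv> tn \<one>\<^bsub>A\<^esub> \<one>"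

lemma ee_left: "t \<in> carrier TT \<Longrightarrow> ee \<odot>\<odot> t = t"
  by (rule AH.T_ext[where f = "\<lambda>t. ee \<odot>\<odot> t" and g = "\<lambda>t. t", OF _ _ TT_mod])
    (auto intro!: lin_intros simp: sm_tn_one)

lemma R_simps [simp]: "carrier R = (\<lambda>t. t \<odot>\<odot> ee) ` carrier TT" "x \<oplus>\<^bsub>R\<^esub> y = x \<oplus>\<^bsub>TT\<^esub> y"
  "\<zero>\<^bsub>R\<^esub> = \<zero>\<^bsub>TT\<^esub>" "c \<odot>\<^bsub>R\<^esub> x = c \<odot>\<^bsub>TT\<^esub> x" "x \<otimes>\<^bsub>R\<^esub> y = x \<odot>\<odot> y" "\<one>\<^bsub>R\<^esub> = ee"
  by (simp_all add: smash_def Let_def)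

text \<open>
  The element \<open>1 \<otimes> 1\<close> is a left unit of \<open>A \<otimes> H\<close> and hence idempotent; the multiples \<open>t (1 \<otimes> 1)\<close>
  are therefore the elements fixed by right multiplication with it.
\<close>

lemma R_mem: "r \<in> carrier R \<longleftrightarrow> r \<in> carrier TT \<and> r \<odot>\<odot> ee = r"
  by (auto simp: sm_assoc ee_left image_iff)

lemma smash_algebra: "assoc_algebra K R"
proof (rule assoc_algebraI)
  interpret TT: module K TT by (rule TT_mod)
  note l = bilD(1)[OF sm_bil, of ee]
  have sub: "submodule (carrier R) K TT"
    by (rule TT.submoduleI_smult)
      (auto simp: R_mem lin_zero[OF TT_mod TT_mod l] lin_add[OF l] lin_smult[OF l] simp del: R_simps)
  show "module K R"
    by (rule module_cong[OF submodule.submodule_is_module[OF sub TT_mod]]) (auto simp: smash_def Let_def)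
  show "bil K R R R (mult R)"
    by (intro bilI linI) (auto simp: R_mem lin_add[OF bilD(1)[OF sm_bil]] lin_add[OF bilD(2)[OF sm_bil]]
       lin_smult[OF bilD(1)[OF sm_bil]] lin_smult[OF bilD(2)[OF sm_bil]] sm_assoc simp del: R_simps(1))
qed (auto simp: R_mem sm_assoc ee_left simp del: R_simps(1))

subsection \<open>Generators and relations of the partial smash product\<close>

lemma R_alg [simp, intro!]: "assoc_algebra K R" by (rule smash_algebra)
lemma R_mod [simp, intro!]: "module K R" by (rule assoc_algebra_module[OF R_alg])

abbreviation rmul (infixl "\<star>" 70) where "a \<star> b \<equiv> a \<otimes>\<^bsub>R\<^esub> b"
abbreviation "inA a \<equiv> smash_elt K H A act a \<one>"
abbreviation "inH h \<equiv> smash_elt K H A act \<one>\<^bsub>A\<^esub> h"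

lemma smash_elt_eq:
  assumes [simp]: "a \<in> carrier A" "h \<in> carrier H" shows "smash_elt K H A act a h = tn a h \<odot>\<odot> ee"
  by (simp add: smash_elt_def sm_tn)

lemma smash_elt_TT: "a \<in> carrier A \<Longrightarrow> h \<in> carrier H \<Longrightarrow>
    smash_elt K H A act a h = sw TT (\<lambda>x y. tn (a \<bullet> act x \<one>\<^bsub>A\<^esub>) y) h"
  by (simp add: smash_elt_def)

lemma smash_elt_closed [simp]: "a \<in> carrier A \<Longrightarrow> h \<in> carrier H \<Longrightarrow> smash_elt K H A act a h \<in> carrier R"
  by (simp add: smash_elt_eq)

lemma smash_elt_lin1: "lin K V A f \<Longrightarrow> h \<in> carrier H \<Longrightarrow> lin K V R (\<lambda>v. smash_elt K H A act (f v) h)"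
proof -
  assume f: "lin K V A f" and h [simp]: "h \<in> carrier H"
  have "lin K A TT (\<lambda>a. smash_elt K H A act a h)" unfolding smash_elt_def by (auto intro!: lin_intros)
  then have "lin K A R (\<lambda>a. smash_elt K H A act a h)" by (auto simp: lin_def simp del: R_simps(1))
  from lin_compose[OF this f] show ?thesis .
qed

lemma smash_elt_lin2: "lin K V H f \<Longrightarrow> a \<in> carrier A \<Longrightarrow> lin K V R (\<lambda>v. smash_elt K H A act a (f v))"
proof -
  assume f: "lin K V H f" and a [simp]: "a \<in> carrier A"
  have "lin K H TT (\<lambda>h. smash_elt K H A act a h)" unfolding smash_elt_def by (auto intro!: lin_intros)
  then have "lin K H R (\<lambda>h. smash_elt K H A act a h)" by (auto simp: lin_def simp del: R_simps(1))
  from lin_compose[OF this f] show ?thesis .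
qed

lemmas [lin_intros] = smash_elt_lin1 smash_elt_lin2

lemma R_TT: "r \<in> carrier R \<Longrightarrow> r \<in> carrier TT" using R_mem by blast

lemma sw_R: "(\<And>x y. x \<in> carrier H \<Longrightarrow> y \<in> carrier H \<Longrightarrow> f x y \<in> carrier R) \<Longrightarrow> h \<in> carrier H \<Longrightarrow>
    sw R f h = sw TT f h"
proof -
  assume f: "\<And>x y. x \<in> carrier H \<Longrightarrow> y \<in> carrier H \<Longrightarrow> f x y \<in> carrier R" and h: "h \<in> carrier H"
  have il: "lin K R TT (\<lambda>x. x)" by (rule linI) (auto simp: R_TT simp del: R_simps(1))
  show ?thesis by (rule sw_push[OF il R_mod TT_mod f h])
qed

lemma inA_eq: "a \<in> carrier A \<Longrightarrow> inA a = tn a \<one>"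
  by (simp add: smash_elt_eq sm_tn_one)

lemma inA_mult: "a \<in> carrier A \<Longrightarrow> b \<in> carrier A \<Longrightarrow> inA a \<star> inA b = inA (a \<bullet> b)"
  by (simp add: inA_eq sm_tn_one)

lemma inA_one: "inA \<one>\<^bsub>A\<^esub> = \<one>\<^bsub>R\<^esub>" by (simp add: inA_eq)

lemma inA_inH:
  assumes [simp]: "a \<in> carrier A" "h \<in> carrier H" shows "inA a \<star> inH h = smash_elt K H A act a h"
proof -
  have "inA a \<star> inH h = tn a \<one> \<odot>\<odot> tn \<one>\<^bsub>A\<^esub> h \<odot>\<odot> ee" by (simp add: inA_eq smash_elt_eq sm_assoc ee_left)
  then show ?thesis by (simp add: sm_tn_one smash_elt_eq)
qed

text \<open>
  In \<open>A \<otimes> H\<close> the product is \<open>(h_1 \<cdot> a) \<otimes> h_2\<close>. On the right-hand side the smash element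
  contributes the additional factor \<open>h_2 \<cdot> 1\<close>, which \<open>h_1 \<cdot> a\<close> absorbs.
\<close>

lemma inH_inA:
  assumes [simp]: "a \<in> carrier A" "h \<in> carrier H"
  shows "inH h \<star> inA a = sw R (\<lambda>x y. inA (act x a) \<star> inH y) h"
proof -
  have "inH h \<star> inA a = tn \<one>\<^bsub>A\<^esub> h \<odot>\<odot> tn a \<one>" by (simp add: smash_elt_eq[of _ h] inA_eq sm_assoc ee_left)
  then have 1: "inH h \<star> inA a = sw TT (\<lambda>x y. tn (act x a) y) h" by (simp add: sm_tn)
  have "sw R (\<lambda>x y. inA (act x a) \<star> inH y) h = sw TT (\<lambda>x y. sw TT (\<lambda>u v. tn (act x a \<bullet> act u \<one>\<^bsub>A\<^esub>) v) y) h"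
    by (subst sw_R) (simp_all add: inA_inH del: R_simps, simp add: smash_elt_TT)
  also have "\<dots> = sw TT (\<lambda>x y. sw TT (\<lambda>u v. tn (act u a \<bullet> act v \<one>\<^bsub>A\<^esub>) y) x) h"
    by (rule sw_assoc[symmetric]) (auto intro!: lin_intros)
  also have "\<dots> = sw TT (\<lambda>x y. tn (sw A (\<lambda>u v. act u a \<bullet> act v \<one>\<^bsub>A\<^esub>) x) y) h"
    by (simp add: tn_sw)
  finally show ?thesis using 1 by (simp add: act_one_right)
qed

text \<open>
  The law of partial actions turns \<open>h_1 \<cdot> (k_1 \<cdot> 1) \<otimes> h_2 k_2\<close> into \<open>(h_1 \<cdot> 1) (h_2 k_1 \<cdot> 1) \<otimes>
  h_3 k_2\<close>, and \<open>(h_2 k_1 \<cdot> 1) \<otimes> h_3 k_2\<close> is the smash element of \<open>h_2 k\<close>.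
\<close>

lemma inH_inH:
  assumes [simp]: "h \<in> carrier H" "k \<in> carrier H"
  shows "inH h \<star> inH k = sw R (\<lambda>x y. inA (act x \<one>\<^bsub>A\<^esub>) \<star> inH (y \<otimes> k)) h"
proof -
  have "inH h \<star> inH k = tn \<one>\<^bsub>A\<^esub> h \<odot>\<odot> inH k" by (simp add: smash_elt_eq sm_assoc ee_left)
  also have "\<dots> = sw TT (\<lambda>u v. sw TT (\<lambda>x y. tn (act x (act u \<one>\<^bsub>A\<^esub>)) (y \<otimes> v)) h) k"
    by (simp add: smash_elt_TT sm_sw_left sm_tn)
  also have "\<dots> = sw TT (\<lambda>u v. sw TT (\<lambda>x y. sw TT (\<lambda>p q. tn (act p \<one>\<^bsub>A\<^esub> \<bullet> act (q \<otimes> u) \<one>\<^bsub>A\<^esub>) (y \<otimes> v)) x) h) k"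
    by (simp add: PA.act_act tn_sw)
  also have "\<dots> = sw TT (\<lambda>u v. sw TT (\<lambda>x y. sw TT (\<lambda>p q. tn (act x \<one>\<^bsub>A\<^esub> \<bullet> act (p \<otimes> u) \<one>\<^bsub>A\<^esub>) (q \<otimes> v)) y) h) k"
    by (intro sw_congruence[OF refl] sw_assoc) (auto intro!: lin_intros)
  also have "\<dots> = sw TT (\<lambda>x y. sw TT (\<lambda>u v. sw TT (\<lambda>p q. tn (act x \<one>\<^bsub>A\<^esub> \<bullet> act (p \<otimes> u) \<one>\<^bsub>A\<^esub>) (q \<otimes> v)) y) k) h"
    by (rule sw_swap) auto
  also have "\<dots> = sw TT (\<lambda>x y. sw TT (\<lambda>p q. sw TT (\<lambda>u v. tn (act x \<one>\<^bsub>A\<^esub> \<bullet> act (p \<otimes> u) \<one>\<^bsub>A\<^esub>) (q \<otimes> v)) k) y) h"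
    by (rule sw_congruence[OF refl], simp, rule sw_swap) auto
  also have "\<dots> = sw TT (\<lambda>x y. sw TT (\<lambda>p q. tn (act x \<one>\<^bsub>A\<^esub> \<bullet> act p \<one>\<^bsub>A\<^esub>) q) (y \<otimes> k)) h"
    by (intro sw_congruence[OF refl] sw_mult[symmetric]) (auto intro!: lin_intros)
  also have "\<dots> = sw R (\<lambda>x y. inA (act x \<one>\<^bsub>A\<^esub>) \<star> inH (y \<otimes> k)) h"
    by (subst sw_R) (simp_all add: inA_inH del: R_simps, simp add: smash_elt_TT)
  finally show ?thesis .
qed

lemma inH_one: "inH \<one> = \<one>\<^bsub>R\<^esub>" by (simp add: inA_one)

lemma R_induct [consumes 1, case_names elt zero add smult]:
  assumes r: "r \<in> carrier R" and elt: "\<And>a h. a \<in> carrier A \<Longrightarrow> h \<in> carrier H \<Longrightarrow> Pr (inA a \<star> inH h)"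
    and zero: "Pr \<zero>\<^bsub>R\<^esub>"
    and add: "\<And>r s. r \<in> carrier R \<Longrightarrow> s \<in> carrier R \<Longrightarrow> Pr r \<Longrightarrow> Pr s \<Longrightarrow> Pr (r \<oplus>\<^bsub>R\<^esub> s)"
    and smult: "\<And>c r. c \<in> carrier K \<Longrightarrow> r \<in> carrier R \<Longrightarrow> Pr r \<Longrightarrow> Pr (c \<odot>\<^bsub>R\<^esub> r)"
  shows "Pr r"
proof -
  note l = bilD(1)[OF sm_bil, of ee]
  obtain t where t: "t \<in> carrier TT" "r = t \<odot>\<odot> ee" using r by auto
  from t(1) have "Pr (t \<odot>\<odot> ee)"
  proof (induction rule: AH.T_induct)
    case (tns a h)
    then have "inA a \<star> inH h = tn a h \<odot>\<odot> ee" by (simp only: inA_inH smash_elt_eq)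
    then show ?case using elt[OF tns] by (simp only:)
  next
    case zero
    then show ?case using assms(3) lin_zero[OF TT_mod TT_mod l] by simp
  next
    case (add s t)
    then show ?case using assms(4)[of "s \<odot>\<odot> ee" "t \<odot>\<odot> ee"] lin_add[OF l] by auto
  next
    case (smult c s)
    then show ?case using assms(5)[of c "s \<odot>\<odot> ee"] lin_smult[OF l] by auto
  qed
  then show ?thesis by (simp add: t(2))
qed

declare R_simps [simp del]

lemmas rmul_sw_left = sw_alg_left[OF R_alg] and rmul_sw_right = sw_alg_right[OF R_alg]

lemma inA_sw: "\<lbrakk>\<And>x y. x \<in> carrier H \<Longrightarrow> y \<in> carrier H \<Longrightarrow> f x y \<in> carrier A; k \<in> carrier H\<rbrakk> \<Longrightarrow>
    inA (sw A f k) = sw R (\<lambda>x y. inA (f x y)) k"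
  by (rule sw_push[where g = "\<lambda>t. inA t"]) (auto intro!: lin_intros)

interpretation Ra: assoc_algebra K R by (rule R_alg)

lemma inA_inA: "a \<in> carrier A \<Longrightarrow> b \<in> carrier A \<Longrightarrow> r \<in> carrier R \<Longrightarrow> inA a \<star> (inA b \<star> r) = inA (a \<bullet> b) \<star> r"
  by (simp add: Ra.A.m_assoc[symmetric] inA_mult)

lemma inH_sum: "h \<in> carrier H \<Longrightarrow> sw R (\<lambda>x y. inA (act x \<one>\<^bsub>A\<^esub>) \<star> inH y) h = inH h"
  using inH_inA[of "\<one>\<^bsub>A\<^esub>" h] by (simp add: inA_one)

text \<open>
  The previous product rule gives \<open>(h_1 \<cdot> 1) # h_2 S(h_3)\<close>, which contracts.
\<close>

lemma smash_e:
  assumes [simp]: "h \<in> carrier H" shows "sw R (\<lambda>x y. inH x \<star> inH (S y)) h = inA (act h \<one>\<^bsub>A\<^esub>)"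
proof -
  have "sw R (\<lambda>x y. inH x \<star> inH (S y)) h = sw R (\<lambda>x y. sw R (\<lambda>u v. inA (act u \<one>\<^bsub>A\<^esub>) \<star> inH (v \<otimes> S y)) x) h"
    by (simp add: inH_inH)
  also have "\<dots> = sw R (\<lambda>x y. sw R (\<lambda>u v. inA (act x \<one>\<^bsub>A\<^esub>) \<star> inH (u \<otimes> S v)) y) h"
    by (rule sw_assoc) (auto intro!: lin_intros)
  also have "\<dots> = inA (act h \<one>\<^bsub>A\<^esub>) \<star> inH \<one>"
    by (rule sw_cancel_right) (auto intro!: lin_intros)
  finally show ?thesis by (simp add: inA_one)
qed

text \<open>
  In the first relation both sides equal \<open>(h_1 k \<cdot> 1) # h_2\<close>; the left-hand side becomes \<open>(1 #
  h) ((k \<cdot> 1) # 1)\<close>, to which the symmetric form of the law of partial actions applies. In the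
  second relation both sides equal \<open>(h \<cdot> 1) # k\<close>.
\<close>

lemma smash_partial_representation: "partial_representation K H R (smash_elt K H A act \<one>\<^bsub>A\<^esub>)"
proof (intro partial_representation.intro partial_representation_axioms.intro)
  show "cocommutative_hopf_algebra K H" by (rule cocommutative_hopf_algebra_axioms)
  show "assoc_algebra K R" by (rule R_alg)
  show "lin K H R (smash_elt K H A act \<one>\<^bsub>A\<^esub>)" by (auto intro!: lin_intros)
  show "inH \<one> = \<one>\<^bsub>R\<^esub>" by (rule inH_one)
  fix h k assume [simp]: "h \<in> carrier H" "k \<in> carrier H"
  have "sw R (\<lambda>x y. inH h \<star> (inH x \<star> inH (S y))) k = inH h \<star> inA (act k \<one>\<^bsub>A\<^esub>)"
    by (simp add: rmul_sw_left[symmetric] smash_e)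
  also have "\<dots> = sw R (\<lambda>x y. sw R (\<lambda>u v. inA (act (u \<otimes> k) \<one>\<^bsub>A\<^esub>) \<star> (inA (act v \<one>\<^bsub>A\<^esub>) \<star> inH y)) x) h"
    by (simp add: inH_inA PA.act_act_sym inA_sw rmul_sw_right inA_inA)
  also have "\<dots> = sw R (\<lambda>x y. sw R (\<lambda>u v. inA (act (x \<otimes> k) \<one>\<^bsub>A\<^esub>) \<star> (inA (act u \<one>\<^bsub>A\<^esub>) \<star> inH v)) y) h"
    by (rule sw_assoc) (auto intro!: lin_intros)
  also have "\<dots> = sw R (\<lambda>x y. inA (act (x \<otimes> k) \<one>\<^bsub>A\<^esub>) \<star> inH y) h"
    by (simp add: rmul_sw_left[symmetric] inH_sum)
  finally have L: "sw R (\<lambda>x y. inH h \<star> (inH x \<star> inH (S y))) k = sw R (\<lambda>x y. inA (act (x \<otimes> k) \<one>\<^bsub>A\<^esub>) \<star> inH y) h" .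
  have "sw R (\<lambda>x y. inH (h \<otimes> x) \<star> inH (S y)) k =
      sw R (\<lambda>x y. sw R (\<lambda>p q. sw R (\<lambda>u v. inA (act (p \<otimes> u) \<one>\<^bsub>A\<^esub>) \<star> inH (q \<otimes> v \<otimes> S y)) x) h) k"
  proof (rule sw_congruence[OF refl])
    fix x y assume [simp]: "x \<in> carrier H" "y \<in> carrier H"
    have "inH (h \<otimes> x) \<star> inH (S y) = sw R (\<lambda>p q. inA (act p \<one>\<^bsub>A\<^esub>) \<star> inH (q \<otimes> S y)) (h \<otimes> x)"
      by (simp add: inH_inH)
    also have "\<dots> = sw R (\<lambda>p q. sw R (\<lambda>u v. inA (act (p \<otimes> u) \<one>\<^bsub>A\<^esub>) \<star> inH (q \<otimes> v \<otimes> S y)) x) h"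
      by (rule sw_mult) (auto intro!: lin_intros)
    finally show "inH (h \<otimes> x) \<star> inH (S y) = sw R (\<lambda>p q. sw R (\<lambda>u v. inA (act (p \<otimes> u) \<one>\<^bsub>A\<^esub>) \<star> inH (q \<otimes> v \<otimes> S y)) x) h" .
  qed auto
  also have "\<dots> = sw R (\<lambda>p q. sw R (\<lambda>x y. sw R (\<lambda>u v. inA (act (p \<otimes> u) \<one>\<^bsub>A\<^esub>) \<star> inH (q \<otimes> v \<otimes> S y)) x) k) h"
    by (rule sw_swap) auto
  also have "\<dots> = sw R (\<lambda>p q. sw R (\<lambda>x y. sw R (\<lambda>u v. inA (act (p \<otimes> x) \<one>\<^bsub>A\<^esub>) \<star> inH (q \<otimes> (u \<otimes> S v))) y) k) h"
    by (simp add: A.m_assoc) (intro sw_congruence[OF refl] sw_assoc; auto intro!: lin_intros)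
  also have "\<dots> = sw R (\<lambda>p q. inA (act (p \<otimes> k) \<one>\<^bsub>A\<^esub>) \<star> inH (q \<otimes> \<one>)) h"
    by (rule sw_congruence[OF refl], simp, rule sw_cancel_right) (auto intro!: lin_intros)
  finally show "sw R (\<lambda>x y. inH h \<star> (inH x \<star> inH (S y))) k = sw R (\<lambda>x y. inH (h \<otimes> x) \<star> inH (S y)) k"
    using L by simp
  have "sw R (\<lambda>x y. inH x \<star> (inH (S y) \<star> inH k)) h = sw R (\<lambda>x y. inH x \<star> inH (S y)) h \<star> inH k"
    by (simp add: rmul_sw_right Ra.A.m_assoc)
  then have L: "sw R (\<lambda>x y. inH x \<star> (inH (S y) \<star> inH k)) h = inA (act h \<one>\<^bsub>A\<^esub>) \<star> inH k" by (simp add: smash_e)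
  have "sw R (\<lambda>x y. inH x \<star> inH (S y \<otimes> k)) h = sw R (\<lambda>x y. sw R (\<lambda>u v. inA (act u \<one>\<^bsub>A\<^esub>) \<star> inH (v \<otimes> (S y \<otimes> k))) x) h"
    by (simp add: inH_inH)
  also have "\<dots> = sw R (\<lambda>x y. sw R (\<lambda>u v. inA (act x \<one>\<^bsub>A\<^esub>) \<star> inH (u \<otimes> (S v \<otimes> k))) y) h"
    by (rule sw_assoc) (auto intro!: lin_intros)
  also have "\<dots> = sw R (\<lambda>x y. sw R (\<lambda>u v. inA (act x \<one>\<^bsub>A\<^esub>) \<star> inH (u \<otimes> S v \<otimes> k)) y) h"
    by (simp add: A.m_assoc)
  also have "\<dots> = inA (act h \<one>\<^bsub>A\<^esub>) \<star> inH (\<one> \<otimes> k)"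
    by (rule sw_cancel_right[where f = "\<lambda>x t. inA (act x \<one>\<^bsub>A\<^esub>) \<star> inH (t \<otimes> k)"]) (auto intro!: lin_intros)
  finally show "sw R (\<lambda>x y. inH x \<star> (inH (S y) \<star> inH k)) h = sw R (\<lambda>x y. inH x \<star> inH (S y \<otimes> k)) h"
    using L by simp
qed

sublocale SR: partial_representation K H R "smash_elt K H A act \<one>\<^bsub>A\<^esub>"
  by (rule smash_partial_representation)

lemma SR_e: "h \<in> carrier H \<Longrightarrow> SR.e h = inA (act h \<one>\<^bsub>A\<^esub>)"
  by (simp add: SR.e_def smash_e)

text \<open>
  The left-hand side is \<open>h_1 \<cdot> (S(h_3) \<cdot> a) # h_2\<close>. By the symmetric form of the law of partial
  actions and absorption of the factor with \<open>1\<close> it becomes \<open>(h_1 S(h_3) \<cdot> a) # h_2\<close>, which by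
  cocommutativity is \<open>(h_1 S(h_2) \<cdot> a) # h_3\<close> and contracts to \<open>a # h\<close>.
\<close>

lemma inH_inA_antipode:
  assumes [simp]: "h \<in> carrier H" "a \<in> carrier A"
  shows "sw R (\<lambda>x y. inH x \<star> inA (act (S y) a)) h = inA a \<star> inH h"
proof -
  have "sw R (\<lambda>x y. inH x \<star> inA (act (S y) a)) h =
      sw R (\<lambda>x y. sw R (\<lambda>p q. sw R (\<lambda>u v. inA (act (u \<otimes> S y) a) \<star> (inA (act v \<one>\<^bsub>A\<^esub>) \<star> inH q)) p) x) h"
    by (simp add: inH_inA PA.act_act_sym inA_sw rmul_sw_right inA_inA)
  also have "\<dots> = sw R (\<lambda>x y. sw R (\<lambda>p q. sw R (\<lambda>u v. inA (act (p \<otimes> S y) a) \<star> (inA (act u \<one>\<^bsub>A\<^esub>) \<star> inH v)) q) x) h"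
    by (intro sw_congruence[OF refl] sw_assoc) (auto intro!: lin_intros)
  also have "\<dots> = sw R (\<lambda>x y. sw R (\<lambda>p q. inA (act (p \<otimes> S y) a) \<star> inH q) x) h"
    by (simp add: rmul_sw_left[symmetric] inH_sum)
  also have "\<dots> = sw R (\<lambda>x y. sw R (\<lambda>p q. inA (act (x \<otimes> S q) a) \<star> inH p) y) h"
    by (rule sw_assoc) (auto intro!: lin_intros)
  also have "\<dots> = sw R (\<lambda>x y. sw R (\<lambda>p q. inA (act (x \<otimes> S p) a) \<star> inH q) y) h"
    by (intro sw_congruence[OF refl] sw_comm) (auto intro!: lin_intros)
  also have "\<dots> = sw R (\<lambda>x y. sw R (\<lambda>p q. inA (act (p \<otimes> S q) a) \<star> inH y) x) h"
    by (rule sw_assoc[symmetric]) (auto intro!: lin_intros)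
  also have "\<dots> = sw R (\<lambda>x y. \<epsilon> x \<odot>\<^bsub>R\<^esub> (inA (act \<one> a) \<star> inH y)) h"
    by (intro sw_congruence[OF refl] sw_antipode_right[where f = "\<lambda>t. inA (act t a) \<star> inH _"]) (auto intro!: lin_intros)
  also have "\<dots> = inA (act \<one> a) \<star> inH h"
    by (rule sw_counit_left) (auto intro!: lin_intros)
  finally show ?thesis by simp
qed

end

section \<open>Hom functors\<close>

lemma module_left_module: "module K V \<Longrightarrow> left_module K V"
proof -
  assume "module K V"
  then interpret V: module K V .
  show ?thesis
    by (intro left_module.intro left_module_axioms.intro V.R.ring_axioms V.M.abelian_group_axioms)
      (auto simp: V.smult_l_distr V.smult_r_distr V.smult_assoc1)
qed

lemma mod_homI:
  assumes "f \<in> extensional (carrier X)" "\<And>x. x \<in> carrier X \<Longrightarrow> f x \<in> carrier M"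
    "\<And>x y. x \<in> carrier X \<Longrightarrow> y \<in> carrier X \<Longrightarrow> f (x \<oplus>\<^bsub>X\<^esub> y) = f x \<oplus>\<^bsub>M\<^esub> f y"
    "\<And>r x. r \<in> carrier R \<Longrightarrow> x \<in> carrier X \<Longrightarrow> f (r \<odot>\<^bsub>X\<^esub> x) = r \<odot>\<^bsub>M\<^esub> f x"
  shows "f \<in> mod_hom R X M"
  using assms by (auto simp: mod_hom_def PiE_def)

lemma mod_homD:
  assumes "f \<in> mod_hom R X M"
  shows "f \<in> extensional (carrier X)" "x \<in> carrier X \<Longrightarrow> f x \<in> carrier M"
    "x \<in> carrier X \<Longrightarrow> y \<in> carrier X \<Longrightarrow> f (x \<oplus>\<^bsub>X\<^esub> y) = f x \<oplus>\<^bsub>M\<^esub> f y"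
    "r \<in> carrier R \<Longrightarrow> x \<in> carrier X \<Longrightarrow> f (r \<odot>\<^bsub>X\<^esub> x) = r \<odot>\<^bsub>M\<^esub> f x"
  using assms by (auto simp: mod_hom_def PiE_def)

lemma mod_hom_outside: "f \<in> mod_hom R X M \<Longrightarrow> x \<notin> carrier X \<Longrightarrow> f x = undefined"
  using mod_homD(1)[of f R X M] by (auto simp: extensional_def)

lemma mod_hom_base_lin:
  assumes R: "assoc_algebra K R" and f: "f \<in> mod_hom R X M"
  shows "lin K (base_module R X) (base_module R M) f"
proof -
  interpret R: assoc_algebra K R by fact
  show ?thesis by (rule linI) (auto simp: mod_homD[OF f])
qed

lemma hom_module_simps [simp]:
  "carrier (hom_module R X M) = mod_hom R X M" "\<zero>\<^bsub>hom_module R X M\<^esub> = (\<lambda>x\<in>carrier X. \<zero>\<^bsub>M\<^esub>)"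
  "f \<oplus>\<^bsub>hom_module R X M\<^esub> g = (\<lambda>x\<in>carrier X. f x \<oplus>\<^bsub>M\<^esub> g x)"
  "c \<odot>\<^bsub>hom_module R X M\<^esub> f = (\<lambda>x\<in>carrier X. (c \<odot>\<^bsub>R\<^esub> \<one>\<^bsub>R\<^esub>) \<odot>\<^bsub>M\<^esub> f x)"
  by (simp_all add: hom_module_def)

lemma hom_module_is_module:
  assumes R: "assoc_algebra K R" and X: "left_module R X" and M: "left_module R M"
  shows "module K (hom_module R X M)"
proof -
  interpret R: assoc_algebra K R by fact
  interpret X: left_module R X by fact
  interpret M: left_module R M by fact
  interpret P: module K "base_module R M" by (rule base_module_is_module[OF R M])
  have cl: "x \<oplus>\<^bsub>X\<^esub> y \<in> carrier X" "r \<odot>\<^bsub>X\<^esub> x \<in> carrier X"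
    if "x \<in> carrier X" "y \<in> carrier X" "r \<in> carrier R" for x y r
    using that X.smult_closed by auto
  \<comment> \<open>Multiples of \<open>1\<close> are central in \<open>R\<close>, so a scalar multiple of a homomorphism is again linear.\<close>
  have central: "(c \<odot>\<^bsub>R\<^esub> \<one>\<^bsub>R\<^esub>) \<odot>\<^bsub>M\<^esub> (r \<odot>\<^bsub>M\<^esub> m) = r \<odot>\<^bsub>M\<^esub> ((c \<odot>\<^bsub>R\<^esub> \<one>\<^bsub>R\<^esub>) \<odot>\<^bsub>M\<^esub> m)"
    if "c \<in> carrier K" "r \<in> carrier R" "m \<in> carrier M" for c r m
    using that by (simp add: M.smult_assoc[symmetric] R.smult_mult_left R.smult_mult_right)
  let ?H = "hom_module R X M"
  have addc: "f \<oplus>\<^bsub>?H\<^esub> g \<in> carrier ?H" if "f \<in> carrier ?H" "g \<in> carrier ?H" for f g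
  proof -
    have f: "f \<in> mod_hom R X M" and g: "g \<in> mod_hom R X M" using that by auto
    show ?thesis unfolding hom_module_simps
      by (rule mod_homI) (auto simp: cl mod_homD(2-)[OF f] mod_homD(2-)[OF g] M.smult_r_distr M.M.a_ac)
  qed
  have smc: "c \<odot>\<^bsub>?H\<^esub> f \<in> carrier ?H" if "f \<in> carrier ?H" "c \<in> carrier K" for f c
  proof -
    have f: "f \<in> mod_hom R X M" using that by auto
    show ?thesis unfolding hom_module_simps
      by (rule mod_homI)
        (use that in \<open>auto simp: cl mod_homD(2-)[OF f] M.smult_closed M.smult_r_distr central\<close>)
  qed
  have r0: "r \<odot>\<^bsub>M\<^esub> \<zero>\<^bsub>M\<^esub> = \<zero>\<^bsub>M\<^esub>" if "r \<in> carrier R" for r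
    using lin_zero[OF P.module_axioms P.module_axioms bilD(2)[OF base_module_bilinear[OF R M]]] that by simp
  have z: "\<zero>\<^bsub>?H\<^esub> \<in> carrier ?H" unfolding hom_module_simps
    by (rule mod_homI) (auto simp: cl r0)
  show ?thesis
  proof (rule moduleI)
    show "cring K" by (rule R.R.is_cring)
    show "abelian_group ?H"
    proof (rule abelian_groupI)
      fix f assume f': "f \<in> carrier ?H"
      then have f: "f \<in> mod_hom R X M" by simp
      have "(\<ominus>\<^bsub>K\<^esub> \<one>\<^bsub>K\<^esub>) \<odot>\<^bsub>?H\<^esub> f \<oplus>\<^bsub>?H\<^esub> f = \<zero>\<^bsub>?H\<^esub>"
      proof -
        have "((\<ominus>\<^bsub>K\<^esub> \<one>\<^bsub>K\<^esub>) \<odot>\<^bsub>R\<^esub> \<one>\<^bsub>R\<^esub>) \<odot>\<^bsub>M\<^esub> m \<oplus>\<^bsub>M\<^esub> m = \<zero>\<^bsub>M\<^esub>" if "m \<in> carrier M" for m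
          using P.smult_l_distr[of "\<ominus>\<^bsub>K\<^esub> \<one>\<^bsub>K\<^esub>" "\<one>\<^bsub>K\<^esub>" m] P.smult_l_null[of m] P.smult_one[of m] that
          by (simp add: R.R.l_neg del: P.smult_l_null)
        then show ?thesis by (auto simp: mod_homD(2)[OF f] fun_eq_iff)
      qed
      then show "\<exists>g\<in>carrier ?H. g \<oplus>\<^bsub>?H\<^esub> f = \<zero>\<^bsub>?H\<^esub>"
        using smc[OF f', of "\<ominus>\<^bsub>K\<^esub> \<one>\<^bsub>K\<^esub>"] by (intro bexI) auto
      show "\<zero>\<^bsub>?H\<^esub> \<oplus>\<^bsub>?H\<^esub> f = f"
        using mod_homD(1,2)[OF f] by (auto simp: fun_eq_iff extensional_def)
    qed (auto simp: addc[simplified] z[simplified] fun_eq_iff M.M.a_ac mod_homD(2))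
    fix a f assume a: "a \<in> carrier K" and "f \<in> carrier ?H"
    then have f: "f \<in> mod_hom R X M" by simp
    note fc = mod_homD(2)[OF f]
    show "a \<odot>\<^bsub>?H\<^esub> f \<in> carrier ?H" using smc a f by simp
    show "(a \<oplus>\<^bsub>K\<^esub> b) \<odot>\<^bsub>?H\<^esub> f = a \<odot>\<^bsub>?H\<^esub> f \<oplus>\<^bsub>?H\<^esub> b \<odot>\<^bsub>?H\<^esub> f" if "b \<in> carrier K" for b
      using P.smult_l_distr[OF a that] fc by (auto simp: fun_eq_iff)
    show "(a \<otimes>\<^bsub>K\<^esub> b) \<odot>\<^bsub>?H\<^esub> f = a \<odot>\<^bsub>?H\<^esub> (b \<odot>\<^bsub>?H\<^esub> f)" if "b \<in> carrier K" for b
      using P.smult_assoc1[OF a that] fc by (auto simp: fun_eq_iff)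
    show "a \<odot>\<^bsub>?H\<^esub> (f \<oplus>\<^bsub>?H\<^esub> g) = a \<odot>\<^bsub>?H\<^esub> f \<oplus>\<^bsub>?H\<^esub> a \<odot>\<^bsub>?H\<^esub> g" if "g \<in> carrier ?H" for g
    proof -
      have g: "g \<in> mod_hom R X M" using that by simp
      show ?thesis using P.smult_r_distr[OF a] fc mod_homD(2)[OF g] by (auto simp: fun_eq_iff)
    qed
  next
    fix f assume "f \<in> carrier ?H"
    then have f: "f \<in> mod_hom R X M" by simp
    show "\<one>\<^bsub>K\<^esub> \<odot>\<^bsub>?H\<^esub> f = f"
    proof
      fix x show "(\<one>\<^bsub>K\<^esub> \<odot>\<^bsub>?H\<^esub> f) x = f x"
        using P.smult_one[of "f x"] mod_homD(2)[OF f, of x] mod_hom_outside[OF f, of x]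
        by (cases "x \<in> carrier X") simp_all
    qed
  qed
qed

lemma mod_hom_compose:
  assumes X: "left_module R X" and f: "f \<in> mod_hom R M N" and g: "g \<in> mod_hom R X M"
  shows "compose (carrier X) f g \<in> mod_hom R X N"
proof -
  interpret X: left_module R X by fact
  show ?thesis
    by (rule mod_homI)
      (auto simp: compose_def mod_homD(2-)[OF f] mod_homD(2-)[OF g] X.smult_closed)
qed

lemma Hom_functor_is_mod_functor:
  assumes R: "assoc_algebra K R" and X: "left_module R X"
  shows "is_mod_functor R K (Hom_functor R X)"
proof -
  interpret R: assoc_algebra K R by fact
  note comp = mod_hom_compose[OF X]
  show ?thesis unfolding is_mod_functor_def Hom_functor_def fst_conv snd_conv
  proof (intro conjI allI impI ballI)
    fix M assume M: "left_module R M"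
    show "left_module K (hom_module R X M)"
      by (rule module_left_module[OF hom_module_is_module[OF R X M]])
    show "(\<lambda>g\<in>mod_hom R X M. compose (carrier X) (\<lambda>x\<in>carrier M. x) g) = (\<lambda>x\<in>carrier (hom_module R X M). x)"
    proof -
      have "compose (carrier X) (\<lambda>x\<in>carrier M. x) g = g" if "g \<in> mod_hom R X M" for g
        using mod_homD(1,2)[OF that] by (auto simp: compose_def fun_eq_iff extensional_def)
      then show ?thesis by (auto simp: fun_eq_iff)
    qed
  next
    fix M N f assume M: "left_module R M" and N: "left_module R N" and f: "f \<in> mod_hom R M N"
    interpret M: left_module R M by fact
    show "(\<lambda>g\<in>mod_hom R X M. compose (carrier X) f g) \<in> mod_hom K (hom_module R X M) (hom_module R X N)"
    proof (rule mod_homI)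
      interpret HM: module K "hom_module R X M" by (rule hom_module_is_module[OF R X M])
      fix g assume g: "g \<in> carrier (hom_module R X M)"
      then show "(\<lambda>g\<in>mod_hom R X M. compose (carrier X) f g) g \<in> carrier (hom_module R X N)"
        using comp[OF f] by simp
      fix g' assume g': "g' \<in> carrier (hom_module R X M)"
      have "g \<oplus>\<^bsub>hom_module R X M\<^esub> g' \<in> mod_hom R X M" using HM.M.a_closed[OF g g'] by simp
      then show "(\<lambda>g\<in>mod_hom R X M. compose (carrier X) f g) (g \<oplus>\<^bsub>hom_module R X M\<^esub> g') =
          (\<lambda>g\<in>mod_hom R X M. compose (carrier X) f g) g \<oplus>\<^bsub>hom_module R X N\<^esub> (\<lambda>g\<in>mod_hom R X M. compose (carrier X) f g) g'"
        using g g' by (auto simp: compose_def fun_eq_iff mod_homD(3)[OF f] mod_homD(2))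
    next
      interpret HM: module K "hom_module R X M" by (rule hom_module_is_module[OF R X M])
      fix c g assume c: "c \<in> carrier K" and g: "g \<in> carrier (hom_module R X M)"
      have "c \<odot>\<^bsub>hom_module R X M\<^esub> g \<in> mod_hom R X M" using HM.smult_closed[OF c g] by simp
      then show "(\<lambda>g\<in>mod_hom R X M. compose (carrier X) f g) (c \<odot>\<^bsub>hom_module R X M\<^esub> g) =
          c \<odot>\<^bsub>hom_module R X N\<^esub> (\<lambda>g\<in>mod_hom R X M. compose (carrier X) f g) g"
        using c g by (auto simp: compose_def fun_eq_iff mod_homD(4)[OF f] mod_homD(2))
    qed (simp add: extensional_def)
  next
    fix L M N f g assume f: "f \<in> mod_hom R L M" and g: "g \<in> mod_hom R M N"
    show "(\<lambda>h\<in>mod_hom R X L. compose (carrier X) (compose (carrier L) g f) h) =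
      compose (carrier (hom_module R X L)) (\<lambda>h\<in>mod_hom R X M. compose (carrier X) g h) (\<lambda>h\<in>mod_hom R X L. compose (carrier X) f h)"
      using comp[OF f] by (auto simp: compose_def fun_eq_iff mod_homD(2) restrict_def)
  qed
qed

section \<open>Bimodules\<close>

locale enveloping_algebra = Al: assoc_algebra K A
  for K :: "'k ring" and A :: "('k, 'a) module"
begin

abbreviation "E \<equiv> env_alg K A"
abbreviation "et \<equiv> env_tensor K A"

sublocale ET: two_algebras K A "opp_alg A"
  by (simp add: two_algebras_def Al.assoc_algebra_axioms opp_alg_algebra)

lemma E_eq: "E = tensor_alg K A (opp_alg A)" by (simp add: env_alg_def)
lemma et_eq: "et a b = ET.tns a b" by (simp add: env_tensor_def)

lemma E_alg: "assoc_algebra K E" unfolding E_eq by (rule ET.T_algebra)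
lemma E_mod: "module K E" by (rule assoc_algebra_module[OF E_alg])

lemma E_carrier: "carrier E = carrier ET.T" by (simp add: E_eq)

lemma et_closed [simp]: "a \<in> carrier A \<Longrightarrow> b \<in> carrier A \<Longrightarrow> et a b \<in> carrier E"
  using ET.tns_closed[of a b] by (simp add: et_eq E_carrier)

lemma et_lin1: "b \<in> carrier A \<Longrightarrow> lin K A E (\<lambda>a. et a b)"
  and et_lin2: "a \<in> carrier A \<Longrightarrow> lin K A E (\<lambda>b. et a b)"
  using bilD(1)[OF ET.tns_bil, of b] bilD(2)[OF ET.tns_bil, of a] by (simp_all add: et_eq E_eq)

lemma et_mult: "\<lbrakk>a \<in> carrier A; b \<in> carrier A; c \<in> carrier A; d \<in> carrier A\<rbrakk> \<Longrightarrow>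
    et a b \<otimes>\<^bsub>E\<^esub> et c d = et (a \<otimes>\<^bsub>A\<^esub> c) (d \<otimes>\<^bsub>A\<^esub> b)"
  using ET.mul_tns[of a c b d] by (simp add: et_eq E_eq)

lemma et_one: "\<one>\<^bsub>E\<^esub> = et \<one>\<^bsub>A\<^esub> \<one>\<^bsub>A\<^esub>" by (simp add: et_eq E_eq)

lemma E_ext:
  assumes "lin K E P f" "lin K E P g" "module K P"
    "\<And>a b. a \<in> carrier A \<Longrightarrow> b \<in> carrier A \<Longrightarrow> f (et a b) = g (et a b)" "t \<in> carrier E"
  shows "f t = g t"
  by (rule ET.T_ext[of P f g]) (use assms in \<open>auto simp: E_eq et_eq\<close>)

abbreviation "RB \<equiv> regular_bimodule K A"

lemma RB_simps [simp]: "carrier RB = carrier A" "x \<oplus>\<^bsub>RB\<^esub> y = x \<oplus>\<^bsub>A\<^esub> y" "\<zero>\<^bsub>RB\<^esub> = \<zero>\<^bsub>A\<^esub>"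
  by (simp_all add: regular_bimodule_def)

lemma RB_inner: "x \<in> carrier A \<Longrightarrow> bil K A (opp_alg A) A (\<lambda>a b. a \<otimes>\<^bsub>A\<^esub> x \<otimes>\<^bsub>A\<^esub> b)"
  by (rule bilI; simp; intro lin_intros Al.assoc_algebra_axioms Al.A.m_closed; assumption)

lemma RB_smult: "t \<odot>\<^bsub>RB\<^esub> x = tensor_lift K A (\<lambda>a b. a \<otimes>\<^bsub>A\<^esub> x \<otimes>\<^bsub>A\<^esub> b) t"
  by (simp add: regular_bimodule_def)

lemma RB_lin: "x \<in> carrier A \<Longrightarrow> lin K E A (\<lambda>t. t \<odot>\<^bsub>RB\<^esub> x)"
  using ET.lift_lin[OF Al.module_axioms RB_inner] by (simp add: RB_smult E_eq)

lemma RB_et: "\<lbrakk>a \<in> carrier A; b \<in> carrier A; x \<in> carrier A\<rbrakk> \<Longrightarrow> et a b \<odot>\<^bsub>RB\<^esub> x = a \<otimes>\<^bsub>A\<^esub> x \<otimes>\<^bsub>A\<^esub> b"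
  using ET.lift_tns[OF Al.module_axioms RB_inner, of x a b] by (simp add: RB_smult et_eq)

lemma RB_closed: "t \<in> carrier E \<Longrightarrow> x \<in> carrier A \<Longrightarrow> t \<odot>\<^bsub>RB\<^esub> x \<in> carrier A"
  using lin_closed[OF RB_lin] .

lemma RB_lin2: "t \<in> carrier E \<Longrightarrow> lin K A A (\<lambda>x. t \<odot>\<^bsub>RB\<^esub> x)"
  unfolding RB_smult E_carrier
  by (rule ET.lift_body_lin) (auto intro!: lin_intros Al.assoc_algebra_axioms Al.module_axioms)

lemma RB_left_module: "left_module E RB"
proof (intro left_module.intro left_module_axioms.intro)
  show "ring E" by (rule assoc_algebra_ring[OF E_alg])
  show "abelian_group RB"
  proof (rule abelian_groupI)
    fix x assume "x \<in> carrier RB"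
    then show "\<exists>y\<in>carrier RB. y \<oplus>\<^bsub>RB\<^esub> x = \<zero>\<^bsub>RB\<^esub>"
      by (intro bexI[of _ "\<ominus>\<^bsub>A\<^esub> x"]) (auto simp: Al.M.l_neg)
  qed (auto simp: Al.M.a_ac)
  show "\<one>\<^bsub>E\<^esub> \<odot>\<^bsub>RB\<^esub> x = x" if "x \<in> carrier RB" for x using that by (simp add: et_one RB_et)
  fix s t x assume s: "s \<in> carrier E" and t: "t \<in> carrier E" and "x \<in> carrier RB"
  then have x: "x \<in> carrier A" by simp
  note mb = assoc_algebra_mult_bil[OF E_alg]
  have 1: "(et a b \<otimes>\<^bsub>E\<^esub> t) \<odot>\<^bsub>RB\<^esub> x = et a b \<odot>\<^bsub>RB\<^esub> (t \<odot>\<^bsub>RB\<^esub> x)" if "a \<in> carrier A" "b \<in> carrier A" for a b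
    by (rule E_ext[where f = "\<lambda>t. (et a b \<otimes>\<^bsub>E\<^esub> t) \<odot>\<^bsub>RB\<^esub> x" and g = "\<lambda>t. et a b \<odot>\<^bsub>RB\<^esub> (t \<odot>\<^bsub>RB\<^esub> x)", OF _ _ Al.module_axioms _ t])
      (use that x in \<open>auto intro!: lin_compose[OF RB_lin[OF x] bilD(2)[OF mb]] lin_compose[OF RB_lin2 RB_lin]
         simp: et_mult RB_et Al.A.m_assoc\<close>)
  show "(s \<otimes>\<^bsub>E\<^esub> t) \<odot>\<^bsub>RB\<^esub> x = s \<odot>\<^bsub>RB\<^esub> (t \<odot>\<^bsub>RB\<^esub> x)"
    by (rule E_ext[where f = "\<lambda>s. (s \<otimes>\<^bsub>E\<^esub> t) \<odot>\<^bsub>RB\<^esub> x" and g = "\<lambda>s. s \<odot>\<^bsub>RB\<^esub> (t \<odot>\<^bsub>RB\<^esub> x)", OF _ _ Al.module_axioms _ s])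
      (use 1 t x in \<open>auto intro!: lin_compose[OF RB_lin[OF x] bilD(1)[OF mb]] RB_lin RB_closed\<close>)
qed (auto simp: RB_closed lin_add[OF RB_lin] lin_add[OF RB_lin2])

end

text \<open>
  A module over the enveloping algebra, viewed as a bimodule with \<open>a m\<close> and \<open>m a\<close> written \<open>lm a
  m\<close> and \<open>rm a m\<close>. The map \<open>orbit m\<close> sends \<open>a\<close> to \<open>a m\<close>.
\<close>

locale enveloping_module = enveloping_algebra K A + Mo: left_module "env_alg K A" M
  for K :: "'k ring" and A :: "('k, 'a) module" and M :: "(('a \<times> 'a \<Rightarrow> 'k) set, 'm) module"
begin

abbreviation "PM \<equiv> base_module E M"

lemma PM_mod: "module K PM" by (rule base_module_is_module[OF E_alg Mo.left_module_axioms])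

definition lm :: "'a \<Rightarrow> 'm \<Rightarrow> 'm" where "lm a m = et a \<one>\<^bsub>A\<^esub> \<odot>\<^bsub>M\<^esub> m"
definition rm :: "'a \<Rightarrow> 'm \<Rightarrow> 'm" where "rm a m = et \<one>\<^bsub>A\<^esub> a \<odot>\<^bsub>M\<^esub> m"

lemma lm_closed [simp]: "a \<in> carrier A \<Longrightarrow> m \<in> carrier M \<Longrightarrow> lm a m \<in> carrier M"
  and rm_closed [simp]: "a \<in> carrier A \<Longrightarrow> m \<in> carrier M \<Longrightarrow> rm a m \<in> carrier M"
  by (simp_all add: lm_def rm_def Mo.smult_closed)

lemma et_smult: "a \<in> carrier A \<Longrightarrow> b \<in> carrier A \<Longrightarrow> m \<in> carrier M \<Longrightarrow> et a b \<odot>\<^bsub>M\<^esub> m = lm a (rm b m)"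
  by (simp add: lm_def rm_def Mo.smult_assoc[symmetric] et_mult)

lemma act_bil: "bil K E PM PM (smult M)"
  by (rule base_module_bilinear[OF E_alg Mo.left_module_axioms])

lemma bimodule_laws:
  shows "bil K A PM PM lm" "bil K A PM PM rm"
    and "\<lbrakk>a \<in> carrier A; b \<in> carrier A; m \<in> carrier PM\<rbrakk> \<Longrightarrow> lm (a \<otimes>\<^bsub>A\<^esub> b) m = lm a (lm b m)"
    and "\<lbrakk>a \<in> carrier A; b \<in> carrier A; m \<in> carrier PM\<rbrakk> \<Longrightarrow> rm (a \<otimes>\<^bsub>A\<^esub> b) m = rm b (rm a m)"
    and "m \<in> carrier PM \<Longrightarrow> lm \<one>\<^bsub>A\<^esub> m = m" "m \<in> carrier PM \<Longrightarrow> rm \<one>\<^bsub>A\<^esub> m = m"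
    and "\<lbrakk>a \<in> carrier A; b \<in> carrier A; m \<in> carrier PM\<rbrakk> \<Longrightarrow> rm b (lm a m) = lm a (rm b m)"
proof -
  show "bil K A PM PM lm" unfolding lm_def
    by (intro bilI lin_compose[OF bilD(1)[OF act_bil]] bilD(2)[OF act_bil] et_lin1) auto
  show "bil K A PM PM rm" unfolding rm_def
    by (intro bilI lin_compose[OF bilD(1)[OF act_bil]] bilD(2)[OF act_bil] et_lin2) auto
qed (simp_all add: lm_def rm_def Mo.smult_assoc[symmetric] et_mult et_one[symmetric] Mo.smult_one)

lemmas lm_bil = bimodule_laws(1) and rm_bil = bimodule_laws(2)

definition center :: "'m set" where
  "center = {m \<in> carrier M. \<forall>a\<in>carrier A. lm a m = rm a m}"

lemma centerI: "m \<in> carrier M \<Longrightarrow> (\<And>a. a \<in> carrier A \<Longrightarrow> lm a m = rm a m) \<Longrightarrow> m \<in> center"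
  by (simp add: center_def)

lemma centerD: "m \<in> center \<Longrightarrow> m \<in> carrier M" "m \<in> center \<Longrightarrow> a \<in> carrier A \<Longrightarrow> rm a m = lm a m"
  by (simp_all add: center_def)

definition orbit :: "'m \<Rightarrow> 'a \<Rightarrow> 'm" where "orbit m = (\<lambda>a\<in>carrier A. lm a m)"

lemma orbit_one: "m \<in> carrier M \<Longrightarrow> orbit m \<one>\<^bsub>A\<^esub> = m"
  using bimodule_laws(5)[of m] by (simp add: orbit_def)

text \<open>
  On pure tensors: \<open>(a \<otimes> b) (x m) = a x m b = (a x b) m\<close>, the last step because \<open>m\<close> is central.
\<close>

lemma orbit_hom:
  assumes m: "m \<in> center" shows "orbit m \<in> mod_hom E RB M"
proof (rule mod_homI)
  have mM [simp]: "m \<in> carrier M" using centerD(1)[OF m] .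
  have ml: "lin K A PM (\<lambda>a. lm a m)" by (rule bilD(1)[OF lm_bil]) simp
  show "orbit m \<in> extensional (carrier RB)" by (simp add: orbit_def)
  show "orbit m x \<in> carrier M" if "x \<in> carrier RB" for x using that by (simp add: orbit_def)
  show "orbit m (x \<oplus>\<^bsub>RB\<^esub> y) = orbit m x \<oplus>\<^bsub>M\<^esub> orbit m y" if "x \<in> carrier RB" "y \<in> carrier RB" for x y
    using that lin_add[OF ml] by (simp add: orbit_def)
  fix t x assume t: "t \<in> carrier E" and "x \<in> carrier RB"
  then have x [simp]: "x \<in> carrier A" by simp
  have "lm (t \<odot>\<^bsub>RB\<^esub> x) m = t \<odot>\<^bsub>M\<^esub> lm x m"
  proof (rule E_ext[where f = "\<lambda>t. lm (t \<odot>\<^bsub>RB\<^esub> x) m" and g = "\<lambda>t. t \<odot>\<^bsub>M\<^esub> lm x m", OF _ _ PM_mod _ t])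
    show "lin K E PM (\<lambda>t. lm (t \<odot>\<^bsub>RB\<^esub> x) m)" by (rule lin_compose[OF ml RB_lin[OF x]])
    show "lin K E PM (\<lambda>t. t \<odot>\<^bsub>M\<^esub> lm x m)" by (rule bilD(1)[OF act_bil]) simp
    fix a b assume [simp]: "a \<in> carrier A" "b \<in> carrier A"
    have "et a b \<odot>\<^bsub>M\<^esub> lm x m = lm a (lm x (rm b m))"
      by (simp add: et_smult bimodule_laws(7))
    then show "lm (et a b \<odot>\<^bsub>RB\<^esub> x) m = et a b \<odot>\<^bsub>M\<^esub> lm x m"
      by (simp add: RB_et centerD(2)[OF m] bimodule_laws(3))
  qed
  then show "orbit m (t \<odot>\<^bsub>RB\<^esub> x) = t \<odot>\<^bsub>M\<^esub> orbit m x" using t by (simp add: orbit_def RB_closed)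
qed

text \<open>
  The element \<open>a\<close> is both \<open>(a \<otimes> 1) 1\<close> and \<open>(1 \<otimes> a) 1\<close>, so \<open>f a\<close> is both \<open>a (f 1)\<close> and \<open>(f 1) a\<close>.
\<close>

lemma hom_orbit:
  assumes f: "f \<in> mod_hom E RB M" shows "f \<one>\<^bsub>A\<^esub> \<in> center" and "f = orbit (f \<one>\<^bsub>A\<^esub>)"
proof -
  have fl: "f a = lm a (f \<one>\<^bsub>A\<^esub>)" if "a \<in> carrier A" for a
    using mod_homD(4)[OF f, of "et a \<one>\<^bsub>A\<^esub>" "\<one>\<^bsub>A\<^esub>"] that by (simp add: RB_et lm_def)
  have fr: "f a = rm a (f \<one>\<^bsub>A\<^esub>)" if "a \<in> carrier A" for a
    using mod_homD(4)[OF f, of "et \<one>\<^bsub>A\<^esub> a" "\<one>\<^bsub>A\<^esub>"] that by (simp add: RB_et rm_def)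
  show "f \<one>\<^bsub>A\<^esub> \<in> center"
  proof (rule centerI)
    show "f \<one>\<^bsub>A\<^esub> \<in> carrier M" using mod_homD(2)[OF f, of "\<one>\<^bsub>A\<^esub>"] by simp
    show "lm a (f \<one>\<^bsub>A\<^esub>) = rm a (f \<one>\<^bsub>A\<^esub>)" if "a \<in> carrier A" for a
      by (rule trans[OF fl[OF that, symmetric] fr[OF that]])
  qed
  show "f = orbit (f \<one>\<^bsub>A\<^esub>)"
  proof
    fix a show "f a = orbit (f \<one>\<^bsub>A\<^esub>) a"
      using mod_homD(1)[OF f] fl[of a] by (cases "a \<in> carrier A") (auto simp: orbit_def extensional_def)
  qed
qed

lemma orbit_add: "m \<in> carrier M \<Longrightarrow> m' \<in> carrier M \<Longrightarrow> orbit (m \<oplus>\<^bsub>M\<^esub> m') = orbit m \<oplus>\<^bsub>hom_module E RB M\<^esub> orbit m'"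
  using lin_add[OF bilD(2)[OF lm_bil], of _ m m'] by (auto simp: orbit_def fun_eq_iff)

lemma orbit_smult: "c \<in> carrier K \<Longrightarrow> m \<in> carrier M \<Longrightarrow>
    orbit ((c \<odot>\<^bsub>E\<^esub> \<one>\<^bsub>E\<^esub>) \<odot>\<^bsub>M\<^esub> m) = c \<odot>\<^bsub>hom_module E RB M\<^esub> orbit m"
  using lin_smult[OF bilD(2)[OF lm_bil], of _ c m] by (auto simp: orbit_def fun_eq_iff)

lemma center_submodule: "submodule center K PM"
proof (rule module.submoduleI_smult[OF PM_mod])
  show "center \<subseteq> carrier PM" by (auto simp: center_def)
  show "\<zero>\<^bsub>PM\<^esub> \<in> center" 
    using lin_zero[OF PM_mod PM_mod bilD(2)[OF lm_bil]] lin_zero[OF PM_mod PM_mod bilD(2)[OF rm_bil]]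
    by (intro centerI) auto
  show "a \<oplus>\<^bsub>PM\<^esub> b \<in> center" if "a \<in> center" "b \<in> center" for a b
    using that lin_add[OF bilD(2)[OF lm_bil], of _ a b] lin_add[OF bilD(2)[OF rm_bil], of _ a b]
    by (auto simp: center_def)
  show "c \<odot>\<^bsub>PM\<^esub> a \<in> center" if "a \<in> center" "c \<in> carrier K" for a c
    using that lin_smult[OF bilD(2)[OF lm_bil], of _ c a] lin_smult[OF bilD(2)[OF rm_bil], of _ c a]
      module.smult_closed[OF PM_mod, of c a]
    by (auto simp: center_def)
qed

end

section \<open>Bimodules over the partial smash product\<close>

text \<open>
  The relations carry over along a surjective map that intertwines the operators. With \<open>\<phi>\<close> the
  orbit map this transports conjugation on the \<open>A\<close>-centre of a bimodule to the action on \<open>G_1\<close>.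
\<close>

lemma operator_representation_transfer:
  fixes H (structure)
  assumes "operator_representation K H P \<rho>" and Q: "module K Q" and \<phi>: "lin K P Q \<phi>"
    and on: "carrier Q = \<phi> ` carrier P"
    and eq: "\<And>h m. h \<in> carrier H \<Longrightarrow> m \<in> carrier P \<Longrightarrow> \<rho>' h (\<phi> m) = \<phi> (\<rho> h m)"
  shows "operator_representation K H Q \<rho>'"
proof -
  interpret operator_representation K H P \<rho> by fact
  have push: "\<phi> (sw P f h) = sw Q (\<lambda>x y. \<phi> (f x y)) h"
    if "\<And>x y. x \<in> carrier H \<Longrightarrow> y \<in> carrier H \<Longrightarrow> f x y \<in> carrier P" "h \<in> carrier H" for f h
    by (rule sw_push[OF \<phi> P_mod Q]) (use that in auto)
  show ?thesis
  proof (intro operator_representation.intro operator_representation_axioms.intro Q)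
    show "cocommutative_hopf_algebra K H" by (rule cocommutative_hopf_algebra_axioms)
    show "bil K H Q Q \<rho>'"
      by (intro bilI linI) (auto simp: on eq lin_add[OF bilD(1)[OF \<rho>_bilinear]] lin_smult[OF bilD(1)[OF \<rho>_bilinear]]
          lin_add[OF bilD(2)[OF \<rho>_bilinear]] lin_smult[OF bilD(2)[OF \<rho>_bilinear]]
          lin_add[OF \<phi>, symmetric] lin_smult[OF \<phi>, symmetric])
  next
    fix m assume "m \<in> carrier Q" then show "\<rho>' \<one> m = m" by (auto simp: on eq \<rho>_one)
  next
    fix h k m assume [simp]: "h \<in> carrier H" "k \<in> carrier H" and "m \<in> carrier Q"
    then obtain p where [simp]: "p \<in> carrier P" and m: "m = \<phi> p" by (auto simp: on)
    show "sw Q (\<lambda>x y. \<rho>' h (\<rho>' x (\<rho>' (S y) m))) k = sw Q (\<lambda>x y. \<rho>' (h \<otimes> x) (\<rho>' (S y) m)) k"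
      using \<rho>_rel1[of h k p] by (simp add: m eq push[symmetric])
    show "sw Q (\<lambda>x y. \<rho>' x (\<rho>' (S y) (\<rho>' k m))) h = sw Q (\<lambda>x y. \<rho>' x (\<rho>' (S y \<otimes> k) m)) h"
      using \<rho>_rel2[of h k p] by (simp add: m eq push[symmetric])
  qed
qed

lemma restrict_scalars_simps [simp]:
  "carrier (restrict_scalars \<phi> M) = carrier M" "x \<oplus>\<^bsub>restrict_scalars \<phi> M\<^esub> y = x \<oplus>\<^bsub>M\<^esub> y"
  "\<zero>\<^bsub>restrict_scalars \<phi> M\<^esub> = \<zero>\<^bsub>M\<^esub>" "s \<odot>\<^bsub>restrict_scalars \<phi> M\<^esub> x = \<phi> s \<odot>\<^bsub>M\<^esub> x"
  by (simp_all add: restrict_scalars_def)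

sublocale cocommutative_partial_action \<subseteq> AE: enveloping_algebra K A
  by (intro enveloping_algebra.intro A_alg)

sublocale cocommutative_partial_action \<subseteq> RE: enveloping_algebra K R
  by (intro enveloping_algebra.intro R_alg)

text \<open>
  A bimodule \<open>M\<close> over \<open>A # H\<close> is used in three ways at once. \<open>MR\<close> is the bimodule itself, \<open>AM\<close>
  is its restriction to \<open>A\<close> along the map \<open>inc\<close> of enveloping algebras, with centre \<open>C\<close>, and
  \<open>MB\<close> provides the conjugation operators \<open>D\<close> for the partial representation \<open>h \<mapsto> 1 # h\<close>.
\<close>

locale smash_bimodule = cocommutative_partial_action K H A act + MR: enveloping_module K "smash K H A act" M
  for K :: "'k ring" and H :: "('k, 'h) hopf" (structure) and A :: "('k, 'a) module"
    and act :: "'h \<Rightarrow> 'a \<Rightarrow> 'a"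
    and M :: "((('a \<times> 'h \<Rightarrow> 'k) set \<times> ('a \<times> 'h \<Rightarrow> 'k) set \<Rightarrow> 'k) set, 'm) module"
begin

abbreviation "lm \<equiv> MR.lm"
abbreviation "rm \<equiv> MR.rm"
abbreviation "PM \<equiv> MR.PM"
abbreviation "EA \<equiv> env_alg K A"
abbreviation "ER \<equiv> env_alg K R"
abbreviation "inc \<equiv> env_incl K H A act"
abbreviation "MA \<equiv> restrict_scalars inc M"

lemma inc_bil: "bil K A (opp_alg A) ER (\<lambda>a b. RE.et (inA a) (inA b))"
proof (rule bilI)
  have iol: "lin K A R inA" by (auto intro!: lin_intros)
  show "lin K A ER (\<lambda>a. RE.et (inA a) (inA b))" if "b \<in> carrier (opp_alg A)" for b
    using that by (intro lin_compose[OF RE.et_lin1 iol]) simp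
  show "lin K (opp_alg A) ER (\<lambda>b. RE.et (inA a) (inA b))" if "a \<in> carrier A" for a
    using that by (simp, intro lin_compose[OF RE.et_lin2 iol]) simp
qed

lemma inc_eq: "inc t = tensor_lift K ER (\<lambda>a b. RE.et (inA a) (inA b)) t"
  by (simp add: env_incl_def Let_def)

lemma inc_lin: "lin K EA ER inc"
  using AE.ET.lift_lin[OF RE.E_mod inc_bil] by (simp add: inc_eq[abs_def] AE.E_eq)

lemma inc_et: "a \<in> carrier A \<Longrightarrow> b \<in> carrier A \<Longrightarrow> inc (env_tensor K A a b) = RE.et (inA a) (inA b)"
  using AE.ET.lift_tns[OF RE.E_mod inc_bil, of a b] by (simp add: inc_eq env_tensor_def)

lemma inc_one: "inc \<one>\<^bsub>EA\<^esub> = \<one>\<^bsub>ER\<^esub>"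
  by (simp add: AE.et_one RE.et_one inc_et inA_one)

lemma inc_mult:
  assumes s: "s \<in> carrier EA" and t: "t \<in> carrier EA"
  shows "inc (s \<otimes>\<^bsub>EA\<^esub> t) = inc s \<otimes>\<^bsub>ER\<^esub> inc t"
proof -
  note mA = assoc_algebra_mult_bil[OF AE.E_alg] and mR = assoc_algebra_mult_bil[OF RE.E_alg]
  note ic = lin_closed[OF inc_lin]
  have 1: "inc (env_tensor K A a b \<otimes>\<^bsub>EA\<^esub> t) = inc (env_tensor K A a b) \<otimes>\<^bsub>ER\<^esub> inc t"
    if "a \<in> carrier A" "b \<in> carrier A" for a b
    by (rule AE.E_ext[where f = "\<lambda>t. inc (env_tensor K A a b \<otimes>\<^bsub>EA\<^esub> t)"
          and g = "\<lambda>t. inc (env_tensor K A a b) \<otimes>\<^bsub>ER\<^esub> inc t", OF _ _ RE.E_mod _ t])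
      (use that in \<open>auto intro!: lin_compose[OF inc_lin bilD(2)[OF mA]] lin_compose[OF bilD(2)[OF mR] inc_lin]
         AE.et_closed ic simp: AE.et_mult inc_et RE.et_mult inA_mult\<close>)
  show ?thesis
    by (rule AE.E_ext[where f = "\<lambda>s. inc (s \<otimes>\<^bsub>EA\<^esub> t)" and g = "\<lambda>s. inc s \<otimes>\<^bsub>ER\<^esub> inc t", OF _ _ RE.E_mod _ s])
      (use 1 t in \<open>auto intro!: lin_compose[OF inc_lin bilD(1)[OF mA]] lin_compose[OF bilD(1)[OF mR] inc_lin] ic\<close>)
qed

lemma MA_left_module: "left_module EA MA"
proof (intro left_module.intro left_module_axioms.intro)
  note ic = lin_closed[OF inc_lin]
  show "ring EA" by (rule assoc_algebra_ring[OF AE.E_alg])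
  show "abelian_group MA"
  proof (rule abelian_groupI)
    fix x assume "x \<in> carrier MA"
    then show "\<exists>y\<in>carrier MA. y \<oplus>\<^bsub>MA\<^esub> x = \<zero>\<^bsub>MA\<^esub>"
      by (intro bexI[of _ "\<ominus>\<^bsub>M\<^esub> x"]) (auto simp: MR.Mo.M.l_neg)
  qed (auto simp: MR.Mo.M.a_ac)
qed (auto simp: lin_closed[OF inc_lin] lin_add[OF inc_lin] inc_mult inc_one MR.Mo.smult_closed MR.Mo.smult_l_distr
      MR.Mo.smult_r_distr MR.Mo.smult_assoc MR.Mo.smult_one)

sublocale AM: enveloping_module K A MA
  by (intro enveloping_module.intro AE.enveloping_algebra_axioms MA_left_module)

lemma AM_lm: "a \<in> carrier A \<Longrightarrow> AM.lm a m = lm (inA a) m"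
  and AM_rm: "a \<in> carrier A \<Longrightarrow> AM.rm a m = rm (inA a) m"
  by (simp_all add: AM.lm_def AM.rm_def MR.lm_def MR.rm_def inc_et inA_one)

lemma MA_scalar: "c \<in> carrier K \<Longrightarrow> (c \<odot>\<^bsub>EA\<^esub> \<one>\<^bsub>EA\<^esub>) \<odot>\<^bsub>MA\<^esub> m = (c \<odot>\<^bsub>ER\<^esub> \<one>\<^bsub>ER\<^esub>) \<odot>\<^bsub>M\<^esub> m"
proof -
  assume "c \<in> carrier K"
  moreover have "\<one>\<^bsub>EA\<^esub> \<in> carrier EA" by (rule monoid.one_closed[OF ring.is_monoid[OF assoc_algebra_ring[OF AE.E_alg]]])
  ultimately show ?thesis by (simp add: lin_smult[OF inc_lin] inc_one)
qed

sublocale MB: bimodule_representation K H R "smash_elt K H A act \<one>\<^bsub>A\<^esub>" PM lm rm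
  by (intro bimodule_representation.intro bimodule_representation_axioms.intro MR.PM_mod
      SR.partial_representation_axioms MR.bimodule_laws)

abbreviation "D \<equiv> MB.D"
abbreviation "C \<equiv> AM.center"

lemma conj_eq: "h \<in> carrier H \<Longrightarrow> m \<in> carrier M \<Longrightarrow> bimodule_conj K H A act M h m = D h m"
  by (simp add: bimodule_conj_def Let_def MB.D_def MR.et_smult)

lemma C_M: "m \<in> C \<Longrightarrow> m \<in> carrier M" using AM.centerD(1) by simp

lemma C_comm: "m \<in> C \<Longrightarrow> a \<in> carrier A \<Longrightarrow> rm (inA a) m = lm (inA a) m"
  using AM.centerD(2)[of m a] by (simp add: AM_lm AM_rm)

lemma CI: "m \<in> carrier M \<Longrightarrow> (\<And>a. a \<in> carrier A \<Longrightarrow> lm (inA a) m = rm (inA a) m) \<Longrightarrow> m \<in> C"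
  by (rule AM.centerI) (auto simp: AM_lm AM_rm)

text \<open>
  The element \<open>a\<close> is moved to the right across \<open>1 # h_1\<close> and becomes \<open>S(h_2) \<cdot> a\<close>.
\<close>

lemma inA_D:
  assumes [simp]: "h \<in> carrier H" "m \<in> carrier M" "a \<in> carrier A"
  shows "lm (inA a) (D h m) = sw PM (\<lambda>x y. sw PM (\<lambda>u v. lm (inH u) (lm (inA (act (S v) a)) (rm (inH (S y)) m))) x) h"
proof -
  have "lm (inA a) (D h m) = sw PM (\<lambda>x y. lm (inA a \<star> inH x) (rm (inH (S y)) m)) h"
    by (simp add: MB.D_def MB.lm_sw(2) MB.lm_mult)
  also have "\<dots> = sw PM (\<lambda>x y. sw PM (\<lambda>u v. lm (inH u) (lm (inA (act (S v) a)) (rm (inH (S y)) m))) x) h"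
    by (simp add: inH_inA_antipode[symmetric] MB.lm_sw(1) MB.lm_mult)
  finally show ?thesis .
qed

text \<open>
  Moved across \<open>1 # h_1\<close>, the element \<open>a\<close> becomes \<open>S(h_2) \<cdot> a\<close>, which commutes with \<open>m\<close>; the
  product \<open>(S(h_2) \<cdot> a) (1 # S(h_3))\<close> is \<open>(1 # S(h_2)) a\<close>.
\<close>

lemma D_C:
  assumes h [simp]: "h \<in> carrier H" and m: "m \<in> C" shows "D h m \<in> C"
proof (rule CI)
  have mM [simp]: "m \<in> carrier M" by (rule C_M[OF m])
  show "D h m \<in> carrier M" using MB.D_closed[of h m] by simp
  fix a assume [simp]: "a \<in> carrier A"
  have "lm (inA a) (D h m) = sw PM (\<lambda>x y. sw PM (\<lambda>u v. lm (inH u) (rm (inA (act (S v) a) \<star> inH (S y)) m)) x) h"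
    by (simp add: inA_D MB.rm_mult MB.rm_lm C_comm[OF m] flip: MB.rm_lm)
  also have "\<dots> = sw PM (\<lambda>x y. sw PM (\<lambda>u v. lm (inH x) (rm (inA (act (S u) a) \<star> inH (S v)) m)) y) h"
    by (rule sw_assoc) (auto intro!: lin_intros)
  also have "\<dots> = sw PM (\<lambda>x y. lm (inH x) (rm (inH (S y) \<star> inA a) m)) h"
  proof (rule sw_congruence[OF refl])
    fix x y assume [simp]: "x \<in> carrier H" "y \<in> carrier H"
    have "inH (S y) \<star> inA a = sw R (\<lambda>u v. inA (act u a) \<star> inH v) (S y)" by (simp add: inH_inA)
    also have "\<dots> = sw R (\<lambda>u v. inA (act (S u) a) \<star> inH (S v)) y"
      by (rule sw_antipode) (auto intro!: lin_intros)
    finally show "sw PM (\<lambda>u v. lm (inH x) (rm (inA (act (S u) a) \<star> inH (S v)) m)) y = lm (inH x) (rm (inH (S y) \<star> inA a) m)"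
      by (simp add: MB.rm_sw(1) MB.lm_sw(2))
  qed simp
  also have "\<dots> = rm (inA a) (D h m)"
    by (simp add: MB.D_def MB.rm_sw(2) MB.rm_mult MB.rm_lm)
  finally show "lm (inA a) (D h m) = rm (inA a) (D h m)" .
qed

abbreviation "G1h \<equiv> G1_hom K H A act M"
abbreviation "G1a \<equiv> G1_action K H A act M"

lemma G1h_eq: "G1h = hom_module EA AE.RB MA" by (simp add: G1_hom_def)

lemma G1h_mod: "module K G1h"
  unfolding G1h_eq by (rule hom_module_is_module[OF AE.E_alg AE.RB_left_module MA_left_module])

lemma orbit_eq: "AM.orbit m = (\<lambda>a\<in>carrier A. lm (inA a) m)"
  by (auto simp: AM.orbit_def AM_lm fun_eq_iff)

text \<open>
  At \<open>a\<close> the left-hand side is \<open>(1 # h_1) (S(h_3) \<cdot> a) m (1 # S h_2)\<close>. With \<open>h_2\<close> and \<open>h_3\<close>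
  exchanged, this is \<open>a (1 # h_1) m (1 # S h_2)\<close>.
\<close>

lemma G1a_orbit:
  assumes h [simp]: "h \<in> carrier H" and m: "m \<in> C" shows "G1a h (AM.orbit m) = AM.orbit (D h m)"
proof -
  have mM [simp]: "m \<in> carrier M" by (rule C_M[OF m])
  have "sw PM (\<lambda>x y. bimodule_conj K H A act M x (AM.orbit m (act (S y) a))) h = lm (inA a) (D h m)"
    if [simp]: "a \<in> carrier A" for a
  proof -
    have "sw PM (\<lambda>x y. bimodule_conj K H A act M x (AM.orbit m (act (S y) a))) h =
        sw PM (\<lambda>x y. D x (lm (inA (act (S y) a)) m)) h"
      by (simp add: conj_eq orbit_eq)
    also have "\<dots> = sw PM (\<lambda>x y. sw PM (\<lambda>u v. lm (inH u) (lm (inA (act (S y) a)) (rm (inH (S v)) m))) x) h"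
      by (simp add: MB.D_def MB.rm_lm)
    also have "\<dots> = sw PM (\<lambda>x y. sw PM (\<lambda>u v. lm (inH x) (lm (inA (act (S v) a)) (rm (inH (S u)) m))) y) h"
      by (rule sw_assoc) (auto intro!: lin_intros)
    also have "\<dots> = sw PM (\<lambda>x y. sw PM (\<lambda>u v. lm (inH x) (lm (inA (act (S u) a)) (rm (inH (S v)) m))) y) h"
      by (intro sw_congruence[OF refl] sw_comm) (auto intro!: lin_intros)
    also have "\<dots> = sw PM (\<lambda>x y. sw PM (\<lambda>u v. lm (inH u) (lm (inA (act (S v) a)) (rm (inH (S y)) m))) x) h"
      by (rule sw_assoc[symmetric]) (auto intro!: lin_intros)
    finally show ?thesis by (simp add: inA_D)
  qed
  then show ?thesis by (auto simp: G1_action_def orbit_eq[of "D h m"] fun_eq_iff)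
qed

abbreviation "CM \<equiv> PM\<lparr>carrier := C\<rparr>"

lemma C_sub: "submodule C K PM"
proof (rule module.submoduleI_smult[OF MR.PM_mod])
  interpret AP: module K AM.PM by (rule AM.PM_mod)
  note s = AP.submoduleE[OF AM.center_submodule]
  show "C \<subseteq> carrier PM" using C_M by auto
  show "\<zero>\<^bsub>PM\<^esub> \<in> C" using submodule_zero[OF AM.PM_mod AM.center_submodule] by simp
  show "a \<oplus>\<^bsub>PM\<^esub> b \<in> C" if "a \<in> C" "b \<in> C" for a b using s(5)[OF that] by simp
  show "c \<odot>\<^bsub>PM\<^esub> a \<in> C" if "c \<in> carrier K" "a \<in> C" for a c using s(4)[OF that] MA_scalar[OF that(1), of a] by simp
qed

lemma CM_mod: "module K CM" by (rule submodule.submodule_is_module[OF C_sub MR.PM_mod])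

lemma CM_rep: "operator_representation K H CM D"
  by (rule operator_representation_restrict[OF MB.D_operator_representation C_sub]) (auto simp: D_C)

lemma orbit_lin: "lin K CM G1h AM.orbit"
proof (rule linI)
  show "AM.orbit m \<in> carrier G1h" if "m \<in> carrier CM" for m
    using that AM.orbit_hom by (simp add: G1h_eq)
  show "AM.orbit (m \<oplus>\<^bsub>CM\<^esub> m') = AM.orbit m \<oplus>\<^bsub>G1h\<^esub> AM.orbit m'" if "m \<in> carrier CM" "m' \<in> carrier CM" for m m'
    using that C_M AM.orbit_add[of m m'] by (simp add: G1h_eq)
  show "AM.orbit (c \<odot>\<^bsub>CM\<^esub> m) = c \<odot>\<^bsub>G1h\<^esub> AM.orbit m" if "c \<in> carrier K" "m \<in> carrier CM" for c m
    using that C_M AM.orbit_smult[of c m] MA_scalar[of c m] by (simp add: G1h_eq)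
qed

lemma G1h_image: "carrier G1h = AM.orbit ` C"
  using AM.orbit_hom AM.hom_orbit by (fastforce simp: G1h_eq)

sublocale G1: hpar_operator_module K H G1h G1a
  by (intro hpar_operator_module.intro operator_representation_transfer[OF CM_rep G1h_mod orbit_lin])
    (auto simp: G1h_image G1a_orbit)

lemma orbit_C_one: "m \<in> C \<Longrightarrow> AM.orbit m \<one>\<^bsub>A\<^esub> = m"
  using AM.orbit_one C_M by simp

text \<open>
  As a product of two classes \<open>e_h\<close> acts on \<open>C\<close> by two conjugations, which together map \<open>m\<close> to
  \<open>(h_1 \<cdot> 1) m (h_2 \<cdot> 1)\<close>. Since \<open>m\<close> commutes with \<open>A\<close> and \<open>(h_1 \<cdot> 1) (h_2 \<cdot> 1) = h \<cdot> 1\<close>, the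
  result is \<open>(h \<cdot> 1) m\<close>.
\<close>

lemma e_orbit:
  assumes h [simp]: "h \<in> carrier H" and m: "m \<in> C"
  shows "HR.e h \<odot>\<^bsub>G1.N\<^esub> AM.orbit m = AM.orbit (lm (inA (act h \<one>\<^bsub>A\<^esub>)) m)"
proof -
  have mM [simp]: "m \<in> carrier M" by (rule C_M[OF m])
  interpret N: left_module HP G1.N by (rule G1.N_left_module)
  have orbitc: "AM.orbit n \<in> carrier G1h" if "n \<in> C" for n using that G1h_image by blast
  have "HR.e h \<odot>\<^bsub>G1.N\<^esub> AM.orbit m = sw G1h (\<lambda>x y. (cls x \<diamondop> cls (S y)) \<odot>\<^bsub>G1.N\<^esub> AM.orbit m) h"
    unfolding HR.e_def
    by (rule sw_push[OF bilD(1)[OF G1.N_smult_bil orbitc[OF m]] HP_mod G1h_mod]) auto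
  also have "\<dots> = sw G1h (\<lambda>x y. AM.orbit (D x (D (S y) m))) h"
    by (simp add: N.smult_assoc orbitc m D_C G1.N_smult_cls G1a_orbit)
  also have "\<dots> = AM.orbit (sw CM (\<lambda>x y. D x (D (S y) m)) h)"
    by (rule sw_push[symmetric, OF orbit_lin CM_mod G1h_mod]) (auto simp: D_C m)
  also have "sw CM (\<lambda>x y. D x (D (S y) m)) h = sw PM (\<lambda>x y. D x (D (S y) m)) h"
    by (rule sw_submodule(1)[OF MR.PM_mod C_sub]) (auto simp: D_C m)
  also have "\<dots> = sw PM (\<lambda>x y. lm (inA (act x \<one>\<^bsub>A\<^esub> \<bullet> act y \<one>\<^bsub>A\<^esub>)) m) h"
    by (simp add: MB.D_D_antipode SR_e C_comm[OF m] MB.lm_mult[symmetric] inA_mult)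
  also have "\<dots> = lm (inA (sw A (\<lambda>x y. act x \<one>\<^bsub>A\<^esub> \<bullet> act y \<one>\<^bsub>A\<^esub>) h)) m"
    by (simp add: inA_sw MB.lm_sw(1))
  finally show ?thesis by (simp add: act_one_right)
qed

lemma C_lm: "a \<in> carrier A \<Longrightarrow> m \<in> C \<Longrightarrow> lm (inA a) m \<in> carrier M"
  using C_M by simp

lemma center_C: "m \<in> MR.center \<Longrightarrow> m \<in> C"
  by (rule CI) (auto simp: MR.centerD)

lemma center_D:
  assumes m: "m \<in> MR.center" and h [simp]: "h \<in> carrier H" shows "D h m = lm (inA (act h \<one>\<^bsub>A\<^esub>)) m"
proof -
  have [simp]: "m \<in> carrier M" using MR.centerD(1)[OF m] .
  have "D h m = sw PM (\<lambda>x y. lm (inH x \<star> inH (S y)) m) h"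
    by (simp add: MB.D_def MR.centerD(2)[OF m] MB.lm_mult)
  also have "\<dots> = lm (sw R (\<lambda>x y. inH x \<star> inH (S y)) h) m"
    by (simp add: MB.lm_sw(1))
  finally show ?thesis by (simp add: smash_e)
qed

text \<open>
  The chain of equalities is \<open>(1 # h) m = (1 # h_1) (S(h_2) \<cdot> 1) m = (1 # h_1) m (1 # S h_2) (1
  # h_3) = ([h_1] \<rhd> m) (1 # h_2) = (h_1 \<cdot> 1) m (1 # h_2) = m (1 # h)\<close>.
\<close>

lemma invariant_center:
  assumes m: "m \<in> C" and inv: "\<And>h. h \<in> carrier H \<Longrightarrow> D h m = lm (inA (act h \<one>\<^bsub>A\<^esub>)) m"
  shows "m \<in> MR.center"
proof (rule MR.centerI)
  show mM [simp]: "m \<in> carrier M" by (rule C_M[OF m])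
  have inH_comm: "lm (inH h) m = rm (inH h) m" if h [simp]: "h \<in> carrier H" for h
  proof -
    have "lm (inH h) m = lm (sw R (\<lambda>x y. inH x \<star> inA (act (S y) \<one>\<^bsub>A\<^esub>)) h) m"
      using inH_inA_antipode[of h "\<one>\<^bsub>A\<^esub>"] by (simp add: inA_one)
    also have "\<dots> = sw PM (\<lambda>x y. lm (inH x) (rm (SR.e (S y)) m)) h"
      by (simp add: MB.lm_sw(1) MB.lm_mult C_comm[OF m] SR_e)
    also have "\<dots> = sw PM (\<lambda>x y. sw PM (\<lambda>u v. rm (inH v) (lm (inH x) (rm (inH (S u)) m))) y) h"
      by (simp add: SR.e_antipode[symmetric] MB.rm_sw(1) MB.lm_sw(2) MB.rm_mult MB.rm_lm)
    also have "\<dots> = sw PM (\<lambda>x y. sw PM (\<lambda>u v. rm (inH y) (lm (inH u) (rm (inH (S v)) m))) x) h"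
      by (rule sw_assoc[symmetric]) (auto intro!: lin_intros)
    also have "\<dots> = sw PM (\<lambda>x y. rm (inH y) (D x m)) h"
      by (simp add: MB.D_def MB.rm_sw(2))
    also have "\<dots> = sw PM (\<lambda>x y. rm (inA (act x \<one>\<^bsub>A\<^esub>) \<star> inH y) m) h"
      by (simp add: inv MB.rm_mult C_comm[OF m])
    also have "\<dots> = rm (sw R (\<lambda>x y. inA (act x \<one>\<^bsub>A\<^esub>) \<star> inH y) h) m"
      by (simp add: MB.rm_sw(1))
    finally show ?thesis by (simp add: inH_sum)
  qed
  show "lm r m = rm r m" if "r \<in> carrier R" for r
    using that
  proof (induction rule: R_induct)
    case (elt a h)
    have "lm (inA a \<star> inH h) m = lm (inA a) (rm (inH h) m)" using elt by (simp add: MB.lm_mult inH_comm)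
    also have "\<dots> = rm (inH h) (rm (inA a) m)" using elt by (simp add: C_comm[OF m] MB.rm_lm)
    also have "\<dots> = rm (inA a \<star> inH h) m" using elt by (simp add: MB.rm_mult)
    finally show ?case .
  qed (simp_all add: lin_zero[OF R_mod MR.PM_mod bilD(1)[OF MR.lm_bil]] lin_zero[OF R_mod MR.PM_mod bilD(1)[OF MR.rm_bil]]
      lin_add[OF bilD(1)[OF MR.lm_bil]] lin_add[OF bilD(1)[OF MR.rm_bil]]
      lin_smult[OF bilD(1)[OF MR.lm_bil]] lin_smult[OF bilD(1)[OF MR.rm_bil]])
qed

abbreviation "N \<equiv> hpar_module K H G1h G1a"

lemma N_left: "left_module HP N" by (rule G1.N_left_module)

lemma G2G1_value:
  assumes F: "F \<in> mod_hom HP BM N"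
  shows "F \<one>\<^bsub>HP\<^esub> \<one>\<^bsub>A\<^esub> \<in> MR.center" and "F \<one>\<^bsub>HP\<^esub> = AM.orbit (F \<one>\<^bsub>HP\<^esub> \<one>\<^bsub>A\<^esub>)"
proof -
  have n: "F \<one>\<^bsub>HP\<^esub> \<in> mod_hom EA AE.RB MA" 
  proof -
    have "F \<one>\<^bsub>HP\<^esub> \<in> carrier G1h" using hom_from_base(1)[OF N_left F] by simp
    then show ?thesis by (simp only: G1h_eq hom_module_simps)
  qed
  show n_eq: "F \<one>\<^bsub>HP\<^esub> = AM.orbit (F \<one>\<^bsub>HP\<^esub> \<one>\<^bsub>A\<^esub>)" by (rule AM.hom_orbit(2)[OF n])
  have m: "F \<one>\<^bsub>HP\<^esub> \<one>\<^bsub>A\<^esub> \<in> C" by (rule AM.hom_orbit(1)[OF n])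
  show "F \<one>\<^bsub>HP\<^esub> \<one>\<^bsub>A\<^esub> \<in> MR.center"
  proof (rule invariant_center[OF m])
    fix h assume h: "h \<in> carrier H"
    let ?m = "F \<one>\<^bsub>HP\<^esub> \<one>\<^bsub>A\<^esub>"
    have orbit: "AM.orbit ?m \<in> carrier G1h" using m G1h_image by blast
    have "cls h \<odot>\<^bsub>N\<^esub> AM.orbit ?m = HR.e h \<odot>\<^bsub>N\<^esub> AM.orbit ?m"
      using hom_from_base(3)[OF N_left F h] by (simp only: n_eq[symmetric])
    with orbit have "AM.orbit (D h ?m) = AM.orbit (lm (inA (act h \<one>\<^bsub>A\<^esub>)) ?m)"
      using h m by (simp add: G1.N_smult_cls G1a_orbit e_orbit)
    from fun_cong[OF this, of "\<one>\<^bsub>A\<^esub>"] show "D h ?m = lm (inA (act h \<one>\<^bsub>A\<^esub>)) ?m"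
      using C_M[OF D_C[OF h m]] C_lm[of "act h \<one>\<^bsub>A\<^esub>", OF _ m] h
      by (simp only: AM.orbit_one restrict_scalars_simps PA.act_closed Aa.A.one_closed)
  qed
qed

lemma G2G1_inverse:
  assumes m: "m \<in> MR.center"
  shows "(\<lambda>b\<in>B. b \<odot>\<^bsub>N\<^esub> AM.orbit m) \<in> mod_hom HP BM N"
proof (rule hom_from_invariant[OF N_left])
  have mC: "m \<in> C" by (rule center_C[OF m])
  show orbit: "AM.orbit m \<in> carrier N" using mC G1h_image by auto
  show "cls h \<odot>\<^bsub>N\<^esub> AM.orbit m = HR.e h \<odot>\<^bsub>N\<^esub> AM.orbit m" if h: "h \<in> carrier H" for h
    using h orbit by (simp add: G1.N_smult_cls G1a_orbit e_orbit mC center_D[OF m])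
qed

end

section \<open>The functors\<close>

context cocommutative_partial_action
begin

abbreviation "ER \<equiv> env_alg K R"
abbreviation "G1o M \<equiv> hpar_module K H (G1_hom K H A act M) (G1_action K H A act M)"

lemma smash_bimodule: "left_module ER M \<Longrightarrow> smash_bimodule K H A act M"
  by (intro smash_bimodule.intro enveloping_module.intro cocommutative_partial_action_axioms RE.enveloping_algebra_axioms)

text \<open>
  Through evaluation at \<open>1\<close> the map \<open>G_1 f\<close> is the restriction of \<open>f\<close> to the \<open>A\<close>-centres. There
  \<open>f\<close> commutes with the conjugation operators, hence with the classes \<open>[h]\<close> and with all of
  \<open>H_par\<close>.
\<close>

lemma G1_map:
  assumes M: "left_module ER M" and N: "left_module ER N" and f: "f \<in> mod_hom ER M N"
  shows "g \<in> carrier (G1o M) \<Longrightarrow> compose (carrier A) f g \<in> carrier (G1o N)"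
    and "(\<lambda>g\<in>carrier (G1_hom K H A act M). compose (carrier A) f g) \<in> mod_hom HP (G1o M) (G1o N)"
proof -
  interpret M: smash_bimodule K H A act M by (rule smash_bimodule[OF M])
  interpret N: smash_bimodule K H A act N by (rule smash_bimodule[OF N])
  let ?F = "compose (carrier A) f"
  have fM: "f m \<in> carrier N" if "m \<in> carrier M" for m using mod_homD(2)[OF f that] .
  have flm: "f (M.lm r m) = N.lm r (f m)" "f (M.rm r m) = N.rm r (f m)"
    if "r \<in> carrier R" "m \<in> carrier M" for r m
    using that by (simp_all add: M.MR.lm_def N.MR.lm_def M.MR.rm_def N.MR.rm_def mod_homD(4)[OF f])
  have fl: "lin K M.PM N.PM f" by (rule mod_hom_base_lin[OF RE.E_alg f])
  have fC: "f m \<in> N.C" if "m \<in> M.C" for m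
    by (rule N.CI) (use that M.C_M M.C_comm in \<open>auto simp: fM flm[symmetric]\<close>)
  have fD: "f (M.D h m) = N.D h (f m)" if "h \<in> carrier H" "m \<in> carrier M" for h m
  proof -
    have "f (M.D h m) = sw N.PM (\<lambda>x y. f (M.lm (inH x) (M.rm (inH (S y)) m))) h"
      unfolding M.MB.D_def by (rule sw_push[OF fl M.MR.PM_mod N.MR.PM_mod]) (use that in auto)
    then show ?thesis using that by (simp add: N.MB.D_def flm)
  qed
  have Forbit: "?F (M.AM.orbit m) = N.AM.orbit (f m)" if "m \<in> carrier M" for m
    using that by (auto simp: M.orbit_eq N.orbit_eq compose_def fun_eq_iff flm)
  have Fc: "?F g \<in> carrier (G1o N)" if "g \<in> carrier (G1o M)" for g
    using that fC by (auto simp: M.G1h_image N.G1h_image Forbit M.C_M)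
  then show "g \<in> carrier (G1o M) \<Longrightarrow> ?F g \<in> carrier (G1o N)" .
  have Fadd: "?F (g \<oplus>\<^bsub>G1o M\<^esub> g') = ?F g \<oplus>\<^bsub>G1o N\<^esub> ?F g'"
    if "g \<in> carrier (G1o M)" "g' \<in> carrier (G1o M)" for g g'
  proof -
    have "g \<in> carrier M.G1h" "g' \<in> carrier M.G1h" using that by simp_all
    then have g: "g \<in> mod_hom M.EA AE.RB M.MA" "g' \<in> mod_hom M.EA AE.RB M.MA"
      by (simp_all only: M.G1h_eq hom_module_simps)
    have "?F (g \<oplus>\<^bsub>M.G1h\<^esub> g') = ?F g \<oplus>\<^bsub>N.G1h\<^esub> ?F g'"
      using mod_homD(2)[OF g(1)] mod_homD(2)[OF g(2)]
      by (auto simp: M.G1h_eq N.G1h_eq compose_def fun_eq_iff mod_homD(3)[OF f])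
    then show ?thesis by simp
  qed
  have Fsm: "?F (c \<odot>\<^bsub>M.G1h\<^esub> g) = c \<odot>\<^bsub>N.G1h\<^esub> ?F g"
    if c: "c \<in> carrier K" and g: "g \<in> carrier (G1o M)" for c g
  proof -
    obtain m where m: "m \<in> M.C" "g = M.AM.orbit m" using g by (auto simp: M.G1h_image)
    have cm: "(c \<odot>\<^bsub>M.PM\<^esub> m) \<in> M.C" using submodule.smult_closed[OF M.C_sub c m(1)] .
    have "c \<odot>\<^bsub>M.G1h\<^esub> g = M.AM.orbit (c \<odot>\<^bsub>M.PM\<^esub> m)"
      using lin_smult[OF M.orbit_lin c, of m] m by simp
    then have "?F (c \<odot>\<^bsub>M.G1h\<^esub> g) = N.AM.orbit (f (c \<odot>\<^bsub>M.PM\<^esub> m))"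
      using Forbit[OF M.C_M[OF cm]] by simp
    also have "\<dots> = N.AM.orbit (c \<odot>\<^bsub>N.PM\<^esub> f m)" using lin_smult[OF fl c, of m] M.C_M[OF m(1)] by simp
    also have "\<dots> = c \<odot>\<^bsub>N.G1h\<^esub> ?F g"
      using lin_smult[OF N.orbit_lin c, of "f m"] fC[OF m(1)] m(2) Forbit[OF M.C_M[OF m(1)]] by simp
    finally show ?thesis .
  qed
  have Fl: "lin K M.G1h N.G1h ?F"
    using Fc Fadd Fsm by (auto intro!: linI)
  have Fact: "?F (M.G1a h g) = N.G1a h (?F g)" if h: "h \<in> carrier H" and g: "g \<in> carrier (G1o M)" for h g
  proof -
    obtain m where m: "m \<in> M.C" "g = M.AM.orbit m" using g by (auto simp: M.G1h_image)
    note mM = M.C_M[OF m(1)]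
    have "?F (M.G1a h g) = N.AM.orbit (N.D h (f m))"
      using m(2) M.G1a_orbit[OF h m(1)] Forbit[OF M.C_M[OF M.D_C[OF h m(1)]]] fD[OF h mM] by simp
    also have "\<dots> = N.G1a h (?F g)" using N.G1a_orbit[OF h fC[OF m(1)]] Forbit[OF mM] m(2) by simp
    finally show ?thesis .
  qed
  interpret LM: left_module HP "G1o M" by (rule M.N_left)
  interpret LN: left_module HP "G1o N" by (rule N.N_left)
  have Fz: "?F (z \<odot>\<^bsub>G1o M\<^esub> g) = z \<odot>\<^bsub>G1o N\<^esub> ?F g"
    if z: "z \<in> carrier HP" and g: "g \<in> carrier (G1o M)" for z g
  proof -
    have gM: "g \<in> carrier M.G1h" using g by simp
    have Fg: "?F g \<in> carrier N.G1h" using Fc[OF g] by simp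
    have l1: "lin K HP N.G1h (\<lambda>z. ?F (z \<odot>\<^bsub>G1o M\<^esub> g))"
      by (rule lin_compose[OF Fl bilD(1)[OF M.G1.N_smult_bil gM]])
    have l2: "lin K HP N.G1h (\<lambda>z. z \<odot>\<^bsub>G1o N\<^esub> ?F g)"
      by (rule bilD(1)[OF N.G1.N_smult_bil Fg])
    from z show ?thesis
    proof (induction rule: hpar_induct)
      case one
      show ?case using LM.smult_one[OF g] LN.smult_one[OF Fc[OF g]] by simp
    next
      case (cls h z)
      have zg: "z \<odot>\<^bsub>G1o M\<^esub> g \<in> carrier (G1o M)" by (rule LM.smult_closed[OF cls(2) g])
      have "?F ((cls h \<diamondop> z) \<odot>\<^bsub>G1o M\<^esub> g) = ?F (M.G1a h (z \<odot>\<^bsub>G1o M\<^esub> g))"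
        using cls zg LM.smult_assoc[OF cls_closed[OF cls(1)] cls(2) g] M.G1.N_smult_cls[OF cls(1), of "z \<odot>\<^bsub>G1o M\<^esub> g"] by simp
      also have "\<dots> = N.G1a h (z \<odot>\<^bsub>G1o N\<^esub> ?F g)" using Fact[OF cls(1) zg] cls(3) by simp
      also have "\<dots> = (cls h \<diamondop> z) \<odot>\<^bsub>G1o N\<^esub> ?F g"
        using LN.smult_assoc[OF cls_closed[OF cls(1)] cls(2) Fc[OF g]]
          N.G1.N_smult_cls[OF cls(1), of "z \<odot>\<^bsub>G1o N\<^esub> ?F g"] LN.smult_closed[OF cls(2) Fc[OF g]] by simp
      finally show ?case .
    next
      case zero
      show ?case using lin_zero[OF HP_mod N.G1h_mod l1] lin_zero[OF HP_mod N.G1h_mod l2] by simp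
    next
      case (add y z)
      then show ?case using lin_add[OF l1, of y z] lin_add[OF l2, of y z] by simp
    next
      case (smult c z)
      then show ?case using lin_smult[OF l1, of c z] lin_smult[OF l2, of c z] by simp
    qed
  qed
  show "(\<lambda>g\<in>carrier M.G1h. ?F g) \<in> mod_hom HP (G1o M) (G1o N)"
  proof (rule mod_homI)
    show "restrict ?F (carrier M.G1h) \<in> extensional (carrier (G1o M))" by simp
    fix g assume g: "g \<in> carrier (G1o M)"
    show "restrict ?F (carrier M.G1h) g \<in> carrier (G1o N)" using Fc[OF g] g by simp
    show "restrict ?F (carrier M.G1h) (g \<oplus>\<^bsub>G1o M\<^esub> g') =
      restrict ?F (carrier M.G1h) g \<oplus>\<^bsub>G1o N\<^esub> restrict ?F (carrier M.G1h) g'" if g': "g' \<in> carrier (G1o M)" for g'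
      using Fadd[OF g g'] LM.M.a_closed[OF g g'] g g' by simp
    show "restrict ?F (carrier M.G1h) (r \<odot>\<^bsub>G1o M\<^esub> g) = r \<odot>\<^bsub>G1o N\<^esub> restrict ?F (carrier M.G1h) g"
      if r: "r \<in> carrier HP" for r
      using Fz[OF r g] LM.smult_closed[OF r g] g by simp
  qed
qed

lemma G1_functor_is_mod_functor: "is_mod_functor ER HP (G1_functor K H A act)"
  unfolding is_mod_functor_def G1_functor_def fst_conv snd_conv
proof (intro conjI allI impI ballI)
  fix M assume M: "left_module ER M"
  interpret M: smash_bimodule K H A act M by (rule smash_bimodule[OF M])
  show "left_module HP (G1o M)" by (rule M.N_left)
  show "(\<lambda>g\<in>carrier (G1_hom K H A act M). compose (carrier A) (\<lambda>x\<in>carrier M. x) g) = (\<lambda>x\<in>carrier (G1o M). x)"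
  proof -
    have "compose (carrier A) (\<lambda>x\<in>carrier M. x) g = g" if "g \<in> carrier (G1_hom K H A act M)" for g
    proof -
      have "g \<in> mod_hom M.EA AE.RB M.MA" using that by (simp add: M.G1h_eq)
      from mod_homD(1,2)[OF this] show ?thesis by (auto simp: compose_def fun_eq_iff extensional_def)
    qed
    then show ?thesis by (auto simp: fun_eq_iff)
  qed
next
  fix M N f assume "left_module ER M" "left_module ER N" "f \<in> mod_hom ER M N"
  then show "(\<lambda>g\<in>carrier (G1_hom K H A act M). compose (carrier A) f g) \<in> mod_hom HP (G1o M) (G1o N)"
    by (rule G1_map(2))
next
  fix L M N f g assume L: "left_module ER L" and M: "left_module ER M" and f: "f \<in> mod_hom ER L M"
  interpret L: smash_bimodule K H A act L by (rule smash_bimodule[OF L])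
  have "compose (carrier A) (compose (carrier L) g f) h = compose (carrier A) g (compose (carrier A) f h)"
    if "h \<in> carrier L.G1h" for h
  proof -
    have "h \<in> mod_hom L.EA AE.RB L.MA" using that by (simp add: L.G1h_eq)
    from mod_homD(2)[OF this] show ?thesis by (auto simp: compose_def fun_eq_iff)
  qed
  moreover have "compose (carrier A) f h \<in> carrier (G1_hom K H A act M)" if "h \<in> carrier L.G1h" for h
    using G1_map(1)[OF L M f, of h] that by (simp add: hpar_module_def)
  ultimately show "(\<lambda>h\<in>carrier (G1_hom K H A act L). compose (carrier A) (compose (carrier L) g f) h) =
    compose (carrier (G1o L)) (\<lambda>h\<in>carrier (G1_hom K H A act M). compose (carrier A) g h)
      (\<lambda>h\<in>carrier (G1_hom K H A act L). compose (carrier A) f h)"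
    unfolding L.G1.N_simps by (intro ext, case_tac "x \<in> carrier L.G1h")
      (simp_all add: compose_eq extensional_arb[OF compose_extensional])
qed

text \<open>
  The orbit map of the central element \<open>F(1)(1)\<close> that corresponds to \<open>F\<close>.
\<close>

definition comparison where
  "comparison M = (\<lambda>F\<in>mod_hom HP BM (G1o M). \<lambda>r\<in>carrier R.
     env_tensor K R r \<one>\<^bsub>R\<^esub> \<odot>\<^bsub>M\<^esub> F \<one>\<^bsub>HP\<^esub> \<one>\<^bsub>A\<^esub>)"

text \<open>
  Both sides are parametrised by the centre of \<open>M\<close>, through \<open>F \<mapsto> F(1)(1)\<close> and through evaluation
  at the unit of \<open>A # H\<close>; the comparison map respects the parameters. Naturality is the equation
  \<open>f(r m) = r f(m)\<close>.
\<close>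

lemma functors_naturally_isomorphic:
  "naturally_isomorphic ER K (comp_mod_functor (G2_functor K H) (G1_functor K H A act))
    (G_functor K H A act :: ((('a \<times> 'h \<Rightarrow> 'k) set \<times> ('a \<times> 'h \<Rightarrow> 'k) set \<Rightarrow> 'k) set, 'm,
       'k, ('a \<times> 'h \<Rightarrow> 'k) set \<Rightarrow> 'm) mod_functor)"
  unfolding naturally_isomorphic_def
proof (rule exI[of _ comparison], intro conjI allI impI ballI)
  fix M assume M: "left_module ER M"
  interpret M: smash_bimodule K H A act M by (rule smash_bimodule[OF M])
  have obj: "fst (comp_mod_functor (G2_functor K H) (G1_functor K H A act)) M = hom_module HP BM M.N"
    "fst (G_functor K H A act) M = hom_module ER RE.RB M"
    by (simp_all add: comp_mod_functor_def G2_functor_def G1_functor_def G_functor_def Hom_functor_def Let_def)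
  have cmp: "comparison M F = M.MR.orbit (F \<one>\<^bsub>HP\<^esub> \<one>\<^bsub>A\<^esub>)" if "F \<in> mod_hom HP BM M.N" for F
    using that by (simp add: comparison_def M.MR.orbit_def M.MR.lm_def)
  interpret HM: module K "hom_module HP BM M.N" by (rule hom_module_is_module[OF HP_alg BM_left_module M.N_left])
  have orbith: "M.MR.orbit (F \<one>\<^bsub>HP\<^esub> \<one>\<^bsub>A\<^esub>) \<in> mod_hom ER RE.RB M" if "F \<in> mod_hom HP BM M.N" for F
    by (rule M.MR.orbit_hom[OF M.G2G1_value(1)[OF that]])
  have val: "F \<one>\<^bsub>HP\<^esub> \<one>\<^bsub>A\<^esub> \<in> carrier M" if "F \<in> mod_hom HP BM M.N" for F
    by (rule M.MR.centerD(1)[OF M.G2G1_value(1)[OF that]])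
  show "comparison M \<in> mod_hom K (fst (comp_mod_functor (G2_functor K H) (G1_functor K H A act)) M) (fst (G_functor K H A act) M)"
    unfolding obj
  proof (rule mod_homI)
    show "comparison M \<in> extensional (carrier (hom_module HP BM M.N))" by (simp add: comparison_def)
    fix F assume "F \<in> carrier (hom_module HP BM M.N)"
    then have F: "F \<in> mod_hom HP BM M.N" by simp
    then show "comparison M F \<in> carrier (hom_module ER RE.RB M)" using orbith by (simp add: cmp)
    have F1: "F \<one>\<^bsub>HP\<^esub> \<in> carrier M.G1h" using hom_from_base(1)[OF M.N_left F] by simp
    show "comparison M (F \<oplus>\<^bsub>hom_module HP BM M.N\<^esub> F') =
        comparison M F \<oplus>\<^bsub>hom_module ER RE.RB M\<^esub> comparison M F'"
      if "F' \<in> carrier (hom_module HP BM M.N)" for F'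
    proof -
      have F': "F' \<in> mod_hom HP BM M.N" using that by simp
      have s: "F \<oplus>\<^bsub>hom_module HP BM M.N\<^esub> F' \<in> mod_hom HP BM M.N"
        using HM.M.a_closed[of F F'] F F' by simp
      have "(F \<oplus>\<^bsub>hom_module HP BM M.N\<^esub> F') \<one>\<^bsub>HP\<^esub> = F \<one>\<^bsub>HP\<^esub> \<oplus>\<^bsub>M.G1h\<^esub> F' \<one>\<^bsub>HP\<^esub>" by simp
      then have "(F \<oplus>\<^bsub>hom_module HP BM M.N\<^esub> F') \<one>\<^bsub>HP\<^esub> \<one>\<^bsub>A\<^esub> = F \<one>\<^bsub>HP\<^esub> \<one>\<^bsub>A\<^esub> \<oplus>\<^bsub>M\<^esub> F' \<one>\<^bsub>HP\<^esub> \<one>\<^bsub>A\<^esub>"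
        by (simp only:) (simp add: M.G1h_eq)
      then show ?thesis
        unfolding cmp[OF s] cmp[OF F] cmp[OF F'] by (simp only: M.MR.orbit_add val[OF F] val[OF F'])
    qed
    show "comparison M (c \<odot>\<^bsub>hom_module HP BM M.N\<^esub> F) = c \<odot>\<^bsub>hom_module ER RE.RB M\<^esub> comparison M F"
      if c: "c \<in> carrier K" for c
    proof -
      have s: "c \<odot>\<^bsub>hom_module HP BM M.N\<^esub> F \<in> mod_hom HP BM M.N"
        using HM.smult_closed[of c F] F c by simp
      have "(c \<odot>\<^bsub>hom_module HP BM M.N\<^esub> F) \<one>\<^bsub>HP\<^esub> = c \<odot>\<^bsub>M.G1h\<^esub> F \<one>\<^bsub>HP\<^esub>"
        using M.G1.N_scalar[OF c F1] by simp
      then have "(c \<odot>\<^bsub>hom_module HP BM M.N\<^esub> F) \<one>\<^bsub>HP\<^esub> \<one>\<^bsub>A\<^esub> = (c \<odot>\<^bsub>ER\<^esub> \<one>\<^bsub>ER\<^esub>) \<odot>\<^bsub>M\<^esub> F \<one>\<^bsub>HP\<^esub> \<one>\<^bsub>A\<^esub>"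
        using M.MA_scalar[OF c, of "F \<one>\<^bsub>HP\<^esub> \<one>\<^bsub>A\<^esub>"] by (simp only:) (simp add: M.G1h_eq)
      then show ?thesis
        unfolding cmp[OF s] cmp[OF F] by (simp only: M.MR.orbit_smult[OF c val[OF F]])
    qed
  qed
  show "bij_betw (comparison M) (carrier (fst (comp_mod_functor (G2_functor K H) (G1_functor K H A act)) M))
      (carrier (fst (G_functor K H A act) M))"
    unfolding obj hom_module_simps
  proof (rule bij_betwI')
    fix F F' assume F: "F \<in> mod_hom HP BM M.N" and F': "F' \<in> mod_hom HP BM M.N"
    show "comparison M F = comparison M F' \<longleftrightarrow> F = F'"
    proof
      assume "comparison M F = comparison M F'"
      then have "M.MR.orbit (F \<one>\<^bsub>HP\<^esub> \<one>\<^bsub>A\<^esub>) = M.MR.orbit (F' \<one>\<^bsub>HP\<^esub> \<one>\<^bsub>A\<^esub>)" using cmp F F' by simp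
      from fun_cong[OF this, of "\<one>\<^bsub>R\<^esub>"] have "F \<one>\<^bsub>HP\<^esub> \<one>\<^bsub>A\<^esub> = F' \<one>\<^bsub>HP\<^esub> \<one>\<^bsub>A\<^esub>"
        by (simp only: M.MR.orbit_one[OF val[OF F]] M.MR.orbit_one[OF val[OF F']])
      then have eq: "F \<one>\<^bsub>HP\<^esub> = F' \<one>\<^bsub>HP\<^esub>"
        using M.G2G1_value(2)[OF F] M.G2G1_value(2)[OF F'] by (metis)
      show "F = F'"
      proof
        fix b show "F b = F' b"
          using hom_from_base(2)[OF M.N_left F, of b] hom_from_base(2)[OF M.N_left F', of b]
            mod_hom_outside[OF F, of b] mod_hom_outside[OF F', of b] eq
          by (cases "b \<in> B") simp_all
      qed
    qed simp
  next
    fix F assume F: "F \<in> mod_hom HP BM M.N"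
    show "comparison M F \<in> mod_hom ER RE.RB M" using cmp[OF F] orbith[OF F] by simp
  next
    fix g assume g: "g \<in> mod_hom ER RE.RB M"
    let ?m = "g \<one>\<^bsub>R\<^esub>"
    note m = M.MR.hom_orbit(1)[OF g]
    let ?F = "\<lambda>b\<in>B. b \<odot>\<^bsub>M.N\<^esub> M.AM.orbit ?m"
    have F: "?F \<in> mod_hom HP BM M.N" by (rule M.G2G1_inverse[OF m])
    have mC: "?m \<in> M.C" by (rule M.center_C[OF m])
    have "M.AM.orbit ?m \<in> carrier M.N" using mC M.G1h_image by auto
    then have "?F \<one>\<^bsub>HP\<^esub> = M.AM.orbit ?m" using left_module.smult_one[OF M.N_left] by simp
    then have "?F \<one>\<^bsub>HP\<^esub> \<one>\<^bsub>A\<^esub> = ?m" by (simp only: M.orbit_C_one[OF mC])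
    then have "g = comparison M ?F" unfolding cmp[OF F] using M.MR.hom_orbit(2)[OF g] by (simp only:)
    then show "\<exists>F\<in>mod_hom HP BM M.N. g = comparison M F" using F by blast
  qed
next
  fix M N :: "((('a \<times> 'h \<Rightarrow> 'k) set \<times> ('a \<times> 'h \<Rightarrow> 'k) set \<Rightarrow> 'k) set, 'm) module" and f F
  assume M: "left_module ER M" and N: "left_module ER N" and f: "f \<in> mod_hom ER M N"
    and "F \<in> carrier (fst (comp_mod_functor (G2_functor K H) (G1_functor K H A act)) M)"
  then have F: "F \<in> mod_hom HP BM (G1o M)"
    by (simp add: comp_mod_functor_def G2_functor_def G1_functor_def Hom_functor_def)
  interpret M: smash_bimodule K H A act M by (rule smash_bimodule[OF M])
  interpret N: smash_bimodule K H A act N by (rule smash_bimodule[OF N])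
  let ?f1 = "\<lambda>g\<in>carrier (G1_hom K H A act M). compose (carrier A) f g"
  let ?m = "F \<one>\<^bsub>HP\<^esub> \<one>\<^bsub>A\<^esub>"
  have m: "?m \<in> carrier M" by (rule M.MR.centerD(1)[OF M.G2G1_value(1)[OF F]])
  have F1: "F \<one>\<^bsub>HP\<^esub> \<in> carrier M.G1h" using hom_from_base(1)[OF M.N_left F] by simp
  have lhs: "snd (comp_mod_functor (G2_functor K H) (G1_functor K H A act)) M N f F = compose B ?f1 F"
    using F by (simp add: comp_mod_functor_def G2_functor_def G1_functor_def Hom_functor_def)
  have mem: "compose B ?f1 F \<in> mod_hom HP BM (G1o N)"
    using mod_hom_compose[OF BM_left_module G1_map(2)[OF M N f] F] by simp
  have "compose B ?f1 F \<one>\<^bsub>HP\<^esub> \<one>\<^bsub>A\<^esub> = f ?m" using F1 by (simp add: compose_eq)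
  then have l: "comparison N (compose B ?f1 F) = N.MR.orbit (f ?m)"
    using mem by (simp add: comparison_def N.MR.orbit_def N.MR.lm_def)
  have c: "comparison M F = M.MR.orbit ?m"
    using F by (simp add: comparison_def M.MR.orbit_def M.MR.lm_def)
  have "snd (G_functor K H A act) M N f (comparison M F) = compose (carrier R) f (M.MR.orbit ?m)"
    using M.MR.orbit_hom[OF M.G2G1_value(1)[OF F]] by (simp add: c G_functor_def Hom_functor_def Let_def)
  also have "\<dots> = N.MR.orbit (f ?m)"
    using m by (auto simp: compose_def M.MR.orbit_def N.MR.orbit_def fun_eq_iff M.MR.lm_def N.MR.lm_def mod_homD(4)[OF f])
  finally show "comparison N (snd (comp_mod_functor (G2_functor K H) (G1_functor K H A act)) M N f F) =
    snd (G_functor K H A act) M N f (comparison M F)" using lhs l by simp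
qed

end

theorem corollary4p4:
  fixes K :: "'k ring" and H :: "('k, 'h) hopf" and A :: "('k, 'a) module"
    and act :: "'h \<Rightarrow> 'a \<Rightarrow> 'a"
    and G1 :: "((('a \<times> 'h \<Rightarrow> 'k) set \<times> ('a \<times> 'h \<Rightarrow> 'k) set \<Rightarrow> 'k) set, 'm,
                ('h list \<Rightarrow> 'k) set set, 'a \<Rightarrow> 'm) mod_functor"
    and G2 :: "(('h list \<Rightarrow> 'k) set set, 'a \<Rightarrow> 'm,
                'k, ('h list \<Rightarrow> 'k) set set \<Rightarrow> 'a \<Rightarrow> 'm) mod_functor"
    and G :: "((('a \<times> 'h \<Rightarrow> 'k) set \<times> ('a \<times> 'h \<Rightarrow> 'k) set \<Rightarrow> 'k) set, 'm,
               'k, ('a \<times> 'h \<Rightarrow> 'k) set \<Rightarrow> 'm) mod_functor"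
  assumes "cocommutative_hopf_algebra K H"
    and "symmetric_partial_action K H A act"
    and "G1 = G1_functor K H A act"
    and "G2 = G2_functor K H"
    and "G = G_functor K H A act"
  shows "is_mod_functor (env_alg K (smash K H A act)) (hpar K H) G1 \<and>
    is_mod_functor (hpar K H) K G2 \<and>
    is_mod_functor (env_alg K (smash K H A act)) K G \<and>
    naturally_isomorphic (env_alg K (smash K H A act)) K (comp_mod_functor G2 G1) G"
proof -
  interpret PA: symmetric_partial_action K H A act by fact
  interpret cocommutative_partial_action K H A act
    by (intro cocommutative_partial_action.intro assms PA.A.assoc_algebra_axioms)
  have "is_mod_functor (hpar K H) K G2"
    unfolding assms(4) G2_functor_def by (rule Hom_functor_is_mod_functor[OF HP_alg BM_left_module])
  moreover have "is_mod_functor (env_alg K (smash K H A act)) K G"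
    unfolding assms(5) G_functor_def Let_def by (rule Hom_functor_is_mod_functor[OF RE.E_alg RE.RB_left_module])
  ultimately show ?thesis
    using G1_functor_is_mod_functor functors_naturally_isomorphic assms(3-5) by simp
qed

end
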